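(* For every integer $d\ge 4$ let $\mathcal Z(d)\subset\mathbb C^{d+4}$ be the affine variety defined in the context, and let $0\in\mathcal Z(d)$ be the origin. Then: (a) For every $d\ge 4$, the symplectic singularity $(\mathcal Z(d),0)$ has trivial local fundamental group. (b) The symplectic singularity $(\mathcal Z(4),0)$ is locally analytically isomorphic to $(\overline{\mathcal O}_{\min}^{\mathfrak{sl}_3},0)$. (c) If $d\ge 5$, then the singularity $(\mathcal Z(d),0)$ is not locally analytically isomorphic to $(\overline{\mathcal O}_{\min}^{\mathfrak g},0)$ for any simple Lie algebra $\mathfrak g$. (d) If $d'>d\ge 4$, then the singularities $(\mathcal Z(d),0)$ and $(\mathcal Z(d'),0)$ are not locally analytically isomorphic.
   Context: Everything is over $\mathbb C$. Define polynomials $\Psi_k\in\mathbb C[q,Q,e]$ by $\Psi_0=1$, $\Psi_1=e$, $\Psi_k=e\Psi_{k-1}-qQ\Psi_{k-2}$ for $k\ge 2$. For $d\ge 4$, $\mathcal Z(d)$ is the Calogero-Moser space (the spectrum of the centre of the rational Cherednik algebra at $t=0$) associated with the dihedral group of order $2d$ at equal parameter $1$. Explicitly, it is the closed subvariety of $\mathbb C^{d+4}$, with coordinates $(q,Q,e,a_0,a_1,\dots,a_d)$, defined by the equations, for all $1\le j\le k\le d-1$, $$e a_j=q a_{j+1}+Q a_{j-1},\qquad a_{j-1}a_{k+1}-a_ja_k=(e^2-4qQ-d^2)\,q^{d-k-1}Q^{j-1}\,\Psi_{k-j}(q,Q,e).$$ It is known that $\mathcal Z(d)$ is irreducible, normal,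 of dimension $4$, carries a natural Poisson structure, has symplectic singularities, and that the origin $0$ is its unique singular point. For a simple complex Lie algebra $\mathfrak g$, $\overline{\mathcal O}_{\min}^{\mathfrak g}$ denotes the closure of the minimal nonzero nilpotent (adjoint) orbit of $\mathfrak g$. The local fundamental group of an isolated singularity $(\mathcal X,x)$ is the fundamental group of $U\setminus\{x\}$ for $U$ a sufficiently small contractible (conical) analytic neighbourhood of $x$. Two singularities $(\mathcal X,x)$ and $(\mathcal X',x')$ are locally analytically isomorphic if the complex analytic germs of $\mathcal X$ at $x$ and of $\mathcal X'$ at $x'$ are isomorphic (no compatibility with Poisson structures is required). *)

theory Defs
  imports "HOL-Analysis.Analysis" "HOL-Algebra.Elementary_Groups" "HOL-Library.Function_Algebras"
begin

text \<open>
  The dimension of the ambient space varies inside the statements, so \<open>\<complex>\<^sup>n\<close> is not modelled by a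
  type. For a finite index set \<open>I\<close>, the space \<open>\<complex>\<^sup>I\<close> consists of the functions vanishing off \<open>I\<close>;
  the product topology of the function type induces its usual topology.
\<close>

definition cspace :: "'i set \<Rightarrow> ('i \<Rightarrow> complex) set" where
  "cspace I = {z. \<forall>i. i \<notin> I \<longrightarrow> z i = 0}"

definition cscale :: "complex \<Rightarrow> ('i \<Rightarrow> complex) \<Rightarrow> 'i \<Rightarrow> complex" where
  "cscale c x = (\<lambda>i. c * x i)"


section \<open>Analytic germs\<close>

text \<open>
  Local expansion into a convergent power series in the variables indexed by \<open>I\<close>;
  \<open>\<alpha>\<close> ranges over the multi-indices.
\<close>

definition analytic_at_point ::
    "'i set \<Rightarrow> (('i \<Rightarrow> complex) \<Rightarrow> complex) \<Rightarrow> ('i \<Rightarrow> complex) \<Rightarrow> bool" where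
  "analytic_at_point I f p \<longleftrightarrow>
     (\<exists>r>0. \<exists>c :: ('i \<Rightarrow> nat) \<Rightarrow> complex. \<forall>z\<in>cspace I. (\<forall>i\<in>I. cmod (z i - p i) < r) \<longrightarrow>
        ((\<lambda>\<alpha>. c \<alpha> * (\<Prod>i\<in>I. (z i - p i) ^ \<alpha> i)) has_sum f z) {\<alpha>. \<forall>i. i \<notin> I \<longrightarrow> \<alpha> i = 0})"

definition analytic_map ::
    "'i set \<Rightarrow> 'j set \<Rightarrow> ('i \<Rightarrow> complex) set \<Rightarrow> (('i \<Rightarrow> complex) \<Rightarrow> 'j \<Rightarrow> complex) \<Rightarrow> bool" where
  "analytic_map I J U F \<longleftrightarrow>
     openin (top_of_set (cspace I)) U \<and> F \<in> U \<rightarrow> cspace J \<and>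
     (\<forall>p\<in>U. \<forall>j\<in>J. analytic_at_point I (\<lambda>z. F z j) p)"

text \<open>
  Isomorphism of the germs \<open>(X,x)\<close> and \<open>(Y,y)\<close> of reduced complex spaces, for analytic subsets
  \<open>X \<subseteq> \<complex>\<^sup>I\<close> and \<open>Y \<subseteq> \<complex>\<^sup>J\<close>: a morphism of such germs is a map that extends to
  an analytic map between neighbourhoods in the ambient spaces.
\<close>

definition locally_analytically_isomorphic ::
    "'i set \<Rightarrow> ('i \<Rightarrow> complex) set \<Rightarrow> ('i \<Rightarrow> complex) \<Rightarrow>
     'j set \<Rightarrow> ('j \<Rightarrow> complex) set \<Rightarrow> ('j \<Rightarrow> complex) \<Rightarrow> bool" where
  "locally_analytically_isomorphic I X x J Y y \<longleftrightarrow>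
     (\<exists>U V F G. x \<in> X \<inter> U \<and> y \<in> Y \<inter> V \<and> analytic_map I J U F \<and> analytic_map J I V G \<and>
        homeomorphism (X \<inter> U) (Y \<inter> V) F G \<and> F x = y)"


section \<open>Local fundamental groups\<close>

definition fundamental_group :: "'a::topological_space set \<Rightarrow> 'a \<Rightarrow> (real \<Rightarrow> 'a) set monoid" where
  "fundamental_group S b =
     \<lparr>carrier = {p. path p \<and> path_image p \<subseteq> S \<and> pathstart p = b \<and> pathfinish p = b}
                  // {(p, q). homotopic_paths S p q},
      mult = (\<lambda>A B. \<Union>p\<in>A. \<Union>q\<in>B. {r. homotopic_paths S (p +++ q) r}),
      one = {r. homotopic_paths S (\<lambda>_. b) r}\<rparr>"

text \<open>
  \<open>U\<close> is an open neighbourhood of \<open>x\<close> in \<open>X\<close> homeomorphic, with \<open>x\<close> as vertex, to the open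
  cone \<open>([0,1) \<times> L) / ({0} \<times> L)\<close> over a compact space \<open>L\<close>. Such a \<open>U\<close> is contractible. One may
  take \<open>L\<close> inside the ambient space of \<open>X\<close>, because \<open>L\<close> is homeomorphic to \<open>h ` ({1/2} \<times> L)\<close>.
\<close>

definition conical_neighbourhood ::
    "'a::topological_space set \<Rightarrow> 'a \<Rightarrow> 'a set \<Rightarrow> bool" where
  "conical_neighbourhood X x U \<longleftrightarrow>
     openin (top_of_set X) U \<and> x \<in> U \<and>
     (\<exists>(L :: 'a set) h. compact L \<and>
        quotient_map (prod_topology (top_of_set {0..<1::real}) (top_of_set L)) (top_of_set U) h \<and>
        (\<forall>l\<in>L. h (0, l) = x) \<and>
        (\<forall>s\<in>{0..<1}. \<forall>t\<in>{0..<1}. \<forall>l\<in>L. \<forall>m\<in>L.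
           h (s, l) = h (t, m) \<longleftrightarrow> (s = t \<and> l = m) \<or> (s = 0 \<and> t = 0)))"

text \<open>
  \<open>G\<close> is the local fundamental group of \<open>X\<close> at \<open>x\<close>. The homotopy type of \<open>U - {x}\<close> does not depend
  on the conical neighbourhood \<open>U\<close> of \<open>x\<close>, so one may equivalently quantify over all
  sufficiently small \<open>U\<close>, as long as conical neighbourhoods exist. The group is only considered
  when the punctured neighbourhood is path-connected, which makes the base point irrelevant.
\<close>

definition has_local_fundamental_group ::
    "'a::topological_space set \<Rightarrow> 'a \<Rightarrow> ('g, 'm) monoid_scheme \<Rightarrow> bool" where
  "has_local_fundamental_group X x G \<longleftrightarrow>
     (\<forall>W. openin (top_of_set X) W \<and> x \<in> W \<longrightarrow>
        (\<exists>U. U \<subseteq> W \<and> conical_neighbourhood X x U \<and> path_connected (U - {x}) \<and>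
           (\<forall>b\<in>U - {x}. fundamental_group (U - {x}) b \<cong> G)))"


section \<open>Simple Lie algebras and minimal nilpotent orbits\<close>

text \<open>
  A finite-dimensional complex Lie algebra is a subspace \<open>g\<close> of some \<open>\<complex>\<^sup>I\<close> with a bracket on
  \<open>g\<close>; up to isomorphism this covers all of them. The values of the bracket outside \<open>g\<close> are
  irrelevant.
\<close>

type_synonym 'i bracket = "('i \<Rightarrow> complex) \<Rightarrow> ('i \<Rightarrow> complex) \<Rightarrow> 'i \<Rightarrow> complex"

definition lie_algebra :: "'i set \<Rightarrow> ('i \<Rightarrow> complex) set \<Rightarrow> 'i bracket \<Rightarrow> bool" where
  "lie_algebra I g br \<longleftrightarrow>
     finite I \<and> g \<subseteq> cspace I \<and> module.subspace cscale g \<and>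
     (\<forall>x\<in>g. \<forall>y\<in>g. br x y \<in> g) \<and>
     (\<forall>x\<in>g. \<forall>y\<in>g. \<forall>z\<in>g. br (x + y) z = br x z + br y z \<and> br z (x + y) = br z x + br z y) \<and>
     (\<forall>c. \<forall>x\<in>g. \<forall>y\<in>g. br (cscale c x) y = cscale c (br x y) \<and>
                         br x (cscale c y) = cscale c (br x y)) \<and>
     (\<forall>x\<in>g. br x x = 0) \<and>
     (\<forall>x\<in>g. \<forall>y\<in>g. \<forall>z\<in>g. br x (br y z) + br y (br z x) + br z (br x y) = 0)"

definition lie_ideal ::
    "('i \<Rightarrow> complex) set \<Rightarrow> ('i \<Rightarrow> complex) set \<Rightarrow> 'i bracket \<Rightarrow> bool" where
  "lie_ideal a g br \<longleftrightarrow>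
     a \<subseteq> g \<and> module.subspace cscale a \<and> (\<forall>x\<in>g. \<forall>y\<in>a. br x y \<in> a)"

definition simple_lie_algebra :: "'i set \<Rightarrow> ('i \<Rightarrow> complex) set \<Rightarrow> 'i bracket \<Rightarrow> bool" where
  "simple_lie_algebra I g br \<longleftrightarrow>
     lie_algebra I g br \<and> (\<exists>x\<in>g. \<exists>y\<in>g. br x y \<noteq> 0) \<and>
     (\<forall>a. lie_ideal a g br \<longrightarrow> a = {0} \<or> a = g)"

text \<open>The value of \<open>exp (ad y)\<close> at \<open>x\<close>; the series converges coordinatewise.\<close>

definition exp_ad :: "'i bracket \<Rightarrow> ('i \<Rightarrow> complex) \<Rightarrow> ('i \<Rightarrow> complex) \<Rightarrow> 'i \<Rightarrow> complex" where
  "exp_ad br y x = (\<lambda>i. \<Sum>n. (br y ^^ n) x i / fact n)"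

text \<open>
  The orbit of \<open>x\<close> under the adjoint group, which is generated by the \<open>exp (ad y)\<close> with \<open>y \<in> g\<close>.
\<close>

inductive_set adjoint_orbit ::
    "('i \<Rightarrow> complex) set \<Rightarrow> 'i bracket \<Rightarrow> ('i \<Rightarrow> complex) \<Rightarrow> ('i \<Rightarrow> complex) set"
  for g br x where
    base: "x \<in> adjoint_orbit g br x"
  | step: "z \<in> adjoint_orbit g br x \<Longrightarrow> y \<in> g \<Longrightarrow> exp_ad br y z \<in> adjoint_orbit g br x"

definition nonzero_nilpotent_orbit ::
    "('i \<Rightarrow> complex) set \<Rightarrow> 'i bracket \<Rightarrow> ('i \<Rightarrow> complex) set \<Rightarrow> bool" where
  "nonzero_nilpotent_orbit g br O' \<longleftrightarrow>
     (\<exists>x\<in>g. x \<noteq> 0 \<and> (\<exists>n. \<forall>y\<in>g. (br x ^^ n) y = 0) \<and> O' = adjoint_orbit g br x)"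

text \<open>
  For simple \<open>g\<close> there is exactly one such orbit. The Euclidean and the Zariski closure of an orbit
  agree.
\<close>

definition minimal_nilpotent_orbit ::
    "('i \<Rightarrow> complex) set \<Rightarrow> 'i bracket \<Rightarrow> ('i \<Rightarrow> complex) set \<Rightarrow> bool" where
  "minimal_nilpotent_orbit g br O' \<longleftrightarrow>
     nonzero_nilpotent_orbit g br O' \<and>
     (\<forall>O''. nonzero_nilpotent_orbit g br O'' \<longrightarrow> O' \<subseteq> closure O'')"

definition sl_index :: "nat \<Rightarrow> (nat \<times> nat) set" where
  "sl_index n = {..<n} \<times> {..<n}"

definition sl :: "nat \<Rightarrow> (nat \<times> nat \<Rightarrow> complex) set" where
  "sl n = {A \<in> cspace (sl_index n). (\<Sum>i<n. A (i, i)) = 0}"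

definition sl_bracket :: "nat \<Rightarrow> (nat \<times> nat) bracket" where
  "sl_bracket n A B = (\<lambda>(i, j). (\<Sum>k<n. A (i, k) * B (k, j)) - (\<Sum>k<n. B (i, k) * A (k, j)))"


section \<open>The Calogero-Moser spaces of dihedral groups at equal parameters\<close>

fun Psi :: "nat \<Rightarrow> complex \<Rightarrow> complex \<Rightarrow> complex \<Rightarrow> complex" where
  "Psi 0 q Q e = 1"
| "Psi (Suc 0) q Q e = e"
| "Psi (Suc (Suc k)) q Q e = e * Psi (Suc k) q Q e - q * Q * Psi k q Q e"

text \<open>
  The coordinates \<open>(q, Q, e, a\<^sub>0, \<dots>, a\<^sub>d)\<close> of \<open>\<complex>\<^sup>d\<^sup>+\<^sup>4\<close> are numbered \<open>0, \<dots>, d + 3\<close>.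
\<close>

definition calogero_moser :: "nat \<Rightarrow> (nat \<Rightarrow> complex) set" where
  "calogero_moser d =
     {z \<in> cspace {..<d + 4}.
        let q = z 0; Q = z 1; e = z 2; a = (\<lambda>j. z (j + 3)) in
        \<forall>j k. 1 \<le> j \<and> j \<le> k \<and> k \<le> d - 1 \<longrightarrow>
          e * a j = q * a (j + 1) + Q * a (j - 1) \<and>
          a (j - 1) * a (k + 1) - a j * a k =
            (e\<^sup>2 - 4 * q * Q - (of_nat d)\<^sup>2) * q ^ (d - k - 1) * Q ^ (j - 1) * Psi (k - j) q Q e}"

end

theory Submission
  imports Defs "HOL-Complex_Analysis.Complex_Analysis"
    "HOL-Computational_Algebra.Fundamental_Theorem_Algebra"
begin

text \<open>
  Near the origin \<open>d\<^sup>2 - e\<^sup>2 + 4 q Q\<close> is a unit, and dividing the \<open>a\<^sub>j\<close> by its square root identifies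
  \<open>\<Z>(d)\<close> with the weighted cone \<open>Y(d)\<close> that has \<open>- 1\<close> in place of this factor. A unipotent group
  acts on \<open>Y(d)\<close>, and the translates of the chart \<open>a\<^sub>0 \<noteq> 0\<close> cover the complement of the origin. The
  chart is \<open>{(q, e, a\<^sub>0, a\<^sub>1). a\<^sub>0 \<noteq> 0}\<close>, in which every loop can be moved to one with
  \<open>(q, e, a\<^sub>1) = (1, 0, 1)\<close>, and this contracts across \<open>a\<^sub>0 = 0\<close> inside the cone; the intersections of the translates are connected and
  have a common point. So the punctured cone is simply connected, by the argument of van Kampen.

  For \<open>d = 4\<close> the nine quadrics defining \<open>Y(4)\<close> are, after a linear change of coordinates, the
  \<open>2 \<times> 2\<close> minors of a traceless \<open>3 \<times> 3\<close> matrix.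

  For \<open>d \<ge> 5\<close> the tangent cone of \<open>\<Z>(d)\<close> at the origin is given by the equations with right-hand
  side \<open>0\<close>. It spans \<open>\<complex>\<^sup>d\<^sup>+\<^sup>4\<close>, so the germ determines \<open>d\<close>. The lines in this cone through one of
  its points have directions that form a linear space exactly when \<open>a \<noteq> 0\<close> there, so the locus
  \<open>a = 0\<close> is intrinsic. The closure of a minimal nilpotent orbit is its own tangent cone, and the
  adjoint group permutes its nonzero points with every orbit dense, so that it has no proper closed
  intrinsic subcone.
\<close>

section \<open>Tangent cones of germs\<close>

text \<open>The bound \<open>d \<ge> 5\<close> comes from orders at the origin: the left-hand sides
  of the quadratic equations have order 2, the right-hand sides order \<open>d - 2\<close>. For
  \<open>d = 4\<close> the orders agree and the right-hand sides survive in the tangent cone. In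
  comparing \<open>d < d'\<close> only the cone of the larger index is computed, so
  \<open>d = 4\<close> is no exception there. Tangent cones are bare limit sets. The linear maps
  induced by an isomorphism of germs are mutually inverse on the cones only, as the ambient
  dimensions may differ; the property that separates the cones is therefore phrased with lines and
  sums of their directions, which such maps respect. In the weighted cone \<open>q, Q, e\<close>
  have weight 2 and the \<open>a_j\<close> have weight \<open>d - 2\<close>. Its dilations shrink
  into any neighbourhood of the origin, so one computation on the whole punctured cone gives the
  local fundamental group. An isomorphism of germs asks for convergent expansions at every point of
  a neighbourhood. The square root of the unit is therefore composed with polynomials inside a
  Banach algebra of power series, of which only norm bounds are recorded.\<close>

lemma cspaceD: "z \<in> cspace I \<Longrightarrow> i \<notin> I \<Longrightarrow> z i = 0"
  by (simp add: cspace_def)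

lemma zero_in_cspace [simp]: "0 \<in> cspace I"
  by (simp add: cspace_def)

lemma open_polydisc:
  fixes p :: "'i \<Rightarrow> complex"
  assumes "finite I"
  shows "open {z. \<forall>i\<in>I. cmod (z i - p i) < e}"
  using product_topology_basis'[of I "\<lambda>i. ball (p i) e" "\<lambda>i. i"] assms
  by (simp add: dist_norm norm_minus_commute)

text \<open>A basic open set of the product topology restricts only finitely many coordinates, so
  the smallest of finitely many radii serves; 1 is inserted in case no coordinate is
  restricted.\<close>

lemma polydisc_subset_open:
  fixes W :: "('i \<Rightarrow> complex) set"
  assumes "open W" "p \<in> W"
  shows "\<exists>e>0. \<exists>F. finite F \<and> (\<forall>z. (\<forall>i\<in>F. cmod (z i - p i) < e) \<longrightarrow> z \<in> W)"
proof -
  have "openin (product_topology (\<lambda>_. euclidean) UNIV) W"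
    using assms(1) by (simp add: open_fun_def)
  then obtain X where X: "finite {i. X i \<noteq> UNIV}" "\<And>i. open (X i)" "p \<in> Pi\<^sub>E UNIV X" "Pi\<^sub>E UNIV X \<subseteq> W"
    using assms(2) unfolding openin_product_topology_alt by force
  let ?F = "{i. X i \<noteq> UNIV}"
  have "\<forall>i. \<exists>e>0. ball (p i) e \<subseteq> X i"
    using X(2,3) unfolding open_contains_ball by (metis PiE_E UNIV_I)
  then obtain e where e: "\<And>i. e i > 0" "\<And>i. ball (p i) (e i) \<subseteq> X i"
    by metis
  define d where "d = Min (insert 1 (e ` ?F))"
  have d: "d > 0" "\<And>i. i \<in> ?F \<Longrightarrow> d \<le> e i"
    using X(1) e(1) by (auto simp: d_def)
  have "z \<in> W" if z: "\<forall>i\<in>?F. cmod (z i - p i) < d" for z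
  proof -
    have "z i \<in> X i" for i
    proof (cases "i \<in> ?F")
      case True
      then have "z i \<in> ball (p i) (e i)"
        using z d(2)[OF True] by (force simp: dist_norm norm_minus_commute)
      then show ?thesis using e(2) by blast
    qed auto
    then show ?thesis using X(4) by (auto simp: PiE_iff)
  qed
  then show ?thesis using d(1) X(1) by blast
qed

text \<open>Coordinates outside \<open>I\<close> vanish at both points, so the finite set delivered
  by the product topology can be replaced by \<open>I\<close>. This turns topology on
  \<open>cspace I\<close> into estimates of the largest coordinate.\<close>

lemma openin_cspace_polydisc:
  assumes "openin (top_of_set (cspace I)) U" "p \<in> U"
  shows "\<exists>e>0. \<forall>z\<in>cspace I. (\<forall>i\<in>I. cmod (z i - p i) < e) \<longrightarrow> z \<in> U"
proof -
  obtain W where W: "open W" "U = cspace I \<inter> W"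
    using assms(1) by (auto simp: openin_open)
  then obtain e F where e: "e > 0" "\<forall>z. (\<forall>i\<in>F. cmod (z i - p i) < e) \<longrightarrow> z \<in> W"
    using polydisc_subset_open[of W p] assms(2) by blast
  have "z \<in> U" if "z \<in> cspace I" "\<forall>i\<in>I. cmod (z i - p i) < e" for z
  proof -
    have "cmod (z i - p i) < e" for i
      using that assms(2) W(2) e(1) by (cases "i \<in> I") (auto simp: cspaceD)
    then show ?thesis using that(1) W(2) e(2) by auto
  qed
  then show ?thesis using e(1) by blast
qed

lemma closed_cspace: "closed (cspace I :: ('i \<Rightarrow> complex) set)"
proof -
  have "cspace I = (\<Inter>i\<in>-I. {z :: 'i \<Rightarrow> complex. z i = 0})"
    by (auto simp: cspace_def)
  moreover have "closed {z :: 'i \<Rightarrow> complex. z i = 0}" for i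
    by (rule closed_Collect_eq) (auto intro: continuous_on_product_then_coordinatewise continuous_on_id)
  ultimately show ?thesis by (simp add: closed_INT)
qed

lemma closure_cspace_iff:
  assumes "finite I" "S \<subseteq> cspace I"
  shows "x \<in> closure S \<longleftrightarrow> x \<in> cspace I \<and> (\<forall>e>0. \<exists>s\<in>S. \<forall>i\<in>I. cmod (s i - x i) < e)"
proof (intro iffI conjI allI impI)
  assume x: "x \<in> closure S"
  then show "x \<in> cspace I"
    using closure_minimal[OF assms(2) closed_cspace] by blast
  fix e :: real assume "e > 0"
  then have "x \<in> {z. \<forall>i\<in>I. cmod (z i - x i) < e}"
    by simp
  then have "S \<inter> {z. \<forall>i\<in>I. cmod (z i - x i) < e} \<noteq> {}"
    using x open_polydisc[OF assms(1), of x e] unfolding closure_iff_nhds_not_empty by blast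
  then show "\<exists>s\<in>S. \<forall>i\<in>I. cmod (s i - x i) < e" by blast
next
  assume x: "x \<in> cspace I \<and> (\<forall>e>0. \<exists>s\<in>S. \<forall>i\<in>I. cmod (s i - x i) < e)"
  have "S \<inter> W \<noteq> {}" if W: "open W" "x \<in> W" for W
  proof -
    obtain e where e: "e > 0" "\<forall>z\<in>cspace I. (\<forall>i\<in>I. cmod (z i - x i) < e) \<longrightarrow> z \<in> cspace I \<inter> W"
      using openin_cspace_polydisc[of I "cspace I \<inter> W" x] W x by (auto simp: openin_open_Int)
    then show ?thesis using x assms(2) by blast
  qed
  then show "x \<in> closure S"
    unfolding closure_iff_nhds_not_empty by blast
qed

section \<open>Linear maps in coordinates and first-order expansions of analytic maps\<close>

definition clin :: "'i set \<Rightarrow> 'j set \<Rightarrow> ('i \<Rightarrow> 'j \<Rightarrow> complex) \<Rightarrow> ('i \<Rightarrow> complex) \<Rightarrow> 'j \<Rightarrow> complex" where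
  "clin I J M v = (\<lambda>j. if j \<in> J then \<Sum>i\<in>I. M i j * v i else 0)"

lemma clin_in_cspace [simp]: "clin I J M v \<in> cspace J"
  by (simp add: clin_def cspace_def)

lemma clin_add: "clin I J M (v + w) = clin I J M v + clin I J M w"
  by (auto simp: clin_def fun_eq_iff sum.distrib distrib_left)

lemma clin_diff: "clin I J M (v - w) = clin I J M v - clin I J M w"
  by (auto simp: clin_def fun_eq_iff sum_subtractf right_diff_distrib)

lemma clin_cscale: "clin I J M (cscale c v) = cscale c (clin I J M v)"
  by (auto simp: clin_def cscale_def fun_eq_iff sum_distrib_left mult_ac)

lemma clin_0 [simp]: "clin I J M 0 = 0"
  by (auto simp: clin_def)

lemma clin_approx:
  assumes "finite I" "finite J" "e > 0"
  shows "\<exists>d>0. \<forall>w. (\<forall>i\<in>I. cmod (w i - v i) < d) \<longrightarrow> (\<forall>j\<in>J. cmod (clin I J M w j - clin I J M v j) < e)"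
proof -
  define K where "K = 1 + (\<Sum>i\<in>I. \<Sum>j\<in>J. cmod (M i j))"
  have K: "K > 0" unfolding K_def by (intro add_pos_nonneg sum_nonneg) auto
  have "cmod (clin I J M w j - clin I J M v j) < e"
    if w: "\<forall>i\<in>I. cmod (w i - v i) < e / K" and j: "j \<in> J" for w j
  proof -
    have "cmod (clin I J M w j - clin I J M v j) = cmod (\<Sum>i\<in>I. M i j * (w i - v i))"
      using j by (simp add: clin_def sum_subtractf right_diff_distrib)
    also have "\<dots> \<le> (\<Sum>i\<in>I. cmod (M i j) * (e / K))"
    proof (rule sum_norm_le)
      fix i assume "i \<in> I"
      then have "cmod (w i - v i) \<le> e / K" using w by (simp add: less_imp_le)
      then show "cmod (M i j * (w i - v i)) \<le> cmod (M i j) * (e / K)"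
        unfolding norm_mult by (rule mult_left_mono) simp
    qed
    also have "\<dots> \<le> (\<Sum>i\<in>I. \<Sum>j\<in>J. cmod (M i j)) * (e / K)"
      using assms(2,3) j K unfolding sum_distrib_right[symmetric]
      by (intro mult_right_mono sum_mono member_le_sum) auto
    also have "\<dots> < K * (e / K)"
      using assms(3) K by (intro mult_strict_right_mono) (auto simp: K_def)
    finally show ?thesis using K by simp
  qed
  then show ?thesis using K assms(3) by (intro exI[of _ "e / K"]) auto
qed

lemma has_sum_imp_summable_weights:
  assumes "(f has_sum S) A"
  shows "(\<lambda>x. cmod (f x)) summable_on A"
  using assms summable_on_iff_abs_summable_on_complex has_sum_imp_summable by blast

text \<open>A Taylor estimate from absolute convergence: once the constant and linear terms are
  removed, every monomial has degree at least 2, so passing from the radius \<rho> to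
  \<open>s\<close> gains a factor \<open>s^2 / \<rho>^2\<close>. The error is expressed through a
  bound \<open>s\<close> for the coordinates, as the scaling argument for tangent cones needs
  it.\<close>

lemma analytic_first_order:
  assumes fin: "finite I" and an: "analytic_at_point I f p" and p: "p \<in> cspace I"
  shows "\<exists>l r K. r > 0 \<and> (\<forall>z\<in>cspace I. \<forall>s\<le>r. (\<forall>i\<in>I. cmod (z i - p i) \<le> s) \<longrightarrow>
           cmod (f z - f p - (\<Sum>i\<in>I. l i * (z i - p i))) \<le> K * s\<^sup>2)"
proof -
  define A :: "('a \<Rightarrow> nat) set" where "A = {\<alpha>. \<forall>i. i \<notin> I \<longrightarrow> \<alpha> i = 0}"
  obtain r c where r: "r > 0" and c: "\<And>z. z \<in> cspace I \<Longrightarrow> (\<forall>i\<in>I. cmod (z i - p i) < r) \<Longrightarrow>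
      ((\<lambda>\<alpha>. c \<alpha> * (\<Prod>i\<in>I. (z i - p i) ^ \<alpha> i)) has_sum f z) A"
    using an unfolding analytic_at_point_def A_def by blast
  define \<rho> where "\<rho> = r / 2"
  have \<rho>: "\<rho> > 0" "\<rho> < r" using r by (auto simp: \<rho>_def)
  define deg where "deg \<alpha> = (\<Sum>i\<in>I. \<alpha> i)" for \<alpha> :: "'a \<Rightarrow> nat"
  \<comment> \<open>At the corner of the polydisc, where every offset equals \<rho>, the monomial of
    \<alpha> is \<open>\<rho> ^ deg \<alpha>\<close>. Summability there is absolute and dominates
    the series on the whole closed polydisc.\<close>
  have "(\<lambda>\<alpha>. cmod (c \<alpha> * (\<Prod>i\<in>I. (p i + (if i \<in> I then of_real \<rho> else 0) - p i) ^ \<alpha> i))) summable_on A"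
    using p \<rho> by (intro has_sum_imp_summable_weights[OF c[of "\<lambda>i. p i + (if i \<in> I then of_real \<rho> else 0)"]])
      (auto simp: cspace_def)
  also have "(\<lambda>\<alpha>. cmod (c \<alpha> * (\<Prod>i\<in>I. (p i + (if i \<in> I then of_real \<rho> else 0) - p i) ^ \<alpha> i))) =
      (\<lambda>\<alpha>. cmod (c \<alpha>) * \<rho> ^ deg \<alpha>)"
    using \<rho> by (simp add: norm_mult prod_norm[symmetric] norm_power power_sum deg_def cong: prod.cong)
  finally have summ: "(\<lambda>\<alpha>. cmod (c \<alpha>) * \<rho> ^ deg \<alpha>) summable_on A" .
  define z0 :: "'a \<Rightarrow> nat" where "z0 = (\<lambda>_. 0)"
  define ev :: "'a \<Rightarrow> 'a \<Rightarrow> nat" where "ev i = z0(i := 1)" for i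
  define B where "B = insert z0 (ev ` I)"
  have inj: "inj_on ev I"
    by (rule inj_onI) (auto simp: ev_def z0_def fun_eq_iff split: if_splits)
  have z0_notin: "z0 \<notin> ev ` I"
  proof
    assume "z0 \<in> ev ` I"
    then obtain i where "z0 = ev i" by blast
    then have "z0 i = ev i i" by simp
    then show False by (simp add: ev_def z0_def)
  qed
  have BA: "B \<subseteq> A" "finite B"
    using fin by (auto simp: B_def A_def z0_def ev_def)
  have deg2: "deg \<alpha> \<ge> 2" if \<alpha>: "\<alpha> \<in> A - B" for \<alpha>
  proof (rule ccontr)
    assume "\<not> deg \<alpha> \<ge> 2"
    then consider "deg \<alpha> = 0" | "deg \<alpha> = 1" by linarith
    then show False
    proof cases
      case 1
      then have "\<alpha> = z0" using \<alpha> fin by (auto simp: deg_def A_def z0_def fun_eq_iff)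
      then show False using \<alpha> by (simp add: B_def)
    next
      case 2
      then obtain i where i: "i \<in> I" "\<alpha> i = 1" "\<forall>j\<in>I. j \<noteq> i \<longrightarrow> \<alpha> j = 0"
        using sum_eq_Suc0_iff[OF fin, of \<alpha>] unfolding deg_def One_nat_def by metis
      then have "\<alpha> = ev i" using \<alpha> by (auto simp: A_def ev_def z0_def fun_eq_iff)
      then show False using \<alpha> i(1) by (simp add: B_def)
    qed
  qed
  define K where "K = (\<Sum>\<^sub>\<infinity>\<alpha>\<in>A - B. cmod (c \<alpha>) * \<rho> ^ deg \<alpha>) / \<rho>\<^sup>2"
  define l where "l i = c (ev i)" for i
  have prod_ev: "(\<Prod>j\<in>I. x j ^ ev i j) = x i" if "i \<in> I" for i and x :: "'a \<Rightarrow> complex"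
  proof -
    have "(\<Prod>j\<in>I. x j ^ ev i j) = (\<Prod>j\<in>I. if j = i then x i else 1)"
      by (intro prod.cong) (auto simp: ev_def z0_def)
    then show ?thesis using that fin by simp
  qed
  have fin_part: "(\<Sum>\<alpha>\<in>B. c \<alpha> * (\<Prod>i\<in>I. (z i - p i) ^ \<alpha> i)) = c z0 + (\<Sum>i\<in>I. l i * (z i - p i))" for z
    using z0_notin inj fin unfolding B_def
    by (simp add: sum.reindex prod_ev l_def z0_def cong: sum.cong)
  have fp: "f p = c z0"
  proof -
    have "((\<lambda>\<alpha>. c \<alpha> * (\<Prod>i\<in>I. (p i - p i) ^ \<alpha> i)) has_sum c z0) A"
    proof -
      have "((\<lambda>\<alpha>. c \<alpha> * (\<Prod>i\<in>I. (p i - p i) ^ \<alpha> i)) has_sum (\<Sum>\<alpha>\<in>{z0}. c \<alpha> * (\<Prod>i\<in>I. (p i - p i) ^ \<alpha> i))) A"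
      proof (rule has_sum_finite_neutralI)
        fix \<alpha> assume \<alpha>: "\<alpha> \<in> A - {z0}"
        then obtain i where "\<alpha> i \<noteq> 0" by (auto simp: z0_def fun_eq_iff)
        moreover from this have "i \<in> I" using \<alpha> by (auto simp: A_def)
        ultimately show "c \<alpha> * (\<Prod>i\<in>I. (p i - p i) ^ \<alpha> i) = 0"
          using fin by (auto simp: power_0_left)
      qed (use BA in \<open>auto simp: B_def\<close>)
      then show ?thesis by (simp add: z0_def)
    qed
    moreover have "((\<lambda>\<alpha>. c \<alpha> * (\<Prod>i\<in>I. (p i - p i) ^ \<alpha> i)) has_sum f p) A"
      using c[of p] p r by simp
    ultimately show ?thesis by (rule has_sum_unique[rotated])
  qed
  have "cmod (f z - f p - (\<Sum>i\<in>I. l i * (z i - p i))) \<le> K * s\<^sup>2"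
    if z: "z \<in> cspace I" "s \<le> \<rho>" "\<forall>i\<in>I. cmod (z i - p i) \<le> s" for z s
  \<comment> \<open>Without coordinates nothing forces \<open>s\<close> to be nonnegative; the claim
    then reduces to \<open>K \<ge> 0\<close>.\<close>
  proof (cases "I = {}")
    case True
    then have "z = p" using z(1) p by (auto simp: cspace_def fun_eq_iff)
    moreover have "K \<ge> 0" unfolding K_def using \<rho> by (intro divide_nonneg_nonneg infsum_nonneg) auto
    ultimately show ?thesis by (simp add: True)
  next
    case False
    then have s0: "s \<ge> 0" using z(3) by (meson all_not_in_conv norm_ge_zero order_trans)
    let ?t = "\<lambda>\<alpha>. c \<alpha> * (\<Prod>i\<in>I. (z i - p i) ^ \<alpha> i)"
    have "(?t has_sum f z) A"
      using c[of z] z \<rho> by force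
    then have hs: "(?t has_sum (f z - (c z0 + (\<Sum>i\<in>I. l i * (z i - p i))))) (A - B)"
      using BA unfolding fin_part[symmetric] by (intro has_sum_Diff) auto
    have bound: "cmod (?t \<alpha>) \<le> cmod (c \<alpha>) * \<rho> ^ deg \<alpha> * (s\<^sup>2 / \<rho>\<^sup>2)" if \<alpha>: "\<alpha> \<in> A - B" for \<alpha>
    proof -
      have "cmod (?t \<alpha>) = cmod (c \<alpha>) * (\<Prod>i\<in>I. cmod (z i - p i) ^ \<alpha> i)"
        by (simp add: norm_mult prod_norm[symmetric] norm_power)
      also have "\<dots> \<le> cmod (c \<alpha>) * (\<Prod>i\<in>I. s ^ \<alpha> i)"
        using z by (intro mult_left_mono prod_mono conjI power_mono) auto
      also have "(\<Prod>i\<in>I. s ^ \<alpha> i) = s ^ (2 + (deg \<alpha> - 2))"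
        unfolding le_add_diff_inverse[OF deg2[OF \<alpha>]] by (simp add: deg_def power_sum)
      also have "\<dots> = s\<^sup>2 * s ^ (deg \<alpha> - 2)"
        by (rule power_add)
      also have "cmod (c \<alpha>) * (s\<^sup>2 * s ^ (deg \<alpha> - 2)) \<le> cmod (c \<alpha>) * (s\<^sup>2 * \<rho> ^ (deg \<alpha> - 2))"
        using z s0 by (intro mult_left_mono power_mono) auto
      also have "s\<^sup>2 * \<rho> ^ (deg \<alpha> - 2) = \<rho> ^ deg \<alpha> * (s\<^sup>2 / \<rho>\<^sup>2)"
        using deg2[OF \<alpha>] \<rho> by (simp add: power_diff)
      finally show ?thesis by (simp add: mult_ac)
    qed
    have summ': "(\<lambda>\<alpha>. cmod (c \<alpha>) * \<rho> ^ deg \<alpha>) summable_on (A - B)"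
      using summ by (rule summable_on_subset_banach) auto
    have hs1: "((\<lambda>\<alpha>. cmod (c \<alpha>) * \<rho> ^ deg \<alpha> * (s\<^sup>2 / \<rho>\<^sup>2)) has_sum
        ((\<Sum>\<^sub>\<infinity>\<alpha>\<in>A - B. cmod (c \<alpha>) * \<rho> ^ deg \<alpha>) * (s\<^sup>2 / \<rho>\<^sup>2))) (A - B)"
      using summ' by (intro has_sum_cmult_left) auto
    have hs2: "((\<lambda>\<alpha>. cmod (?t \<alpha>)) has_sum infsum (\<lambda>\<alpha>. cmod (?t \<alpha>)) (A - B)) (A - B)"
      by (rule has_sum_infsum[OF has_sum_imp_summable_weights[OF hs]])
    have "infsum (\<lambda>\<alpha>. cmod (?t \<alpha>)) (A - B) \<le> (\<Sum>\<^sub>\<infinity>\<alpha>\<in>A - B. cmod (c \<alpha>) * \<rho> ^ deg \<alpha>) * (s\<^sup>2 / \<rho>\<^sup>2)"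
      by (rule has_sum_mono[OF hs2 hs1 bound])
    moreover have "cmod (f z - (c z0 + (\<Sum>i\<in>I. l i * (z i - p i)))) \<le> infsum (\<lambda>\<alpha>. cmod (?t \<alpha>)) (A - B)"
      using norm_has_sum_bound[OF has_sum_infsum[OF has_sum_imp_summable_weights[OF hs]] hs] .
    ultimately show ?thesis
      by (simp add: K_def fp algebra_simps)
  qed
  then show ?thesis using \<rho> by blast
qed

text \<open>Whitney's tangent cone at the origin, as a set: limits of \<open>t x\<close> with
  \<open>t > 0\<close> and \<open>x\<close> in \<open>X\<close> tending to 0. No equations or
  multiplicities are attached to it.\<close>

definition tangent_cone :: "'i set \<Rightarrow> ('i \<Rightarrow> complex) set \<Rightarrow> ('i \<Rightarrow> complex) set" where
  "tangent_cone I X = {v \<in> cspace I. \<forall>e>0. \<exists>x\<in>X. \<exists>t::real. t > 0 \<and>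
     (\<forall>i\<in>I. cmod (x i) < e \<and> cmod (of_real t * x i - v i) < e)}"

text \<open>Differentiability at the origin in the form adapted to tangent cones: \<open>x\<close>
  near 0 and \<open>t x\<close> near \<open>v\<close> force \<open>F x\<close> near 0 and
  \<open>t F x\<close> near \<open>M v\<close>, uniformly in the multiplier
  \<open>t\<close>.\<close>

definition tangent_map ::
    "'i set \<Rightarrow> 'j set \<Rightarrow> (('i \<Rightarrow> complex) \<Rightarrow> 'j \<Rightarrow> complex) \<Rightarrow> ('i \<Rightarrow> 'j \<Rightarrow> complex) \<Rightarrow> bool" where
  "tangent_map I J F M \<longleftrightarrow> (\<forall>v\<in>cspace I. \<forall>e>0. \<exists>d>0. \<forall>x\<in>cspace I. \<forall>t>0.
     (\<forall>i\<in>I. cmod (x i) < d \<and> cmod (of_real t * x i - v i) < d) \<longrightarrow>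
     (\<forall>j\<in>J. cmod (F x j) < e \<and> cmod (of_real t * F x j - clin I J M v j) < e))"

lemma tangent_mapE:
  assumes "tangent_map I J F M" "v \<in> cspace I" "e > 0"
  obtains d where "d > 0" "\<forall>x\<in>cspace I. \<forall>t>0.
     (\<forall>i\<in>I. cmod (x i) < d \<and> cmod (of_real t * x i - v i) < d) \<longrightarrow>
     (\<forall>j\<in>J. cmod (F x j) < e \<and> cmod (of_real t * F x j - clin I J M v j) < e)"
  using assms(1)[unfolded tangent_map_def, THEN bspec, OF assms(2), THEN spec, THEN mp, OF assms(3)] by blast

text \<open>The multiplier \<open>t\<close> is unbounded, so a quadratic remainder being small is
  not enough. But \<open>t x\<close> stays bounded, hence \<open>t\<close> times the remainder is
  still of the order of \<open>x\<close>.\<close>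

lemma analytic_map_tangent:
  assumes fin: "finite I" "finite J" and an: "analytic_map I J U F" and "0 \<in> U" "F 0 = 0"
  shows "\<exists>M. tangent_map I J F M"
proof -
  define P where "P j l r K \<longleftrightarrow> r > 0 \<and> (\<forall>z\<in>cspace I. \<forall>s\<le>r. (\<forall>i\<in>I. cmod (z i) \<le> s) \<longrightarrow>
           cmod (F z j - (\<Sum>i\<in>I. l i * z i)) \<le> K * s\<^sup>2)" for j l r K
  have "\<forall>j\<in>J. \<exists>l r K. P j l r K"
  proof
    fix j assume j: "j \<in> J"
    have "analytic_at_point I (\<lambda>z. F z j) 0"
      using an j assms(4) by (auto simp: analytic_map_def)
    from analytic_first_order[OF fin(1) this]
    show "\<exists>l r K. P j l r K"
      using assms(5) by (simp add: P_def)
  qed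
  then obtain l r K where "\<And>j. j \<in> J \<Longrightarrow> P j (l j) (r j) (K j)"
    by metis
  then have lrK: "\<And>j. j \<in> J \<Longrightarrow> r j > 0"
    "\<And>j z s. j \<in> J \<Longrightarrow> z \<in> cspace I \<Longrightarrow> s \<le> r j \<Longrightarrow> (\<forall>i\<in>I. cmod (z i) \<le> s) \<Longrightarrow>
        cmod (F z j - (\<Sum>i\<in>I. l j i * z i)) \<le> K j * s\<^sup>2"
    unfolding P_def by blast+
  define M where "M i j = l j i" for i j
  define R where "R = Min (insert 1 (r ` J))"
  have R: "R > 0" "\<And>j. j \<in> J \<Longrightarrow> R \<le> r j"
    using fin(2) lrK(1) by (auto simp: R_def)
  define L where "L = 1 + (\<Sum>j\<in>J. \<bar>K j\<bar>)"
  have L: "L \<ge> 1" "\<And>j. j \<in> J \<Longrightarrow> K j \<le> L"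
  proof -
    show "L \<ge> 1" by (simp add: L_def sum_nonneg)
    fix j assume "j \<in> J"
    then have "\<bar>K j\<bar> \<le> (\<Sum>j\<in>J. \<bar>K j\<bar>)" using fin(2) by (intro member_le_sum) auto
    then show "K j \<le> L" by (simp add: L_def)
  qed
  have est: "cmod (F z j - clin I J M z j) \<le> L * s\<^sup>2"
    if "j \<in> J" "z \<in> cspace I" "s \<le> R" "\<forall>i\<in>I. cmod (z i) \<le> s" for j z s
  proof -
    have "cmod (F z j - clin I J M z j) \<le> K j * s\<^sup>2"
      using lrK(2)[of j z s] that R(2)[of j] by (simp add: clin_def M_def)
    also have "\<dots> \<le> L * s\<^sup>2" using L(2)[OF that(1)] by (intro mult_right_mono) auto
    finally show ?thesis .
  qed
  show ?thesis
    unfolding tangent_map_def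
  proof (intro exI[of _ M] ballI allI impI)
    fix v :: "'a \<Rightarrow> complex" and e :: real assume v: "v \<in> cspace I" "e > 0"
    define B where "B = 1 + (\<Sum>i\<in>I. cmod (v i))"
    have B: "B \<ge> 1" "\<And>i. i \<in> I \<Longrightarrow> cmod (v i) + 1 \<le> B"
    proof -
      show "B \<ge> 1" by (simp add: B_def sum_nonneg)
      fix i assume "i \<in> I"
      then have "cmod (v i) \<le> (\<Sum>i\<in>I. cmod (v i))" using fin(1) by (intro member_le_sum) auto
      then show "cmod (v i) + 1 \<le> B" by (simp add: B_def)
    qed
    obtain d1 where d1: "d1 > 0" "\<And>w. (\<forall>i\<in>I. cmod (w i - v i) < d1) \<Longrightarrow> (\<forall>j\<in>J. cmod (clin I J M w j - clin I J M v j) < e / 2)"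
      using clin_approx[OF fin, of "e/2" v M] v(2) by auto
    obtain d2 where d2: "d2 > 0" "\<And>w. (\<forall>i\<in>I. cmod (w i - 0 i) < d2) \<Longrightarrow> (\<forall>j\<in>J. cmod (clin I J M w j - clin I J M 0 j) < e / 2)"
      using clin_approx[OF fin, of "e/2" 0 M] v(2) by auto
    define d where "d = Min {d1, d2, 1, R, e / (3 * L * B)}"
    have d: "d > 0" "d \<le> d1" "d \<le> d2" "d \<le> 1" "d \<le> R" "d \<le> e / (3 * L * B)"
      using d1 d2 R(1) v(2) L(1) B(1) by (auto simp: d_def)
    have dLB: "L * B * d < e / 2"
    proof -
      have "L * B * d \<le> L * B * (e / (3 * L * B))"
        using d(6) L(1) B(1) by (intro mult_left_mono) auto
      also have "\<dots> = e / 3" using L(1) B(1) by (simp add: field_simps)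
      finally show ?thesis using v(2) by simp
    qed
    have "cmod (F x j) < e \<and> cmod (of_real t * F x j - clin I J M v j) < e"
      if x: "x \<in> cspace I" "t > 0" "\<forall>i\<in>I. cmod (x i) < d \<and> cmod (of_real t * x i - v i) < d" and j: "j \<in> J" for x t j
    proof
      have 1: "cmod (F x j - clin I J M x j) \<le> L * d\<^sup>2"
        using est[OF j x(1) d(5)] x(3) by (meson less_imp_le)
      have "L * d\<^sup>2 \<le> L * B * d"
        using d L(1) B(1) by (simp add: power2_eq_square mult_mono' mult_le_one)
      moreover have "cmod (clin I J M x j) < e / 2"
        using d2(2)[of x] x(3) d(3) j by fastforce
      ultimately show "cmod (F x j) < e"
        using 1 dLB norm_triangle_sub[of "F x j" "clin I J M x j"] by linarith
      have 2: "cmod (of_real t * F x j - of_real t * clin I J M x j) \<le> L * B * d"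
      proof -
        \<comment> \<open>Both bounds on the coordinates of \<open>x\<close> are used in
          \<open>s * s\<close>: one factor is replaced by the small \<open>d\<close>, the other by
          \<open>B / t\<close>, which cancels \<open>t\<close>.\<close>
        define s where "s = Min {d, B / t}"
        have "cmod (x i) \<le> s" if i: "i \<in> I" for i
        proof -
          have "t * cmod (x i) \<le> cmod (of_real t * x i - v i) + cmod (v i)"
            using norm_triangle_sub[of "of_real t * x i" "v i"] x(2) by (simp add: norm_mult)
          also have "\<dots> \<le> B" using x(3) i d(4) B(2)[OF i] by force
          finally have "cmod (x i) \<le> B / t" using x(2) by (simp add: field_simps)
          then show ?thesis using x(3) i by (auto simp: s_def intro: less_imp_le)
        qed
        moreover have s: "s \<le> d" "s \<le> B / t" "s > 0" using d(1) B(1) x(2) by (auto simp: s_def)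
        ultimately have "cmod (F x j - clin I J M x j) \<le> L * s\<^sup>2"
          using est[OF j x(1), of s] d(5) by auto
        then have "t * cmod (F x j - clin I J M x j) \<le> t * (L * (s * s))"
          using x(2) by (simp add: power2_eq_square)
        also have "\<dots> \<le> t * (L * (d * (B / t)))"
          using s x(2) L(1) d(1) by (intro mult_left_mono mult_mono) auto
        also have "\<dots> = L * B * d" using x(2) by simp
        finally show ?thesis
          using x(2) by (simp add: norm_mult flip: right_diff_distrib)
      qed
      have 3: "cmod (of_real t * clin I J M x j - clin I J M v j) < e / 2"
      proof -
        have "clin I J M (cscale (of_real t) x) j = of_real t * clin I J M x j"
          by (simp add: clin_cscale) (simp add: cscale_def)
        moreover have "\<forall>i\<in>I. cmod (cscale (of_real t) x i - v i) < d1"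
          using x(3) d(2) by (force simp: cscale_def)
        ultimately show ?thesis using d1(2)[of "cscale (of_real t) x"] j by metis
      qed
      show "cmod (of_real t * F x j - clin I J M v j) < e"
        using norm_triangle_ineq[of "of_real t * F x j - of_real t * clin I J M x j" "of_real t * clin I J M x j - clin I J M v j"]
          2 3 dLB by simp
    qed
    then show "\<exists>d>0. \<forall>x\<in>cspace I. \<forall>t>0.
     (\<forall>i\<in>I. cmod (x i) < d \<and> cmod (of_real t * x i - v i) < d) \<longrightarrow>
     (\<forall>j\<in>J. cmod (F x j) < e \<and> cmod (of_real t * F x j - clin I J M v j) < e)"
      using d(1) by blast
  qed
qed

text \<open>No chain rule is involved: the points \<open>x\<close> that approximate \<open>v\<close>
  have images that approximate \<open>M v\<close>, and \<open>G (F x) = x\<close> makes the same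
  points show that \<open>N\<close> takes \<open>M v\<close> back to \<open>v\<close>.\<close>

lemma tangent_cone_map:
  assumes fin: "finite I" "finite J" and X: "X \<subseteq> cspace I" and Y: "Y \<subseteq> cspace J"
    and U: "openin (top_of_set (cspace I)) U" "0 \<in> U"
    and FG: "\<And>x. x \<in> X \<inter> U \<Longrightarrow> F x \<in> Y" "\<And>x. x \<in> X \<inter> U \<Longrightarrow> G (F x) = x"
    and M: "tangent_map I J F M"
    and N: "tangent_map J I G N"
    and v: "v \<in> tangent_cone I X"
  shows "clin I J M v \<in> tangent_cone J Y" "clin J I N (clin I J M v) = v"
proof -
  have vc: "v \<in> cspace I" using v by (simp add: tangent_cone_def)
  obtain d0 where d0: "d0 > 0" "\<And>z. z \<in> cspace I \<Longrightarrow> (\<forall>i\<in>I. cmod (z i) < d0) \<Longrightarrow> z \<in> U"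
    using openin_cspace_polydisc[OF U] by auto
  have key: "\<exists>x\<in>X \<inter> U. \<exists>t::real. t > 0 \<and> (\<forall>i\<in>I. cmod (of_real t * x i - v i) < e) \<and>
      (\<forall>j\<in>J. cmod (F x j) < e \<and> cmod (of_real t * F x j - clin I J M v j) < e)" if e: "e > 0" for e
  proof -
    obtain d where d: "d > 0" "\<forall>x\<in>cspace I. \<forall>t>0.
      (\<forall>i\<in>I. cmod (x i) < d \<and> cmod (of_real t * x i - v i) < d) \<longrightarrow>
     (\<forall>j\<in>J. cmod (F x j) < e \<and> cmod (of_real t * F x j - clin I J M v j) < e)"
      by (rule tangent_mapE[OF M vc e])
    define d' where "d' = Min {d, d0, e}"
    have d': "d' > 0" "d' \<le> d" "d' \<le> d0" "d' \<le> e" using d(1) d0(1) e by (auto simp: d'_def)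
    obtain x t where x: "x \<in> X" "t > 0" "\<forall>i\<in>I. cmod (x i) < d' \<and> cmod (of_real t * x i - v i) < d'"
      using v d'(1) unfolding tangent_cone_def by blast
    have "x \<in> U" using d0(2)[of x] x X d'(3) by force
    moreover have "\<forall>i\<in>I. cmod (of_real t * x i - v i) < e" using x(3) d'(4) by force
    moreover have "\<forall>j\<in>J. cmod (F x j) < e \<and> cmod (of_real t * F x j - clin I J M v j) < e"
      using d(2)[THEN bspec, THEN spec, THEN mp, THEN mp, of x t] x X d'(2) by force
    ultimately show ?thesis using x(1,2) by blast
  qed
  show "clin I J M v \<in> tangent_cone J Y"
    unfolding tangent_cone_def
  proof (intro CollectI conjI allI impI)
    fix e :: real assume "e > 0"
    from key[OF this] obtain x t where "x \<in> X \<inter> U" "t > 0"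
      "\<forall>j\<in>J. cmod (F x j) < e \<and> cmod (of_real t * F x j - clin I J M v j) < e" by blast
    then show "\<exists>y\<in>Y. \<exists>t::real. t > 0 \<and> (\<forall>j\<in>J. cmod (y j) < e \<and> cmod (of_real t * y j - clin I J M v j) < e)"
      using FG(1) by blast
  qed simp
  show "clin J I N (clin I J M v) = v"
  proof
    fix i
    show "clin J I N (clin I J M v) i = v i"
    proof (cases "i \<in> I")
      case True
      let ?w = "clin I J M v"
      have "cmod (clin J I N ?w i - v i) \<le> 0 + e" if e: "e > 0" for e
      proof -
        obtain d where d: "d > 0" "\<forall>x\<in>cspace J. \<forall>t>0.
            (\<forall>i\<in>J. cmod (x i) < d \<and> cmod (of_real t * x i - ?w i) < d) \<longrightarrow>
            (\<forall>j\<in>I. cmod (G x j) < e/2 \<and> cmod (of_real t * G x j - clin J I N ?w j) < e/2)"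
          by (rule tangent_mapE[OF N clin_in_cspace half_gt_zero[OF e]])
        define d' where "d' = min d (e/2)"
        obtain x t where x: "x \<in> X \<inter> U" "t > 0" "\<forall>i\<in>I. cmod (of_real t * x i - v i) < d'"
           "\<forall>j\<in>J. cmod (F x j) < d' \<and> cmod (of_real t * F x j - ?w j) < d'"
          using key[of d'] d(1) e by (auto simp: d'_def)
        have "cmod (of_real t * G (F x) i - clin J I N ?w i) < e/2"
          using d(2)[THEN bspec, THEN spec, THEN mp, THEN mp, of "F x" t] x FG(1)[OF x(1)] Y True by (auto simp: d'_def)
        moreover have "cmod (of_real t * x i - v i) < e/2" using x(3) True by (simp add: d'_def)
        ultimately show ?thesis
          using FG(2)[OF x(1)] norm_triangle_ineq4[of "of_real t * x i - v i" "of_real t * x i - clin J I N ?w i"] by simp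
      qed
      then have "cmod (clin J I N ?w i - v i) \<le> 0" by (rule field_le_epsilon)
      then show ?thesis by simp
    next
      case False
      then show ?thesis using vc by (simp add: clin_def cspace_def)
    qed
  qed
qed

text \<open>The index sets may have different sizes; \<open>M\<close> and \<open>N\<close> are
  inverse on the two cones and nothing is claimed off them.\<close>

theorem tangent_cone_iso:
  assumes fin: "finite I" "finite J" and X: "X \<subseteq> cspace I" and Y: "Y \<subseteq> cspace J"
    and iso: "locally_analytically_isomorphic I X 0 J Y 0"
  obtains M N where
    "\<And>v. v \<in> tangent_cone I X \<Longrightarrow> clin I J M v \<in> tangent_cone J Y"
    "\<And>v. v \<in> tangent_cone I X \<Longrightarrow> clin J I N (clin I J M v) = v"
    "\<And>v. v \<in> tangent_cone J Y \<Longrightarrow> clin J I N v \<in> tangent_cone I X"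
    "\<And>v. v \<in> tangent_cone J Y \<Longrightarrow> clin I J M (clin J I N v) = v"
proof -
  obtain U V F G where UV: "0 \<in> X \<inter> U" "0 \<in> Y \<inter> V" "analytic_map I J U F" "analytic_map J I V G"
     "homeomorphism (X \<inter> U) (Y \<inter> V) F G" "F 0 = 0"
    using iso unfolding locally_analytically_isomorphic_def by blast
  have G0: "G 0 = 0" using UV by (metis homeomorphism_def)
  have op: "openin (top_of_set (cspace I)) U" "openin (top_of_set (cspace J)) V"
    using UV by (auto simp: analytic_map_def)
  have FG: "\<And>x. x \<in> X \<inter> U \<Longrightarrow> F x \<in> Y" "\<And>x. x \<in> X \<inter> U \<Longrightarrow> G (F x) = x"
      "\<And>y. y \<in> Y \<inter> V \<Longrightarrow> G y \<in> X" "\<And>y. y \<in> Y \<inter> V \<Longrightarrow> F (G y) = y"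
    using UV(5) by (auto simp: homeomorphism_def)
  obtain M where M: "tangent_map I J F M"
    using analytic_map_tangent[OF fin UV(3)] UV by blast
  obtain N where N: "tangent_map J I G N"
    using analytic_map_tangent[OF fin(2,1) UV(4)] UV G0 by blast
  show ?thesis
  proof
    show "clin I J M v \<in> tangent_cone J Y" if "v \<in> tangent_cone I X" for v
      using tangent_cone_map[OF fin X Y op(1) _ FG(1,2) M N] UV that by blast
    show "clin J I N (clin I J M v) = v" if "v \<in> tangent_cone I X" for v
      using tangent_cone_map[OF fin X Y op(1) _ FG(1,2) M N] UV that by blast
    show "clin J I N v \<in> tangent_cone I X" if "v \<in> tangent_cone J Y" for v
      using tangent_cone_map[OF fin(2,1) Y X op(2) _ FG(3,4) N M] UV that by blast
    show "clin I J M (clin J I N v) = v" if "v \<in> tangent_cone J Y" for v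
      using tangent_cone_map[OF fin(2,1) Y X op(2) _ FG(3,4) N M] UV that by blast
  qed
qed

section \<open>The defining equations\<close>

text \<open>The factor \<kappa> separates the three varieties in play:
  \<open>e^2 - 4 q Q - d^2\<close> gives the Calogero-Moser space, 0 its tangent cone for
  \<open>d \<ge> 5\<close>, and \<open>-1\<close> the weighted cone.\<close>

definition cm_eqs :: "nat \<Rightarrow> complex \<Rightarrow> complex \<Rightarrow> complex \<Rightarrow> complex \<Rightarrow> (nat \<Rightarrow> complex) \<Rightarrow> bool" where
  "cm_eqs d \<kappa> q Q e a \<longleftrightarrow> (\<forall>j k. 1 \<le> j \<and> j \<le> k \<and> k \<le> d - 1 \<longrightarrow>
      e * a j = q * a (j + 1) + Q * a (j - 1) \<and>
      a (j - 1) * a (k + 1) - a j * a k = \<kappa> * q ^ (d - k - 1) * Q ^ (j - 1) * Psi (k - j) q Q e)"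

lemma calogero_moser_eq:
  "calogero_moser d = {z \<in> cspace {..<d + 4}.
     cm_eqs d ((z 2)\<^sup>2 - 4 * z 0 * z 1 - (of_nat d)\<^sup>2) (z 0) (z 1) (z 2) (\<lambda>j. z (j + 3))}"
  unfolding calogero_moser_def cm_eqs_def Let_def ..

lemma cm_eqsI:
  assumes "\<And>j. 1 \<le> j \<Longrightarrow> j \<le> d - 1 \<Longrightarrow> e * a j = q * a (j + 1) + Q * a (j - 1)"
    and "\<And>j k. 1 \<le> j \<Longrightarrow> j \<le> k \<Longrightarrow> k \<le> d - 1 \<Longrightarrow>
      a (j - 1) * a (k + 1) - a j * a k = \<kappa> * q ^ (d - k - 1) * Q ^ (j - 1) * Psi (k - j) q Q e"
  shows "cm_eqs d \<kappa> q Q e a"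
  using assms unfolding cm_eqs_def by (meson order_trans)

lemma cm_eqsD:
  assumes "cm_eqs d \<kappa> q Q e a"
  shows "1 \<le> j \<Longrightarrow> j \<le> d - 1 \<Longrightarrow> e * a j = q * a (j + 1) + Q * a (j - 1)"
    and "1 \<le> j \<Longrightarrow> j \<le> k \<Longrightarrow> k \<le> d - 1 \<Longrightarrow>
      a (j - 1) * a (k + 1) - a j * a k = \<kappa> * q ^ (d - k - 1) * Q ^ (j - 1) * Psi (k - j) q Q e"
  using assms unfolding cm_eqs_def by blast+

lemma cm_eqs_cong:
  assumes "\<And>j. j \<le> d \<Longrightarrow> a j = b j" "d \<ge> 1"
  shows "cm_eqs d \<kappa> q Q e a \<longleftrightarrow> cm_eqs d \<kappa> q Q e b"
proof -
  have "a (j - 1) = b (j - 1) \<and> a j = b j \<and> a (j + 1) = b (j + 1) \<and> a k = b k \<and> a (k + 1) = b (k + 1)"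
    if "1 \<le> j \<and> j \<le> k \<and> k \<le> d - 1" for j k
    using that assms by auto
  then show ?thesis unfolding cm_eqs_def by metis
qed

lemma Psi_scale: "Psi k (r * q) (r * Q) (r * e) = r ^ k * Psi k q Q e"
  by (induction k q Q e rule: Psi.induct) (auto simp: algebra_simps power2_eq_square)

text \<open>Bihomogeneity: the right-hand sides have degree \<open>d - 2\<close> in
  \<open>q, Q, e\<close>, the left-hand sides degree 2 in \<open>a\<close>. With
  \<open>r = 1\<close> this absorbs a unit into \<open>a\<close>; with \<kappa> kept it gives the
  weighted dilations.\<close>

lemma cm_eqs_scale:
  assumes eqs: "cm_eqs d \<kappa> q Q e a" and \<kappa>: "\<kappa>' * r ^ (d - 2) = \<kappa> * s\<^sup>2"
  shows "cm_eqs d \<kappa>' (r * q) (r * Q) (r * e) (\<lambda>j. s * a j)"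
proof (rule cm_eqsI)
  fix j assume "1 \<le> j" "j \<le> d - 1"
  then have "r * s * (e * a j) = r * s * (q * a (j + 1) + Q * a (j - 1))"
    using cm_eqsD(1)[OF eqs] by simp
  then show "r * e * (s * a j) = r * q * (s * a (j + 1)) + r * Q * (s * a (j - 1))"
    by (simp add: algebra_simps)
next
  fix j k assume jk: "1 \<le> j" "j \<le> k" "k \<le> d - 1"
  have "d - 2 = (d - k - 1) + (j - 1) + (k - j)" using jk by auto
  then have r: "r ^ (d - 2) = r ^ (d - k - 1) * r ^ (j - 1) * r ^ (k - j)"
    by (simp only: power_add)
  have "s * a (j - 1) * (s * a (k + 1)) - s * a j * (s * a k) = s\<^sup>2 * (a (j - 1) * a (k + 1) - a j * a k)"
    by (simp add: algebra_simps power2_eq_square)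
  also have "\<dots> = (\<kappa> * s\<^sup>2) * (q ^ (d - k - 1) * Q ^ (j - 1) * Psi (k - j) q Q e)"
    using cm_eqsD(2)[OF eqs jk] by (simp add: algebra_simps)
  also have "\<dots> = \<kappa>' * (r * q) ^ (d - k - 1) * (r * Q) ^ (j - 1) * Psi (k - j) (r * q) (r * Q) (r * e)"
    unfolding \<kappa>[symmetric] r Psi_scale power_mult_distrib by (simp only: mult_ac)
  finally show "s * a (j - 1) * (s * a (k + 1)) - s * a j * (s * a k) =
     \<kappa>' * (r * q) ^ (d - k - 1) * (r * Q) ^ (j - 1) * Psi (k - j) (r * q) (r * Q) (r * e)" .
qed

text \<open>Binet's formula: if \<open>e = s + t\<close> and \<open>q Q = s t\<close>, then
  \<open>Psi k\<close> is \<open>(s^(k+1) - t^(k+1)) / (s - t)\<close>; here \<open>s = x y'\<close>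
  and \<open>t = x' y\<close>. The denominator is multiplied out so that \<open>s = t\<close> is
  allowed.\<close>

lemma Psi_binet:
  "(x * y' - x' * y) * Psi k (x * x') (y * y') (x * y' + x' * y) = (x * y') ^ Suc k - (x' * y) ^ Suc k"
proof (induction k rule: less_induct)
  case (less k)
  consider "k = 0" | "k = 1" | m where "k = Suc (Suc m)"
    by (metis One_nat_def not0_implies_Suc)
  then show ?case
  proof cases
    case 3
    define s t where "s = x * y'" and "t = x' * y"
    have st: "x * x' * (y * y') = s * t" by (simp add: s_def t_def)
    let ?P = "\<lambda>k. Psi k (x * x') (y * y') (x * y' + x' * y)"
    have "(s - t) * ?P k = (s + t) * ((s - t) * ?P (Suc m)) - s * t * ((s - t) * ?P m)"
      using 3 by (simp add: st flip: s_def t_def) (simp add: algebra_simps)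
    also have "\<dots> = (s + t) * (s ^ Suc (Suc m) - t ^ Suc (Suc m)) - s * t * (s ^ Suc m - t ^ Suc m)"
      using less.IH[of "Suc m"] less.IH[of m] 3 by (simp add: s_def t_def)
    also have "\<dots> = s ^ Suc k - t ^ Suc k"
      using 3 by (simp add: algebra_simps)
    finally show ?thesis by (simp add: s_def t_def)
  qed (auto simp: algebra_simps power2_eq_square)
qed

text \<open>
  With \<open>v = (x, y)\<close> and \<open>v' = (x', y')\<close>, the point with \<open>(q, Q, e) = v v'\<close> (a product of linear
  forms) and \<open>a = \<alpha> v\<^sup>d + \<beta> v'\<^sup>d\<close>; such points are dense.
\<close>

lemma cm_eqs_param:
  assumes "\<alpha> * \<beta> * (x * y' - x' * y)\<^sup>2 = \<kappa>"
  shows "cm_eqs d \<kappa> (x * x') (y * y') (x * y' + x' * y)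
           (\<lambda>j. \<alpha> * x ^ (d - j) * y ^ j + \<beta> * x' ^ (d - j) * y' ^ j)"
proof (rule cm_eqsI)
  fix j assume j: "1 \<le> j" "j \<le> d - 1"
  define i n where "i = j - 1" and "n = d - j - 1"
  have "j = Suc i" "d = Suc (Suc i) + n"
    using j by (auto simp: i_def n_def)
  then show "(x * y' + x' * y) * (\<alpha> * x ^ (d - j) * y ^ j + \<beta> * x' ^ (d - j) * y' ^ j) =
    x * x' * (\<alpha> * x ^ (d - (j + 1)) * y ^ (j + 1) + \<beta> * x' ^ (d - (j + 1)) * y' ^ (j + 1)) +
    y * y' * (\<alpha> * x ^ (d - (j - 1)) * y ^ (j - 1) + \<beta> * x' ^ (d - (j - 1)) * y' ^ (j - 1))"
    by (simp add: algebra_simps)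
next
  fix j k assume jk: "1 \<le> j" "j \<le> k" "k \<le> d - 1"
  define i m n where "i = j - 1" and "m = k - j" and "n = d - k - 1"
  have ex: "j = Suc i" "k = Suc i + m" "d = Suc (Suc i + m) + n"
    using jk by (auto simp: i_def m_def n_def)
  have e1: "d - (j - 1) = n + m + 2" "d - (k + 1) = n" "d - j = n + m + 1" "d - k = n + 1" "d - k - 1 = n"
    "j - 1 = i" "k - j = m" "k + 1 = i + m + 2" "j = i + 1" "k = i + m + 1"
    using ex by auto
  have "(\<alpha> * x ^ (n + m + 2) * y ^ i + \<beta> * x' ^ (n + m + 2) * y' ^ i) *
     (\<alpha> * x ^ n * y ^ (i + m + 2) + \<beta> * x' ^ n * y' ^ (i + m + 2)) -
     (\<alpha> * x ^ (n + m + 1) * y ^ (i + 1) + \<beta> * x' ^ (n + m + 1) * y' ^ (i + 1)) *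
     (\<alpha> * x ^ (n + 1) * y ^ (i + m + 1) + \<beta> * x' ^ (n + 1) * y' ^ (i + m + 1)) =
     \<alpha> * \<beta> * (x * x') ^ n * (y * y') ^ i * ((x * y' - x' * y) * ((x * y') ^ Suc m - (x' * y) ^ Suc m))"
    by (simp add: power_add power_mult_distrib power2_eq_square algebra_simps)
  also have "\<dots> = \<kappa> * (x * x') ^ n * (y * y') ^ i * Psi m (x * x') (y * y') (x * y' + x' * y)"
    unfolding Psi_binet[symmetric] assms[symmetric] by (simp add: power2_eq_square algebra_simps)
  finally show "(\<alpha> * x ^ (d - (j - 1)) * y ^ (j - 1) + \<beta> * x' ^ (d - (j - 1)) * y' ^ (j - 1)) *
       (\<alpha> * x ^ (d - (k + 1)) * y ^ (k + 1) + \<beta> * x' ^ (d - (k + 1)) * y' ^ (k + 1)) -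
       (\<alpha> * x ^ (d - j) * y ^ j + \<beta> * x' ^ (d - j) * y' ^ j) *
       (\<alpha> * x ^ (d - k) * y ^ k + \<beta> * x' ^ (d - k) * y' ^ k) =
       \<kappa> * (x * x') ^ (d - k - 1) * (y * y') ^ (j - 1) *
       Psi (k - j) (x * x') (y * y') (x * y' + x' * y)"
    unfolding e1(1) unfolding e1(2) unfolding e1(3) unfolding e1(5) unfolding e1(4)
    unfolding e1(6) unfolding e1(7) unfolding e1(8) unfolding e1(9) unfolding e1(10) .
qed

definition cm_point :: "nat \<Rightarrow> complex \<Rightarrow> complex \<Rightarrow> complex \<Rightarrow> (nat \<Rightarrow> complex) \<Rightarrow> nat \<Rightarrow> complex" where
  "cm_point d q Q e a = (\<lambda>i. if i = 0 then q else if i = 1 then Q else if i = 2 then e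
     else if i < d + 4 then a (i - 3) else 0)"

lemma cm_point_in_cspace [simp]: "cm_point d q Q e a \<in> cspace {..<d + 4}"
  by (auto simp: cm_point_def cspace_def)

lemma cm_point_simps [simp]:
  "cm_point d q Q e a 0 = q" "cm_point d q Q e a (Suc 0) = Q" "cm_point d q Q e a 2 = e"
  "j \<le> d \<Longrightarrow> cm_point d q Q e a (j + 3) = a j"
  by (auto simp: cm_point_def)

lemma cm_point_coords:
  assumes "z \<in> cspace {..<d + 4}"
  shows "z = cm_point d (z 0) (z 1) (z 2) (\<lambda>j. z (j + 3))"
proof
  fix i
  show "z i = cm_point d (z 0) (z 1) (z 2) (\<lambda>j. z (j + 3)) i"
    using cspaceD[OF assms, of i] by (auto simp: cm_point_def)
qed

lemma cm_eqs_point: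
  assumes "d \<ge> 1"
  shows "cm_eqs d \<kappa> q Q e (\<lambda>j. cm_point d q' Q' e' a (j + 3)) \<longleftrightarrow> cm_eqs d \<kappa> q Q e a"
  by (intro cm_eqs_cong assms) simp

lemma cm_point_eqI:
  assumes "q = q'" "Q = Q'" "e = e'" "\<And>j. j \<le> d \<Longrightarrow> a j = b j"
  shows "cm_point d q Q e a = cm_point d q' Q' e' b"
  using assms by (auto simp: cm_point_def fun_eq_iff)

section \<open>Lines in the cone over the rational normal curve\<close>

text \<open>The rational normal curve of degree \<open>d\<close>.\<close>

definition rnc :: "nat \<Rightarrow> (nat \<Rightarrow> complex) \<Rightarrow> bool" where
  "rnc d a \<longleftrightarrow> (\<forall>j k. 1 \<le> j \<and> j \<le> k \<and> k \<le> d - 1 \<longrightarrow> a (j - 1) * a (k + 1) = a j * a k)"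

lemma cm_eqs_0_iff:
  "cm_eqs d 0 q Q e a \<longleftrightarrow> rnc d a \<and> (\<forall>j. 1 \<le> j \<and> j \<le> d - 1 \<longrightarrow> e * a j = q * a (j + 1) + Q * a (j - 1))"
  unfolding cm_eqs_def rnc_def by (auto dest: order_trans)

text \<open>The relations \<open>a_(j-1) a_(j+1) = a_j^2\<close> push a zero upwards, but only below
  \<open>d\<close>: the vector with \<open>a_d\<close> as its single nonzero entry lies on the
  cone.\<close>

lemma rnc_vanish:
  assumes "rnc d a" "a 0 = 0" "j < d"
  shows "a j = 0"
  using assms(3)
proof (induction j)
  case (Suc j)
  then have "a j * a (Suc j + 1) = a (Suc j) * a (Suc j)"
    using assms(1)[unfolded rnc_def, rule_format, of "Suc j" "Suc j"] by auto
  then show ?case using Suc by simp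
qed (use assms in auto)

lemma rnc_geometric:
  assumes "rnc d a" "a 0 \<noteq> 0" "j \<le> d"
  shows "a j = a 0 * (a 1 / a 0) ^ j"
  using assms(3)
proof (induction j)
  case (Suc j)
  show ?case
  proof (cases "j = 0")
    case False
    then have "a 0 * a (j + 1) = a 1 * a j"
      using assms(1)[unfolded rnc_def, rule_format, of 1 j] Suc by auto
    then show ?thesis using Suc assms(2) by (simp add: field_simps)
  qed (use assms in auto)
qed auto

text \<open>Lines in this cone are radial. The equations are quadratic in the parameter of the line,
  so the values at -1, 0 and 1 give the equations of \<open>b\<close> and the mixed ones. If
  \<open>a_0\<close> is nonzero, subtracting the multiple of \<open>a\<close> that kills the first
  entry leaves a vector of the cone that vanishes below \<open>d\<close>, and a mixed equation kills
  its last entry. If \<open>a_0 = 0\<close>, then \<open>a\<close> is supported at \<open>d\<close>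
  and the mixed equations force the same on \<open>b\<close>.\<close>

lemma rnc_line:
  assumes d: "d \<ge> 3" and a0: "\<exists>j\<le>d. a j \<noteq> 0"
    and a: "rnc d a" and plus: "rnc d (\<lambda>j. a j + b j)" and minus: "rnc d (\<lambda>j. a j - b j)"
  shows "\<exists>c. \<forall>j\<le>d. b j = c * a j"
proof -
  have E: "b (j - 1) * b (k + 1) = b j * b k \<and>
      a (j - 1) * b (k + 1) + b (j - 1) * a (k + 1) = a j * b k + b j * a k"
    if jk: "1 \<le> j" "j \<le> k" "k \<le> d - 1" for j k
  proof -
    have 1: "a (j - 1) * a (k + 1) = a j * a k"
      "(a (j - 1) + b (j - 1)) * (a (k + 1) + b (k + 1)) = (a j + b j) * (a k + b k)"
      "(a (j - 1) - b (j - 1)) * (a (k + 1) - b (k + 1)) = (a j - b j) * (a k - b k)"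
      using a plus minus jk unfolding rnc_def by blast+
    have "2 * (b (j - 1) * b (k + 1)) = 2 * (b j * b k)" using 1 by algebra
    moreover have "2 * (a (j - 1) * b (k + 1) + b (j - 1) * a (k + 1)) = 2 * (a j * b k + b j * a k)" using 1 by algebra
    ultimately show ?thesis by (simp only: mult_cancel_left) simp
  qed
  show ?thesis
  proof (cases "a 0 = 0")
    case False
    define s where "s = b 0 / a 0"
    define c where "c j = b j - s * a j" for j
    have c0: "c 0 = 0" using False by (simp add: c_def s_def)
    have "rnc d c" unfolding rnc_def
    proof (intro allI impI)
      fix j k assume jk: "1 \<le> j \<and> j \<le> k \<and> k \<le> d - 1"
      have "a (j - 1) * a (k + 1) = a j * a k" using a jk unfolding rnc_def by blast
      then show "c (j - 1) * c (k + 1) = c j * c k"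
        using E[of j k] jk unfolding c_def by algebra
    qed
    note c = rnc_vanish[OF this c0]
    have "a 0 * a d = a 1 * a (d - 1)"
      using a[unfolded rnc_def, rule_format, of 1 "d - 1"] d by auto
    moreover have "a 0 * b d + b 0 * a d = a 1 * b (d - 1) + b 1 * a (d - 1)"
      using E[of 1 "d - 1"] d by auto
    moreover have "b 0 = s * a 0" "b 1 = s * a 1" "b (d - 1) = s * a (d - 1)"
      using c[of 0] c[of 1] c[of "d - 1"] d by (auto simp: c_def)
    ultimately have "a 0 * (b d - s * a d) = 0" by algebra
    then have "c d = 0" using False by (simp add: c_def)
    then have "\<forall>j\<le>d. b j = s * a j" using c by (auto simp: c_def le_less)
    then show ?thesis by blast
  next
    case True
    note av = rnc_vanish[OF a True]
    have ad: "a d \<noteq> 0" using a0 av by (metis le_less)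
    have b1: "b j = 0" if j: "j \<le> d - 2" for j
    proof -
      have "a j * b d + b j * a d = a (j + 1) * b (d - 1) + b (j + 1) * a (d - 1)"
        using E[of "j + 1" "d - 1"] d j by auto
      then show ?thesis using av j d ad by auto
    qed
    have "b (d - 2) * b d = b (d - 1) * b (d - 1)"
      using E[of "d - 1" "d - 1"] d by (auto simp: numeral_2_eq_2)
    then have "b (d - 1) = 0" using b1[of "d - 2"] by auto
    then have bv: "b j = 0" if "j < d" for j
      using b1[of j] that by (cases "j = d - 1") auto
    have "\<forall>j\<le>d. b j = (b d / a d) * a j"
      using ad av bv by (metis le_less mult_zero_right nonzero_eq_divide_eq)
    then show ?thesis by blast
  qed
qed

section \<open>The tangent cone of the Calogero-Moser space\<close>

text \<open>The multiplier belonging to the parameter \<open>s\<close> is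
  \<open>1 / s\<close>.\<close>

lemma tangent_coneI_curve:
  assumes "finite I" "v \<in> cspace I" "eventually (\<lambda>s. x s \<in> X) (at_right (0::real))"
    and lim: "\<And>i. i \<in> I \<Longrightarrow> ((\<lambda>s. x s i / of_real s) \<longlongrightarrow> v i) (at_right 0)"
  shows "v \<in> tangent_cone I X"
  unfolding tangent_cone_def
proof (intro CollectI conjI allI impI assms(2))
  fix e :: real assume e: "e > 0"
  have 1: "eventually (\<lambda>s. cmod (x s i / of_real s - v i) < e) (at_right 0)" if "i \<in> I" for i
    using tendstoD[OF lim[OF that] e] by (simp add: dist_norm)
  have 2: "eventually (\<lambda>s. cmod (x s i) < e) (at_right 0)" if "i \<in> I" for i
  proof -
    have "((\<lambda>s. of_real s * (x s i / of_real s)) \<longlongrightarrow> of_real 0 * v i) (at_right 0)"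
      by (intro tendsto_intros lim that)
    then have "eventually (\<lambda>s. dist (of_real s * (x s i / of_real s)) (of_real 0 * v i) < e) (at_right 0)"
      using e by (rule tendstoD)
    moreover have "eventually (\<lambda>s. s > 0) (at_right (0::real))"
      by (rule eventually_at_right_less)
    ultimately show ?thesis by eventually_elim auto
  qed
  have "eventually (\<lambda>s. \<forall>i\<in>I. cmod (x s i) < e \<and> cmod (x s i / of_real s - v i) < e) (at_right 0)"
    using 1 2 assms(1) by (simp add: eventually_ball_finite_distrib eventually_conj_iff)
  with assms(3) eventually_at_right_less[of 0]
  have "eventually (\<lambda>s. x s \<in> X \<and> s > 0 \<and> (\<forall>i\<in>I. cmod (x s i) < e \<and> cmod (x s i / of_real s - v i) < e)) (at_right 0)"
    by eventually_elim auto
  from eventually_happens'[OF _ this] obtain s where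
    s: "x s \<in> X" "s > 0" "\<forall>i\<in>I. cmod (x s i) < e \<and> cmod (x s i / of_real s - v i) < e"
    by auto
  then show "\<exists>y\<in>X. \<exists>t>0. \<forall>i\<in>I. cmod (y i) < e \<and> cmod (of_real t * y i - v i) < e"
    by (intro bexI[of _ "x s"] exI[of _ "1 / s"]) (auto simp: divide_simps)
qed

text \<open>Tangent cones are closed: half of the tolerance goes to the approximation of
  \<open>v\<close> by an element of the cone, half to the approximation of that element by multiples
  of points of \<open>X\<close>.\<close>

lemma tangent_cone_limit:
  assumes "finite I" "v \<in> cspace I" "eventually (\<lambda>s. x s \<in> tangent_cone I X) (at_right (0::real))"
    and lim: "\<And>i. i \<in> I \<Longrightarrow> ((\<lambda>s. x s i) \<longlongrightarrow> v i) (at_right 0)"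
  shows "v \<in> tangent_cone I X"
  unfolding tangent_cone_def
proof (intro CollectI conjI allI impI assms(2))
  fix e :: real assume e: "e > 0"
  have "eventually (\<lambda>s. \<forall>i\<in>I. cmod (x s i - v i) < e / 2) (at_right 0)"
    unfolding eventually_ball_finite_distrib[OF assms(1)]
  proof
    fix i assume "i \<in> I"
    from tendstoD[OF lim[OF this] half_gt_zero[OF e]]
    show "eventually (\<lambda>s. cmod (x s i - v i) < e / 2) (at_right 0)"
      unfolding dist_norm .
  qed
  with assms(3) have "eventually (\<lambda>s. x s \<in> tangent_cone I X \<and> (\<forall>i\<in>I. cmod (x s i - v i) < e / 2)) (at_right 0)"
    by eventually_elim auto
  from eventually_happens'[OF _ this] obtain s where
    s: "x s \<in> tangent_cone I X" "\<forall>i\<in>I. cmod (x s i - v i) < e / 2" by auto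
  then obtain y t where y: "y \<in> X" "t > 0" "\<forall>i\<in>I. cmod (y i) < e / 2 \<and> cmod (of_real t * y i - x s i) < e / 2"
    using e unfolding tangent_cone_def by (auto dest!: spec[of _ "e/2"])
  have "cmod (of_real t * y i - v i) < e" if "i \<in> I" for i
    using norm_triangle_ineq[of "of_real t * y i - x s i" "x s i - v i"] s(2) y(3) that by fastforce
  moreover have "cmod (y i) < e" if "i \<in> I" for i
    using y(3) that e by fastforce
  ultimately show "\<exists>y\<in>X. \<exists>t>0. \<forall>i\<in>I. cmod (y i) < e \<and> cmod (of_real t * y i - v i) < e"
    using y(1,2) by blast
qed

lemma tangent_cone_sequence:
  assumes "v \<in> tangent_cone I X"
  obtains x t where "\<And>n. x n \<in> X" "\<And>n. t n > (0::real)"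
    "\<And>i. i \<in> I \<Longrightarrow> (\<lambda>n. x n i) \<longlonglongrightarrow> 0" "\<And>i. i \<in> I \<Longrightarrow> (\<lambda>n. of_real (t n) * x n i) \<longlonglongrightarrow> v i"
proof -
  have "\<exists>x t. x \<in> X \<and> t > (0::real) \<and> (\<forall>i\<in>I. cmod (x i) < 1 / Suc n \<and> cmod (of_real t * x i - v i) < 1 / Suc n)" for n
  proof -
    have "1 / real (Suc n) > 0" by simp
    then show ?thesis using assms unfolding tangent_cone_def by blast
  qed
  then obtain x t where xt: "\<And>n. x n \<in> X" "\<And>n. t n > (0::real)"
    "\<And>n i. i \<in> I \<Longrightarrow> cmod (x n i) < 1 / Suc n" "\<And>n i. i \<in> I \<Longrightarrow> cmod (of_real (t n) * x n i - v i) < 1 / Suc n"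
    by metis
  show ?thesis
  proof (rule that[OF xt(1,2)])
    have lim: "(\<lambda>n. 1 / real (Suc n)) \<longlonglongrightarrow> 0"
      using LIMSEQ_inverse_real_of_nat by (simp add: inverse_eq_divide)
    fix i assume i: "i \<in> I"
    show "(\<lambda>n. x n i) \<longlonglongrightarrow> 0"
      by (rule Lim_null_comparison[OF _ lim]) (use xt(3)[OF i] in \<open>auto intro!: always_eventually less_imp_le\<close>)
    show "(\<lambda>n. of_real (t n) * x n i) \<longlonglongrightarrow> v i"
      by (rule LIM_zero_cancel, rule Lim_null_comparison[OF _ lim])
        (use xt(4)[OF i] in \<open>auto intro!: always_eventually less_imp_le\<close>)
  qed
qed

text \<open>The recursion yields \<open>2^(k+1) + 2^k = 3 * 2^k\<close>, at most
  \<open>2^(k+2)\<close>. What matters is the order \<open>k\<close> in \<open>m\<close>.\<close>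

lemma Psi_bound:
  assumes "cmod q \<le> m" "cmod Q \<le> m" "cmod e \<le> m"
  shows "cmod (Psi k q Q e) \<le> 2 ^ k * m ^ k"
  using assms
proof (induction k q Q e rule: Psi.induct)
  case (3 k q Q e)
  have m: "m \<ge> 0" using 3(3) by (meson norm_ge_zero order_trans)
  have "cmod (Psi (Suc (Suc k)) q Q e) \<le> cmod e * cmod (Psi (Suc k) q Q e) + cmod q * cmod Q * cmod (Psi k q Q e)"
    using norm_triangle_ineq4[of "e * Psi (Suc k) q Q e" "q * Q * Psi k q Q e"] by (simp add: norm_mult)
  also have "\<dots> \<le> m * (2 ^ Suc k * m ^ Suc k) + m * m * (2 ^ k * m ^ k)"
    using 3 m by (intro add_mono mult_mono) auto
  also have "\<dots> = 3 * (2 ^ k * m ^ Suc (Suc k))"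
    by (simp add: algebra_simps)
  also have "\<dots> \<le> 4 * (2 ^ k * m ^ Suc (Suc k))"
    using m by (intro mult_right_mono) auto
  finally show ?case by (simp add: algebra_simps)
next
  case (2 q Q e)
  have "m \<ge> 0" using 2(1) by (meson norm_ge_zero order_trans)
  then show ?case using 2 by simp
qed auto

definition cm_tcone :: "nat \<Rightarrow> (nat \<Rightarrow> complex) set" where
  "cm_tcone d = {z \<in> cspace {..<d + 4}. cm_eqs d 0 (z 0) (z 1) (z 2) (\<lambda>j. z (j + 3))}"

lemma cm_point_in_tcone:
  assumes "d \<ge> 1"
  shows "cm_point d q Q e a \<in> cm_tcone d \<longleftrightarrow> cm_eqs d 0 q Q e a"
  using assms by (simp add: cm_tcone_def cm_eqs_point)

lemma cm_point_in_calogero_moser: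
  assumes "d \<ge> 1"
  shows "cm_point d q Q e a \<in> calogero_moser d \<longleftrightarrow> cm_eqs d (e\<^sup>2 - 4 * q * Q - (of_nat d)\<^sup>2) q Q e a"
  using assms by (simp add: calogero_moser_eq cm_eqs_point)

text \<open>With \<open>m\<close> the size of \<open>(q, Q, e)\<close>, the right-hand sides are of
  the order \<open>m^(d-2)\<close>; multiplied by \<open>t^2\<close> they become
  \<open>m^(d-4)\<close> times \<open>(t m)^2\<close>. Here \<open>t m\<close> converges and
  \<open>m\<close> tends to 0, so they disappear in the limit exactly because \<open>d - 4\<close>
  is positive.\<close>

lemma tangent_cone_subset_tcone:
  assumes d: "d \<ge> 5"
  shows "tangent_cone {..<d + 4} (calogero_moser d) \<subseteq> cm_tcone d"
proof
  fix v assume v: "v \<in> tangent_cone {..<d + 4} (calogero_moser d)"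
  then obtain x t where x: "\<And>n. x n \<in> calogero_moser d" and t: "\<And>n. t n > (0::real)"
    and x0: "\<And>i. i < d + 4 \<Longrightarrow> (\<lambda>n. x n i) \<longlonglongrightarrow> 0"
    and tx: "\<And>i. i < d + 4 \<Longrightarrow> (\<lambda>n. of_real (t n) * x n i) \<longlonglongrightarrow> v i"
    by (rule tangent_cone_sequence) auto
  have eqs: "cm_eqs d ((x n 2)\<^sup>2 - 4 * x n 0 * x n 1 - (of_nat d)\<^sup>2) (x n 0) (x n 1) (x n 2) (\<lambda>j. x n (j + 3))" for n
    using x[of n] by (simp add: calogero_moser_eq)
  have "cm_eqs d 0 (v 0) (v 1) (v 2) (\<lambda>j. v (j + 3))"
  proof (rule cm_eqsI)
    fix j assume j: "1 \<le> j" "j \<le> d - 1"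
    define T where "T i n = of_real (t n) * x n i" for i n
    have T: "T i \<longlonglongrightarrow> v i" if "i < d + 4" for i
      using tx[OF that] by (simp add: T_def[abs_def])
    have "T 2 n * T (j + 3) n = T 0 n * T (j + 1 + 3) n + T 1 n * T (j - 1 + 3) n" for n
      using cm_eqsD(1)[OF eqs[of n] j] unfolding T_def by algebra
    moreover have "(\<lambda>n. T 2 n * T (j + 3) n) \<longlonglongrightarrow> v 2 * v (j + 3)"
      using j by (intro tendsto_mult T) auto
    moreover have "(\<lambda>n. T 0 n * T (j + 1 + 3) n + T 1 n * T (j - 1 + 3) n) \<longlonglongrightarrow> v 0 * v (j + 1 + 3) + v 1 * v (j - 1 + 3)"
      using j by (intro tendsto_add tendsto_mult T) auto
    ultimately show "v 2 * v (j + 3) = v 0 * v (j + 1 + 3) + v 1 * v (j - 1 + 3)"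
      using LIMSEQ_unique by (metis (no_types, lifting) ext)
  next
    fix j k assume jk: "1 \<le> j" "j \<le> k" "k \<le> d - 1"
    define T where "T i n = of_real (t n) * x n i" for i n
    have T: "T i \<longlonglongrightarrow> v i" if "i < d + 4" for i
      using tx[OF that] by (simp add: T_def[abs_def])
    define m where "m n = cmod (x n 0) + cmod (x n 1) + cmod (x n 2)" for n
    define \<kappa> where "\<kappa> n = (x n 2)\<^sup>2 - 4 * x n 0 * x n 1 - (of_nat d)\<^sup>2" for n
    have m0: "m \<longlonglongrightarrow> 0 + 0 + 0" unfolding m_def[abs_def]
      using d by (intro tendsto_add tendsto_norm_zero x0) auto
    have tm: "(\<lambda>n. t n * m n) \<longlonglongrightarrow> cmod (v 0) + cmod (v 1) + cmod (v 2)"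
    proof -
      have "t n * m n = cmod (T 0 n) + cmod (T 1 n) + cmod (T 2 n)" for n
        using t[of n] by (simp add: m_def T_def norm_mult algebra_simps)
      then show ?thesis using d by (simp only:) (intro tendsto_add tendsto_norm T; simp)
    qed
    have \<kappa>lim: "\<kappa> \<longlonglongrightarrow> 0\<^sup>2 - 4 * 0 * 0 - (of_nat d)\<^sup>2" unfolding \<kappa>_def[abs_def]
      using d by (intro tendsto_intros x0) auto
    define G where "G n = T (j - 1 + 3) n * T (k + 1 + 3) n - T (j + 3) n * T (k + 3) n" for n
    have G: "G \<longlonglongrightarrow> v (j - 1 + 3) * v (k + 1 + 3) - v (j + 3) * v (k + 3)"
      unfolding G_def[abs_def] using jk by (intro tendsto_intros T) auto
    have bound: "cmod (G n) \<le> cmod (\<kappa> n) * (2 ^ (k - j) * (m n ^ (d - 4) * (t n * m n)\<^sup>2))" for n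
    proof -
      have mn: "cmod (x n 0) \<le> m n" "cmod (x n 1) \<le> m n" "cmod (x n 2) \<le> m n" "m n \<ge> 0"
        by (auto simp: m_def)
      have "d - 2 = (d - 4) + 2" using d by simp
      then have dd: "m n ^ (d - 2) = m n ^ (d - 4) * (m n)\<^sup>2" by (simp only: power_add)
      have "d - 2 = (d - k - 1) + (j - 1) + (k - j)" using jk by auto
      then have dd2: "m n ^ (d - 2) = m n ^ (d - k - 1) * m n ^ (j - 1) * m n ^ (k - j)" by (simp only: power_add)
      have "G n = (of_real (t n))\<^sup>2 * (\<kappa> n * x n 0 ^ (d - k - 1) * x n 1 ^ (j - 1) * Psi (k - j) (x n 0) (x n 1) (x n 2))"
        unfolding G_def T_def \<kappa>_def cm_eqsD(2)[OF eqs[of n] jk, symmetric]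
        by (simp only: power2_eq_square right_diff_distrib mult_ac)
      then have "cmod (G n) = (t n)\<^sup>2 * (cmod (\<kappa> n) * (cmod (x n 0) ^ (d - k - 1) * cmod (x n 1) ^ (j - 1) * cmod (Psi (k - j) (x n 0) (x n 1) (x n 2))))"
        by (simp add: norm_mult norm_power)
      also have "\<dots> \<le> (t n)\<^sup>2 * (cmod (\<kappa> n) * (m n ^ (d - k - 1) * m n ^ (j - 1) * (2 ^ (k - j) * m n ^ (k - j))))"
        using mn by (intro mult_left_mono mult_mono power_mono Psi_bound) auto
      also have "\<dots> = (t n)\<^sup>2 * (cmod (\<kappa> n) * (2 ^ (k - j) * m n ^ (d - 2)))"
        unfolding dd2 by (simp only: mult_ac)
      also have "\<dots> = cmod (\<kappa> n) * (2 ^ (k - j) * (m n ^ (d - 4) * (t n * m n)\<^sup>2))"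
        unfolding dd by (simp only: mult_ac power_mult_distrib)
      finally show ?thesis .
    qed
    have "(\<lambda>n. cmod (\<kappa> n) * (2 ^ (k - j) * (m n ^ (d - 4) * (t n * m n)\<^sup>2))) \<longlonglongrightarrow>
       cmod (0\<^sup>2 - 4 * 0 * 0 - (of_nat d)\<^sup>2) * (2 ^ (k - j) * ((0 + 0 + 0) ^ (d - 4) * (cmod (v 0) + cmod (v 1) + cmod (v 2))\<^sup>2))"
      by (intro tendsto_intros \<kappa>lim m0 tm)
    moreover have "(0 + 0 + 0 :: real) ^ (d - 4) = 0" using d by simp
    ultimately have "(\<lambda>n. cmod (\<kappa> n) * (2 ^ (k - j) * (m n ^ (d - 4) * (t n * m n)\<^sup>2))) \<longlonglongrightarrow> 0"
      by (simp only: mult_zero_left mult_zero_right)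
    then have "G \<longlonglongrightarrow> 0"
      by (rule Lim_null_comparison[rotated]) (use bound in auto)
    then have "v (j - 1 + 3) * v (k + 1 + 3) - v (j + 3) * v (k + 3) = 0"
      using G LIMSEQ_unique by blast
    then show "v (j - 1 + 3) * v (k + 1 + 3) - v (j + 3) * v (k + 3) =
       0 * v 0 ^ (d - k - 1) * v 1 ^ (j - 1) * Psi (k - j) (v 0) (v 1) (v 2)"
      by simp
  qed
  then show "v \<in> cm_tcone d" using v by (simp add: cm_tcone_def tangent_cone_def)
qed

text \<open>If \<open>a\<close> is nonzero it is a point \<open>l v^d\<close> over the rational
  normal curve, and the linear equations say that \<open>v\<close> divides the binary quadratic form
  \<open>(q, Q, e)\<close>; the quotient is \<open>(x', y')\<close>. If \<open>a = 0\<close>, any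
  linear factor of the form will do. The cases with \<open>x = 0\<close> are the factor at
  infinity.\<close>

lemma cm_tcone_param:
  assumes d: "d \<ge> 3" and z: "z \<in> cm_tcone d"
  obtains x y x' y' l where "(x, y) \<noteq> (0, 0)"
    "z = cm_point d (x * x') (y * y') (x * y' + x' * y) (\<lambda>j. l * x ^ (d - j) * y ^ j)"
proof -
  define q Q e a where "q = z 0" and "Q = z 1" and "e = z 2" and "a = (\<lambda>j. z (j + 3))"
  have zc: "z = cm_point d q Q e a"
    using z cm_point_coords[of z d] by (simp add: cm_tcone_def q_def Q_def e_def a_def)
  have "cm_eqs d 0 q Q e a" using z by (simp add: cm_tcone_def q_def Q_def e_def a_def)
  then have r: "rnc d a" and E: "\<And>j. 1 \<le> j \<Longrightarrow> j \<le> d - 1 \<Longrightarrow> e * a j = q * a (j + 1) + Q * a (j - 1)"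
    by (auto simp: cm_eqs_0_iff)
  consider "\<forall>j\<le>d. a j = 0" "q = 0" | "\<forall>j\<le>d. a j = 0" "q \<noteq> 0" | "a 0 \<noteq> 0" | "a 0 = 0" "a d \<noteq> 0"
    using rnc_vanish[OF r] by (metis le_less)
  then show thesis
  proof cases
    case 1
    then show ?thesis
      by (intro that[of 0 1 e Q 0]) (auto simp: zc intro!: cm_point_eqI)
  next
    case 2
    \<comment> \<open>A root of \<open>q y^2 - e y + Q\<close>, which gives the linear factor
      \<open>(1, y)\<close>.\<close>
    define y where "y = (e + csqrt (e\<^sup>2 - 4 * q * Q)) / (2 * q)"
    have "(2 * q * y - e)\<^sup>2 = e\<^sup>2 - 4 * q * Q"
      using 2(2) by (simp add: y_def)
    then have "4 * q * (q * y\<^sup>2 - e * y + Q) = 0" by algebra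
    then have "q * y\<^sup>2 - e * y + Q = 0" using 2(2) by simp
    then have "y * (e - q * y) = Q" by algebra
    then show ?thesis
      using 2 by (intro that[of 1 y q "e - q * y" 0]) (auto simp: zc intro!: cm_point_eqI)
  next
    case 3
    define y where "y = a 1 / a 0"
    have g: "a j = a 0 * y ^ j" if "j \<le> d" for j
      using rnc_geometric[OF r 3 that] by (simp add: y_def)
    have "e * (a 0 * y) = q * (a 0 * y\<^sup>2) + Q * a 0"
      using E[of 1] g[of 1] g[of 2] d by (simp add: numeral_2_eq_2)
    then have "a 0 * (e * y) = a 0 * (q * y\<^sup>2 + Q)" by algebra
    then have "e * y = q * y\<^sup>2 + Q" using 3 by simp
    then have "y * (e - q * y) = Q" by algebra
    have "z = cm_point d (1 * q) (y * (e - q * y)) (1 * (e - q * y) + q * y) (\<lambda>j. a 0 * 1 ^ (d - j) * y ^ j)"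
      unfolding zc
    proof (rule cm_point_eqI)
      show "a j = a 0 * 1 ^ (d - j) * y ^ j" if "j \<le> d" for j
        by (subst g[OF that]) simp
    qed (use \<open>y * (e - q * y) = Q\<close> in auto)
    then show ?thesis
      by (intro that[of 1 y q "e - q * y" "a 0"]) simp_all
  next
    case 4
    have "e * a (d - 1) = q * a (d - 1 + 1) + Q * a (d - 1 - 1)" using E[of "d - 1"] d by auto
    then have "q = 0" using rnc_vanish[OF r 4(1), of "d - 1"] rnc_vanish[OF r 4(1), of "d - 1 - 1"] 4(2) d by auto
    then show ?thesis
      using rnc_vanish[OF r 4(1)] d
      by (intro that[of 0 1 e Q "a d"]) (auto simp: zc power_0_left le_less intro!: cm_point_eqI)
  qed
qed

text \<open>In the parametrisation by \<open>v\<close>, \<open>v'\<close>, \<alpha>, \<beta> the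
  curve replaces \<open>v'\<close> by \<open>s v'\<close> and \<alpha> by \<open>s l\<close>. The
  term with \<beta> becomes negligible after division by \<open>s\<close>, and what remains is the
  prescribed direction.\<close>

lemma generic_in_tangent_cone:
  assumes d: "d \<ge> 5" and l: "l \<noteq> 0" and det: "x * y' - x' * y \<noteq> 0"
  shows "cm_point d (x * x') (y * y') (x * y' + x' * y) (\<lambda>j. l * x ^ (d - j) * y ^ j)
           \<in> tangent_cone {..<d + 4} (calogero_moser d)" (is "?v \<in> _")
proof -
  define D where "D = x * y' - x' * y"
  \<comment> \<open>Solved from \<open>\<alpha> \<beta> D^2 s^2 = \<kappa>\<close> with
    \<open>\<alpha> = s l\<close>; here \<kappa> is \<open>s^2 D^2 - d^2\<close>, as
    \<open>e^2 - 4 q Q\<close> is the discriminant \<open>s^2 D^2\<close>. The pole of order 3 is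
    outweighed by \<open>s^d\<close> from the \<open>d\<close>-th power of \<open>s v'\<close>:
    after division by \<open>s\<close> the order is \<open>d - 4\<close>.\<close>
  define \<beta> where "\<beta> s = (s\<^sup>2 * D\<^sup>2 - (of_nat d)\<^sup>2) / (s ^ 3 * l * D\<^sup>2)" for s :: complex
  define c where "c s = cm_point d (x * (s * x')) (y * (s * y')) (x * (s * y') + (s * x') * y)
     (\<lambda>j. (s * l) * x ^ (d - j) * y ^ j + \<beta> s * (s * x') ^ (d - j) * (s * y') ^ j)" for s :: complex
  show ?thesis
  proof (rule tangent_coneI_curve[where x = "\<lambda>s. c (of_real s)"])
    have "c (of_real s) \<in> calogero_moser d" if "s > 0" for s :: real
    proof -
      define r where "r = complex_of_real s"
      have r: "r \<noteq> 0" using that by (simp add: r_def)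
      have "(r * l) * \<beta> r * (x * (r * y') - (r * x') * y)\<^sup>2 = (r * l) * \<beta> r * (r * D)\<^sup>2"
        by (simp add: D_def algebra_simps)
      also have "\<dots> = r\<^sup>2 * D\<^sup>2 - (of_nat d)\<^sup>2"
        using r l det[folded D_def] by (simp add: \<beta>_def field_simps power2_eq_square power3_eq_cube)
      also have "\<dots> = (x * (r * y') + (r * x') * y)\<^sup>2 - 4 * (x * (r * x')) * (y * (r * y')) - (of_nat d)\<^sup>2"
        by (simp add: D_def power2_eq_square algebra_simps)
      finally show ?thesis
        unfolding c_def r_def[symmetric] using d by (subst cm_point_in_calogero_moser) (auto intro: cm_eqs_param)
    qed
    then show "eventually (\<lambda>s. c (of_real s) \<in> calogero_moser d) (at_right 0)"
      using eventually_at_right_less[of "0::real"] by (auto elim: eventually_mono)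
    fix i assume i: "i \<in> {..<d + 4}"
    define E where "E s = (s\<^sup>2 * D\<^sup>2 - (of_nat d)\<^sup>2) / (l * D\<^sup>2) * s ^ (d - 4) * (x' ^ (d - (i - 3)) * y' ^ (i - 3))" for s
    have ev: "c s i / s = (if i < 3 then ?v i else ?v i + E s)" if s: "s \<noteq> 0" for s
    proof -
      have id: "i < 3 \<or> (i \<ge> 3 \<and> i - 3 \<le> d \<and> i < d + 4)" using i by auto
      have ex: "s ^ d = s ^ 4 * s ^ (d - 4)" using d by (simp flip: power_add)
      have "\<beta> s * (s * x') ^ (d - (i - 3)) * (s * y') ^ (i - 3) = s * E s" if "i - 3 \<le> d"
      proof -
        define A K where "A = s\<^sup>2 * D\<^sup>2 - (of_nat d)\<^sup>2" and "K = x' ^ (d - (i - 3)) * y' ^ (i - 3)"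
        have sd: "s ^ (d - (i - 3)) * s ^ (i - 3) = s ^ d" using that by (simp flip: power_add)
        have "(s * x') ^ (d - (i - 3)) * (s * y') ^ (i - 3) = (s ^ (d - (i - 3)) * s ^ (i - 3)) * K"
          by (simp only: K_def power_mult_distrib mult_ac)
        also have "\<dots> = s ^ d * K" by (simp only: sd)
        also have "\<dots> = s * s ^ 3 * s ^ (d - 4) * K"
          unfolding ex by (simp add: power4_eq_xxxx power3_eq_cube)
        finally have 1: "(s * x') ^ (d - (i - 3)) * (s * y') ^ (i - 3) = s * s ^ 3 * s ^ (d - 4) * K" .
        have 2: "A / (s ^ 3 * l * D\<^sup>2) * (s * s ^ 3 * P * K) = s * (A / (l * D\<^sup>2) * P * K)" for P
          using s l det[folded D_def] by (simp add: divide_simps)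
        have "\<beta> s * (s * x') ^ (d - (i - 3)) * (s * y') ^ (i - 3) =
            A / (s ^ 3 * l * D\<^sup>2) * ((s * x') ^ (d - (i - 3)) * (s * y') ^ (i - 3))"
          by (simp only: \<beta>_def A_def mult.assoc)
        also have "\<dots> = A / (s ^ 3 * l * D\<^sup>2) * (s * s ^ 3 * s ^ (d - 4) * K)"
          by (simp only: 1)
        also have "\<dots> = s * (A / (l * D\<^sup>2) * s ^ (d - 4) * K)"
          by (rule 2)
        also have "\<dots> = s * E s"
          by (simp only: E_def A_def K_def)
        finally show ?thesis .
      qed
      then show ?thesis using id s
        by (auto simp: c_def cm_point_def field_simps)
    qed
    have "((\<lambda>s. E (complex_of_real s)) \<longlongrightarrow> E (of_real 0)) (at_right 0)"
      unfolding E_def using l det[folded D_def] by (intro tendsto_intros) simp_all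
    moreover have "E 0 = 0" using d by (simp add: E_def)
    ultimately have "((\<lambda>s. if i < 3 then ?v i else ?v i + E (complex_of_real s)) \<longlongrightarrow> ?v i) (at_right 0)"
      by (cases "i < 3") (auto intro!: tendsto_eq_intros)
    then show "((\<lambda>s. c (complex_of_real s) i / complex_of_real s) \<longlongrightarrow> ?v i) (at_right 0)"
      by (rule Lim_transform_eventually)
        (use eventually_at_right_less[of "0::real"] ev in \<open>auto elim!: eventually_mono\<close>)
  qed auto
qed

text \<open>Every point of the cone is a limit of points with \<open>l\<close> nonzero and
  independent \<open>v, v'\<close>, for which the curve exists; the tangent cone being closed, the
  limit belongs to it too.\<close>

theorem tangent_cone_calogero_moser:
  assumes d: "d \<ge> 5"
  shows "tangent_cone {..<d + 4} (calogero_moser d) = cm_tcone d"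
proof (rule antisym[OF tangent_cone_subset_tcone[OF d]], rule subsetI)
  fix z assume "z \<in> cm_tcone d"
  then obtain x y x' y' l where xy: "(x, y) \<noteq> (0, 0)"
    and z: "z = cm_point d (x * x') (y * y') (x * y' + x' * y) (\<lambda>j. l * x ^ (d - j) * y ^ j)"
    by (rule cm_tcone_param[rotated]) (use d in auto)
  \<comment> \<open>Moving \<open>v'\<close> along \<open>(- cnj y, cnj x)\<close> changes the
    determinant by \<open>s (|x|^2 + |y|^2)\<close>, with a positive coefficient, so only finitely
    many real \<open>s\<close> are not generic.\<close>
  define f where "f s = cm_point d (x * (x' - s * cnj y)) (y * (y' + s * cnj x)) (x * (y' + s * cnj x) + (x' - s * cnj y) * y)
     (\<lambda>j. (l + s) * x ^ (d - j) * y ^ j)" for s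
  define N where "N = (cmod x)\<^sup>2 + (cmod y)\<^sup>2"
  have N: "N > 0" using xy unfolding N_def by (auto simp: add_pos_nonneg add_nonneg_pos)
  have xxyy: "x * cnj x + y * cnj y = of_real N" by (simp add: N_def complex_norm_square del: of_real_power)
  define B where "B = {s :: real. of_real s = - l \<or> of_real s = - (x * y' - x' * y) / of_real N}"
  have "B \<subseteq> {Re (- l), Re (- (x * y' - x' * y) / of_real N)}"
    by (auto simp: B_def dest: arg_cong[of _ _ Re] simp del: minus_diff_eq)
  then have "finite B" by (rule finite_subset) auto
  then have ev: "eventually (\<lambda>s. s \<notin> B) (at_right 0)"
    using islimpt_finite[of B 0] by (simp add: islimpt_conv_frequently_at not_frequently eventually_at_split)
  show "z \<in> tangent_cone {..<d + 4} (calogero_moser d)"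
  proof (rule tangent_cone_limit[where x = "\<lambda>s. f (of_real s)"])
    have "f (of_real s) \<in> tangent_cone {..<d + 4} (calogero_moser d)" if "s \<notin> B" for s
      unfolding f_def
    proof (rule generic_in_tangent_cone[OF d])
      show "l + of_real s \<noteq> 0" using that by (auto simp: B_def add_eq_0_iff)
      have "x * (y' + of_real s * cnj x) - (x' - of_real s * cnj y) * y = (x * y' - x' * y) + of_real s * of_real N"
        unfolding xxyy[symmetric] by (simp add: algebra_simps)
      then show "x * (y' + of_real s * cnj x) - (x' - of_real s * cnj y) * y \<noteq> 0"
        using that N by (auto simp: B_def field_simps add_eq_0_iff)
    qed
    then show "eventually (\<lambda>s. f (of_real s) \<in> tangent_cone {..<d + 4} (calogero_moser d)) (at_right 0)"
      using ev by (auto elim: eventually_mono)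
    fix i
    have "f 0 = z" by (simp add: f_def z)
    moreover have "continuous (at 0) (\<lambda>s. f s i)"
      unfolding f_def cm_point_def by (cases "i = 0"; cases "i = 1"; cases "i = 2"; cases "i < d + 4"; simp; intro continuous_intros)
    ultimately have "((\<lambda>s. f s i) \<longlongrightarrow> z i) (at 0)" by (simp add: isCont_def)
    moreover have "filterlim complex_of_real (at 0) (at_right 0)"
      by (auto simp: filterlim_at intro!: tendsto_eq_intros eventually_mono[OF eventually_at_right_less])
    ultimately show "((\<lambda>s. f (of_real s) i) \<longlongrightarrow> z i) (at_right 0)"
      by (rule filterlim_compose)
  qed (auto simp: z)
qed

section \<open>Lines in the tangent cone and its linear span\<close>

lemma tcone_base:
  assumes "d \<ge> 1"
  shows "cm_point d q Q e (\<lambda>_. 0) \<in> cm_tcone d"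
  using assms by (simp add: cm_point_in_tcone cm_eqs_0_iff rnc_def)

text \<open>The directions of the lines through a point with \<open>a \<noteq> 0\<close> form a linear space.\<close>

lemma tcone_lines:
  assumes d: "d \<ge> 3" and z: "z \<in> cm_tcone d" and nz: "j0 \<le> d" "z (j0 + 3) \<noteq> 0"
    and u: "u \<in> cspace {..<d + 4}" "\<And>t. z + cscale t u \<in> cm_tcone d"
    and w: "w \<in> cspace {..<d + 4}" "\<And>t. z + cscale t w \<in> cm_tcone d"
  shows "z + cscale t (u + w) \<in> cm_tcone d"
proof -
  define a where "a j = z (j + 3)" for j
  have key: "\<exists>c. (\<forall>j\<le>d. u (j + 3) = c * a j) \<and>
      (\<forall>j. 1 \<le> j \<and> j \<le> d - 1 \<longrightarrow> u 2 * a j = u 0 * a (j + 1) + u 1 * a (j - 1))"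
    if u: "u \<in> cspace {..<d + 4}" "\<And>t. z + cscale t u \<in> cm_tcone d" for u
  proof -
    define b where "b j = u (j + 3)" for j
    have t: "rnc d (\<lambda>j. a j + t * b j) \<and> (\<forall>j. 1 \<le> j \<and> j \<le> d - 1 \<longrightarrow>
       (z 2 + t * u 2) * (a j + t * b j) = (z 0 + t * u 0) * (a (j + 1) + t * b (j + 1)) + (z 1 + t * u 1) * (a (j - 1) + t * b (j - 1)))" for t
      using u(2)[of t] by (simp add: cm_tcone_def cm_eqs_0_iff a_def b_def cscale_def)
    obtain c where c: "\<forall>j\<le>d. b j = c * a j"
      using rnc_line[of d a b] t[of 0] t[of 1] t[of "-1"] d nz unfolding a_def by auto
    have "u 2 * a j = u 0 * a (j + 1) + u 1 * a (j - 1)" if j: "1 \<le> j" "j \<le> d - 1" for j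
    proof -
      have bc: "b j = c * a j" "b (j + 1) = c * a (j + 1)" "b (j - 1) = c * a (j - 1)"
        using c j by auto
      have E0: "z 2 * a j = z 0 * a (j + 1) + z 1 * a (j - 1)" using t[of 0] j by auto
      have E: "(1 + t * c) * (t * (u 2 * a j - u 0 * a (j + 1) - u 1 * a (j - 1))) = 0" for t
      proof -
        have "(z 2 + t * u 2) * (a j + t * b j) = (z 0 + t * u 0) * (a (j + 1) + t * b (j + 1)) + (z 1 + t * u 1) * (a (j - 1) + t * b (j - 1))"
          using t[of t] j by blast
        then show ?thesis using E0 unfolding bc by algebra
      qed
      show ?thesis
      \<comment> \<open>Any \<open>t\<close> with \<open>t (1 + t c)\<close> nonzero may be
        inserted: \<open>t = 1\<close> works unless \<open>c = -1\<close>, and then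
        \<open>t = -1\<close> does.\<close>
      proof (cases "c = -1")
        case True
        have "u 2 * a j - u 0 * a (j + 1) - u 1 * a (j - 1) = 0"
          using E[of "-1"] True by (metis add_eq_0_iff_both_eq_0 mult_eq_0_iff mult_minus1 neg_equal_0_iff_equal one_add_one minus_minus zero_neq_numeral)
        then show ?thesis by algebra
      next
        case False
        then have "1 + c \<noteq> 0" by (simp add: add_eq_0_iff)
        then have "u 2 * a j - u 0 * a (j + 1) - u 1 * a (j - 1) = 0"
          using E[of 1] by simp
        then show ?thesis by algebra
      qed
    qed
    then show ?thesis using c by (auto simp: b_def)
  qed
  obtain c where c: "\<And>j. j \<le> d \<Longrightarrow> u (j + 3) = c * a j"
    "\<And>j. 1 \<le> j \<Longrightarrow> j \<le> d - 1 \<Longrightarrow> u 2 * a j = u 0 * a (j + 1) + u 1 * a (j - 1)"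
    using key[OF u] by blast
  obtain c' where c': "\<And>j. j \<le> d \<Longrightarrow> w (j + 3) = c' * a j"
    "\<And>j. 1 \<le> j \<Longrightarrow> j \<le> d - 1 \<Longrightarrow> w 2 * a j = w 0 * a (j + 1) + w 1 * a (j - 1)"
    using key[OF w] by blast
  have z': "rnc d a" "\<And>j. 1 \<le> j \<Longrightarrow> j \<le> d - 1 \<Longrightarrow> z 2 * a j = z 0 * a (j + 1) + z 1 * a (j - 1)"
    using z unfolding cm_tcone_def cm_eqs_0_iff a_def[abs_def] by blast+
  let ?m = "1 + t * (c + c')"
  have "cm_eqs d 0 (z 0 + t * (u 0 + w 0)) (z 1 + t * (u 1 + w 1)) (z 2 + t * (u 2 + w 2)) (\<lambda>j. ?m * a j)"
    unfolding cm_eqs_0_iff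
  proof (intro conjI allI impI)
    show "rnc d (\<lambda>j. ?m * a j)"
      unfolding rnc_def
    proof (intro allI impI)
      fix j k assume "1 \<le> j \<and> j \<le> k \<and> k \<le> d - 1"
      then have "a (j - 1) * a (k + 1) = a j * a k" using z'(1) unfolding rnc_def by blast
      then show "?m * a (j - 1) * (?m * a (k + 1)) = ?m * a j * (?m * a k)" by algebra
    qed
    fix j assume "1 \<le> j \<and> j \<le> d - 1"
    then show "(z 2 + t * (u 2 + w 2)) * (?m * a j) =
       (z 0 + t * (u 0 + w 0)) * (?m * a (j + 1)) + (z 1 + t * (u 1 + w 1)) * (?m * a (j - 1))"
      using z'(2)[of j] c(2)[of j] c'(2)[of j] by algebra
  qed
  moreover have "?m * a j = (z + cscale t (u + w)) (j + 3)" if "j \<le> d" for j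
    using c(1)[OF that] c'(1)[OF that] by (simp add: cscale_def a_def algebra_simps)
  ultimately have "cm_eqs d 0 (z 0 + t * (u 0 + w 0)) (z 1 + t * (u 1 + w 1)) (z 2 + t * (u 2 + w 2)) (\<lambda>j. (z + cscale t (u + w)) (j + 3))"
    using d by (subst (asm) cm_eqs_cong) auto
  moreover have "z + cscale t (u + w) \<in> cspace {..<d + 4}"
    using z u(1) w(1) by (auto simp: cm_tcone_def cspace_def cscale_def)
  ultimately show ?thesis by (simp add: cm_tcone_def cscale_def)
qed

text \<open>At the points with \<open>a = 0\<close> two branches meet.\<close>

lemma tcone_branching:
  assumes d: "d \<ge> 3"
  defines "z \<equiv> cm_point d 0 0 1 (\<lambda>_. 0)" and "u \<equiv> cm_point d 0 0 0 (\<lambda>j. if j = 0 then 1 else 0)"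
    and "w \<equiv> cm_point d 0 1 0 (\<lambda>_. 0)"
  shows "z + cscale t u \<in> cm_tcone d" "z + cscale t w \<in> cm_tcone d" "z + (u + w) \<notin> cm_tcone d"
proof -
  have "z + cscale t u = cm_point d 0 0 1 (\<lambda>j. if j = 0 then t else 0)"
    by (auto simp: z_def u_def cscale_def cm_point_def fun_eq_iff)
  moreover have "cm_eqs d 0 0 0 1 (\<lambda>j. if j = 0 then t else 0)"
    by (auto simp: cm_eqs_0_iff rnc_def)
  ultimately show "z + cscale t u \<in> cm_tcone d" using d by (simp add: cm_point_in_tcone)
  have "z + cscale t w = cm_point d 0 t 1 (\<lambda>j. 0)"
    by (auto simp: z_def w_def cscale_def cm_point_def fun_eq_iff)
  then show "z + cscale t w \<in> cm_tcone d" using d tcone_base by simp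
  have "z + (u + w) = cm_point d 0 1 1 (\<lambda>j. if j = 0 then 1 else 0)"
    by (auto simp: z_def u_def w_def cm_point_def fun_eq_iff)
  moreover have "\<not> cm_eqs d 0 0 1 1 (\<lambda>j. if j = 0 then 1 else 0)"
    using d by (auto simp: cm_eqs_0_iff intro!: exI[of _ 1])
  ultimately show "z + (u + w) \<notin> cm_tcone d" using d by (simp add: cm_point_in_tcone)
qed

lemma tcone_veronese:
  assumes "d \<ge> 1"
  shows "cm_point d 0 0 0 (\<lambda>j. y ^ j) \<in> cm_tcone d"
proof -
  have "y ^ (j - 1) * y ^ (k + 1) = y ^ j * y ^ k" if "1 \<le> j" for j k
  proof -
    have "j - 1 + (k + 1) = j + k" using that by simp
    then show ?thesis by (metis power_add)
  qed
  then have "rnc d (\<lambda>j. y ^ j)" unfolding rnc_def by blast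
  then show ?thesis using assms by (simp add: cm_point_in_tcone cm_eqs_0_iff)
qed

text \<open>The cone contains the whole space \<open>a = 0\<close> and the curve
  \<open>(1, y, ..., y^d)\<close>. Each row of the map minus the identity, evaluated on the curve,
  is a polynomial in \<open>y\<close> that vanishes identically, so its coefficients vanish.\<close>

lemma tcone_spans:
  assumes d: "d \<ge> 1" and M: "\<And>v. v \<in> cm_tcone d \<Longrightarrow> clin {..<d + 4} {..<d + 4} M v = v"
    and v: "v \<in> cspace {..<d + 4}"
  shows "clin {..<d + 4} {..<d + 4} M v = v"
proof -
  let ?L = "clin {..<d + 4} {..<d + 4} M"
  have base: "?L (cm_point d q Q e (\<lambda>_. 0)) = cm_point d q Q e (\<lambda>_. 0)" for q Q e
    by (rule M[OF tcone_base[OF d]])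
  have ver: "?L (cm_point d 0 0 0 a) i = cm_point d 0 0 0 a i" for a i
  proof (cases "i < d + 4")
    case True
    define c where "c j = M (j + 3) i - (if i = j + 3 then 1 else 0)" for j
    have split: "(\<Sum>k<d + 4. f k) = f 0 + f 1 + f 2 + (\<Sum>j\<le>d. f (j + 3))" for f :: "nat \<Rightarrow> complex"
    proof -
      have "(\<Sum>k<Suc (Suc (Suc n)). f k) = f 0 + f 1 + f 2 + (\<Sum>k<n. f (k + 3))" for n
        by (simp only: sum.lessThan_Suc_shift) (simp add: numeral_2_eq_2 numeral_3_eq_3 add.assoc)
      from this[of "Suc d"] show ?thesis
        by (simp add: lessThan_Suc_atMost eval_nat_numeral)
    qed
    have L: "?L (cm_point d 0 0 0 b) i - cm_point d 0 0 0 b i = (\<Sum>j\<le>d. c j * b j)" for b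
    proof -
      have "(\<Sum>j\<le>d. (if i = j + 3 then 1 else 0) * b j) = cm_point d 0 0 0 b i"
      proof (cases "i < 3")
        case False
        have "(\<Sum>j\<le>d. (if i = j + 3 then 1 else 0) * b j) = (\<Sum>j\<le>d. if i - 3 = j then b j else 0)"
          using False by (intro sum.cong) auto
        then show ?thesis using True False by (auto simp: cm_point_def)
      qed (auto simp: cm_point_def)
      then show ?thesis
        using True unfolding clin_def split by (simp add: c_def left_diff_distrib sum_subtractf)
    qed
    have "(\<Sum>j\<le>d. c j * y ^ j) = 0" for y
      using L[of "\<lambda>j. y ^ j"] M[OF tcone_veronese[OF d, of y]] by simp
    then have "\<forall>j\<le>d. c j = 0" using polyfun_eq_0[of c d] by auto
    then show ?thesis using L[of a] by simp
  next
    case False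
    then show ?thesis by (simp add: clin_def cm_point_def)
  qed
  have "v = cm_point d (v 0) (v 1) (v 2) (\<lambda>_. 0) + cm_point d 0 0 0 (\<lambda>j. v (j + 3))"
    by (subst cm_point_coords[OF v]) (auto simp: cm_point_def fun_eq_iff)
  moreover have "?L (cm_point d 0 0 0 a) = cm_point d 0 0 0 a" for a
    by (rule ext) (rule ver)
  moreover have "?L w = w" if "w = A + B" "?L A = A" "?L B = B" for w A B
    using that by (simp add: clin_add)
  ultimately show ?thesis using base by blast
qed

text \<open>Gaussian elimination: a pivot in the equation \<open>i0\<close> removes one unknown and
  one equation, and the inequality between their numbers persists.\<close>

lemma homogeneous_system:
  assumes "finite I" "finite J" "card I < card J"
  shows "\<exists>v. (\<forall>i\<in>I. (\<Sum>j\<in>J. N j i * v j) = (0::complex)) \<and> (\<exists>j\<in>J. v j \<noteq> 0)"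
  using assms
proof (induction I arbitrary: J N rule: finite_induct)
  case empty
  then show ?case by (auto simp: card_gt_0_iff intro!: exI[of _ "\<lambda>_. 1"])
next
  case (insert i0 I)
  show ?case
  proof (cases "\<exists>j\<in>J. N j i0 \<noteq> 0")
    case False
    obtain v where "\<forall>i\<in>I. (\<Sum>j\<in>J. N j i * v j) = 0" "\<exists>j\<in>J. v j \<noteq> 0"
      using insert.IH[of J N] insert.prems insert.hyps by auto
    then show ?thesis using False by (intro exI[of _ v]) auto
  next
    case True
    then obtain j0 where j0: "j0 \<in> J" "N j0 i0 \<noteq> 0" by blast
    define J' where "J' = J - {j0}"
    define N' where "N' j i = N j i - N j i0 * N j0 i / N j0 i0" for j i
    have "finite J'" "card I < card J'"
      using insert j0 by (auto simp: J'_def)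
    then obtain v where v: "\<forall>i\<in>I. (\<Sum>j\<in>J'. N' j i * v j) = 0" "\<exists>j\<in>J'. v j \<noteq> 0"
      using insert.IH[of J' N'] by blast
    define S where "S i = (\<Sum>j\<in>J'. N j i * v j)" for i
    define w where "w = v(j0 := - S i0 / N j0 i0)"
    have sum: "(\<Sum>j\<in>J. N j i * w j) = N j0 i * (- S i0 / N j0 i0) + S i" for i
    proof -
      have "(\<Sum>j\<in>J. N j i * w j) = N j0 i * w j0 + (\<Sum>j\<in>J'. N j i * w j)"
        unfolding J'_def using insert.prems(1) j0(1) by (rule sum.remove)
      also have "(\<Sum>j\<in>J'. N j i * w j) = S i"
        unfolding S_def by (intro sum.cong) (auto simp: w_def J'_def)
      finally show ?thesis by (simp add: w_def)
    qed
    have "S i - S i0 * N j0 i / N j0 i0 = 0" if "i \<in> I" for i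
    proof -
      have "(\<Sum>j\<in>J'. N' j i * v j) = S i - S i0 * (N j0 i / N j0 i0)"
      proof -
        have "N' j i * v j = N j i * v j - N j i0 * v j * (N j0 i / N j0 i0)" for j
          by (simp add: N'_def left_diff_distrib)
        then show ?thesis
          by (simp only: S_def sum_subtractf sum_distrib_right)
      qed
      then show ?thesis using v(1) that by simp
    qed
    then have "\<forall>i\<in>insert i0 I. (\<Sum>j\<in>J. N j i * w j) = 0"
      unfolding sum using j0(2) by (auto simp: field_simps)
    moreover have "\<exists>j\<in>J. w j \<noteq> 0" using v(2) by (auto simp: w_def J'_def)
    ultimately show ?thesis by blast
  qed
qed

text \<open>Composing the two linear maps gives the identity on the cone of index \<open>d'\<close>,
  hence on its span, which is everything. This identity of a space of dimension
  \<open>d' + 4\<close> would factor through dimension \<open>d + 4\<close>. As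
  \<open>d' \<ge> 5\<close>, the description of the cone applies.\<close>

theorem calogero_moser_not_isomorphic:
  assumes "4 \<le> d" "d < d'"
  shows "\<not> locally_analytically_isomorphic
           {..<d + 4} (calogero_moser d) 0 {..<d' + 4} (calogero_moser d') 0"
proof
  assume iso: "locally_analytically_isomorphic {..<d + 4} (calogero_moser d) 0 {..<d' + 4} (calogero_moser d') 0"
  have sub: "calogero_moser n \<subseteq> cspace {..<n + 4}" for n
    by (auto simp: calogero_moser_def)
  let ?I = "{..<d + 4}" and ?J = "{..<d' + 4}"
  obtain M N where MN: "\<And>v. v \<in> tangent_cone ?J (calogero_moser d') \<Longrightarrow> clin ?I ?J M (clin ?J ?I N v) = v"
    using tangent_cone_iso[OF _ _ sub sub iso] by (metis finite_lessThan)
  define K where "K i j = (\<Sum>k\<in>?I. M k j * N i k)" for i j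
  have comp: "clin ?J ?J K v = clin ?I ?J M (clin ?J ?I N v)" for v
  proof -
    have "(\<Sum>i\<in>?J. K i j * v i) = (\<Sum>k\<in>?I. M k j * (\<Sum>i\<in>?J. N i k * v i))" for j
      unfolding K_def sum_distrib_left sum_distrib_right by (subst sum.swap) (simp only: mult.assoc)
    then show ?thesis by (simp add: clin_def fun_eq_iff)
  qed
  have id: "clin ?J ?J K v = v" if "v \<in> cspace ?J" for v
  proof (rule tcone_spans[OF _ _ that])
    fix w assume "w \<in> cm_tcone d'"
    then have "w \<in> tangent_cone ?J (calogero_moser d')"
      using assms by (subst tangent_cone_calogero_moser) auto
    then show "clin ?J ?J K w = w" unfolding comp by (rule MN)
  qed (use assms in simp)
  obtain v j where v: "\<forall>i\<in>?I. (\<Sum>j\<in>?J. N j i * v j) = 0" "j \<in> ?J" "v j \<noteq> 0"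
    using homogeneous_system[of ?I ?J N] assms by auto
  define w where "w i = (if i \<in> ?J then v i else 0)" for i
  have "w \<in> cspace ?J" by (simp add: w_def cspace_def)
  moreover have "clin ?J ?I N w = 0"
    using v(1) by (auto simp: clin_def w_def fun_eq_iff)
  ultimately have "w = 0" using id[of w] by (simp add: comp)
  then have "w j = 0" by simp
  then show False using v(2,3) by (simp add: w_def)
qed

section \<open>Orbits of the adjoint group\<close>

lemma vector_space_cscale: "vector_space cscale"
  by unfold_locales (auto simp: cscale_def fun_eq_iff algebra_simps)

interpretation cs: vector_space cscale
  by (rule vector_space_cscale)

interpretation cs2: vector_space_pair cscale cscale
  by unfold_locales

definition cdelta :: "'i \<Rightarrow> 'i \<Rightarrow> complex" where
  "cdelta i = (\<lambda>j. if j = i then 1 else 0)"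

lemma sum_fun_apply: "(\<Sum>i\<in>I. f i) x = (\<Sum>i\<in>I. f i x)"
  by (induction I rule: infinite_finite_induct) auto

lemma cspace_expand:
  assumes "finite I" "z \<in> cspace I"
  shows "z = (\<Sum>i\<in>I. cscale (z i) (cdelta i))"
proof
  fix k
  have "(\<Sum>i\<in>I. cscale (z i) (cdelta i) k) = (\<Sum>i\<in>I. if k = i then z i else 0)"
    by (intro sum.cong) (auto simp: cscale_def cdelta_def)
  then show "z k = (\<Sum>i\<in>I. cscale (z i) (cdelta i)) k"
    using assms by (auto simp: sum_fun_apply cspace_def)
qed

text \<open>The \<open>p i\<close> are the images of the unit vectors under a linear projection onto
  \<open>g\<close>. They need not be a basis; their use is that the coefficients are the ambient
  coordinates.\<close>

lemma subspace_projection: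
  assumes fin: "finite I" and g: "g \<subseteq> cspace I" "cs.subspace g"
  obtains p where "\<And>i. p i \<in> g" "\<And>z. z \<in> g \<Longrightarrow> z = (\<Sum>i\<in>I. cscale (z i) (p i))"
proof -
  obtain f where f: "f ` UNIV \<subseteq> g" "Vector_Spaces.linear cscale cscale f" "\<forall>v\<in>g. f (id v) = v"
    using cs2.linear_exists_left_inverse_on[OF cs.linear_id g(2)] by auto
  interpret f: Vector_Spaces.linear cscale cscale f by (rule f(2))
  show ?thesis
  proof
    show "f (cdelta i) \<in> g" for i using f(1) by blast
    fix z assume z: "z \<in> g"
    then have "z = f (\<Sum>i\<in>I. cscale (z i) (cdelta i))"
      using f(3) cspace_expand[OF fin, of z] g(1) by auto
    then show "z = (\<Sum>i\<in>I. cscale (z i) (f (cdelta i)))"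
      by (simp add: f.sum f.scale)
  qed
qed

lemma continuous_coord: "continuous_on S (\<lambda>x. x i :: complex)"
  by (rule continuous_on_product_then_coordinatewise) (rule continuous_on_id)

lemma continuous_clin: "continuous_on S (clin I J M)"
proof (rule continuous_on_coordinatewise_then_product)
  fix j show "continuous_on S (\<lambda>x. clin I J M x j)"
    by (cases "j \<in> J") (auto simp: clin_def intro!: continuous_intros continuous_coord)
qed

text \<open>The subspace is the fixed point set of a projection, so it is cut out by linear
  equations in finitely many coordinates.\<close>

lemma subspace_closed:
  assumes fin: "finite I" and g: "g \<subseteq> cspace I" "cs.subspace g"
  shows "closed g"
proof -
  obtain p where p: "\<And>i. p i \<in> g" "\<And>z. z \<in> g \<Longrightarrow> z = (\<Sum>i\<in>I. cscale (z i) (p i))"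
    using subspace_projection[OF assms] by blast
  have mem: "(\<Sum>i\<in>I. cscale (z i) (p i)) \<in> g" for z
    using g(2) p(1) by (intro cs.subspace_sum cs.subspace_scale)
  have "g = (\<Inter>k. {z. z k = (\<Sum>i\<in>I. z i * p i k)})"
  proof (intro equalityI subsetI)
    fix z assume "z \<in> g"
    then have "z k = (\<Sum>i\<in>I. z i * p i k)" for k
      using fun_cong[OF p(2), of z k] unfolding sum_fun_apply cscale_def by blast
    then show "z \<in> (\<Inter>k. {z. z k = (\<Sum>i\<in>I. z i * p i k)})"
      by blast
  next
    fix z assume "z \<in> (\<Inter>k. {z. z k = (\<Sum>i\<in>I. z i * p i k)})"
    then have "z k = (\<Sum>i\<in>I. z i * p i k)" for k by blast
    then have "z = (\<Sum>i\<in>I. cscale (z i) (p i))"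
      unfolding fun_eq_iff sum_fun_apply cscale_def by blast
    with mem[of z] show "z \<in> g" by simp
  qed
  also have "closed \<dots>"
    by (intro closed_INT ballI closed_Collect_eq continuous_intros continuous_coord)
  finally show ?thesis .
qed

text \<open>Pascal's rule, in the form of the induction step of Leibniz' formula for a
  derivation.\<close>

lemma leibniz_sum:
  fixes f :: "nat \<Rightarrow> nat \<Rightarrow> complex"
  shows "(\<Sum>m\<le>n. of_nat (n choose m) * (f (Suc m) (n - m) + f m (Suc n - m))) =
    (\<Sum>m\<le>Suc n. of_nat (Suc n choose m) * f m (Suc n - m))"
proof -
  have "(\<Sum>m\<le>Suc n. of_nat (Suc n choose m) * f m (Suc n - m)) =
      f 0 (Suc n) + (\<Sum>m\<le>n. of_nat ((n choose m) + (n choose Suc m)) * f (Suc m) (n - m))"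
    by (subst sum.atMost_Suc_shift) simp
  also have "\<dots> = (f 0 (Suc n) + (\<Sum>m\<le>n. of_nat (n choose Suc m) * f (Suc m) (Suc n - Suc m))) +
      (\<Sum>m\<le>n. of_nat (n choose m) * f (Suc m) (n - m))"
    by (simp add: sum.distrib distrib_right)
  also have "f 0 (Suc n) + (\<Sum>m\<le>n. of_nat (n choose Suc m) * f (Suc m) (Suc n - Suc m)) =
      (\<Sum>m\<le>Suc n. of_nat (n choose m) * f m (Suc n - m))"
    by (subst sum.atMost_Suc_shift) simp
  also have "\<dots> = (\<Sum>m\<le>n. of_nat (n choose m) * f m (Suc n - m))"
    by simp
  finally show ?thesis by (simp add: sum.distrib distrib_left)
qed

lemma summable_exp_bound:
  assumes "\<And>n. cmod (f n) \<le> K ^ n * B"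
  shows "summable (\<lambda>n. cmod (f n / fact n))"
proof (rule summable_comparison_test'[where N = 0])
  show "summable (\<lambda>n. inverse (fact n) * K ^ n * B)"
    using summable_exp[of K] by (rule summable_mult2)
  fix n :: nat
  show "norm (cmod (f n / fact n)) \<le> inverse (fact n) * K ^ n * B"
    using assms[of n] by (simp add: norm_divide divide_simps)
qed

lemma cauchy_sums:
  fixes a b :: "nat \<Rightarrow> complex"
  assumes "summable (\<lambda>n. cmod (a n))" "summable (\<lambda>n. cmod (b n))" "a sums A" "b sums B"
  shows "(\<lambda>n. \<Sum>m\<le>n. a m * b (n - m)) sums (A * B)"
  using Cauchy_product_sums[OF assms(1,2)] assms(3,4) by (simp add: sums_iff)

lemma cscale_direction: "(s + cscale 1 v) - s = v"
  by (auto simp: cscale_def)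

section \<open>The exponential of the adjoint action\<close>

locale lie_alg =
  fixes I :: "'i set" and g :: "('i \<Rightarrow> complex) set" and br :: "'i bracket"
  assumes lie: "lie_algebra I g br"
begin

lemma fin: "finite I" and gI: "g \<subseteq> cspace I" and sub: "cs.subspace g"
  and br_in [simp]: "\<And>x y. x \<in> g \<Longrightarrow> y \<in> g \<Longrightarrow> br x y \<in> g"
  and br_add1: "\<And>x y z. x \<in> g \<Longrightarrow> y \<in> g \<Longrightarrow> z \<in> g \<Longrightarrow> br (x + y) z = br x z + br y z"
  and br_add2: "\<And>x y z. x \<in> g \<Longrightarrow> y \<in> g \<Longrightarrow> z \<in> g \<Longrightarrow> br z (x + y) = br z x + br z y"
  and br_scale1: "\<And>c x y. x \<in> g \<Longrightarrow> y \<in> g \<Longrightarrow> br (cscale c x) y = cscale c (br x y)"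
  and br_scale2: "\<And>c x y. x \<in> g \<Longrightarrow> y \<in> g \<Longrightarrow> br x (cscale c y) = cscale c (br x y)"
  and br_self: "\<And>x. x \<in> g \<Longrightarrow> br x x = 0"
  and jacobi: "\<And>x y z. x \<in> g \<Longrightarrow> y \<in> g \<Longrightarrow> z \<in> g \<Longrightarrow> br x (br y z) + br y (br z x) + br z (br x y) = 0"
  using lie unfolding lie_algebra_def by blast+

lemma g_add [simp]: "x \<in> g \<Longrightarrow> y \<in> g \<Longrightarrow> x + y \<in> g"
  and g_diff [simp]: "x \<in> g \<Longrightarrow> y \<in> g \<Longrightarrow> x - y \<in> g"
  and g_scale [simp]: "x \<in> g \<Longrightarrow> cscale c x \<in> g"
  and g_0 [simp]: "0 \<in> g"
  and g_neg [simp]: "x \<in> g \<Longrightarrow> - x \<in> g"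
  by (auto intro: cs.subspace_add[OF sub] cs.subspace_diff[OF sub] cs.subspace_scale[OF sub]
      cs.subspace_0[OF sub] cs.subspace_neg[OF sub])

lemma closed_g: "closed g"
  by (rule subspace_closed[OF fin gI sub])

lemma br_sum1:
  assumes "finite A" "\<And>i. i \<in> A \<Longrightarrow> f i \<in> g" "y \<in> g"
  shows "br (\<Sum>i\<in>A. f i) y = (\<Sum>i\<in>A. br (f i) y)"
  using assms(1,2)
proof (induction A rule: finite_induct)
  case empty
  show ?case using br_scale1[OF g_0 assms(3), of 0] by (simp add: cscale_def zero_fun_def)
next
  case (insert a A)
  then have fA: "(\<Sum>i\<in>A. f i) \<in> g" using sub by (intro cs.subspace_sum) auto
  have 1: "br (\<Sum>i\<in>A. f i) y = (\<Sum>i\<in>A. br (f i) y)" by (rule insert.IH) (use insert.prems in blast)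
  have 2: "br (f a + (\<Sum>i\<in>A. f i)) y = br (f a) y + br (\<Sum>i\<in>A. f i) y" by (rule br_add1) (use insert.prems fA assms(3) in blast)+
  show ?case unfolding sum.insert[OF insert.hyps] 2 1 ..
qed

lemma br_sum2:
  assumes "finite A" "\<And>i. i \<in> A \<Longrightarrow> f i \<in> g" "y \<in> g"
  shows "br y (\<Sum>i\<in>A. f i) = (\<Sum>i\<in>A. br y (f i))"
  using assms(1,2)
proof (induction A rule: finite_induct)
  case empty
  show ?case using br_scale2[OF assms(3) g_0, of 0] by (simp add: cscale_def zero_fun_def)
next
  case (insert a A)
  then have fA: "(\<Sum>i\<in>A. f i) \<in> g" using sub by (intro cs.subspace_sum) auto
  have 1: "br y (\<Sum>i\<in>A. f i) = (\<Sum>i\<in>A. br y (f i))" by (rule insert.IH) (use insert.prems in blast)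
  have 2: "br y (f a + (\<Sum>i\<in>A. f i)) = br y (f a) + br y (\<Sum>i\<in>A. f i)" by (rule br_add2) (use insert.prems fA assms(3) in blast)+
  show ?case unfolding sum.insert[OF insert.hyps] 2 1 ..
qed

text \<open>Expanding both arguments through a projection onto \<open>g\<close> makes the bracket a
  bilinear polynomial in the ambient coordinates. Limits and series of brackets can then be taken
  coordinate by coordinate.\<close>

lemma structure_constants:
  "\<exists>c. \<forall>x\<in>g. \<forall>y\<in>g. \<forall>k. br x y k = (\<Sum>i\<in>I. \<Sum>j\<in>I. x i * y j * c i j k)"
proof -
  obtain p where p: "\<And>i. p i \<in> g" "\<And>z. z \<in> g \<Longrightarrow> z = (\<Sum>i\<in>I. cscale (z i) (p i))"
    using subspace_projection[OF fin gI sub] by blast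
  have "br x y k = (\<Sum>i\<in>I. \<Sum>j\<in>I. x i * y j * br (p i) (p j) k)" if x: "x \<in> g" and y: "y \<in> g" for x y k
  proof -
    have "br x y = br (\<Sum>i\<in>I. cscale (x i) (p i)) y"
      using p(2)[OF x] by metis
    also have "\<dots> = (\<Sum>i\<in>I. cscale (x i) (br (p i) y))"
      using fin p(1) y by (subst br_sum1) (auto simp: br_scale1)
    also have "\<dots> = (\<Sum>i\<in>I. cscale (x i) (\<Sum>j\<in>I. cscale (y j) (br (p i) (p j))))"
    proof (rule sum.cong[OF refl])
      fix i
      have "br (p i) y = br (p i) (\<Sum>j\<in>I. cscale (y j) (p j))"
        using p(2)[OF y] by metis
      also have "\<dots> = (\<Sum>j\<in>I. cscale (y j) (br (p i) (p j)))"
        using fin p(1) by (subst br_sum2) (auto simp: br_scale2)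
      finally show "cscale (x i) (br (p i) y) = cscale (x i) (\<Sum>j\<in>I. cscale (y j) (br (p i) (p j)))"
        by simp
    qed
    finally show ?thesis
      by (simp add: sum_fun_apply cscale_def sum_distrib_left mult.assoc)
  qed
  then show ?thesis by (intro exI[of _ "\<lambda>i j. br (p i) (p j)"]) blast
qed

definition sc :: "'i \<Rightarrow> 'i \<Rightarrow> 'i \<Rightarrow> complex" where
  "sc = (SOME c. \<forall>x\<in>g. \<forall>y\<in>g. \<forall>k. br x y k = (\<Sum>i\<in>I. \<Sum>j\<in>I. x i * y j * c i j k))"

lemma br_sc: "x \<in> g \<Longrightarrow> y \<in> g \<Longrightarrow> br x y k = (\<Sum>i\<in>I. \<Sum>j\<in>I. x i * y j * sc i j k)"
  using someI_ex[OF structure_constants] unfolding sc_def by blast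

lemma funpow_in [simp]: "y \<in> g \<Longrightarrow> z \<in> g \<Longrightarrow> (br y ^^ n) z \<in> g"
  by (induction n) auto

definition adm :: "('i \<Rightarrow> complex) \<Rightarrow> 'i \<Rightarrow> 'i \<Rightarrow> complex" where
  "adm y j i = (\<Sum>k\<in>I. y k * sc k j i)"

lemma br_adm: "y \<in> g \<Longrightarrow> z \<in> g \<Longrightarrow> br y z i = (\<Sum>j\<in>I. adm y j i * z j)"
  unfolding br_sc adm_def sum_distrib_right by (subst sum.swap) (simp add: mult_ac)

text \<open>Powers of the matrix of \<open>ad y\<close>, extended from \<open>g\<close> to all of
  \<open>cspace I\<close> by the structure constants. Working with matrix entries permits bounds
  that do not refer to the vector acted upon.\<close>

primrec adpow :: "('i \<Rightarrow> complex) \<Rightarrow> nat \<Rightarrow> 'i \<Rightarrow> 'i \<Rightarrow> complex" where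
  "adpow y 0 = (\<lambda>j i. if i = j then 1 else 0)"
| "adpow y (Suc n) = (\<lambda>j i. \<Sum>k\<in>I. adm y k i * adpow y n j k)"

lemma funpow_adpow:
  assumes "y \<in> g" "z \<in> g" "i \<in> I"
  shows "(br y ^^ n) z i = (\<Sum>j\<in>I. adpow y n j i * z j)"
  using assms(3)
proof (induction n arbitrary: i)
  case 0
  have "(\<Sum>j\<in>I. (if i = j then 1 else 0) * z j) = (\<Sum>j\<in>I. if i = j then z j else 0)"
    by (intro sum.cong) auto
  then show ?case using fin 0 by simp
next
  case (Suc n)
  have "(br y ^^ Suc n) z i = (\<Sum>k\<in>I. adm y k i * (\<Sum>j\<in>I. adpow y n j k * z j))"
    using assms Suc by (simp add: br_adm)
  also have "\<dots> = (\<Sum>j\<in>I. (\<Sum>k\<in>I. adm y k i * adpow y n j k) * z j)"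
    unfolding sum_distrib_left sum_distrib_right by (subst sum.swap) (simp only: mult.assoc)
  finally show ?case by simp
qed

definition adbound :: "('i \<Rightarrow> complex) \<Rightarrow> real" where
  "adbound y = (\<Sum>i\<in>I. \<Sum>k\<in>I. cmod (adm y k i))"

lemma adbound_nonneg: "adbound y \<ge> 0"
  unfolding adbound_def by (intro sum_nonneg) auto

lemma adpow_bound: "i \<in> I \<Longrightarrow> cmod (adpow y n j i) \<le> adbound y ^ n * 1"
proof (induction n arbitrary: i)
  case (Suc n)
  have "cmod (adpow y (Suc n) j i) \<le> (\<Sum>k\<in>I. cmod (adm y k i) * adbound y ^ n)"
    using Suc.IH by (auto simp: norm_mult intro!: sum_norm_le mult_left_mono)
  also have "\<dots> = (\<Sum>k\<in>I. cmod (adm y k i)) * adbound y ^ n"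
    by (simp add: sum_distrib_right)
  also have "\<dots> \<le> adbound y * adbound y ^ n"
    using fin Suc.prems adbound_nonneg unfolding adbound_def
    by (intro mult_right_mono member_le_sum[of i I "\<lambda>i. \<Sum>k\<in>I. cmod (adm y k i)"] zero_le_power) (auto intro: sum_nonneg)
  finally show ?case by simp
qed auto

lemma adpow_summable: "i \<in> I \<Longrightarrow> summable (\<lambda>n. cmod (adpow y n j i / fact n))"
  by (rule summable_exp_bound[where K = "adbound y" and B = 1]) (rule adpow_bound)

lemma funpow_bound:
  assumes "y \<in> g" "z \<in> g" "i \<in> I"
  shows "cmod ((br y ^^ n) z i) \<le> adbound y ^ n * (\<Sum>j\<in>I. cmod (z j))"
proof -
  have "cmod ((br y ^^ n) z i) \<le> (\<Sum>j\<in>I. cmod (adpow y n j i) * cmod (z j))"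
    unfolding funpow_adpow[OF assms] by (rule sum_norm_le) (simp add: norm_mult)
  also have "\<dots> \<le> (\<Sum>j\<in>I. adbound y ^ n * cmod (z j))"
    using adpow_bound[OF assms(3)] by (intro sum_mono mult_right_mono) auto
  finally show ?thesis by (simp add: sum_distrib_left)
qed

lemma funpow_summable:
  assumes "y \<in> g" "z \<in> g"
  shows "summable (\<lambda>n. cmod ((br y ^^ n) z i / fact n))"
proof (cases "i \<in> I")
  case True
  then show ?thesis
    by (rule summable_exp_bound[OF funpow_bound[OF assms]])
next
  case False
  then have "(br y ^^ n) z i = 0" for n
    using funpow_in[OF assms] gI by (auto dest: cspaceD)
  then show ?thesis by simp
qed

lemma exp_ad_sums:
  assumes "y \<in> g" "z \<in> g"
  shows "(\<lambda>n. (br y ^^ n) z i / fact n) sums exp_ad br y z i"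
  unfolding exp_ad_def using summable_norm_cancel[OF funpow_summable[OF assms]] by (rule summable_sums)

definition expm :: "('i \<Rightarrow> complex) \<Rightarrow> 'i \<Rightarrow> 'i \<Rightarrow> complex" where
  "expm y j i = (\<Sum>n. adpow y n j i / fact n)"

lemma expm_sums: "i \<in> I \<Longrightarrow> (\<lambda>n. adpow y n j i / fact n) sums expm y j i"
  unfolding expm_def by (rule summable_sums[OF summable_norm_cancel[OF adpow_summable]])

text \<open>On \<open>g\<close> the exponential series is a matrix applied to \<open>z\<close>;
  linearity and continuity of the adjoint group action follow from this.\<close>

lemma exp_ad_clin:
  assumes "y \<in> g" "z \<in> g"
  shows "exp_ad br y z = clin I I (expm y) z"
proof
  fix i
  show "exp_ad br y z i = clin I I (expm y) z i"
  proof (cases "i \<in> I")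
    case True
    have "(\<lambda>n. \<Sum>j\<in>I. adpow y n j i / fact n * z j) sums (\<Sum>j\<in>I. expm y j i * z j)"
      by (intro sums_sum sums_mult2 expm_sums True)
    also have "(\<lambda>n. \<Sum>j\<in>I. adpow y n j i / fact n * z j) = (\<lambda>n. (br y ^^ n) z i / fact n)"
      by (simp add: funpow_adpow[OF assms True] sum_divide_distrib)
    finally have "(\<lambda>n. (br y ^^ n) z i / fact n) sums (\<Sum>j\<in>I. expm y j i * z j)" .
    from sums_unique2[OF exp_ad_sums[OF assms] this] show ?thesis
      using True by (simp add: clin_def)
  next
    case False
    then have "(br y ^^ n) z i = 0" for n
      using funpow_in[OF assms] gI by (auto dest: cspaceD)
    then show ?thesis using False by (simp add: exp_ad_def clin_def)
  qed
qed

lemma exp_ad_in [simp]: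
  assumes "y \<in> g" "z \<in> g"
  shows "exp_ad br y z \<in> g"
proof -
  define S where "S N = (\<Sum>n<N. cscale (1 / fact n) ((br y ^^ n) z))" for N
  have S: "S N \<in> g" for N
    unfolding S_def using sub assms by (intro cs.subspace_sum) auto
  have lim: "(\<lambda>N. S N i) \<longlonglongrightarrow> exp_ad br y z i" for i
    using exp_ad_sums[OF assms, of i] unfolding sums_def S_def
    by (simp add: sum_fun_apply cscale_def)
  have "exp_ad br y z \<in> closure g"
    unfolding closure_cspace_iff[OF fin gI]
  proof (intro conjI allI impI)
    show "exp_ad br y z \<in> cspace I" by (simp add: exp_ad_clin[OF assms])
    fix e :: real assume e: "e > 0"
    have "eventually (\<lambda>N. \<forall>i\<in>I. cmod (S N i - exp_ad br y z i) < e) sequentially"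
      unfolding eventually_ball_finite_distrib[OF fin]
      using tendstoD[OF lim e] by (simp add: dist_norm)
    then obtain N where "\<forall>i\<in>I. cmod (S N i - exp_ad br y z i) < e"
      using eventually_happens'[OF sequentially_bot] by blast
    then show "\<exists>s\<in>g. \<forall>i\<in>I. cmod (s i - exp_ad br y z i) < e" using S by blast
  qed
  then show ?thesis using closed_g by simp
qed

lemma exp_ad_add: "y \<in> g \<Longrightarrow> a \<in> g \<Longrightarrow> b \<in> g \<Longrightarrow> exp_ad br y (a + b) = exp_ad br y a + exp_ad br y b"
  by (simp add: exp_ad_clin clin_add)

lemma exp_ad_scale: "y \<in> g \<Longrightarrow> a \<in> g \<Longrightarrow> exp_ad br y (cscale c a) = cscale c (exp_ad br y a)"
  by (simp add: exp_ad_clin clin_cscale)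

lemma br_antisym:
  assumes "x \<in> g" "y \<in> g"
  shows "br y x = cscale (-1) (br x y)"
proof -
  have "br (x + y) (x + y) = br x y + br y x"
    using assms by (simp add: br_add1 br_add2 br_self[OF assms(1)] br_self[OF assms(2)])
  with br_self[OF g_add[OF assms]] have "br x y + br y x = 0" by metis
  then show ?thesis by (auto simp: cscale_def fun_eq_iff add_eq_0_iff)
qed

lemma br_derivation:
  assumes "x \<in> g" "y \<in> g" "z \<in> g"
  shows "br y (br x z) = br (br y x) z + br x (br y z)"
proof -
  have 1: "br x (br y z) + br y (br z x) + br z (br x y) = 0"
    using jacobi assms by blast
  have 2: "br y (br z x) = cscale (-1) (br y (br x z))"
    unfolding br_antisym[OF assms(1,3)] by (rule br_scale2) (use assms in auto)
  have 3: "br z (br x y) = br (br y x) z"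
    unfolding br_antisym[OF br_in[OF assms(1,2)] assms(3)] br_antisym[OF assms(1,2)]
    by (rule br_scale1[symmetric]) (use assms in auto)
  show ?thesis
  proof
    fix k
    have "br x (br y z) k + (- br y (br x z) k) + br (br y x) z k = 0"
      using fun_cong[OF 1, of k] unfolding 2 3 by (simp only: plus_fun_apply cscale_def zero_fun_apply) simp
    then show "br y (br x z) k = (br (br y x) z + br x (br y z)) k"
      unfolding plus_fun_apply by algebra
  qed
qed

lemma funpow_add_vec:
  assumes "y \<in> g" "a \<in> g" "b \<in> g"
  shows "(br y ^^ n) (a + b) = (br y ^^ n) a + (br y ^^ n) b"
proof (induction n)
  case (Suc n)
  have "br y ((br y ^^ n) a + (br y ^^ n) b) = br y ((br y ^^ n) a) + br y ((br y ^^ n) b)"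
    by (rule br_add2) (use assms in auto)
  then show ?case using Suc.IH unfolding funpow.simps o_apply by metis
qed simp

lemma br_leibniz:
  assumes "y \<in> g" "x \<in> g" "z \<in> g"
  shows "(br y ^^ n) (br x z) k =
    (\<Sum>m\<le>n. of_nat (n choose m) * br ((br y ^^ m) x) ((br y ^^ (n - m)) z) k)"
  using assms(2,3)
proof (induction n arbitrary: x z)
  case (Suc n)
  let ?f = "\<lambda>m l. br ((br y ^^ m) x) ((br y ^^ l) z) k"
  have "(br y ^^ Suc n) (br x z) k = (br y ^^ n) (br (br y x) z) k + (br y ^^ n) (br x (br y z)) k"
    using assms(1) Suc.prems
    by (simp del: funpow.simps add: funpow_Suc_right funpow_add_vec br_derivation[of x y z])
  also have "\<dots> = (\<Sum>m\<le>n. of_nat (n choose m) * (?f (Suc m) (n - m) + ?f m (Suc n - m)))"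
    using Suc.IH[of "br y x" z] Suc.IH[of x "br y z"] assms(1) Suc.prems
    by (simp add: sum.distrib distrib_left funpow_swap1 Suc_diff_le)
  finally show ?case by (rule trans[OF _ leibniz_sum[of n ?f]])
qed auto

text \<open>The exponential of a derivation is an automorphism. Leibniz' formula, divided by
  \<open>n!\<close>, shows the terms of a Cauchy product; the structure constants reduce the bracket
  of two series to products of scalar series.\<close>

lemma exp_ad_bracket:
  assumes "y \<in> g" "x \<in> g" "z \<in> g"
  shows "exp_ad br y (br x z) = br (exp_ad br y x) (exp_ad br y z)"
proof
  fix k
  let ?x = "\<lambda>i n. (br y ^^ n) x i / fact n" and ?z = "\<lambda>i n. (br y ^^ n) z i / fact n"
  have "(\<lambda>n. \<Sum>i\<in>I. \<Sum>j\<in>I. (\<Sum>m\<le>n. ?x i m * ?z j (n - m)) * sc i j k) sums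
     (\<Sum>i\<in>I. \<Sum>j\<in>I. exp_ad br y x i * exp_ad br y z j * sc i j k)"
    using assms by (intro sums_sum sums_mult2 cauchy_sums funpow_summable exp_ad_sums)
  also have "(\<Sum>i\<in>I. \<Sum>j\<in>I. exp_ad br y x i * exp_ad br y z j * sc i j k) = br (exp_ad br y x) (exp_ad br y z) k"
    using assms by (simp add: br_sc)
  also have "(\<lambda>n. \<Sum>i\<in>I. \<Sum>j\<in>I. (\<Sum>m\<le>n. ?x i m * ?z j (n - m)) * sc i j k) = (\<lambda>n. (br y ^^ n) (br x z) k / fact n)"
  proof
    fix n
    have "(br y ^^ n) (br x z) k / fact n =
       (\<Sum>m\<le>n. of_nat (n choose m) / fact n * (\<Sum>i\<in>I. \<Sum>j\<in>I. (br y ^^ m) x i * (br y ^^ (n - m)) z j * sc i j k))"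
      using assms by (simp add: br_leibniz br_sc sum_divide_distrib)
    also have "\<dots> = (\<Sum>m\<le>n. \<Sum>i\<in>I. \<Sum>j\<in>I. ?x i m * ?z j (n - m) * sc i j k)"
    proof (rule sum.cong[OF refl])
      fix m assume "m \<in> {..n}"
      then have "of_nat (n choose m) / fact n = (1 / (fact m * fact (n - m)) :: complex)"
        by (simp add: binomial_fact field_simps)
      then show "of_nat (n choose m) / fact n * (\<Sum>i\<in>I. \<Sum>j\<in>I. (br y ^^ m) x i * (br y ^^ (n - m)) z j * sc i j k) =
        (\<Sum>i\<in>I. \<Sum>j\<in>I. ?x i m * ?z j (n - m) * sc i j k)"
        by (simp add: sum_divide_distrib)
    qed
    also have "\<dots> = (\<Sum>i\<in>I. \<Sum>m\<le>n. \<Sum>j\<in>I. ?x i m * ?z j (n - m) * sc i j k)"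
      by (rule sum.swap)
    also have "\<dots> = (\<Sum>i\<in>I. \<Sum>j\<in>I. \<Sum>m\<le>n. ?x i m * ?z j (n - m) * sc i j k)"
      by (intro sum.cong[OF refl] sum.swap)
    finally show "(\<Sum>i\<in>I. \<Sum>j\<in>I. (\<Sum>m\<le>n. ?x i m * ?z j (n - m)) * sc i j k) = (br y ^^ n) (br x z) k / fact n"
      by (simp add: sum_distrib_right)
  qed
  finally show "exp_ad br y (br x z) k = br (exp_ad br y x) (exp_ad br y z) k"
    using exp_ad_sums[of y "br x z" k] assms sums_unique2 by (metis br_in)
qed

lemma adpow_neg: "adpow (- y) n j i = (-1) ^ n * adpow y n j i"
proof (induction n arbitrary: i)
  case (Suc n)
  have adm: "adm (- y) k i = - adm y k i" for k i
    by (simp add: adm_def sum_negf)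
  show ?case unfolding adpow.simps Suc.IH adm by (simp add: sum_distrib_left mult_ac sum_negf)
qed auto

text \<open>The Cauchy product of the matrix series for \<open>- y\<close> with the series of
  \<open>exp_ad br y z\<close> has the \<open>n\<close>-th term \<open>(-1 + 1)^n / n!\<close> times
  \<open>(ad y)^n z\<close>, so only the term with \<open>n = 0\<close> is left.\<close>

lemma exp_ad_inverse:
  assumes y: "y \<in> g" and z: "z \<in> g"
  shows "exp_ad br (- y) (exp_ad br y z) = z"
proof
  fix i
  let ?y = "- y"
  have y': "?y \<in> g" using y by simp
  show "exp_ad br ?y (exp_ad br y z) i = z i"
  proof (cases "i \<in> I")
    case True
    let ?a = "\<lambda>j n. adpow ?y n j i / fact n" and ?b = "\<lambda>j n. (br y ^^ n) z j / fact n"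
    have "(\<lambda>n. \<Sum>j\<in>I. \<Sum>m\<le>n. ?a j m * ?b j (n - m)) sums (\<Sum>j\<in>I. expm ?y j i * exp_ad br y z j)"
      by (intro sums_sum cauchy_sums adpow_summable funpow_summable y z expm_sums exp_ad_sums True)
    also have "(\<Sum>j\<in>I. expm ?y j i * exp_ad br y z j) = exp_ad br ?y (exp_ad br y z) i"
      using True y z y' by (subst (2) exp_ad_clin) (auto simp: clin_def)
    also have "(\<lambda>n. \<Sum>j\<in>I. \<Sum>m\<le>n. ?a j m * ?b j (n - m)) = (\<lambda>n. if n = 0 then z i else 0)"
    proof
      fix n
      have "(\<Sum>j\<in>I. \<Sum>m\<le>n. ?a j m * ?b j (n - m)) =
          (\<Sum>m\<le>n. (-1) ^ m / (fact m * fact (n - m)) * (\<Sum>j\<in>I. adpow y m j i * (br y ^^ (n - m)) z j))"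
        by (subst sum.swap) (simp add: adpow_neg sum_distrib_left mult_ac)
      also have "\<dots> = (\<Sum>m\<le>n. of_nat (n choose m) * (-1) ^ m / fact n * (br y ^^ n) z i)"
      proof (rule sum.cong[OF refl])
        fix m assume m: "m \<in> {..n}"
        then have "(\<Sum>j\<in>I. adpow y m j i * (br y ^^ (n - m)) z j) = (br y ^^ m) ((br y ^^ (n - m)) z) i"
          using funpow_adpow[OF y _ True, of "(br y ^^ (n - m)) z" m] y z by simp
        also have "\<dots> = (br y ^^ n) z i"
          using fun_cong[OF funpow_add[of m "n - m" "br y"], of z] m by simp
        finally show "(-1) ^ m / (fact m * fact (n - m)) * (\<Sum>j\<in>I. adpow y m j i * (br y ^^ (n - m)) z j) =
          of_nat (n choose m) * (-1) ^ m / fact n * (br y ^^ n) z i"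
          using m by (simp add: binomial_fact field_simps)
      qed
      also have "\<dots> = (\<Sum>m\<le>n. of_nat (n choose m) * (-1) ^ m) / fact n * (br y ^^ n) z i"
        by (simp add: sum_distrib_right sum_divide_distrib)
      also have "(\<Sum>m\<le>n. of_nat (n choose m) * (-1 :: complex) ^ m) = (-1 + 1) ^ n"
        using binomial_ring[of "-1 :: complex" 1 n] by simp
      finally have eq: "(\<Sum>j\<in>I. \<Sum>m\<le>n. ?a j m * ?b j (n - m)) = (-1 + 1) ^ n / fact n * (br y ^^ n) z i" .
      show "(\<Sum>j\<in>I. \<Sum>m\<le>n. ?a j m * ?b j (n - m)) = (if n = 0 then z i else 0)"
        unfolding eq by (auto simp: power_0_left)
    qed
    finally show ?thesis
      using sums_single[of 0 "\<lambda>_. z i"] sums_unique2 by blast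
  next
    case False
    then show ?thesis using y z y' gI exp_ad_in by (metis cspaceD subsetD)
  qed
qed

section \<open>Nilpotent elements and closures of orbits\<close>

definition adnil :: "nat \<Rightarrow> ('i \<Rightarrow> complex) \<Rightarrow> bool" where
  "adnil n x \<longleftrightarrow> x \<in> g \<and> (\<forall>y\<in>g. (br x ^^ n) y = 0)"

lemma adnil_exp_ad:
  assumes "adnil n x" "y \<in> g"
  shows "adnil n (exp_ad br y x)"
proof -
  have x: "x \<in> g" using assms(1) by (simp add: adnil_def)
  let ?G = "exp_ad br y" and ?H = "exp_ad br (- y)"
  have y': "(- y) \<in> g" using assms(2) by simp
  have GH: "?G (?H w) = w" if "w \<in> g" for w
    using exp_ad_inverse[OF y' that] by simp
  have "(br (?G x) ^^ m) w = ?G ((br x ^^ m) (?H w))" if w: "w \<in> g" for w m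
  proof (induction m)
    case (Suc m)
    show ?case unfolding funpow.simps o_apply Suc.IH
      by (rule exp_ad_bracket[symmetric]) (intro assms(2) x funpow_in exp_ad_in y' w)+
  qed (simp only: funpow.simps id_apply GH[OF w])
  moreover have "?G 0 = 0" using assms(2) by (simp add: exp_ad_clin)
  ultimately show ?thesis using assms x y' by (simp add: adnil_def)
qed

text \<open>The exponent is fixed, so the condition is polynomial in the coordinates of
  \<open>x\<close>. It passes from an orbit to its closure with the same exponent.\<close>

lemma closed_adnil: "closed {x. adnil n x}"
proof -
  have cont: "continuous_on g (\<lambda>x. (br x ^^ m) y k)" if y: "y \<in> g" for y m k
  proof (induction m arbitrary: k)
    case (Suc m)
    have "continuous_on g (\<lambda>x. \<Sum>i\<in>I. \<Sum>j\<in>I. x i * (br x ^^ m) y j * sc i j k)"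
      by (intro continuous_intros continuous_coord Suc.IH)
    then show ?case
      by (rule continuous_on_eq) (use y in \<open>simp add: br_sc\<close>)
  qed simp
  have "{x. adnil n x} = g \<inter> (\<Inter>y\<in>g. \<Inter>k. {x \<in> g. (br x ^^ n) y k = 0})"
    by (auto simp: adnil_def fun_eq_iff)
  moreover have "closed {x \<in> g. (br x ^^ n) y k = 0}" if "y \<in> g" for y k
    by (rule continuous_closed_preimage_constant[OF cont[OF that] closed_g])
  ultimately show ?thesis using closed_g by (simp add: closed_INT closed_Int)
qed

lemma orbit_in_g: "x \<in> g \<Longrightarrow> z \<in> adjoint_orbit g br x \<Longrightarrow> z \<in> g"
  by (rotate_tac, induction rule: adjoint_orbit.induct) auto

lemma exp_ad_closure_orbit:
  assumes x: "x \<in> g" and y: "y \<in> g" and z: "z \<in> closure (adjoint_orbit g br x)"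
  shows "exp_ad br y z \<in> closure (adjoint_orbit g br x)"
proof -
  let ?O = "adjoint_orbit g br x"
  have O: "?O \<subseteq> g" using orbit_in_g[OF x] by blast
  have zg: "z \<in> g" using closure_minimal[OF O closed_g] z by blast
  have "clin I I (expm y) ` closure ?O \<subseteq> closure (clin I I (expm y) ` ?O)"
    using continuous_image_closure_subset[OF continuous_clin subset_UNIV] by blast
  moreover have "clin I I (expm y) ` ?O \<subseteq> ?O"
    using O y by (auto simp: exp_ad_clin[symmetric] subset_iff intro: adjoint_orbit.step)
  ultimately have "clin I I (expm y) z \<in> closure ?O"
    using z closure_mono by blast
  then show ?thesis using exp_ad_clin[OF y zg] by simp
qed

text \<open>Minimality replaces structure theory: \<open>x / c\<close> is again a nonzero nilpotent,
  so \<open>O'\<close> lies in the closure of its orbit, and multiplication by \<open>c\<close>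
  carries that orbit into the orbit of \<open>x\<close>.\<close>

lemma minimal_orbit_cone:
  assumes O: "minimal_nilpotent_orbit g br O'" and z: "z \<in> closure O'" and c: "c \<noteq> 0"
  shows "cscale c z \<in> closure O'"
proof -
  obtain x n where x: "x \<in> g" "x \<noteq> 0" "\<forall>y\<in>g. (br x ^^ n) y = 0" "O' = adjoint_orbit g br x"
    using O unfolding minimal_nilpotent_orbit_def nonzero_nilpotent_orbit_def by blast
  let ?x = "cscale (1 / c) x"
  have "(br ?x ^^ m) y = cscale ((1 / c) ^ m) ((br x ^^ m) y)" if "y \<in> g" for y m
  proof (induction m)
    case (Suc m)
    have "br ?x (cscale ((1 / c) ^ m) ((br x ^^ m) y)) = cscale ((1 / c) ^ m) (br ?x ((br x ^^ m) y))"
      by (rule br_scale2) (use x(1) that in auto)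
    also have "br ?x ((br x ^^ m) y) = cscale (1 / c) (br x ((br x ^^ m) y))"
      by (rule br_scale1) (use x(1) that in auto)
    finally show ?case unfolding funpow.simps o_apply Suc.IH by (simp add: cs.scale_scale mult.commute)
  qed simp
  then have "\<forall>y\<in>g. (br ?x ^^ n) y = 0"
    using x(3) by (auto simp: cscale_def fun_eq_iff)
  moreover have "?x \<in> g" using x(1) by (rule g_scale)
  moreover have "?x \<noteq> 0"
    using x(2) c by (auto simp: cscale_def fun_eq_iff)
  ultimately have "nonzero_nilpotent_orbit g br (adjoint_orbit g br ?x)"
    unfolding nonzero_nilpotent_orbit_def by blast
  then have sub1: "O' \<subseteq> closure (adjoint_orbit g br ?x)"
    using O unfolding minimal_nilpotent_orbit_def by blast
  have "cscale c w \<in> O'" if "w \<in> adjoint_orbit g br ?x" for w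
    using that
  proof (induction rule: adjoint_orbit.induct)
    case base
    have "cscale c ?x = x" using c by (simp add: cscale_def)
    then show ?case using x(4) adjoint_orbit.base by metis
  next
    case (step z y)
    have "z \<in> g" using orbit_in_g[OF \<open>?x \<in> g\<close> step(1)] .
    then have "cscale c (exp_ad br y z) = exp_ad br y (cscale c z)"
      using step(2) by (simp add: exp_ad_scale)
    then show ?case using step x(4) by (metis adjoint_orbit.step)
  qed
  then have "cscale c ` adjoint_orbit g br ?x \<subseteq> O'" by blast
  moreover have cont: "continuous_on S (cscale c)" for S
    by (rule continuous_on_coordinatewise_then_product)
      (auto simp: cscale_def intro!: continuous_intros continuous_coord)
  ultimately have "cscale c ` closure (adjoint_orbit g br ?x) \<subseteq> closure O'"
    using continuous_image_closure_subset[OF cont subset_UNIV] closure_mono by (meson order_trans)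
  moreover have "z \<in> closure (adjoint_orbit g br ?x)"
    using z closure_minimal[OF sub1 closed_closure] by blast
  ultimately show ?thesis by blast
qed

lemma tangent_cone_minimal_orbit:
  assumes O: "minimal_nilpotent_orbit g br O'"
  shows "tangent_cone I (closure O') = closure O'"
proof -
  obtain x where x: "x \<in> g" "O' = adjoint_orbit g br x"
    using O unfolding minimal_nilpotent_orbit_def nonzero_nilpotent_orbit_def by blast
  have "O' \<subseteq> g" using orbit_in_g[OF x(1)] x(2) by blast
  then have C: "closure O' \<subseteq> g" using closure_minimal closed_g by blast
  then have CI: "closure O' \<subseteq> cspace I" using gI by blast
  show ?thesis
  proof (intro equalityI subsetI)
    fix v assume v: "v \<in> tangent_cone I (closure O')"
    have "v \<in> closure (closure O')"
      unfolding closure_cspace_iff[OF fin CI]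
    proof (intro conjI allI impI)
      show "v \<in> cspace I" using v by (simp add: tangent_cone_def)
      fix e :: real assume "e > 0"
      then obtain y t where y: "y \<in> closure O'" "t > 0" "\<forall>i\<in>I. cmod (of_real t * y i - v i) < e"
        using v unfolding tangent_cone_def by blast
      then have "cscale (of_real t) y \<in> closure O'"
        using minimal_orbit_cone[OF O] by simp
      then show "\<exists>s\<in>closure O'. \<forall>i\<in>I. cmod (s i - v i) < e"
        using y(3) by (intro bexI[of _ "cscale (of_real t) y"]) (auto simp: cscale_def)
    qed
    then show "v \<in> closure O'" by simp
  next
    fix v assume v: "v \<in> closure O'"
    show "v \<in> tangent_cone I (closure O')"
    proof (rule tangent_coneI_curve[OF fin, where x = "\<lambda>s. cscale (of_real s) v"])
      show "v \<in> cspace I" using v CI by blast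
      have "cscale (of_real s) v \<in> closure O'" if "s > 0" for s
        using minimal_orbit_cone[OF O v] that by simp
      then show "eventually (\<lambda>s. cscale (of_real s) v \<in> closure O') (at_right 0)"
        using eventually_at_right_less[of "0::real"] by (auto elim: eventually_mono)
      fix i
      have "eventually (\<lambda>s. v i = cscale (of_real s) v i / of_real s) (at_right (0::real))"
        using eventually_at_right_less[of "0::real"] by eventually_elim (simp add: cscale_def)
      then show "((\<lambda>s. cscale (complex_of_real s) v i / complex_of_real s) \<longlongrightarrow> v i) (at_right 0)"
        by (rule Lim_transform_eventually[OF tendsto_const])
    qed
  qed
qed

text \<open>
  The closure of every nonzero nilpotent orbit contains the minimal one, and the adjoint group acts
  by linear automorphisms of the cone over it. So no closed proper subcone that is defined by the
  linear geometry of the cone contains a nonzero point; the tangent cone of \<open>\<Z>(d)\<close> has such a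
  subcone, the locus \<open>a = 0\<close>.
\<close>

theorem calogero_moser_not_minimal_orbit:
  assumes d: "d \<ge> 5" and O: "minimal_nilpotent_orbit g br O'"
  shows "\<not> locally_analytically_isomorphic {..<d + 4} (calogero_moser d) 0 I (closure O') 0"
proof
  assume iso: "locally_analytically_isomorphic {..<d + 4} (calogero_moser d) 0 I (closure O') 0"
  obtain x n where x: "x \<in> g" "adnil n x" "O' = adjoint_orbit g br x"
    using O unfolding minimal_nilpotent_orbit_def nonzero_nilpotent_orbit_def adnil_def by blast
  have "O' \<subseteq> g" using orbit_in_g[OF x(1)] x(3) by blast
  then have C: "closure O' \<subseteq> g" using closure_minimal closed_g by blast
  then have CI: "closure O' \<subseteq> cspace I" using gI by blast
  have "z \<in> {x. adnil n x}" if "z \<in> O'" for z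
    using that unfolding x(3) by (induction rule: adjoint_orbit.induct) (use x adnil_exp_ad in auto)
  then have nil: "adnil n z" if "z \<in> closure O'" for z
    using closure_minimal[OF _ closed_adnil, of O' n] that by blast
  let ?T = "cm_tcone d" and ?C = "closure O'"
  obtain M N where MN: "\<And>v. v \<in> ?T \<Longrightarrow> clin {..<d + 4} I M v \<in> ?C"
    "\<And>v. v \<in> ?T \<Longrightarrow> clin I {..<d + 4} N (clin {..<d + 4} I M v) = v"
    "\<And>v. v \<in> ?C \<Longrightarrow> clin I {..<d + 4} N v \<in> ?T"
    "\<And>v. v \<in> ?C \<Longrightarrow> clin {..<d + 4} I M (clin I {..<d + 4} N v) = v"
    using tangent_cone_iso[OF _ fin _ CI iso]
    unfolding tangent_cone_calogero_moser[OF d] tangent_cone_minimal_orbit[OF O]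
    by (metis (no_types, lifting) calogero_moser_eq finite_lessThan mem_Collect_eq subsetI)
  let ?A = "clin {..<d + 4} I M" and ?B = "clin I {..<d + 4} N"
  \<comment> \<open>The failure of the directions of lines at \<open>s\<close> to form a linear
    space. The definition mentions only the cone and its linear structure, so it is transported by
    \<open>?A\<close>, \<open>?B\<close> and by the adjoint group.\<close>
  define branching where "branching s \<longleftrightarrow> s \<in> ?C \<and> (\<exists>u w. (\<forall>t. s + cscale t u \<in> ?C) \<and>
     (\<forall>t. s + cscale t w \<in> ?C) \<and> s + (u + w) \<notin> ?C)" for s
  define z u w where "z = cm_point d 0 0 1 (\<lambda>_. 0)" and "u = cm_point d 0 0 0 (\<lambda>j. if j = 0 then 1 else 0)"
    and "w = cm_point d 0 1 0 (\<lambda>_. 0)"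
  have zT: "z \<in> ?T" using d by (simp add: z_def tcone_base)
  have lin: "z + cscale t u \<in> ?T" "z + cscale t w \<in> ?T" "z + (u + w) \<notin> ?T" for t
    using tcone_branching[of d] d by (auto simp: z_def u_def w_def)
  have branching_A: "branching (?A z)"
    unfolding branching_def
  proof (intro conjI exI allI)
    show "?A z \<in> ?C" by (rule MN(1)[OF zT])
    show "?A z + cscale t (?A u) \<in> ?C" "?A z + cscale t (?A w) \<in> ?C" for t
      using MN(1)[OF lin(1)] MN(1)[OF lin(2)] by (simp_all add: clin_add clin_cscale)
    \<comment> \<open>The direction \<open>v\<close> need not lie on the cone, where alone
      \<open>?B\<close> is known to invert \<open>?A\<close>; it is a difference of two points of
      the cone, which is enough by linearity.\<close>
    have BA: "?B (?A v) = v" if "\<And>t. z + cscale t v \<in> ?T" for v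
    proof -
      have "?B (?A ((z + cscale 1 v) - z)) = (z + cscale 1 v) - z"
        by (simp only: clin_diff MN(2)[OF that] MN(2)[OF zT])
      then show ?thesis by (simp only: cscale_direction)
    qed
    show "?A z + (?A u + ?A w) \<notin> ?C"
    proof
      assume "?A z + (?A u + ?A w) \<in> ?C"
      then have "?B (?A z + (?A u + ?A w)) \<in> ?T" by (rule MN(3))
      also have "?B (?A z + (?A u + ?A w)) = z + (u + w)"
        using BA[OF lin(1)] BA[OF lin(2)] MN(2)[OF zT] by (simp add: clin_add)
      finally show False using lin(3) by blast
    qed
  qed
  have branching_exp: "branching (exp_ad br y s)" if s: "branching s" and y: "y \<in> g" for s y
  proof -
    obtain u w where uw: "\<And>t. s + cscale t u \<in> ?C" "\<And>t. s + cscale t w \<in> ?C" "s + (u + w) \<notin> ?C" and sC: "s \<in> ?C"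
      using s unfolding branching_def by blast
    have sg: "s \<in> g" using sC C by blast
    have "v \<in> g" if "\<And>t. s + cscale t v \<in> ?C" for v
      using g_diff[of "s + cscale 1 v" s] that[of 1] C sg unfolding cscale_direction by blast
    then have ug: "u \<in> g" "w \<in> g" using uw by blast+
    let ?G = "exp_ad br y"
    have GC: "?G v \<in> ?C" if "v \<in> ?C" for v
      using exp_ad_closure_orbit[OF x(1) y] that unfolding x(3) by blast
    show ?thesis
      unfolding branching_def
    proof (intro conjI exI allI)
      show "?G s \<in> ?C" by (rule GC[OF sC])
      show "?G s + cscale t (?G u) \<in> ?C" "?G s + cscale t (?G w) \<in> ?C" for t
        using GC[OF uw(1), of t] GC[OF uw(2), of t] y sg ug by (simp_all add: exp_ad_add exp_ad_scale)
      show "?G s + (?G u + ?G w) \<notin> ?C"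
      proof
        assume "?G s + (?G u + ?G w) \<in> ?C"
        then have "?G (s + (u + w)) \<in> ?C" using y sg ug by (simp add: exp_ad_add)
        then have "exp_ad br (- y) (?G (s + (u + w))) \<in> ?C"
          using exp_ad_closure_orbit[OF x(1), of "(- y)"] y unfolding x(3) by simp
        then show False using exp_ad_inverse[OF y, of "s + (u + w)"] sg ug uw(3) by simp
      qed
    qed
  qed
  have branch: "branching s" if "s \<in> adjoint_orbit g br (?A z)" for s
    using that
  proof (induction rule: adjoint_orbit.induct)
    case base
    show ?case by (rule branching_A)
  next
    case (step z y)
    show ?case by (rule branching_exp[OF step.IH step.hyps(2)])
  qed
  have vanish: "?B s (j + 3) = 0" if s: "branching s" and j: "j \<le> d" for s j
  proof (rule ccontr)
    assume nz: "?B s (j + 3) \<noteq> 0"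
    obtain u w where uw: "\<And>t. s + cscale t u \<in> ?C" "\<And>t. s + cscale t w \<in> ?C" "s + (u + w) \<notin> ?C" and sC: "s \<in> ?C"
      using s unfolding branching_def by blast
    have lines: "?B s + cscale t (?B v) \<in> ?T" if "\<And>t. s + cscale t v \<in> ?C" for v t
      using MN(3)[OF that[of t]] by (simp add: clin_add clin_cscale)
    have AB: "?A (?B v) = v" if "\<And>t. s + cscale t v \<in> ?C" for v
    proof -
      have "?A (?B ((s + cscale 1 v) - s)) = (s + cscale 1 v) - s"
        by (simp only: clin_diff MN(4)[OF that] MN(4)[OF sC])
      then show ?thesis by (simp only: cscale_direction)
    qed
    have "?B s + cscale 1 (?B u + ?B w) \<in> ?T"
      using d by (intro tcone_lines[OF _ MN(3)[OF sC] j nz] lines uw) auto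
    then have "?A (?B s + cscale 1 (?B u + ?B w)) \<in> ?C" by (rule MN(1))
    also have "?A (?B s + cscale 1 (?B u + ?B w)) = s + (u + w)"
      using AB[OF uw(1)] AB[OF uw(2)] MN(4)[OF sC] by (simp add: clin_add clin_cscale)
    finally show False using uw(3) by blast
  qed
  have AzC: "?A z \<in> ?C" by (rule MN(1)[OF zT])
  have Az0: "?A z \<noteq> 0"
  proof
    assume "?A z = 0"
    then have "z = 0" using MN(2)[OF zT] by simp
    then have "z 2 = 0" by simp
    then show False by (simp add: z_def)
  qed
  have Azg: "?A z \<in> g" "\<forall>y\<in>g. (br (?A z) ^^ n) y = 0"
    using nil[OF AzC] unfolding adnil_def by (rule conjunct1, rule conjunct2)
  \<comment> \<open>The image of \<open>z\<close> lies in the closure of \<open>O'\<close> and is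
    therefore ad-nilpotent. By minimality the closure of its orbit contains \<open>O'\<close>, so
    whatever vanishes on this orbit vanishes on the whole cone.\<close>
  have "nonzero_nilpotent_orbit g br (adjoint_orbit g br (?A z))"
    unfolding nonzero_nilpotent_orbit_def
  proof (rule bexI[OF _ Azg(1)], intro conjI)
    show "\<exists>n. \<forall>y\<in>g. (br (?A z) ^^ n) y = 0" by (rule exI[of _ n]) (rule Azg(2))
  qed (rule Az0, rule refl)
  then have "O' \<subseteq> closure (adjoint_orbit g br (?A z))"
    using O unfolding minimal_nilpotent_orbit_def by blast
  moreover have "closed {s. ?B s 3 = 0}"
    by (rule closed_Collect_eq[OF continuous_on_product_then_coordinatewise[OF continuous_clin] continuous_on_const])
  moreover have "adjoint_orbit g br (?A z) \<subseteq> {s. ?B s 3 = 0}"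
  proof
    fix s assume s: "s \<in> adjoint_orbit g br (?A z)"
    have "?B s (0 + 3) = 0" by (rule vanish[OF branch[OF s]]) simp
    then have "?B s 3 = 0" unfolding add_0 .
    then show "s \<in> {s. ?B s 3 = 0}" unfolding mem_Collect_eq .
  qed
  ultimately have "?C \<subseteq> {s. ?B s 3 = 0}"
    using closure_minimal[of O'] closure_minimal[of "adjoint_orbit g br (?A z)" "{s. ?B s 3 = 0}"] by blast
  \<comment> \<open>As \<open>0 ^ 0 = 1\<close>, this is the point of the tangent cone with
    \<open>a_0 = 1\<close> and all other coordinates zero.\<close>
  moreover define z1 where "z1 = cm_point d 0 0 0 (\<lambda>j. 0 ^ j)"
  have z1T: "z1 \<in> ?T" unfolding z1_def using d by (intro tcone_veronese) auto
  ultimately have "?B (?A z1) 3 = 0" using MN(1)[OF z1T] by blast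
  then have "z1 3 = 0" using MN(2)[OF z1T] by simp
  then show False by (simp add: z1_def cm_point_def)
qed

end

section \<open>Simple connectedness of a union\<close>

text \<open>The part of van Kampen's theorem needed for triviality. Any two paths from
  \<open>b\<close> to the same point, each inside some member of the cover, are homotopic in
  \<open>X\<close>: compare both with a path in the intersection of the two members. Fix such a path
  \<open>g y\<close> to every point \<open>y\<close>; a loop is compared with these along its
  parameter. Only double intersections enter, and \<open>i = j\<close> makes the members themselves
  path-connected.\<close>

lemma simply_connected_cover:
  fixes X :: "'a::real_normed_vector set"
  assumes cover: "X = (\<Union>i\<in>I. U i)"
    and op: "\<And>i. i \<in> I \<Longrightarrow> openin (top_of_set X) (U i)"
    and base: "\<And>i. i \<in> I \<Longrightarrow> b \<in> U i"
    and conn: "\<And>i j. i \<in> I \<Longrightarrow> j \<in> I \<Longrightarrow> path_connected (U i \<inter> U j)"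
    and null: "\<And>i p. i \<in> I \<Longrightarrow> path p \<Longrightarrow> path_image p \<subseteq> U i \<Longrightarrow> pathfinish p = pathstart p \<Longrightarrow>
                 \<exists>a. homotopic_loops X p (linepath a a)"
  shows "simply_connected X"
proof -
  have sub: "U i \<subseteq> X" if "i \<in> I" for i
    using cover that by auto
  have pc: "path_connected (U i)" if "i \<in> I" for i
    using conn[OF that that] by simp
  have ex_path: "\<exists>g. path g \<and> path_image g \<subseteq> U i \<and> pathstart g = b \<and> pathfinish g = y"
    if "i \<in> I" "y \<in> U i" for i y
    using pc[OF that(1)] base[OF that(1)] that(2) unfolding path_connected_def by blast
  have loop: "homotopic_paths X g h"
    if gh: "i \<in> I" "path g" "path h" "path_image g \<subseteq> U i" "path_image h \<subseteq> U i"
      "pathstart g = pathstart h" "pathfinish g = pathfinish h" for i g h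
  proof -
    have "path_image (g +++ reversepath h) \<subseteq> U i"
      using gh by (simp add: path_image_join)
    then obtain a where "homotopic_loops X (g +++ reversepath h) (linepath a a)"
      using null[OF gh(1), of "g +++ reversepath h"] gh by auto
    then show ?thesis
      using homotopic_paths_loop_parts gh(3) by blast
  qed
  have uniq: "homotopic_paths X g h"
    if gh: "i \<in> I" "j \<in> I" "path g" "path h" "path_image g \<subseteq> U i" "path_image h \<subseteq> U j"
      "pathstart g = b" "pathstart h = b" "pathfinish g = y" "pathfinish h = y" for i j g h y
  proof -
    have "y \<in> U i \<inter> U j"
      using gh by (metis IntI pathfinish_in_path_image subsetD)
    moreover have "b \<in> U i \<inter> U j"
      using base gh by auto
    ultimately obtain k where k: "path k" "path_image k \<subseteq> U i \<inter> U j" "pathstart k = b" "pathfinish k = y"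
      using conn[OF gh(1,2)] unfolding path_connected_def by blast
    have "homotopic_paths X g k"
      using loop[OF gh(1), of g k] k gh by auto
    moreover have "homotopic_paths X k h"
      using loop[OF gh(2), of k h] k gh by auto
    ultimately show ?thesis
      by (rule homotopic_paths_trans)
  qed
  have "\<exists>g. \<forall>y\<in>X. \<exists>i\<in>I. path (g y) \<and> path_image (g y) \<subseteq> U i \<and> pathstart (g y) = b \<and> pathfinish (g y) = y"
    using ex_path cover by (intro bchoice) blast
  then obtain g where g: "\<And>y. y \<in> X \<Longrightarrow> \<exists>i\<in>I. path (g y) \<and> path_image (g y) \<subseteq> U i \<and> pathstart (g y) = b \<and> pathfinish (g y) = y"
    by blast
  have gp: "path (g y)" "path_image (g y) \<subseteq> X" "pathstart (g y) = b" "pathfinish (g y) = y" if "y \<in> X" for y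
    using g[OF that] sub by blast+
  have g_uniq: "homotopic_paths X h (g y)"
    if "i \<in> I" "path h" "path_image h \<subseteq> U i" "pathstart h = b" "pathfinish h = y" "y \<in> X" for i h y
    using g[OF that(6)] uniq[OF that(1) _ that(2) _ that(3) _ that(4) _ that(5)] by blast
  have main: "homotopic_paths X p (linepath (pathstart p) (pathstart p))"
    if p: "path p" "path_image p \<subseteq> X" "pathfinish p = pathstart p" for p
  proof -
    \<comment> \<open>The segment of \<open>p\<close> from \<open>s\<close> to \<open>t\<close> acts
      on the chosen paths as expected. This is an equivalence relation that holds locally, so
      connectedness of the unit interval replaces a subdivision by Lebesgue numbers.\<close>
    define R where "R s t \<longleftrightarrow> homotopic_paths X (g (p s) +++ subpath s t p) (g (p t))" for s t
    have pX: "p s \<in> X" if "s \<in> {0..1}" for s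
      using p(2) that by (auto simp: path_image_def)
    have sp: "path (subpath s t p)" "path_image (subpath s t p) \<subseteq> X" if "s \<in> {0..1}" "t \<in> {0..1}" for s t
      using p that path_image_subpath_subset[of s t p] by (auto intro: path_subpath)
    have subp_join: "homotopic_paths X (subpath s t p +++ subpath t u p) (subpath s u p)"
      if "s \<in> {0..1}" "t \<in> {0..1}" "u \<in> {0..1}" for s t u
      using homotopic_join_subpaths[OF p(1,2) that] .
    have Rtrans: "R s u" if "R s t" "R t u" "s \<in> {0..1}" "t \<in> {0..1}" "u \<in> {0..1}" for s t u
    proof -
      have "homotopic_paths X (g (p s) +++ subpath s u p) (g (p s) +++ (subpath s t p +++ subpath t u p))"
        using subp_join[OF that(3-5)] gp[OF pX[OF that(3)]]
        by (intro homotopic_paths_join) (auto simp: homotopic_paths_sym)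
      also have "homotopic_paths X \<dots> ((g (p s) +++ subpath s t p) +++ subpath t u p)"
        using gp[OF pX[OF that(3)]] sp that by (intro homotopic_paths_assoc) auto
      also have "homotopic_paths X \<dots> (g (p t) +++ subpath t u p)"
        using that(1) sp that by (intro homotopic_paths_join) (auto simp: R_def)
      also have "homotopic_paths X \<dots> (g (p u))"
        using that(2) by (simp add: R_def)
      finally show ?thesis by (simp add: R_def)
    qed
    have Rrefl: "R s s" if "s \<in> {0..1}" for s
      using gp[OF pX[OF that]] homotopic_paths_rid'[of "g (p s)" X "p s"] by (simp add: R_def subpath_refl)
    have Rsym: "R t s" if "R s t" "s \<in> {0..1}" "t \<in> {0..1}" for s t
    proof -
      have "homotopic_paths X (g (p t) +++ subpath t s p) ((g (p s) +++ subpath s t p) +++ subpath t s p)"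
        using that sp by (intro homotopic_paths_join) (auto simp: R_def homotopic_paths_sym dest: homotopic_paths_imp_pathfinish gp)
      also have "homotopic_paths X \<dots> (g (p s) +++ (subpath s t p +++ subpath t s p))"
        using gp[OF pX[OF that(2)]] sp that by (intro homotopic_paths_sym[OF homotopic_paths_assoc]) auto
      also have "homotopic_paths X \<dots> (g (p s) +++ subpath s s p)"
        using subp_join[of s t s] gp[OF pX[OF that(2)]] that by (intro homotopic_paths_join) auto
      also have "homotopic_paths X \<dots> (g (p s))"
        using Rrefl[OF that(2)] by (simp add: R_def)
      finally show ?thesis by (simp add: R_def)
    qed
    have Rloc: "\<exists>T. openin (top_of_set {0..1}) T \<and> s \<in> T \<and> (\<forall>t\<in>T. R s t)" if s: "s \<in> {0..1}" for s
    proof -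
      obtain i where i: "i \<in> I" "p s \<in> U i"
        using pX[OF s] cover by auto
      have "openin (top_of_set {0..1}) ({0..1} \<inter> p -` U i)"
        using p op[OF i(1)] by (intro continuous_openin_preimage[of _ _ X]) (auto simp: path_def path_image_def)
      then obtain e where e: "e > 0" "ball s e \<inter> {0..1} \<subseteq> {0..1} \<inter> p -` U i"
        using i s unfolding openin_contains_ball by blast
      define T where "T = {0..1} \<inter> ball s e"
      have "R s t" if t: "t \<in> T" for t
      proof -
        have t01: "t \<in> {0..1}" using t by (simp add: T_def)
        have "path_image (subpath s t p) \<subseteq> U i"
        proof
          fix y assume "y \<in> path_image (subpath s t p)"
          then obtain r where r: "r \<in> closed_segment s t" "y = p r"
            using path_image_subpath_gen[of s t p] by auto
          have "r \<in> T"
            using r(1) s t closed_segment_subset[of s T t] e(1) unfolding T_def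
            by (meson IntI centre_in_ball convex_Int convex_ball convex_real_interval(5) subsetD)
          then show "y \<in> U i"
            using e r by (auto simp: T_def)
        qed
        moreover obtain h where h: "path h" "path_image h \<subseteq> U i" "pathstart h = b" "pathfinish h = p s"
          using ex_path[OF i] by blast
        ultimately have "homotopic_paths X (h +++ subpath s t p) (g (p t))"
          using sp[OF s t01] pX[OF t01] i by (intro g_uniq[of i]) (auto simp: path_image_join)
        moreover have "homotopic_paths X (g (p s) +++ subpath s t p) (h +++ subpath s t p)"
          using g_uniq[OF i(1) h pX[OF s]] sp[OF s t01] gp[OF pX[OF s]]
          by (intro homotopic_paths_join) (auto simp: homotopic_paths_sym)
        ultimately show ?thesis
          unfolding R_def by (blast intro: homotopic_paths_trans)
      qed
      then show ?thesis
        using s e(1) by (intro exI[of _ T]) (auto simp: T_def)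
    qed
    have "R 0 1"
      by (rule connected_equivalence_relation[of "{0..1::real}" 0 1 R])
         (auto intro: Rsym Rtrans Rloc)
    then have 1: "homotopic_paths X (g (p 0) +++ p) (g (p 0))"
      using p(3) by (simp add: R_def pathstart_def pathfinish_def)
    let ?g = "g (p 0)"
    have gg: "path ?g" "path_image ?g \<subseteq> X" "pathstart ?g = b" "pathfinish ?g = p 0"
      using gp[of "p 0"] pX[of 0] by auto
    have p0: "pathstart p = p 0" by (simp add: pathstart_def)
    have "homotopic_paths X p (linepath (p 0) (p 0) +++ p)"
      using p p0 by (intro homotopic_paths_sym[OF homotopic_paths_lid']) auto
    also have "homotopic_paths X \<dots> ((reversepath ?g +++ ?g) +++ p)"
      using homotopic_paths_linv[OF gg(1,2)] p p0 gg
      by (intro homotopic_paths_join) (auto simp: homotopic_paths_sym)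
    also have "homotopic_paths X \<dots> (reversepath ?g +++ (?g +++ p))"
      using p p0 gg by (intro homotopic_paths_sym[OF homotopic_paths_assoc]) auto
    also have "homotopic_paths X \<dots> (reversepath ?g +++ ?g)"
      using 1 gg p0 by (intro homotopic_paths_join) auto
    also have "homotopic_paths X \<dots> (linepath (p 0) (p 0))"
      using homotopic_paths_linv[OF gg(1,2)] gg by simp
    finally show ?thesis using p0 by simp
  qed
  have "path_connected X"
  proof (cases "I = {}")
    case False
    have "path_component X b y" if "y \<in> X" for y
      using gp[OF that] unfolding path_component_def by blast
    then show ?thesis
      unfolding path_connected_component by (meson path_component_sym path_component_trans)
  qed (use cover in auto)
  then show ?thesis
    using main by (simp add: simply_connected_eq_contractible_path)
qed

section \<open>The unipotent action and the chart\<close>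

text \<open>On the vector with entries \<open>x^(d-j) y^j\<close> this gives
  \<open>(x + c y)^(d-j) y^j\<close>: it is the substitution \<open>x \<mapsto> x + c y\<close> on
  the span of the rational normal curve.\<close>

definition avec :: "nat \<Rightarrow> (nat \<Rightarrow> complex) \<Rightarrow> complex \<Rightarrow> nat \<Rightarrow> complex" where
  "avec d a c j = (\<Sum>i\<le>d - j. of_nat ((d - j) choose i) * c ^ i * a (j + i))"

lemma avec_0 [simp]: "avec d a 0 j = a j"
proof -
  have "avec d a 0 j = (\<Sum>i\<le>d - j. if i = 0 then a j else 0)"
    unfolding avec_def by (intro sum.cong) auto
  then show ?thesis by simp
qed

lemma avec_deriv:
  assumes "j < d"
  shows "((\<lambda>c. avec d a c j) has_field_derivative of_nat (d - j) * avec d a c (Suc j)) (at c)"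
proof -
  obtain m where m: "d - j = Suc m" "d - Suc j = m"
    using assms by (metis Suc_diff_Suc)
  have "((\<lambda>c. avec d a c j) has_field_derivative
      (\<Sum>i\<le>Suc m. of_nat (Suc m choose i) * (of_nat i * c ^ (i - 1)) * a (j + i))) (at c)"
    unfolding avec_def m by (rule DERIV_sum) (auto intro!: derivative_eq_intros)
  also have "(\<Sum>i\<le>Suc m. of_nat (Suc m choose i) * (of_nat i * c ^ (i - 1)) * a (j + i)) =
      (\<Sum>i\<le>m. of_nat (Suc m choose Suc i) * (of_nat (Suc i) * c ^ i) * a (j + Suc i))"
    by (subst sum.atMost_Suc_shift) simp
  also have "\<dots> = (\<Sum>i\<le>m. of_nat (Suc m) * (of_nat (m choose i) * c ^ i * a (Suc j + i)))"
  proof (rule sum.cong[OF refl])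
    fix i
    have "(of_nat (Suc i) * of_nat (Suc m choose Suc i) :: complex) = of_nat (Suc m) * of_nat (m choose i)"
      unfolding of_nat_mult[symmetric] by (simp only: Suc_times_binomial)
    moreover have "j + Suc i = Suc j + i" by simp
    ultimately show "of_nat (Suc m choose Suc i) * (of_nat (Suc i) * c ^ i) * a (j + Suc i) =
        of_nat (Suc m) * (of_nat (m choose i) * c ^ i * a (Suc j + i))"
      by (metis (no_types, lifting) mult.assoc mult.commute)
  qed
  also have "\<dots> = of_nat (d - j) * avec d a c (Suc j)"
    unfolding avec_def m by (simp only: sum_distrib_left)
  finally show ?thesis .
qed

lemma avec_last: "avec d a c d = a d"
  by (simp add: avec_def)

lemma constant_if_deriv_zero:
  fixes f :: "complex \<Rightarrow> complex"
  assumes "\<And>c. (f has_field_derivative 0) (at c)"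
  shows "f c = f 0"
proof -
  obtain k where "\<forall>x\<in>UNIV. f x = k"
    using has_field_derivative_zero_constant[of UNIV f] assms by auto
  then show ?thesis by simp
qed

text \<open>The system is triangular: descending from \<open>X d = 0\<close>, each
  \<open>X j\<close> has derivative zero and starts at zero.\<close>

lemma nilpotent_flow_unique:
  fixes X :: "nat \<Rightarrow> complex \<Rightarrow> complex"
  assumes X: "\<And>j c. j < d \<Longrightarrow> (X j has_field_derivative of_nat (d - j) * X (Suc j) c) (at c)"
    and Xd: "\<And>c. X d c = 0" and X0: "\<And>j. j \<le> d \<Longrightarrow> X j 0 = 0" and j: "j \<le> d"
  shows "X j c = 0"
  using j
proof (induction j arbitrary: c rule: inc_induct)
  case base
  then show ?case by (rule Xd)
next
  case (step j)
  have "(X j has_field_derivative 0) (at c)" for c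
    using X[of j c] step by simp
  then have "X j c = X j 0" by (rule constant_if_deriv_zero)
  then show ?case using X0[of j] step.hyps by simp
qed

text \<open>Both sides, as functions of \<open>t\<close>, follow the flow with generator
  \<open>a_j \<mapsto> (d - j) a_(j+1)\<close> and agree at \<open>t = 0\<close>. The group law
  supplies the inverse of every substitution.\<close>

lemma avec_add:
  assumes "j \<le> d"
  shows "avec d (avec d a c) t j = avec d a (c + t) j"
proof -
  define X where "X j t = avec d (avec d a c) t j - avec d a (c + t) j" for j t
  have "X j t = 0"
  proof (rule nilpotent_flow_unique[of d X, OF _ _ _ assms])
    fix j t assume j: "j < d"
    have "((\<lambda>t. avec d a (c + t) j) has_field_derivative of_nat (d - j) * avec d a (c + t) (Suc j) * 1) (at t)"
      by (rule DERIV_chain'[OF _ avec_deriv[OF j]]) (auto intro!: derivative_eq_intros)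
    then have "((\<lambda>t. avec d (avec d a c) t j - avec d a (c + t) j) has_field_derivative
        of_nat (d - j) * avec d (avec d a c) t (Suc j) - of_nat (d - j) * avec d a (c + t) (Suc j) * 1) (at t)"
      using avec_deriv[OF j] by (intro DERIV_diff)
    then show "(X j has_field_derivative of_nat (d - j) * X (Suc j) t) (at t)"
      unfolding X_def[abs_def] by (simp add: right_diff_distrib)
  qed (simp_all add: X_def avec_last)
  then show ?thesis by (simp add: X_def)
qed

text \<open>In terms of the roots \<open>s, t\<close> with \<open>e = s + t\<close> and
  \<open>q Q = s t\<close>, the flow moves both with speed \<open>Q\<close>, and the sum of the two
  partial derivatives takes the complete homogeneous polynomial of degree \<open>k\<close> to
  \<open>k + 1\<close> times the one of degree \<open>k - 1\<close>.\<close>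

lemma Psi_deriv:
  assumes q: "\<And>c. (q has_field_derivative e c) (at c)" and e: "\<And>c. (e has_field_derivative 2 * Q) (at c)"
  shows "((\<lambda>c. Psi k (q c) Q (e c)) has_field_derivative
     (if k = 0 then 0 else of_nat (k + 1) * Q * Psi (k - 1) (q c) Q (e c))) (at c)"
proof (induction k rule: less_induct)
  case (less k)
  consider "k = 0" | "k = 1" | m where "k = Suc (Suc m)"
    by (metis One_nat_def not0_implies_Suc)
  then show ?case
  proof cases
    case 3
    have IH1: "((\<lambda>c. Psi (Suc m) (q c) Q (e c)) has_field_derivative of_nat (m + 2) * Q * Psi m (q c) Q (e c)) (at c)"
      using less.IH[of "Suc m"] 3 by (simp add: algebra_simps)
    have IH0: "((\<lambda>c. Psi m (q c) Q (e c)) has_field_derivative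
       (if m = 0 then 0 else of_nat (m + 1) * Q * Psi (m - 1) (q c) Q (e c))) (at c)"
      using less.IH[of m] 3 by simp
    have "((\<lambda>c. e c * Psi (Suc m) (q c) Q (e c) - q c * Q * Psi m (q c) Q (e c)) has_field_derivative
       (2 * Q * Psi (Suc m) (q c) Q (e c) + of_nat (m + 2) * Q * Psi m (q c) Q (e c) * e c) -
       (e c * Q * Psi m (q c) Q (e c) + (if m = 0 then 0 else of_nat (m + 1) * Q * Psi (m - 1) (q c) Q (e c)) * (q c * Q))) (at c)"
      by (intro DERIV_diff DERIV_mult IH1 IH0 e DERIV_cmult_right q)
    moreover have "(2 * Q * Psi (Suc m) (q c) Q (e c) + of_nat (m + 2) * Q * Psi m (q c) Q (e c) * e c) -
       (e c * Q * Psi m (q c) Q (e c) + (if m = 0 then 0 else of_nat (m + 1) * Q * Psi (m - 1) (q c) Q (e c)) * (q c * Q)) =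
       of_nat (k + 1) * Q * Psi (k - 1) (q c) Q (e c)"
    proof (cases m)
      case 0
      then show ?thesis using 3 by (simp add: algebra_simps)
    next
      case (Suc n)
      then show ?thesis using 3 by (simp add: algebra_simps)
    qed
    ultimately show ?thesis using 3 by simp
  qed (use e in \<open>auto intro!: derivative_eq_intros\<close>)
qed

text \<open>
  The unipotent group of substitutions \<open>(x, y) \<mapsto> (x + c y, y)\<close> acts on the pairs of binary forms
  \<open>(q, Q, e)\<close> and \<open>a\<close>. The defining equations are permuted by its infinitesimal generator.
\<close>

lemma cm_eqs_action:
  assumes d: "d \<ge> 2" and eqs: "cm_eqs d \<kappa> q Q e a"
  shows "cm_eqs d \<kappa> (q + c * e + c\<^sup>2 * Q) Q (e + 2 * c * Q) (avec d a c)"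
proof -
  define qc where "qc c = q + c * e + c\<^sup>2 * Q" for c
  define ec where "ec c = e + 2 * c * Q" for c
  define A where "A j c = avec d a c j" for j c
  have A': "(A j has_field_derivative of_nat (d - j) * A (Suc j) c) (at c)" if "j \<le> d" for j c
  proof (cases "j < d")
    case True
    then show ?thesis using avec_deriv unfolding A_def[abs_def] by blast
  next
    case False
    then show ?thesis using that by (simp add: A_def[abs_def] avec_last)
  qed
  have qc': "(qc has_field_derivative ec c) (at c)" for c
    unfolding qc_def[abs_def] ec_def by (auto intro!: derivative_eq_intros)
  have ec': "(ec has_field_derivative 2 * Q) (at c)" for c
    unfolding ec_def[abs_def] by (auto intro!: derivative_eq_intros)
  \<comment> \<open>The derivative of the linear equation of index \<open>j\<close> is
    \<open>d - j - 1\<close> times the one of index \<open>j + 1\<close>; hence the descending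
    induction, which starts at \<open>d - 1\<close> with derivative zero.\<close>
  have E: "ec c * A j c - qc c * A (Suc j) c - Q * A (j - 1) c = 0" if "j \<le> d - 1" "1 \<le> j" for j c
    using that
  proof (induction j arbitrary: c rule: inc_induct)
    case base
    define f where "f c = ec c * A (d - 1) c - qc c * A (Suc (d - 1)) c - Q * A (d - 1 - 1) c" for c
    have "(f has_field_derivative 0) (at c)" for c
    proof -
      have "(f has_field_derivative (2 * Q * A (d - 1) c + of_nat (d - (d - 1)) * A (Suc (d - 1)) c * ec c) -
         (ec c * A (Suc (d - 1)) c + of_nat (d - Suc (d - 1)) * A (Suc (Suc (d - 1))) c * qc c) -
         Q * (of_nat (d - (d - 1 - 1)) * A (Suc (d - 1 - 1)) c)) (at c)"
        unfolding f_def[abs_def] using d by (intro DERIV_diff DERIV_mult DERIV_cmult A' qc' ec') auto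
      moreover have "d - (d - 1) = 1" "d - Suc (d - 1) = 0" "d - (d - 1 - 1) = 2" "Suc (d - 1 - 1) = d - 1"
        using d by auto
      ultimately show ?thesis by (simp add: algebra_simps)
    qed
    then have "f c = f 0" by (rule constant_if_deriv_zero)
    moreover have "f 0 = 0"
      using cm_eqsD(1)[OF eqs, of "d - 1"] d by (simp add: f_def qc_def ec_def A_def)
    ultimately show ?case by (simp add: f_def)
  next
    case (step j)
    define f where "f c = ec c * A j c - qc c * A (Suc j) c - Q * A (j - 1) c" for c
    have "(f has_field_derivative 0) (at c)" for c
    proof -
      have "(f has_field_derivative (2 * Q * A j c + of_nat (d - j) * A (Suc j) c * ec c) -
         (ec c * A (Suc j) c + of_nat (d - Suc j) * A (Suc (Suc j)) c * qc c) -
         Q * (of_nat (d - (j - 1)) * A (Suc (j - 1)) c)) (at c)"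
        unfolding f_def[abs_def] using step by (intro DERIV_diff DERIV_mult DERIV_cmult A' qc' ec') auto
      moreover have "Suc (j - 1) = j" using step by simp
      moreover have "(of_nat (d - j) :: complex) = of_nat (d - Suc j) + 1" "(of_nat (d - (j - 1)) :: complex) = of_nat (d - Suc j) + 2"
      proof -
        have "d - j = (d - Suc j) + 1" "d - (j - 1) = (d - Suc j) + 2" using step by auto
        then show "(of_nat (d - j) :: complex) = of_nat (d - Suc j) + 1" "(of_nat (d - (j - 1)) :: complex) = of_nat (d - Suc j) + 2"
          by (metis of_nat_add of_nat_1, metis of_nat_add of_nat_numeral)
      qed
      moreover have "ec c * A (Suc j) c - qc c * A (Suc (Suc j)) c - Q * A j c = 0"
        using step.IH[of c] by simp
      then have "of_nat (d - Suc j) * (ec c * A (Suc j) c - qc c * A (Suc (Suc j)) c - Q * A j c) = 0"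
        by simp
      ultimately show ?thesis by (simp add: algebra_simps)
    qed
    then have "f c = f 0" by (rule constant_if_deriv_zero)
    moreover have "f 0 = 0"
      using cm_eqsD(1)[OF eqs, of j] step by (simp add: f_def qc_def ec_def A_def)
    ultimately show ?case by (simp add: f_def)
  qed
  define F where "F i m n c = A i c * A (i + m + 2) c - A (i + 1) c * A (i + m + 1) c -
     \<kappa> * qc c ^ n * Q ^ i * Psi m (qc c) Q (ec c)" for i m n c
  \<comment> \<open>Here \<open>i = j - 1\<close>, \<open>m = k - j\<close> and
    \<open>n = d - k - 1\<close>. The derivative involves the equations
    \<open>(i, m + 1, n - 1)\<close> and \<open>(i + 1, m - 1, n)\<close>, and
    \<open>m + 2 n\<close> drops by one in both.\<close>
  have F: "F i m n c = 0" if "i + m + n + 2 = d" for i m n c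
    using that
  proof (induction "m + 2 * n" arbitrary: i m n c rule: less_induct)
    case less
    define X where "X c = A (i + 1) c * A (i + m + 2) c" for c
    have deriv: "(F i m n has_field_derivative
       (of_nat (n + m + 2) * A (i + 1) c * A (i + m + 2) c + of_nat n * A (i + m + 3) c * A i c) -
       (of_nat (n + m + 1) * A (i + 2) c * A (i + m + 1) c + of_nat (n + 1) * A (i + m + 2) c * A (i + 1) c) -
       ((\<kappa> * (of_nat n * (ec c * qc c ^ (n - 1))) * Q ^ i) * Psi m (qc c) Q (ec c) +
        (if m = 0 then 0 else of_nat (m + 1) * Q * Psi (m - 1) (qc c) Q (ec c)) * (\<kappa> * qc c ^ n * Q ^ i))) (at c)" for c
    proof -
      have 1: "(A i has_field_derivative of_nat (n + m + 2) * A (i + 1) c) (at c)"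
        "(A (i + m + 2) has_field_derivative of_nat n * A (i + m + 3) c) (at c)"
        "(A (i + 1) has_field_derivative of_nat (n + m + 1) * A (i + 2) c) (at c)"
        "(A (i + m + 1) has_field_derivative of_nat (n + 1) * A (i + m + 2) c) (at c)"
      proof -
        have e: "d - i = n + m + 2" "d - (i + m + 2) = n" "d - (i + 1) = n + m + 1" "d - (i + m + 1) = n + 1"
          "Suc i = i + 1" "Suc (i + m + 2) = i + m + 3" "Suc (i + 1) = i + 2" "Suc (i + m + 1) = i + m + 2"
          "i \<le> d" "i + m + 2 \<le> d" "i + 1 \<le> d" "i + m + 1 \<le> d"
          using less.prems by auto
        show "(A i has_field_derivative of_nat (n + m + 2) * A (i + 1) c) (at c)"
          using A'[OF e(9), of c] unfolding e(1,5) .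
        show "(A (i + m + 2) has_field_derivative of_nat n * A (i + m + 3) c) (at c)"
          using A'[OF e(10), of c] unfolding e(2,6) .
        show "(A (i + 1) has_field_derivative of_nat (n + m + 1) * A (i + 2) c) (at c)"
          using A'[OF e(11), of c] unfolding e(3,7) .
        show "(A (i + m + 1) has_field_derivative of_nat (n + 1) * A (i + m + 2) c) (at c)"
          using A'[OF e(12), of c] unfolding e(4,8) .
      qed
      have 2: "((\<lambda>c. qc c ^ n) has_field_derivative of_nat n * (ec c * qc c ^ (n - 1))) (at c)"
        using DERIV_power[OF qc', of n] by simp
      show ?thesis
        unfolding F_def[abs_def]
        by (intro DERIV_diff DERIV_mult DERIV_cmult DERIV_cmult_right 1 2 Psi_deriv[OF qc' ec'])
    qed
    have IHn: "of_nat n * (A i c * A (i + m + 3) c) = of_nat n * (X c + \<kappa> * qc c ^ (n - 1) * Q ^ i * Psi (Suc m) (qc c) Q (ec c))" for c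
    proof (cases n)
      case (Suc n')
      then have "F i (Suc m) n' c = 0" by (intro less.hyps) (use less.prems in auto)
      then have "A i c * A (i + m + 3) c = X c + \<kappa> * qc c ^ (n - 1) * Q ^ i * Psi (Suc m) (qc c) Q (ec c)"
        using Suc by (simp add: F_def X_def eval_nat_numeral algebra_simps)
      then show ?thesis by simp
    qed simp
    have IHm: "A (i + 2) c * A (i + m + 1) c = X c - (if m = 0 then 0 else \<kappa> * qc c ^ n * Q ^ (i + 1) * Psi (m - 1) (qc c) Q (ec c))" for c
    proof (cases m)
      case (Suc m')
      then have "F (i + 1) m' n c = 0" by (intro less.hyps) (use less.prems in auto)
      then show ?thesis
        using Suc by (simp add: F_def X_def eval_nat_numeral algebra_simps)
    qed (simp add: X_def mult.commute)
    have "(F i m n has_field_derivative 0) (at c)" for c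
    proof -
      have n0: "of_nat n * (\<kappa> * qc c ^ (n - 1) * Q ^ i * (qc c * Q * P)) = of_nat n * (\<kappa> * qc c ^ n * Q ^ (i + 1) * P)" for P
        by (cases n) (auto simp: algebra_simps)
      have "(of_nat (n + m + 2) * A (i + 1) c * A (i + m + 2) c + of_nat n * A (i + m + 3) c * A i c) -
       (of_nat (n + m + 1) * A (i + 2) c * A (i + m + 1) c + of_nat (n + 1) * A (i + m + 2) c * A (i + 1) c) -
       ((\<kappa> * (of_nat n * (ec c * qc c ^ (n - 1))) * Q ^ i) * Psi m (qc c) Q (ec c) +
        (if m = 0 then 0 else of_nat (m + 1) * Q * Psi (m - 1) (qc c) Q (ec c)) * (\<kappa> * qc c ^ n * Q ^ i)) =
       (of_nat (n + m + 2) * X c + of_nat n * (A i c * A (i + m + 3) c)) -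
       (of_nat (n + m + 1) * (A (i + 2) c * A (i + m + 1) c) + of_nat (n + 1) * X c) -
       (of_nat n * (\<kappa> * qc c ^ (n - 1) * Q ^ i * (ec c * Psi m (qc c) Q (ec c))) +
        (if m = 0 then 0 else of_nat (m + 1) * (\<kappa> * qc c ^ n * Q ^ (i + 1) * Psi (m - 1) (qc c) Q (ec c))))"
        by (simp add: X_def algebra_simps)
      also have "\<dots> = 0"
      proof (cases m)
        case 0
        then show ?thesis unfolding IHn IHm by (simp add: algebra_simps)
      next
        case (Suc m')
        show ?thesis
          using n0[of "Psi m' (qc c) Q (ec c)"] unfolding IHn IHm unfolding Suc by (auto simp: algebra_simps)
      qed
      finally show ?thesis using deriv[of c] by simp
    qed
    then have "F i m n c = F i m n 0" by (rule constant_if_deriv_zero)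
    moreover have "F i m n 0 = 0"
    proof -
      have "1 \<le> i + 1" "i + 1 \<le> i + m + 1" "i + m + 1 \<le> d - 1" "d - (i + m + 1) - 1 = n" "i + m + 1 + 1 = i + m + 2"
        "i + m + 1 - (i + 1) = m" using less.prems by auto
      then show ?thesis
        using cm_eqsD(2)[OF eqs, of "i + 1" "i + m + 1"] by (simp add: F_def qc_def ec_def A_def)
    qed
    ultimately show ?case by simp
  qed
  have "cm_eqs d \<kappa> (qc c) Q (ec c) (\<lambda>j. A j c)"
  proof (rule cm_eqsI)
    fix j assume "1 \<le> j" "j \<le> d - 1"
    then show "ec c * A j c = qc c * A (j + 1) c + Q * A (j - 1) c"
      using E[of j c] by (simp add: algebra_simps)
  next
    fix j k assume jk: "1 \<le> j" "j \<le> k" "k \<le> d - 1"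
    have "F (j - 1) (k - j) (d - k - 1) c = 0" using jk d by (intro F) auto
    moreover have "j - 1 + (k - j) + 2 = k + 1" "j - 1 + 1 = j" "j - 1 + (k - j) + 1 = k"
      using jk by auto
    ultimately show "A (j - 1) c * A (k + 1) c - A j c * A k c =
       \<kappa> * qc c ^ (d - k - 1) * Q ^ (j - 1) * Psi (k - j) (qc c) Q (ec c)"
      unfolding F_def by simp
  qed
  then show ?thesis by (simp add: qc_def ec_def A_def)
qed

text \<open>Where \<open>a\<^sub>0 \<noteq> 0\<close>, the equations with \<open>j = 1\<close> imply the others.\<close>

lemma recurrence_Psi:
  assumes E: "\<And>j. 1 \<le> j \<Longrightarrow> j < n \<Longrightarrow> e * a j = q * a (j + 1) + Q * a (j - 1)"
    and "Suc i + m < n"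
  shows "a (Suc i) * Psi (Suc i + m) q Q e - q ^ Suc m * Psi i q Q e * a (Suc i + Suc m) = a 0 * Q ^ Suc i * Psi m q Q e"
  using assms(2)
proof (induction m rule: less_induct)
  case (less m)
  \<comment> \<open>The numbers \<open>q^j a_j\<close> satisfy the recursion of \<open>Psi\<close>,
    so this is a Casorati determinant with powers of \<open>q\<close> removed; raising
    \<open>i\<close> multiplies it by \<open>Q\<close>. For growing \<open>m\<close> both sides of
    the claim follow the recursion of \<open>Psi\<close>.\<close>
  have base: "a (Suc i) * Psi (Suc i) q Q e - q * Psi i q Q e * a (Suc (Suc i)) = a 0 * Q ^ Suc i" if "Suc i < n" for i
    using that
  proof (induction i)
    case 0
    then show ?case using E[of 1] by (simp add: algebra_simps numeral_2_eq_2)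
  next
    case (Suc i)
    define R where "R = Q ^ Suc i"
    have "e * a (Suc (Suc i)) = q * a (Suc (Suc (Suc i))) + Q * a (Suc i)"
      using E[of "Suc (Suc i)"] Suc.prems by simp
    moreover have "a (Suc i) * Psi (Suc i) q Q e - q * Psi i q Q e * a (Suc (Suc i)) = a 0 * R"
      using Suc by (simp add: R_def)
    moreover have "Psi (Suc (Suc i)) q Q e = e * Psi (Suc i) q Q e - q * Q * Psi i q Q e"
      by simp
    ultimately have "a (Suc (Suc i)) * Psi (Suc (Suc i)) q Q e -
        q * Psi (Suc i) q Q e * a (Suc (Suc (Suc i))) = a 0 * (Q * R)"
      by algebra
    then show ?case unfolding R_def by simp
  qed
  consider "m = 0" | "m = 1" | l where "m = Suc (Suc l)"
    by (metis One_nat_def not0_implies_Suc)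
  then show ?case
  proof cases
    case 1
    then show ?thesis using base[of i] less.prems by simp
  next
    case 2
    define R where "R = Q ^ Suc i"
    have "e * a (Suc (Suc i)) = q * a (Suc (Suc (Suc i))) + Q * a (Suc i)"
      using E[of "Suc (Suc i)"] less.prems 2 by simp
    moreover have "a (Suc i) * Psi (Suc i) q Q e - q * Psi i q Q e * a (Suc (Suc i)) = a 0 * R"
      using base[of i] less.prems by (simp add: R_def)
    moreover have "Psi (Suc (Suc i)) q Q e = e * Psi (Suc i) q Q e - q * Q * Psi i q Q e"
      by simp
    ultimately have "a (Suc i) * Psi (Suc (Suc i)) q Q e - q * q * Psi i q Q e * a (Suc (Suc (Suc i))) = a 0 * R * e"
      by algebra
    moreover have "Suc i + m = Suc (Suc i)" "Suc i + Suc m = Suc (Suc (Suc i))" "q ^ Suc m = q * q" "Psi m q Q e = e"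
      using 2 by auto
    ultimately show ?thesis by (simp only: R_def)
  next
    case 3
    define s where "s = Suc i + l"
    define R p where "R = Q ^ Suc i" and "p = q ^ Suc l"
    have "e * a (s + 2) = q * a (s + 3) + Q * a (s + 1)"
      using E[of "s + 2"] less.prems 3 by (simp add: s_def eval_nat_numeral)
    moreover have "a (Suc i) * Psi (s + 1) q Q e - q * p * Psi i q Q e * a (s + 2) = a 0 * R * Psi (Suc l) q Q e"
    proof -
      have "Suc i + Suc l = s + 1" "Suc i + Suc (Suc l) = s + 2" "q ^ Suc (Suc l) = q * p" by (auto simp: s_def p_def)
      then show ?thesis using less.IH[of "Suc l"] less.prems 3 unfolding R_def by (metis lessI s_def add_Suc_right Suc_lessD)
    qed
    moreover have "a (Suc i) * Psi s q Q e - p * Psi i q Q e * a (s + 1) = a 0 * R * Psi l q Q e"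
    proof -
      have "Suc i + l = s" "Suc i + Suc l = s + 1" by (auto simp: s_def)
      then show ?thesis using less.IH[of l] less.prems 3 unfolding R_def p_def by simp
    qed
    moreover have "Psi (s + 2) q Q e = e * Psi (s + 1) q Q e - q * Q * Psi s q Q e" by simp
    moreover have "Psi (Suc (Suc l)) q Q e = e * Psi (Suc l) q Q e - q * Q * Psi l q Q e" by simp
    ultimately have "a (Suc i) * Psi (s + 2) q Q e - q * (q * p) * Psi i q Q e * a (s + 3) =
        a 0 * R * Psi (Suc (Suc l)) q Q e"
      by algebra
    moreover have "Suc i + m = s + 2" "Suc i + Suc m = s + 3" "q ^ Suc m = q * (q * p)" "Psi m q Q e = Psi (Suc (Suc l)) q Q e"
      using 3 by (auto simp: s_def p_def)
    ultimately show ?thesis by (simp only: R_def)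
  qed
qed

text \<open>The equations are proved after multiplication by \<open>a_0\<close>; nothing else is
  inverted, in particular not \<open>q\<close>. The linear ones follow by induction on
  \<open>j\<close>. The quadratic ones come from the Pluecker relation that writes
  \<open>a_0 (a_(j-1) a_(k+1) - a_j a_k)\<close> through minors containing \<open>a_0\<close>, whose
  values are combined by \<open>recurrence_Psi\<close>.\<close>

lemma cm_eqs_from_first:
  assumes d: "d \<ge> 2" and a0: "a 0 \<noteq> 0" and E1: "e * a 1 = q * a 2 + Q * a 0"
    and F1: "\<And>k. 1 \<le> k \<Longrightarrow> k \<le> d - 1 \<Longrightarrow> a 0 * a (k + 1) - a 1 * a k = \<kappa> * q ^ (d - k - 1) * Psi (k - 1) q Q e"
  shows "cm_eqs d \<kappa> q Q e a"
proof -
  have E: "e * a j = q * a (j + 1) + Q * a (j - 1)" if "1 \<le> j" "j < d" for j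
    using that
  proof (induction j rule: less_induct)
    case (less j)
    consider "j = 1" | "j = 2" | i where "j = i + 3"
      using less.prems by (metis One_nat_def Suc_1 add.commute le_Suc_ex le_antisym not_less_eq_eq numeral_3_eq_3)
    then show ?case
    proof cases
      case 1
      then show ?thesis using E1 by (simp add: numeral_2_eq_2)
    next
      case 2
      define p where "p = q ^ (d - 3)"
      have p: "q ^ (d - 2) = q * p"
        using less.prems 2 unfolding p_def by (metis Suc_diff_Suc numeral_2_eq_2 numeral_3_eq_3 power_Suc)
      have "a 0 * a 2 - a 1 * a 1 = \<kappa> * (q * p)"
        using F1[of 1] less.prems 2 p by (simp add: numeral_2_eq_2)
      moreover have "a 0 * a 3 - a 1 * a 2 = \<kappa> * p * e"
        using F1[of 2] less.prems 2 by (simp add: p_def numeral_3_eq_3 numeral_2_eq_2)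
      ultimately have "a 0 * (e * a 2 - q * a 3 - Q * a 1) = 0" using E1 by algebra
      then have "e * a 2 - q * a 3 - Q * a 1 = 0" using a0 mult_eq_0_iff by blast
      then have "e * a 2 = q * a 3 + Q * a 1" by algebra
      then show ?thesis using 2 by (simp add: numeral_3_eq_3 numeral_2_eq_2)
    next
      case 3
      define p where "p = q ^ (d - (i + 4))"
      have p: "q ^ (d - (i + 3)) = q * p" "q ^ (d - (i + 2)) = q * (q * p)"
      proof -
        have "d - (i + 3) = Suc (d - (i + 4))" "d - (i + 2) = Suc (Suc (d - (i + 4)))" using less.prems 3 by auto
        then show "q ^ (d - (i + 3)) = q * p" "q ^ (d - (i + 2)) = q * (q * p)" by (simp_all add: p_def)
      qed
      have f: "a 0 * a (i + 2) - a 1 * a (i + 1) = \<kappa> * (q * (q * p)) * Psi i q Q e"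
        "a 0 * a (i + 3) - a 1 * a (i + 2) = \<kappa> * (q * p) * Psi (i + 1) q Q e"
        "a 0 * a (i + 4) - a 1 * a (i + 3) = \<kappa> * p * Psi (i + 2) q Q e"
        using F1[of "i + 1"] F1[of "i + 2"] F1[of "i + 3"] less.prems 3 p
        by (simp_all add: p_def eval_nat_numeral)
      moreover have "Psi (i + 2) q Q e = e * Psi (i + 1) q Q e - q * Q * Psi i q Q e" by simp
      moreover have "e * a (i + 2) = q * a (i + 3) + Q * a (i + 1)"
        using less.IH[of "i + 2"] less.prems 3 by (simp add: eval_nat_numeral)
      ultimately have "a 0 * (e * a (i + 3) - q * a (i + 4) - Q * a (i + 2)) = 0" by algebra
      then have "e * a (i + 3) - q * a (i + 4) - Q * a (i + 2) = 0" using a0 mult_eq_0_iff by blast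
      then have "e * a (i + 3) = q * a (i + 4) + Q * a (i + 2)" by algebra
      then show ?thesis using 3 by (simp add: eval_nat_numeral)
    qed
  qed
  show ?thesis
  proof (rule cm_eqsI)
    fix j assume "1 \<le> j" "j \<le> d - 1"
    then show "e * a j = q * a (j + 1) + Q * a (j - 1)" using E[of j] d by auto
  next
    fix j k assume jk: "1 \<le> j" "j \<le> k" "k \<le> d - 1"
    show "a (j - 1) * a (k + 1) - a j * a k = \<kappa> * q ^ (d - k - 1) * Q ^ (j - 1) * Psi (k - j) q Q e"
    proof (cases "j = 1")
      case True
      then show ?thesis using F1[of k] jk by simp
    next
      case False
      define i m where "i = j - 2" and "m = k - j"
      have ex: "j = Suc (Suc i)" "k = Suc i + Suc m" using jk False by (auto simp: i_def m_def)
      have L: "a (Suc i) * Psi (Suc i + m) q Q e - q ^ Suc m * Psi i q Q e * a k = a 0 * Q ^ Suc i * Psi m q Q e"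
        unfolding ex(2) using ex jk d by (intro recurrence_Psi[where n = d] E) auto
      have f1: "a 0 * a (k + 1) - a 1 * a k = \<kappa> * q ^ (d - k - 1) * Psi (Suc i + m) q Q e"
        using F1[of k] jk ex by simp
      have "d - Suc i - 1 = (d - k - 1) + Suc m" using jk ex d by auto
      then have f2: "a 0 * a j - a 1 * a (Suc i) = \<kappa> * (q ^ (d - k - 1) * q ^ Suc m) * Psi i q Q e"
        using F1[of "Suc i"] jk ex d by (simp only: power_add) simp
      have "a 0 * (a (Suc i) * a (k + 1) - a j * a k) =
          a (Suc i) * (a 0 * a (k + 1) - a 1 * a k) - a k * (a 0 * a j - a 1 * a (Suc i))"
        by algebra
      also have "\<dots> = \<kappa> * q ^ (d - k - 1) * (a (Suc i) * Psi (Suc i + m) q Q e - q ^ Suc m * Psi i q Q e * a k)"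
        unfolding f1 f2 by algebra
      also have "\<dots> = a 0 * (\<kappa> * q ^ (d - k - 1) * Q ^ Suc i * Psi m q Q e)"
        unfolding L by algebra
      finally have "a (Suc i) * a (k + 1) - a j * a k = \<kappa> * q ^ (d - k - 1) * Q ^ Suc i * Psi m q Q e"
        using a0 by simp
      moreover have "j - 1 = Suc i" "k - j = m" using ex by auto
      ultimately show ?thesis by simp
    qed
  qed
qed

text \<open>Obtained by eliminating \<open>a_2\<close> from \<open>e a_1 = q a_2 + Q a_0\<close> and
  \<open>a_0 a_2 - a_1^2 = - q^(d-2)\<close>; the arguments \<open>x, y\<close> are
  \<open>a_0, a_1\<close>.\<close>

definition chart_Q :: "nat \<Rightarrow> complex \<Rightarrow> complex \<Rightarrow> complex \<Rightarrow> complex \<Rightarrow> complex" where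
  "chart_Q d q e x y = (e * y * x - q * y\<^sup>2 + q ^ (d - 1)) / x\<^sup>2"

text \<open>The quadratic equations with \<open>j = 1\<close> and \<kappa> equal to -1, solved for
  their last coordinate.\<close>

fun chart_a :: "nat \<Rightarrow> complex \<Rightarrow> complex \<Rightarrow> complex \<Rightarrow> complex \<Rightarrow> nat \<Rightarrow> complex" where
  "chart_a d q e x y 0 = x"
| "chart_a d q e x y (Suc 0) = y"
| "chart_a d q e x y (Suc (Suc k)) =
    (y * chart_a d q e x y (Suc k) - q ^ (d - k - 2) * Psi k q (chart_Q d q e x y) e) / x"

definition chart :: "nat \<Rightarrow> complex \<Rightarrow> complex \<Rightarrow> complex \<Rightarrow> complex \<Rightarrow> nat \<Rightarrow> complex" where
  "chart d q e x y = cm_point d q (chart_Q d q e x y) e (chart_a d q e x y)"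

definition cm_cone :: "nat \<Rightarrow> (nat \<Rightarrow> complex) set" where
  "cm_cone d = {z \<in> cspace {..<d + 4}. cm_eqs d (-1) (z 0) (z 1) (z 2) (\<lambda>j. z (j + 3))}"

lemma cm_point_in_cone:
  assumes "d \<ge> 1"
  shows "cm_point d q Q e a \<in> cm_cone d \<longleftrightarrow> cm_eqs d (-1) q Q e a"
  using assms by (simp add: cm_cone_def cm_eqs_point)

lemma chart_in_cone:
  assumes d: "d \<ge> 2" and x: "x \<noteq> 0"
  shows "chart d q e x y \<in> cm_cone d"
proof -
  define Q where "Q = chart_Q d q e x y"
  have "cm_eqs d (-1) q Q e (chart_a d q e x y)"
  proof (rule cm_eqs_from_first[OF d])
    define P where "P = q ^ (d - 2)"
    have "d - 1 = Suc (d - 2)" using d by simp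
    then have p: "q ^ (d - 1) = q * P" by (simp add: P_def)
    have "chart_a d q e x y 2 = (y * y - P) / x" by (simp add: numeral_2_eq_2 P_def)
    then have "x * chart_a d q e x y 2 = y * y - P" using x by simp
    moreover have "Q = (e * y * x - q * y\<^sup>2 + q * P) / x\<^sup>2" by (simp add: Q_def chart_Q_def p[unfolded One_nat_def])
    then have "Q * x\<^sup>2 = e * y * x - q * y\<^sup>2 + q * P" using x by simp
    ultimately have "x * (e * y) = x * (q * chart_a d q e x y 2 + Q * x)" by algebra
    then have "e * y = q * chart_a d q e x y 2 + Q * x" using x mult_left_cancel by blast
    then show "e * chart_a d q e x y 1 = q * chart_a d q e x y 2 + Q * chart_a d q e x y 0"
      by simp
    fix k assume k: "1 \<le> k" "k \<le> d - 1"
    then obtain l where l: "k = Suc l" by (metis Suc_le_D One_nat_def)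
    then have "d - l - 2 = d - k - 1" by simp
    then show "chart_a d q e x y 0 * chart_a d q e x y (k + 1) - chart_a d q e x y 1 * chart_a d q e x y k =
        - 1 * q ^ (d - k - 1) * Psi (k - 1) q Q e"
      using x l by (simp add: Q_def)
  qed (use x in simp)
  then show ?thesis using d by (simp add: chart_def cm_point_in_cone Q_def)
qed

lemma chart_coords:
  assumes d: "d \<ge> 2" and z: "z \<in> cm_cone d" and a0: "z 3 \<noteq> 0"
  shows "z = chart d (z 0) (z 2) (z 3) (z 4)"
proof -
  define q Q e a where "q = z 0" and "Q = z 1" and "e = z 2" and "a = (\<lambda>j. z (j + 3))"
  have zc: "z = cm_point d q Q e a"
    using z cm_point_coords[of z d] by (simp add: cm_cone_def q_def Q_def e_def a_def)
  have eqs: "cm_eqs d (-1) q Q e a" using z by (simp add: cm_cone_def q_def Q_def e_def a_def)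
  have a0': "a 0 \<noteq> 0" using a0 by (simp add: a_def)
  define P where "P = q ^ (d - 2)"
  have "d - 1 = Suc (d - 2)" using d by simp
  then have p: "q ^ (d - 1) = q * P" by (simp add: P_def)
  have 1: "e * a 1 = q * a 2 + Q * a 0" using cm_eqsD(1)[OF eqs, of 1] d by (simp add: numeral_2_eq_2)
  have 2: "a 0 * a 2 - a 1 * a 1 = - P" using cm_eqsD(2)[OF eqs, of 1 1] d by (simp add: numeral_2_eq_2 P_def)
  have "Q * (a 0)\<^sup>2 = e * a 1 * a 0 - q * (a 1)\<^sup>2 + q ^ (d - 1)"
    using 1 2 unfolding p by algebra
  then have Q: "Q = chart_Q d q e (a 0) (a 1)"
    using a0' by (simp add: chart_Q_def field_simps)
  have A: "chart_a d q e (a 0) (a 1) j = a j" if "j \<le> d" for j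
    using that
  proof (induction j rule: less_induct)
    case (less j)
    consider "j = 0" | "j = 1" | k where "j = Suc (Suc k)"
      by (metis One_nat_def not0_implies_Suc)
    then show ?case
    proof cases
      case 3
      have "d - Suc k - 1 = d - k - 2" by simp
      then have "a 0 * a j - a 1 * a (Suc k) = - (q ^ (d - k - 2) * Psi k q Q e)"
        using cm_eqsD(2)[OF eqs, of 1 "Suc k"] less.prems 3 by simp
      then have "a j = (a 1 * a (Suc k) - q ^ (d - k - 2) * Psi k q Q e) / a 0"
        using a0' by (simp add: field_simps)
      then show ?thesis using less.IH[of "Suc k"] less.prems 3 by (simp add: Q[symmetric, unfolded One_nat_def])
    qed auto
  qed
  have "z = chart d q e (a 0) (a 1)"
    unfolding chart_def zc using Q A by (intro cm_point_eqI) auto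
  then show ?thesis by (simp add: q_def e_def a_def)
qed

section \<open>Loops in the punctured cone\<close>

lemma nat_induct_pair:
  "P 0 \<Longrightarrow> P (Suc 0) \<Longrightarrow> (\<And>n. P n \<Longrightarrow> P (Suc n) \<Longrightarrow> P (Suc (Suc n))) \<Longrightarrow> P n"
  by (rule induct_nat_012)

lemma continuous_on_Psi:
  assumes "continuous_on S q" "continuous_on S Q" "continuous_on S e"
  shows "continuous_on S (\<lambda>t. Psi k (q t) (Q t) (e t))"
proof (induction k rule: nat_induct_pair)
  case (3 n)
  show ?case unfolding Psi.simps by (intro continuous_intros assms 3)
qed (use assms in auto)

lemma holomorphic_on_Psi:
  assumes "q holomorphic_on S" "Q holomorphic_on S" "e holomorphic_on S"
  shows "(\<lambda>t. Psi k (q t) (Q t) (e t)) holomorphic_on S"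
proof (induction k rule: nat_induct_pair)
  case (3 n)
  show ?case unfolding Psi.simps by (intro holomorphic_intros assms 3)
qed (use assms in auto)

lemma Psi_0_right: "Psi k q 0 e = e ^ k"
  by (induction k rule: nat_induct_pair) auto

lemma continuous_on_chart:
  assumes q: "continuous_on S q" and e: "continuous_on S e" and x: "continuous_on S x" and y: "continuous_on S y"
    and nz: "\<And>t. t \<in> S \<Longrightarrow> x t \<noteq> 0"
  shows "continuous_on S (\<lambda>t. chart d (q t) (e t) (x t) (y t))"
proof -
  have Q: "continuous_on S (\<lambda>t. chart_Q d (q t) (e t) (x t) (y t))"
    unfolding chart_Q_def using nz by (intro continuous_intros q e x y) auto
  have a: "continuous_on S (\<lambda>t. chart_a d (q t) (e t) (x t) (y t) k)" for k
  proof (induction k rule: nat_induct_pair)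
    case (3 n)
    show ?case unfolding chart_a.simps using nz
      by (intro continuous_intros q e x y 3 continuous_on_Psi Q) auto
  qed (use x y in auto)
  show ?thesis
  proof (rule continuous_on_coordinatewise_then_product)
    fix i
    show "continuous_on S (\<lambda>t. chart d (q t) (e t) (x t) (y t) i)"
      unfolding chart_def cm_point_def
      by (cases "i = 0"; cases "i = 1"; cases "i = 2"; cases "i < d + 4") (simp_all add: q e Q a)
  qed
qed

lemma holomorphic_on_chart:
  assumes q: "q holomorphic_on S" and e: "e holomorphic_on S" and x: "x holomorphic_on S" and y: "y holomorphic_on S"
    and nz: "\<And>t. t \<in> S \<Longrightarrow> x t \<noteq> 0"
  shows "(\<lambda>t. chart d (q t) (e t) (x t) (y t) i) holomorphic_on S"
proof -
  have Q: "(\<lambda>t. chart_Q d (q t) (e t) (x t) (y t)) holomorphic_on S"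
    unfolding chart_Q_def using nz by (intro holomorphic_intros q e x y) auto
  have a: "(\<lambda>t. chart_a d (q t) (e t) (x t) (y t) k) holomorphic_on S" for k
  proof (induction k rule: nat_induct_pair)
    case (3 n)
    show ?case unfolding chart_a.simps using nz
      by (intro holomorphic_intros q e x y 3 holomorphic_on_Psi Q) auto
  qed (use x y in auto)
  show ?thesis
    unfolding chart_def cm_point_def
    by (cases "i = 0"; cases "i = 1"; cases "i = 2"; cases "i < d + 4") (simp_all add: q e Q a)
qed

section \<open>The patches of the punctured cone\<close>

definition unip :: "nat \<Rightarrow> complex \<Rightarrow> (nat \<Rightarrow> complex) \<Rightarrow> nat \<Rightarrow> complex" where
  "unip d c z = cm_point d (z 0 + c * z 2 + c\<^sup>2 * z 1) (z 1) (z 2 + 2 * c * z 1) (avec d (\<lambda>j. z (j + 3)) c)"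

lemma unip_coord: "j \<le> d \<Longrightarrow> unip d c z (j + 3) = avec d (\<lambda>j. z (j + 3)) c j"
  by (simp add: unip_def)

lemma avec_cong:
  assumes "\<And>j. j \<le> d \<Longrightarrow> a j = b j" "j \<le> d"
  shows "avec d a c j = avec d b c j"
  unfolding avec_def using assms by (intro sum.cong) auto

lemma unip_in_cone:
  assumes "d \<ge> 2" "z \<in> cm_cone d"
  shows "unip d c z \<in> cm_cone d"
proof -
  have "cm_eqs d (-1) (z 0 + c * z 2 + c\<^sup>2 * z 1) (z 1) (z 2 + 2 * c * z 1) (avec d (\<lambda>j. z (j + 3)) c)"
    using assms by (intro cm_eqs_action) (auto simp: cm_cone_def)
  then show ?thesis using assms by (simp add: unip_def cm_point_in_cone)
qed

lemma unip_inverse: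
  assumes "z \<in> cspace {..<d + 4}"
  shows "unip d (- c) (unip d c z) = z"
proof -
  have "unip d (- c) (unip d c z) = cm_point d (z 0) (z 1) (z 2) (\<lambda>j. z (j + 3))"
    unfolding unip_def[of d "- c" "unip d c z"]
  proof (rule cm_point_eqI)
    show "unip d c z 0 + - c * unip d c z 2 + (- c)\<^sup>2 * unip d c z 1 = z 0"
      by (simp add: unip_def algebra_simps power2_eq_square)
    fix j assume j: "j \<le> d"
    have "avec d (\<lambda>j. unip d c z (j + 3)) (- c) j = avec d (avec d (\<lambda>j. z (j + 3)) c) (- c) j"
      using j by (intro avec_cong) (auto simp: unip_coord)
    also have "\<dots> = avec d (\<lambda>j. z (j + 3)) (c + - c) j" by (rule avec_add[OF j])
    finally show "avec d (\<lambda>j. unip d c z (j + 3)) (- c) j = z (j + 3)" by simp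
  qed (simp_all add: unip_def)
  then show ?thesis using cm_point_coords[OF assms] by simp
qed

lemma unip_inverse':
  assumes "z \<in> cspace {..<d + 4}"
  shows "unip d c (unip d (- c) z) = z"
  using unip_inverse[OF assms, of "- c"] by simp

lemma unip_0 [simp]: "unip d c 0 = 0"
proof
  fix i show "unip d c 0 i = (0 :: nat \<Rightarrow> complex) i"
    by (simp add: unip_def cm_point_def avec_def)
qed

lemma continuous_unip: "continuous_on S (unip d c)"
proof (rule continuous_on_coordinatewise_then_product)
  fix i
  have "continuous_on S (\<lambda>z. avec d (\<lambda>j. z (j + 3)) c k)" for k
    unfolding avec_def by (intro continuous_intros continuous_coord)
  moreover have "continuous_on S (\<lambda>z :: nat \<Rightarrow> complex. z 0 + c * z 2 + c\<^sup>2 * z 1)" "continuous_on S (\<lambda>z :: nat \<Rightarrow> complex. z 2 + 2 * c * z 1)"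
    by (intro continuous_intros continuous_coord)+
  ultimately show "continuous_on S (\<lambda>z. unip d c z i)"
    unfolding unip_def cm_point_def
    by (cases "i = 0"; cases "i = 1"; cases "i = 2"; cases "i < d + 4") (simp_all add: continuous_coord)
qed

text \<open>The coordinate \<open>a_0\<close> after the substitution with parameter
  \<open>c\<close>. As a polynomial in \<open>c\<close> its coefficients are nonzero multiples of
  the \<open>a_i\<close>, so some translate of the chart contains a given point as soon as
  \<open>a\<close> is nonzero there.\<close>

definition aform :: "nat \<Rightarrow> complex \<Rightarrow> (nat \<Rightarrow> complex) \<Rightarrow> complex" where
  "aform d c z = (\<Sum>i\<le>d. of_nat (d choose i) * c ^ i * z (i + 3))"

lemma unip_3: "unip d c z 3 = aform d c z"
  using unip_coord[of 0 d c z] by (simp add: avec_def aform_def)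

lemma aform_0 [simp]: "aform d c 0 = 0"
  by (simp add: aform_def)

text \<open>If \<open>a = 0\<close>, the right-hand sides vanish; since \<kappa> is -1 and not 0,
  those with indices \<open>(1, 1)\<close>, \<open>(d-1, d-1)\<close> and \<open>(1, d-1)\<close>
  give in turn that \<open>q\<close>, \<open>Q\<close> and, using \<open>Q = 0\<close>,
  \<open>e\<close> are zero. Only the origin is left.\<close>

lemma aform_nonzero:
  assumes d: "d \<ge> 3" and z: "z \<in> cm_cone d" "z \<noteq> 0"
  shows "\<exists>c. aform d c z \<noteq> 0"
proof (rule ccontr)
  assume "\<not> ?thesis"
  then have "\<And>c. (\<Sum>i\<le>d. (of_nat (d choose i) * z (i + 3)) * c ^ i) = 0"
    by (simp add: aform_def mult_ac)
  then have "\<forall>i\<le>d. of_nat (d choose i) * z (i + 3) = 0"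
    using polyfun_eq_0[of "\<lambda>i. of_nat (d choose i) * z (i + 3)" d] by auto
  then have a: "z (i + 3) = 0" if "i \<le> d" for i
    using that by (metis binomial_eq_0_iff mult_eq_0_iff not_less of_nat_eq_0_iff)
  have eqs: "cm_eqs d (-1) (z 0) (z 1) (z 2) (\<lambda>j. z (j + 3))" using z(1) by (simp add: cm_cone_def)
  have rhs: "z 0 ^ (d - k - 1) * z 1 ^ (j - 1) * Psi (k - j) (z 0) (z 1) (z 2) = 0" if "1 \<le> j" "j \<le> k" "k \<le> d - 1" for j k
    using cm_eqsD(2)[OF eqs that] a[of "j - 1"] a[of j] that d by simp
  have Q: "z 1 = 0" using rhs[of "d - 1" "d - 1"] d by (auto simp: power_0_left)
  moreover have "z 0 = 0" using rhs[of 1 1] d by auto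
  moreover have "z 2 = 0" using rhs[of 1 "d - 1"] d Q by (auto simp: Psi_0_right)
  moreover have "z = cm_point d (z 0) (z 1) (z 2) (\<lambda>j. z (j + 3))"
    using z(1) by (intro cm_point_coords) (auto simp: cm_cone_def)
  moreover have "cm_point d 0 0 0 (\<lambda>j. z (j + 3)) = 0"
  proof
    fix i show "cm_point d 0 0 0 (\<lambda>j. z (j + 3)) i = (0 :: nat \<Rightarrow> complex) i"
      using a[of "i - 3"] by (cases "i < 3") (auto simp: cm_point_def)
  qed
  ultimately show False using z(2) by metis
qed

definition cm_patch :: "nat \<Rightarrow> complex \<Rightarrow> (nat \<Rightarrow> complex) set" where
  "cm_patch d c = {z \<in> cm_cone d. aform d c z \<noteq> 0}"

lemma cone_in_cspace: "cm_cone d \<subseteq> cspace {..<d + 4}"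
  by (auto simp: cm_cone_def)

text \<open>Two points are joined by a complex line in the coordinates of the chart. Inside the
  plane of its parameter, \<open>a_0\<close> and the second form fail to be nonzero only on a
  countable set, and the complement of such a set is path-connected. With \<open>c = c'\<close> the
  patch itself is covered.\<close>

lemma cm_patch_path_connected:
  assumes d: "d \<ge> 2"
  shows "path_connected (cm_patch d c \<inter> cm_patch d c')"
  unfolding path_connected_component
proof (intro ballI)
  fix z w assume z: "z \<in> cm_patch d c \<inter> cm_patch d c'" and w: "w \<in> cm_patch d c \<inter> cm_patch d c'"
  define P P' where "P = unip d c z" and "P' = unip d c w"
  have zY: "z \<in> cm_cone d" and wY: "w \<in> cm_cone d" using z w by (auto simp: cm_patch_def)
  have PY: "P \<in> cm_cone d" "P' \<in> cm_cone d" using unip_in_cone[OF d] zY wY by (auto simp: P_def P'_def)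
  have P3: "P 3 \<noteq> 0" "P' 3 \<noteq> 0" using z w by (auto simp: P_def P'_def unip_3 cm_patch_def)
  define f where "f i t = P i + t * (P' i - P i)" for i t
  define S where "S = {t. f 3 t \<noteq> 0}"
  define C where "C t = chart d (f 0 t) (f 2 t) (f 3 t) (f 4 t)" for t
  define G where "G t = unip d (- c) (C t)" for t
  have fh: "f i holomorphic_on S" for i
    unfolding f_def by (intro holomorphic_intros)
  have fc: "continuous_on S (f i)" for i S
    unfolding f_def by (intro continuous_intros)
  have G0: "G 0 = z"
  proof -
    have "C 0 = P" using chart_coords[OF d PY(1) P3(1), symmetric] by (simp add: C_def f_def)
    then have "G 0 = unip d (- c) (unip d c z)" unfolding G_def P_def by (rule arg_cong)
    also have "\<dots> = z" using zY cone_in_cspace by (intro unip_inverse) blast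
    finally show ?thesis .
  qed
  have G1: "G 1 = w"
  proof -
    have "C 1 = P'" using chart_coords[OF d PY(2) P3(2), symmetric] by (simp add: C_def f_def)
    then have "G 1 = unip d (- c) (unip d c w)" unfolding G_def P'_def by (rule arg_cong)
    also have "\<dots> = w" using wY cone_in_cspace by (intro unip_inverse) blast
    finally show ?thesis .
  qed
  have CY: "C t \<in> cm_cone d" if "t \<in> S" for t
    using that d unfolding C_def S_def by (intro chart_in_cone) auto
  have GY: "G t \<in> cm_patch d c" if "t \<in> S" for t
  proof -
    have "aform d c (G t) = unip d c (G t) 3" by (simp add: unip_3)
    also have "\<dots> = C t 3"
      using CY[OF that] cone_in_cspace unfolding G_def by (subst unip_inverse') auto
    also have "\<dots> = f 3 t" by (simp add: C_def chart_def cm_point_def)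
    finally show ?thesis
      using that unip_in_cone[OF d CY[OF that]] by (simp add: cm_patch_def G_def S_def)
  qed
  define \<psi> where "\<psi> t = aform d c' (G t)" for t
  have \<psi>: "\<psi> holomorphic_on S"
  proof -
    have C: "(\<lambda>t. C t i) holomorphic_on S" for i
      unfolding C_def by (intro holomorphic_on_chart fh) (auto simp: S_def)
    have "(\<lambda>t. G t i) holomorphic_on S" for i
    proof -
      have "(\<lambda>t. avec d (\<lambda>j. C t (j + 3)) (- c) k) holomorphic_on S" for k
        unfolding avec_def by (intro holomorphic_intros C)
      moreover have "(\<lambda>t. C t 0 + - c * C t 2 + (- c)\<^sup>2 * C t 1) holomorphic_on S" "(\<lambda>t. C t 2 + 2 * - c * C t 1) holomorphic_on S"
        by (intro holomorphic_intros C)+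
      ultimately show ?thesis
        unfolding G_def unip_def cm_point_def
        by (cases "i = 0"; cases "i = 1"; cases "i = 2"; cases "i < d + 4") (simp_all add: C)
    qed
    then show ?thesis unfolding \<psi>_def aform_def by (intro holomorphic_intros)
  qed
  \<comment> \<open>Along the line \<open>a_0\<close> is affine in the parameter, so it has at most
    one zero.\<close>
  have "-S \<subseteq> {- P 3 / (P' 3 - P 3)}"
  proof
    fix t assume "t \<in> - S"
    then have t: "t * (P' 3 - P 3) = - P 3" by (auto simp: S_def f_def add_eq_0_iff)
    then have "P' 3 - P 3 \<noteq> 0" using P3 by auto
    then show "t \<in> {- P 3 / (P' 3 - P 3)}" using t by (simp add: field_simps)
  qed
  then have cS: "countable (- S)" by (rule countable_subset) auto
  have S_eq: "S = UNIV - (- S)" by auto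
  have "connected S"
    by (subst S_eq) (intro path_connected_imp_connected path_connected_open_diff_countable cS; simp)
  moreover have oS: "open S"
    unfolding S_def by (intro open_Collect_neq fc continuous_on_const)
  moreover have "countable {t \<in> S. \<psi> t = 0}"
  \<comment> \<open>A constant \<open>\<psi>\<close> cannot be zero because of its value at the
    parameter 0; a nonconstant one has countably many zeros on the connected open set
    \<open>S\<close>.\<close>
  proof (cases "\<psi> constant_on S")
    case True
    have "0 \<in> S" using P3 by (simp add: S_def f_def)
    moreover have "\<psi> 0 \<noteq> 0" using z G0 by (simp add: \<psi>_def cm_patch_def)
    ultimately have "{t \<in> S. \<psi> t = 0} = {}" using True unfolding constant_on_def by force
    then show ?thesis by (rule ssubst) (rule countable_empty)
  next
    case False
    obtain K :: "nat \<Rightarrow> complex set" where K: "\<And>n. compact (K n)" "\<Union> (range K) = S"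
      using open_Union_compact_subsets[OF oS] by metis
    then have "fsigma S" using fsigma.intros[of K] compact_imp_closed by auto
    then show ?thesis
      using holomorphic_countable_zeros[OF \<psi> oS \<open>connected S\<close>] False by blast
  qed
  ultimately have "path_connected (S - {t \<in> S. \<psi> t = 0})"
    by (intro path_connected_open_diff_countable) simp_all
  moreover have contG: "continuous_on (S - {t \<in> S. \<psi> t = 0}) G"
  proof -
    have "continuous_on S C"
      unfolding C_def by (intro continuous_on_chart fc) (auto simp: S_def)
    then have "continuous_on S G"
      unfolding G_def using continuous_on_compose2[OF continuous_unip[of UNIV]] by blast
    then show ?thesis by (rule continuous_on_subset) auto
  qed
  ultimately have "path_connected (G ` (S - {t \<in> S. \<psi> t = 0}))"
    by (intro path_connected_continuous_image)
  moreover have "z \<in> G ` (S - {t \<in> S. \<psi> t = 0})" "w \<in> G ` (S - {t \<in> S. \<psi> t = 0})"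
  proof -
    have "0 \<in> S" "1 \<in> S" using P3 by (auto simp: S_def f_def)
    moreover have "\<psi> 0 \<noteq> 0" "\<psi> 1 \<noteq> 0" using z w G0 G1 by (auto simp: \<psi>_def cm_patch_def)
    ultimately show "z \<in> G ` (S - {t \<in> S. \<psi> t = 0})" "w \<in> G ` (S - {t \<in> S. \<psi> t = 0})"
      using G0 G1 by (auto intro: image_eqI[of _ _ 0] image_eqI[of _ _ 1])
  qed
  moreover have "G ` (S - {t \<in> S. \<psi> t = 0}) \<subseteq> cm_patch d c \<inter> cm_patch d c'"
    using GY by (auto simp: \<psi>_def cm_patch_def)
  ultimately show "path_component (cm_patch d c \<inter> cm_patch d c') z w"
    by (meson path_component_of_subset path_connected_component)
qed

text \<open>A complex line in the cone that crosses \<open>a_0 = 0\<close> at \<open>x = 0\<close>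
  and avoids the origin, since \<open>q = 1\<close>. The disc it provides contracts the loops around
  that divisor.\<close>

definition cm_line :: "nat \<Rightarrow> complex \<Rightarrow> nat \<Rightarrow> complex" where
  "cm_line d x = cm_point d 1 0 0 (\<lambda>j. if j = 0 then x else if j = 1 then 1 else 0)"

lemma cm_line_in_cone:
  assumes d: "d \<ge> 2"
  shows "cm_line d x \<in> cm_cone d - {0}"
proof -
  have "cm_eqs d (-1) 1 0 0 (\<lambda>j. if j = 0 then x else if j = 1 then 1 else 0)"
    by (rule cm_eqsI) (auto simp: Psi_0_right power_0_left)
  then have "cm_line d x \<in> cm_cone d" using d by (simp add: cm_line_def cm_point_in_cone)
  moreover have "cm_line d x 0 \<noteq> 0 0" by (simp add: cm_line_def)
  ultimately show ?thesis by auto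
qed

lemma continuous_cm_line:
  assumes "continuous_on S x"
  shows "continuous_on S (\<lambda>t. cm_line d (x t))"
proof (rule continuous_on_coordinatewise_then_product)
  fix i
  show "continuous_on S (\<lambda>t. cm_line d (x t) i)"
    unfolding cm_line_def cm_point_def
    by (cases "i = 0"; cases "i = 1"; cases "i = 2"; cases "i < d + 4"; cases "i = 3"; cases "i = 4") (simp_all add: assms)
qed

lemma chart_cm_line:
  assumes "d \<ge> 2" "x \<noteq> 0"
  shows "chart d 1 0 x 1 = cm_line d x"
  using chart_coords[OF assms(1), of "cm_line d x"] cm_line_in_cone[OF assms(1), of x] assms
  by (simp add: cm_line_def cm_point_def)

lemma chart_nonzero:
  assumes "x \<noteq> 0"
  shows "chart d q e x y \<noteq> 0"
proof
  assume "chart d q e x y = 0"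
  then have "chart d q e x y 3 = 0" by simp
  then show False using assms by (simp add: chart_def cm_point_def)
qed

text \<open>
  A loop in the chart is freely homotopic to one with \<open>(q, e, a\<^sub>1) = (1, 0, 1)\<close>, on which also
  \<open>Q = 0\<close> and \<open>a\<^sub>0\<close> is unconstrained.
\<close>

lemma loop_in_patch_0_null:
  assumes d: "d \<ge> 2" and p: "path p" "path_image p \<subseteq> cm_patch d 0" "pathfinish p = pathstart p"
  shows "homotopic_loops (cm_cone d - {0}) p (\<lambda>_. cm_line d 0)"
proof (rule homotopic_loops_trans)
  have pt: "p t \<in> cm_cone d" "p t 3 \<noteq> 0" if "t \<in> {0..1}" for t
  proof -
    have "p t \<in> cm_patch d 0" using p(2) that by (auto simp: path_image_def)
    moreover have "aform d 0 z = z 3" for z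
      using avec_0[of d "\<lambda>j. z (j + 3)" 0] by (simp add: aform_def avec_def)
    ultimately show "p t \<in> cm_cone d" "p t 3 \<noteq> 0" by (auto simp: cm_patch_def)
  qed
  have coord: "continuous_on {0..1} (\<lambda>t. p t i)" for i
    using p(1) unfolding path_def by (rule continuous_on_product_then_coordinatewise)
  have snd_coord: "continuous_on ({0..1} \<times> {0..1}) (\<lambda>u. p (snd u) i)" for i
    by (rule continuous_on_compose2[OF coord]) (auto intro: continuous_intros)
  have p01: "p 1 = p 0" using p(3) by (simp add: pathfinish_def pathstart_def)
  show "homotopic_loops (cm_cone d - {0}) p (\<lambda>t. cm_line d (p t 3))"
    unfolding homotopic_loops
  proof (intro exI conjI ballI)
    \<comment> \<open>An affine homotopy of \<open>(q, e, a_1)\<close> to \<open>(1, 0, 1)\<close>;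
      \<open>a_0\<close> is left alone, so the homotopy stays in the chart.\<close>
    let ?h = "\<lambda>u. chart d ((1 - of_real (fst u)) * p (snd u) 0 + of_real (fst u)) ((1 - of_real (fst u)) * p (snd u) 2)
       (p (snd u) 3) ((1 - of_real (fst u)) * p (snd u) 4 + of_real (fst u))"
    show "continuous_on ({0..1} \<times> {0..1}) ?h"
      using pt by (intro continuous_on_chart continuous_intros snd_coord) auto
    show "?h \<in> {0..1} \<times> {0..1} \<rightarrow> cm_cone d - {0}"
    proof
      fix u :: "real \<times> real" assume "u \<in> {0..1} \<times> {0..1}"
      then have "p (snd u) 3 \<noteq> 0" using pt(2)[of "snd u"] by (simp add: mem_Times_iff)
      then show "?h u \<in> cm_cone d - {0}" using chart_in_cone[OF d] chart_nonzero by blast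
    qed
    show "?h (0, t) = p t" if "t \<in> {0..1}" for t
      using chart_coords[OF d pt[OF that], symmetric] by simp
    show "?h (1, t) = cm_line d (p t 3)" if "t \<in> {0..1}" for t
      using chart_cm_line[OF d pt(2)[OF that]] by simp
    show "pathfinish (?h \<circ> Pair s) = pathstart (?h \<circ> Pair s)" for s
      using p01 by (simp add: pathfinish_def pathstart_def)
  qed
  show "homotopic_loops (cm_cone d - {0}) (\<lambda>t. cm_line d (p t 3)) (\<lambda>_. cm_line d 0)"
    unfolding homotopic_loops
  proof (intro exI conjI ballI)
    \<comment> \<open>Now \<open>a_0\<close> is shrunk to 0. This leaves the chart but not the
      punctured cone.\<close>
    let ?h = "\<lambda>u. cm_line d ((1 - of_real (fst u)) * p (snd u) 3)"
    show "continuous_on ({0..1} \<times> {0..1}) ?h"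
      by (intro continuous_cm_line continuous_intros snd_coord)
    show "?h \<in> {0..1} \<times> {0..1} \<rightarrow> cm_cone d - {0}"
      using cm_line_in_cone[OF d] by auto
    show "pathfinish (?h \<circ> Pair s) = pathstart (?h \<circ> Pair s)" for s
      using p01 by (simp add: pathfinish_def pathstart_def)
  qed auto
qed

lemma unip_punctured_cone:
  assumes "d \<ge> 2"
  shows "unip d c \<in> cm_cone d - {0} \<rightarrow> cm_cone d - {0}"
proof
  fix z assume z: "z \<in> cm_cone d - {0}"
  have "unip d c z \<noteq> 0"
  proof
    assume "unip d c z = 0"
    then have "unip d (- c) (unip d c z) = 0" by simp
    then show False using unip_inverse[of z d c] z cone_in_cspace by auto
  qed
  then show "unip d c z \<in> cm_cone d - {0}" using unip_in_cone[OF assms] z by auto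
qed

text \<open>Translation by \<open>unip d c\<close> moves the loop into the basic chart, and the
  inverse translation, a self-map of the punctured cone, brings the contraction back.\<close>

lemma loop_in_patch_null:
  assumes d: "d \<ge> 2" and p: "path p" "path_image p \<subseteq> cm_patch d c" "pathfinish p = pathstart p"
  shows "\<exists>w. homotopic_loops (cm_cone d - {0}) p (\<lambda>_. w)"
proof -
  have pt: "p t \<in> cm_patch d c" if "t \<in> {0..1}" for t
    using p(2) that by (auto simp: path_image_def)
  have p': "path (unip d c \<circ> p)"
    by (intro path_continuous_image p continuous_unip)
  have aform0: "aform d 0 z = z 3" for z
    using avec_0[of d "\<lambda>j. z (j + 3)" 0] by (simp add: aform_def avec_def)
  have im: "path_image (unip d c \<circ> p) \<subseteq> cm_patch d 0"
    using pt unip_in_cone[OF d] by (auto simp: path_image_def cm_patch_def aform0 unip_3)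
  have "homotopic_loops (cm_cone d - {0}) (unip d c \<circ> p) (\<lambda>_. cm_line d 0)"
    using p(3) by (intro loop_in_patch_0_null d p' im) (simp add: pathfinish_def pathstart_def)
  then have 1: "homotopic_loops (cm_cone d - {0}) (unip d (- c) \<circ> (unip d c \<circ> p)) (unip d (- c) \<circ> (\<lambda>_. cm_line d 0))"
    by (rule homotopic_loops_continuous_image[OF _ continuous_unip unip_punctured_cone[OF d]])
  have "homotopic_loops (cm_cone d - {0}) p (unip d (- c) \<circ> (unip d c \<circ> p))"
  proof (rule homotopic_loops_eq[OF p(1) _ p(3)])
    show "path_image p \<subseteq> cm_cone d - {0}" using p(2) by (auto simp: cm_patch_def)
    fix t :: real assume "t \<in> {0..1}"
    from pt[OF this] have "p t \<in> cspace {..<d + 4}" using cone_in_cspace by (auto simp: cm_patch_def)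
    then show "p t = (unip d (- c) \<circ> (unip d c \<circ> p)) t" by (simp add: unip_inverse)
  qed
  from homotopic_loops_trans[OF this 1] show ?thesis
    by (intro exI[of _ "unip d (- c) (cm_line d 0)"]) (simp add: o_def)
qed

text \<open>Simple connectedness in a form that makes sense for the function type with its product
  topology.\<close>

definition trivial_loops :: "'a::topological_space set \<Rightarrow> bool" where
  "trivial_loops S \<longleftrightarrow> path_connected S \<and> (\<forall>p q. path p \<and> path_image p \<subseteq> S \<and> path q \<and> path_image q \<subseteq> S \<and>
     pathstart q = pathstart p \<and> pathfinish q = pathfinish p \<longrightarrow> homotopic_paths S p q)"

text \<open>A section \<open>g\<close> suffices: paths are lifted by \<open>g\<close>, deformed in
  \<open>S\<close> and projected by \<open>f\<close>. This serves both to leave the normed model of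
  the cone and to pass from the cone to a conical neighbourhood.\<close>

lemma trivial_loops_retract:
  assumes S: "trivial_loops S" and f: "continuous_on S f" "f ` S = T"
    and g: "continuous_on T g" "g \<in> T \<rightarrow> S" and fg: "\<And>y. y \<in> T \<Longrightarrow> f (g y) = y"
  shows "trivial_loops T"
  unfolding trivial_loops_def
proof (intro conjI allI impI)
  show "path_connected T"
    using S f path_connected_continuous_image unfolding trivial_loops_def by blast
  fix p q assume pq: "path p \<and> path_image p \<subseteq> T \<and> path q \<and> path_image q \<subseteq> T \<and>
     pathstart q = pathstart p \<and> pathfinish q = pathfinish p"
  have gp: "path (g \<circ> r)" "path_image (g \<circ> r) \<subseteq> S" if "path r" "path_image r \<subseteq> T" for r
    using that g by (auto intro!: path_continuous_image continuous_on_subset[OF g(1)] simp: path_image_compose)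
  have "homotopic_paths S (g \<circ> p) (g \<circ> q)"
    using S gp pq unfolding trivial_loops_def by (auto simp: pathstart_compose pathfinish_compose)
  then have 1: "homotopic_paths T (f \<circ> (g \<circ> p)) (f \<circ> (g \<circ> q))"
    by (rule homotopic_paths_continuous_image[OF _ f(1)]) (use f(2) in blast)
  have 2: "homotopic_paths T r (f \<circ> (g \<circ> r))" if "path r" "path_image r \<subseteq> T" for r
    using that fg by (intro homotopic_paths_eq) (auto simp: path_image_def subset_iff)
  show "homotopic_paths T p q"
    using 1 2[of p] 2[of q] pq by (meson homotopic_paths_sym homotopic_paths_trans)
qed

lemma trivial_fundamental_group:
  assumes S: "trivial_loops S" and b: "b \<in> S"
  shows "fundamental_group S b \<cong> singleton_group ()"
proof -
  define A where "A = {p. path p \<and> path_image p \<subseteq> S \<and> pathstart p = b \<and> pathfinish p = b}"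
  have hom: "homotopic_paths S p q \<longleftrightarrow> q \<in> A" if "p \<in> A" for p q
  proof
    assume h: "homotopic_paths S p q"
    then show "q \<in> A"
      using that homotopic_paths_imp_path[OF h] homotopic_paths_imp_subset[OF h]
        homotopic_paths_imp_pathstart[OF h] homotopic_paths_imp_pathfinish[OF h] by (simp add: A_def)
  next
    assume "q \<in> A"
    then show "homotopic_paths S p q" using that S unfolding A_def trivial_loops_def by auto
  qed
  have const: "(\<lambda>_. b) \<in> A"
    using b by (auto simp: A_def path_def path_image_def pathstart_def pathfinish_def)
  have cls: "{(p, q). homotopic_paths S p q} `` {p} = A" if "p \<in> A" for p
    using hom[OF that] by auto
  have carrier: "carrier (fundamental_group S b) = {A}"
    using const cls unfolding fundamental_group_def A_def[symmetric] quotient_def by auto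
  have join: "p +++ q \<in> A" if "p \<in> A" "q \<in> A" for p q
    using that by (auto simp: A_def path_image_join)
  have mult: "A \<otimes>\<^bsub>fundamental_group S b\<^esub> A = A"
    using const hom join unfolding fundamental_group_def by auto
  have "(\<lambda>_. ()) \<in> iso (fundamental_group S b) (singleton_group ())"
    by (rule isoI) (auto simp: hom_def carrier mult singleton_group_def bij_betw_def)
  then show ?thesis unfolding is_iso_def by blast
qed

text \<open>A copy of the space of the first \<open>n\<close> coordinates inside a normed space, in
  which the covering argument is carried out; \<open>apply_bcontfun\<close> leads back.\<close>

definition bc_embed :: "nat \<Rightarrow> (nat \<Rightarrow> complex) \<Rightarrow> (nat \<Rightarrow>\<^sub>C complex)" where
  "bc_embed n z = Bcontfun (\<lambda>i. if i < n then z i else 0)"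

lemma apply_bc_embed: "apply_bcontfun (bc_embed n z) i = (if i < n then z i else 0)"
proof -
  have "(\<lambda>i. if i < n then z i else 0) \<in> bcontfun"
  proof (rule bcontfun_normI)
    fix i show "norm (if i < n then z i else 0) \<le> (\<Sum>i<n. norm (z i))"
      by (auto intro: member_le_sum sum_nonneg)
  qed (simp add: continuous_on_open_vimage open_discrete)
  then show ?thesis unfolding bc_embed_def by (simp add: Bcontfun_inverse)
qed

lemma continuous_bc_embed: "continuous_on S (bc_embed n)"
  unfolding continuous_on_def
proof
  fix w assume "w \<in> S"
  have bound: "dist (bc_embed n z) (bc_embed n w) \<le> (\<Sum>i<n. dist (z i) (w i))" for z
  proof (rule dist_bound)
    fix i show "dist (apply_bcontfun (bc_embed n z) i) (apply_bcontfun (bc_embed n w) i) \<le> (\<Sum>i<n. dist (z i) (w i))"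
      by (auto simp: apply_bc_embed intro: member_le_sum[of i "{..<n}" "\<lambda>i. dist (z i) (w i)"] sum_nonneg)
  qed
  have "((\<lambda>z. z i) \<longlongrightarrow> w i) (at w within S)" for i
    using continuous_coord[of S i] \<open>w \<in> S\<close> unfolding continuous_on_def by blast
  then have "((\<lambda>z. \<Sum>i<n. dist (z i) (w i)) \<longlongrightarrow> (\<Sum>i<n. dist (w i) (w i))) (at w within S)"
    by (intro tendsto_sum tendsto_dist tendsto_const)
  then have "((\<lambda>z. \<Sum>i<n. dist (z i) (w i)) \<longlongrightarrow> 0) (at w within S)" by simp
  then have "((\<lambda>z. dist (bc_embed n z) (bc_embed n w)) \<longlongrightarrow> 0) (at w within S)"
    by (rule tendsto_0_le[where K = 1]) (auto intro!: always_eventually order_trans[OF bound])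
  then show "(bc_embed n \<longlongrightarrow> bc_embed n w) (at w within S)"
    by (rule tendsto_dist_iff[THEN iffD2])
qed

lemma continuous_apply_bcontfun: "continuous_on S (\<lambda>f :: nat \<Rightarrow>\<^sub>C complex. apply_bcontfun f)"
proof (rule continuous_on_coordinatewise_then_product)
  fix i
  show "continuous_on S (\<lambda>f :: nat \<Rightarrow>\<^sub>C complex. apply_bcontfun f i)"
    unfolding continuous_on_iff
  proof (intro ballI allI impI)
    fix f :: "nat \<Rightarrow>\<^sub>C complex" and e :: real assume "e > 0"
    moreover have "dist (apply_bcontfun g i) (apply_bcontfun f i) \<le> dist g f" for g
      by (rule dist_bounded)
    ultimately show "\<exists>d>0. \<forall>g\<in>S. dist g f < d \<longrightarrow> dist (apply_bcontfun g i) (apply_bcontfun f i) < e"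
      by (meson le_less_trans)
  qed
qed

theorem punctured_cone_trivial_loops:
  assumes d: "d \<ge> 3"
  shows "trivial_loops (cm_cone d - {0})"
proof -
  let ?Y = "cm_cone d - {0}" and ?n = "d + 4"
  let ?X = "bc_embed ?n ` ?Y"
  have d2: "d \<ge> 2" using d by simp
  have inv: "apply_bcontfun (bc_embed ?n z) = z" if "z \<in> cspace {..<?n}" for z
    using cspaceD[OF that] by (auto simp: apply_bc_embed fun_eq_iff)
  have invY: "apply_bcontfun (bc_embed ?n z) = z" if "z \<in> cm_cone d" for z
    using inv cone_in_cspace that by blast
  have inj: "bc_embed ?n z = bc_embed ?n w \<Longrightarrow> z \<in> cm_cone d \<Longrightarrow> w \<in> cm_cone d \<Longrightarrow> z = w" for z w
    by (metis invY)
  have patch: "cm_patch d c \<subseteq> ?Y" for c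
    by (auto simp: cm_patch_def)
  have pre: "bc_embed ?n ` cm_patch d c = ?X \<inter> apply_bcontfun -` {z. aform d c z \<noteq> 0}" for c
    using invY by (auto simp: cm_patch_def)
  have "simply_connected ?X"
  proof (rule simply_connected_cover[where I = UNIV and U = "\<lambda>c. bc_embed ?n ` cm_patch d c"])
    show "?X = (\<Union>c\<in>UNIV. bc_embed ?n ` cm_patch d c)"
    proof
      show "?X \<subseteq> (\<Union>c\<in>UNIV. bc_embed ?n ` cm_patch d c)"
        using aform_nonzero[OF d] by (fastforce simp: cm_patch_def)
      show "(\<Union>c\<in>UNIV. bc_embed ?n ` cm_patch d c) \<subseteq> ?X" using patch by auto
    qed
    show "openin (top_of_set ?X) (bc_embed ?n ` cm_patch d c)" for c
    proof -
      have "open {z. aform d c z \<noteq> 0}"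
        unfolding aform_def by (intro open_Collect_neq continuous_intros continuous_coord)
      then show ?thesis
        unfolding pre by (rule continuous_openin_preimage_gen[OF continuous_apply_bcontfun])
    qed
    \<comment> \<open>The common point of all patches: it has \<open>a_0 = 1\<close> and all other
      coordinates zero, so every form \<open>aform d c\<close> takes the value 1 on it.\<close>
    define b where "b = cm_point d 0 0 0 (\<lambda>j. if j = 0 then 1 else 0)"
    have b: "b \<in> cm_patch d c" for c
    proof -
      have "cm_eqs d (-1) 0 0 0 (\<lambda>j. if j = 0 then 1 else 0)"
      proof (rule cm_eqsI)
        fix j k assume jk: "1 \<le> j" "j \<le> k" "k \<le> d - 1"
        then have "(d - k - 1) + (j - 1) + (k - j) \<noteq> 0" using d by auto
        then have "(0::complex) ^ (d - k - 1) * 0 ^ (j - 1) * 0 ^ (k - j) = 0" by auto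
        then show "(if j - 1 = 0 then 1 else 0) * (if k + 1 = 0 then 1 else 0) - (if j = 0 then 1 else 0) * (if k = 0 then 1 else 0) =
            - 1 * (0::complex) ^ (d - k - 1) * 0 ^ (j - 1) * Psi (k - j) 0 0 0"
          using jk by (simp add: Psi_0_right mult.assoc)
      qed auto
      then have "b \<in> cm_cone d" using d by (simp add: b_def cm_point_in_cone)
      moreover have "aform d c b = 1"
      proof -
        have "aform d c b = (\<Sum>i\<le>d. if i = 0 then 1 else 0)"
          unfolding aform_def b_def by (intro sum.cong) auto
        then show ?thesis by simp
      qed
      ultimately show ?thesis by (simp add: cm_patch_def)
    qed
    show "bc_embed ?n b \<in> bc_embed ?n ` cm_patch d c" for c using b by blast
    show "path_connected (bc_embed ?n ` cm_patch d c \<inter> bc_embed ?n ` cm_patch d c')" for c c'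
    proof -
      have "bc_embed ?n ` cm_patch d c \<inter> bc_embed ?n ` cm_patch d c' = bc_embed ?n ` (cm_patch d c \<inter> cm_patch d c')"
        using inj by (auto simp: cm_patch_def)
      then show ?thesis
        using path_connected_continuous_image[OF continuous_bc_embed cm_patch_path_connected[OF d2]] by simp
    qed
    fix c p assume p: "path p" "path_image p \<subseteq> bc_embed ?n ` cm_patch d c" "pathfinish p = pathstart p"
    let ?p = "apply_bcontfun \<circ> p"
    have "path ?p" by (intro path_continuous_image p continuous_apply_bcontfun)
    moreover have "path_image ?p \<subseteq> cm_patch d c"
      using p(2) invY by (force simp: path_image_compose cm_patch_def)
    moreover have "pathfinish ?p = pathstart ?p" using p(3) by (simp add: pathfinish_compose pathstart_compose)
    ultimately obtain w where "homotopic_loops ?Y ?p (\<lambda>_. w)"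
      using loop_in_patch_null[OF d2] by blast
    then have 1: "homotopic_loops ?X (bc_embed ?n \<circ> ?p) (bc_embed ?n \<circ> (\<lambda>_. w))"
      by (rule homotopic_loops_continuous_image[OF _ continuous_bc_embed]) auto
    have pX: "path_image p \<subseteq> ?X" using p(2) patch by blast
    have "homotopic_loops ?X p (bc_embed ?n \<circ> ?p)"
    proof (rule homotopic_loops_eq[OF p(1) pX p(3)])
      fix t :: real assume "t \<in> {0..1}"
      then have "p t \<in> ?X" using pX by (auto simp: path_image_def)
      then show "p t = (bc_embed ?n \<circ> ?p) t" using invY by auto
    qed
    from homotopic_loops_trans[OF this 1] have "homotopic_loops ?X p (linepath (bc_embed ?n w) (bc_embed ?n w))"
      by (simp add: o_def linepath_refl)
    then show "\<exists>a. homotopic_loops ?X p (linepath a a)" by blast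
  qed
  then have X: "trivial_loops ?X"
    unfolding trivial_loops_def simply_connected_eq_homotopic_paths by blast
  show ?thesis
  proof (rule trivial_loops_retract[OF X continuous_apply_bcontfun])
    show "apply_bcontfun ` ?X = ?Y" using invY by (auto simp: image_image)
    show "continuous_on ?Y (bc_embed ?n)" by (rule continuous_bc_embed)
  qed (use invY in auto)
qed

section \<open>Conical neighbourhoods of the origin\<close>

text \<open>
  Near the origin the factor \<open>d\<^sup>2 - e\<^sup>2 + 4 q Q\<close> is a unit, and rescaling the \<open>a\<^sub>j\<close> by its square root
  identifies \<open>\<Z>(d)\<close> with a weighted homogeneous cone.
\<close>

definition cm_unit :: "nat \<Rightarrow> (nat \<Rightarrow> complex) \<Rightarrow> complex" where
  "cm_unit d z = (of_nat d)\<^sup>2 - (z 2)\<^sup>2 + 4 * z 0 * z 1"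

definition scale_a :: "complex \<Rightarrow> (nat \<Rightarrow> complex) \<Rightarrow> nat \<Rightarrow> complex" where
  "scale_a c z = (\<lambda>i. if i < 3 then z i else c * z i)"

text \<open>The unit depends on \<open>q, Q, e\<close> only, which are not rescaled; therefore it
  has the same value before and after, and \<open>from_cm\<close> is the inverse.\<close>

definition to_cm :: "nat \<Rightarrow> (nat \<Rightarrow> complex) \<Rightarrow> nat \<Rightarrow> complex" where
  "to_cm d z = scale_a (csqrt (cm_unit d z)) z"

definition from_cm :: "nat \<Rightarrow> (nat \<Rightarrow> complex) \<Rightarrow> nat \<Rightarrow> complex" where
  "from_cm d z = scale_a (1 / csqrt (cm_unit d z)) z"

text \<open>In the right half-plane the principal square root is holomorphic and nonzero. The origin
  belongs to the region because the unit takes the value \<open>d^2\<close> there.\<close>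

definition cm_region :: "nat \<Rightarrow> (nat \<Rightarrow> complex) set" where
  "cm_region d = {z. 0 < Re (cm_unit d z)}"

lemma cm_unit_scale_a [simp]: "cm_unit d (scale_a c z) = cm_unit d z"
  by (simp add: cm_unit_def scale_a_def)

lemma scale_a_in_cspace: "z \<in> cspace I \<Longrightarrow> scale_a c z \<in> cspace I"
  by (auto simp: scale_a_def cspace_def)

lemma scale_a_scale_a: "scale_a c (scale_a c' z) = scale_a (c * c') z"
  by (auto simp: scale_a_def)

lemma scale_a_1 [simp]: "scale_a 1 z = z"
  by (auto simp: scale_a_def)

lemma scale_a_0 [simp]: "scale_a c 0 = 0"
proof
  fix i show "scale_a c 0 i = (0 :: nat \<Rightarrow> complex) i" by (simp add: scale_a_def)
qed

lemma region_nonzero: "z \<in> cm_region d \<Longrightarrow> csqrt (cm_unit d z) \<noteq> 0"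
  by (auto simp: cm_region_def)

lemma to_cm_region [simp]: "to_cm d z \<in> cm_region d \<longleftrightarrow> z \<in> cm_region d"
  and from_cm_region [simp]: "from_cm d z \<in> cm_region d \<longleftrightarrow> z \<in> cm_region d"
  by (simp_all add: cm_region_def to_cm_def from_cm_def)

lemma from_to_cm: "z \<in> cm_region d \<Longrightarrow> from_cm d (to_cm d z) = z"
  using region_nonzero[of z d] by (simp add: from_cm_def to_cm_def scale_a_scale_a)

lemma to_from_cm: "z \<in> cm_region d \<Longrightarrow> to_cm d (from_cm d z) = z"
  using region_nonzero[of z d] by (simp add: from_cm_def to_cm_def scale_a_scale_a)

lemma to_cm_0 [simp]: "to_cm d 0 = 0"
  by (simp add: to_cm_def)

lemma scale_a_eqs:
  assumes "cm_eqs d \<kappa> (z 0) (z 1) (z 2) (\<lambda>j. z (j + 3))" "\<kappa>' = \<kappa> * c\<^sup>2"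
  shows "cm_eqs d \<kappa>' (scale_a c z 0) (scale_a c z 1) (scale_a c z 2) (\<lambda>j. scale_a c z (j + 3))"
  using cm_eqs_scale[OF assms(1), of \<kappa>' 1 c] assms(2) by (simp add: scale_a_def)

lemma to_cm_in:
  assumes "z \<in> cm_cone d"
  shows "to_cm d z \<in> calogero_moser d"
proof -
  have "cm_eqs d (- cm_unit d z) (to_cm d z 0) (to_cm d z 1) (to_cm d z 2) (\<lambda>j. to_cm d z (j + 3))"
    using assms unfolding to_cm_def by (intro scale_a_eqs[where \<kappa> = "-1"]) (auto simp: cm_cone_def)
  moreover have "- cm_unit d z = (to_cm d z 2)\<^sup>2 - 4 * to_cm d z 0 * to_cm d z 1 - (of_nat d)\<^sup>2"
    by (simp add: cm_unit_def to_cm_def scale_a_def)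
  moreover have "to_cm d z \<in> cspace {..<d + 4}"
    using assms unfolding to_cm_def by (intro scale_a_in_cspace) (auto simp: cm_cone_def)
  ultimately show ?thesis by (simp add: calogero_moser_eq)
qed

lemma from_cm_in:
  assumes z: "z \<in> calogero_moser d" "z \<in> cm_region d"
  shows "from_cm d z \<in> cm_cone d"
proof -
  have "cm_eqs d (- cm_unit d z) (z 0) (z 1) (z 2) (\<lambda>j. z (j + 3))"
  proof -
    have "- cm_unit d z = (z 2)\<^sup>2 - 4 * z 0 * z 1 - (of_nat d)\<^sup>2" by (simp add: cm_unit_def)
    then show ?thesis using z(1) by (simp add: calogero_moser_eq)
  qed
  moreover have "-1 = - cm_unit d z * (1 / csqrt (cm_unit d z))\<^sup>2"
    using region_nonzero[OF z(2)] by (simp add: power_divide)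
  ultimately have "cm_eqs d (-1) (from_cm d z 0) (from_cm d z 1) (from_cm d z 2) (\<lambda>j. from_cm d z (j + 3))"
    unfolding from_cm_def by (rule scale_a_eqs)
  moreover have "from_cm d z \<in> cspace {..<d + 4}"
    using z(1) unfolding from_cm_def by (intro scale_a_in_cspace) (auto simp: calogero_moser_eq)
  ultimately show ?thesis by (simp add: cm_cone_def)
qed

lemma continuous_cm_unit: "continuous_on S (cm_unit d)"
  unfolding cm_unit_def by (intro continuous_intros continuous_coord)

lemma open_cm_region: "open (cm_region d)"
  unfolding cm_region_def by (intro open_Collect_less continuous_intros continuous_cm_unit)

lemma continuous_scale_a:
  assumes "continuous_on S c"
  shows "continuous_on S (\<lambda>z. scale_a (c z) z)"
proof (rule continuous_on_coordinatewise_then_product)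
  fix i show "continuous_on S (\<lambda>z. scale_a (c z) z i)"
    unfolding scale_a_def by (cases "i < 3") (auto intro!: continuous_intros continuous_coord assms)
qed

lemma continuous_csqrt_unit: "continuous_on (cm_region d) (\<lambda>z. csqrt (cm_unit d z))"
proof -
  have "continuous_on {u. 0 < Re u} csqrt"
    by (intro continuous_at_imp_continuous_on ballI continuous_at_csqrt)
      (auto simp: complex_nonpos_Reals_iff)
  then show ?thesis
    by (rule continuous_on_compose2[OF _ continuous_cm_unit]) (auto simp: cm_region_def)
qed

lemma continuous_to_cm: "continuous_on (cm_region d) (to_cm d)"
  unfolding to_cm_def[abs_def] by (intro continuous_scale_a continuous_csqrt_unit)

lemma continuous_from_cm: "continuous_on (cm_region d) (from_cm d)"
  unfolding from_cm_def[abs_def] using region_nonzero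
  by (intro continuous_scale_a continuous_intros continuous_csqrt_unit) auto

text \<open>The weights 2 and \<open>d - 2\<close> balance the equations, both sides getting weight
  \<open>2 (d - 2)\<close>. Halving them would produce half-integers for odd
  \<open>d\<close>.\<close>

definition dil :: "nat \<Rightarrow> real \<Rightarrow> (nat \<Rightarrow> complex) \<Rightarrow> nat \<Rightarrow> complex" where
  "dil d s z = (\<lambda>i. if i < 3 then of_real (s\<^sup>2) * z i else of_real (s ^ (d - 2)) * z i)"

lemma dil_dil: "dil d s (dil d t z) = dil d (s * t) z"
  by (auto simp: dil_def power_mult_distrib)

lemma dil_1 [simp]: "dil d 1 z = z"
  by (auto simp: dil_def)

lemma dil_0:
  assumes "d \<ge> 3"
  shows "dil d 0 z = 0"
proof
  fix i show "dil d 0 z i = (0 :: nat \<Rightarrow> complex) i" using assms by (simp add: dil_def)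
qed

lemma dil_in_cone:
  assumes "z \<in> cm_cone d"
  shows "dil d s z \<in> cm_cone d"
proof -
  define r c where "r = complex_of_real (s\<^sup>2)" and "c = complex_of_real (s ^ (d - 2))"
  have "r ^ (d - 2) = c\<^sup>2" unfolding r_def c_def of_real_power by (simp flip: power_mult add: mult.commute)
  then have "cm_eqs d (-1) (r * z 0) (r * z 1) (r * z 2) (\<lambda>j. c * z (j + 3))"
    using assms by (intro cm_eqs_scale[where \<kappa> = "-1"]) (auto simp: cm_cone_def)
  moreover have "dil d s z \<in> cspace {..<d + 4}" using assms by (auto simp: cm_cone_def cspace_def dil_def)
  ultimately show ?thesis by (simp add: cm_cone_def dil_def r_def c_def)
qed

lemma continuous_dil:
  assumes f: "continuous_on S f" and g: "continuous_on S g"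
  shows "continuous_on S (\<lambda>x. dil d (f x) (g x))"
proof (rule continuous_on_coordinatewise_then_product)
  fix i
  have "continuous_on S (\<lambda>x. g x i)" using g by (rule continuous_on_product_then_coordinatewise)
  then show "continuous_on S (\<lambda>x. dil d (f x) (g x) i)"
    unfolding dil_def by (cases "i < 3") (auto intro!: continuous_intros f)
qed

text \<open>The exponents complement the weights of \<open>dil\<close>, so that every summand is
  homogeneous of degree \<open>2 (d - 2)\<close>; the root of this order in \<open>wnorm\<close> is
  then homogeneous of degree one.\<close>

definition wsum :: "nat \<Rightarrow> (nat \<Rightarrow> complex) \<Rightarrow> real" where
  "wsum d z = (\<Sum>i<3. cmod (z i) ^ (d - 2)) + (\<Sum>i\<in>{3..<d + 4}. (cmod (z i))\<^sup>2)"

definition wnorm :: "nat \<Rightarrow> (nat \<Rightarrow> complex) \<Rightarrow> real" where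
  "wnorm d z = root (2 * (d - 2)) (wsum d z)"

lemma wsum_nonneg: "wsum d z \<ge> 0"
  unfolding wsum_def by (intro add_nonneg_nonneg sum_nonneg) auto

lemma wnorm_nonneg: "wnorm d z \<ge> 0"
  unfolding wnorm_def by (rule real_root_ge_zero[OF wsum_nonneg])

lemma wsum_coord:
  shows "i < 3 \<Longrightarrow> cmod (z i) ^ (d - 2) \<le> wsum d z"
    and "3 \<le> i \<Longrightarrow> i < d + 4 \<Longrightarrow> (cmod (z i))\<^sup>2 \<le> wsum d z"
proof -
  have 1: "(\<Sum>i<3. cmod (z i) ^ (d - 2)) \<ge> 0" "(\<Sum>i\<in>{3..<d + 4}. (cmod (z i))\<^sup>2) \<ge> 0"
    by (auto intro: sum_nonneg)
  show "cmod (z i) ^ (d - 2) \<le> wsum d z" if "i < 3"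
    using member_le_sum[of i "{..<3}" "\<lambda>i. cmod (z i) ^ (d - 2)"] 1 that by (simp add: wsum_def)
  show "(cmod (z i))\<^sup>2 \<le> wsum d z" if "3 \<le> i" "i < d + 4"
    using member_le_sum[of i "{3..<d + 4}" "\<lambda>i. (cmod (z i))\<^sup>2"] 1 that by (simp add: wsum_def)
qed

lemma wnorm_power:
  assumes "d \<ge> 3"
  shows "wnorm d z ^ (2 * (d - 2)) = wsum d z"
  unfolding wnorm_def using assms by (intro real_root_pow_pos2 wsum_nonneg) auto

lemma wsum_dil: "s \<ge> 0 \<Longrightarrow> wsum d (dil d s z) = s ^ (2 * (d - 2)) * wsum d z"
  by (simp add: wsum_def dil_def norm_mult norm_power power_mult_distrib sum_distrib_left distrib_left mult.commute
      flip: power_mult)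

lemma wnorm_dil:
  assumes "d \<ge> 3" "s \<ge> 0"
  shows "wnorm d (dil d s z) = s * wnorm d z"
  unfolding wnorm_def wsum_dil[OF assms(2)] real_root_mult using assms
  by (subst real_root_power_cancel) auto

lemma wnorm_eq_0_iff:
  assumes d: "d \<ge> 3" and z: "z \<in> cspace {..<d + 4}"
  shows "wnorm d z = 0 \<longleftrightarrow> z = 0"
proof
  assume "wnorm d z = 0"
  then have 0: "wsum d z = 0" using wnorm_power[OF d, of z] d by (simp add: power_0_left)
  have "z i = 0" for i
  proof -
    consider "i < 3" | "3 \<le> i" "i < d + 4" | "\<not> i < d + 4" by linarith
    then show ?thesis
      using wsum_coord(1)[of i z d] wsum_coord(2)[of i d z] 0 cspaceD[OF z, of i] d by cases (auto simp: power_le_zero_eq)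
  qed
  then show "z = 0" by (simp add: fun_eq_iff)
next
  assume "z = 0"
  then have "wsum d z = 0" using d by (simp add: wsum_def)
  then show "wnorm d z = 0" by (simp add: wnorm_def)
qed

lemma continuous_wnorm: "continuous_on S (wnorm d)"
  unfolding wnorm_def wsum_def by (intro continuous_intros continuous_coord)

lemma closed_cm_cone: "closed (cm_cone d)"
proof -
  let ?C = "\<lambda>j k. {z :: nat \<Rightarrow> complex. z 2 * z (j + 3) = z 0 * z (j + 1 + 3) + z 1 * z (j - 1 + 3)} \<inter>
      {z. z (j - 1 + 3) * z (k + 1 + 3) - z (j + 3) * z (k + 3) =
         -1 * z 0 ^ (d - k - 1) * z 1 ^ (j - 1) * Psi (k - j) (z 0) (z 1) (z 2)}"
  have "cm_cone d = cspace {..<d + 4} \<inter> (\<Inter>(j, k)\<in>{(j, k). 1 \<le> j \<and> j \<le> k \<and> k \<le> d - 1}. ?C j k)"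
    unfolding cm_cone_def cm_eqs_def by blast
  also have "closed \<dots>"
    by (intro closed_Int closed_cspace closed_INT ballI, unfold case_prod_unfold,
        intro closed_Int closed_Collect_eq continuous_intros continuous_on_Psi continuous_coord)
  finally show ?thesis .
qed

lemma compact_link:
  assumes d: "d \<ge> 3"
  shows "compact {z \<in> cm_cone d. wnorm d z = 1}"
proof -
  let ?K = "\<lambda>i. if i < d + 4 then cball 0 1 else {0 :: complex}"
  have "compactin (product_topology (\<lambda>_. euclidean) UNIV) (Pi\<^sub>E UNIV ?K)"
    unfolding compactin_PiE by (auto simp: compactin_euclidean_iff)
  then have K: "compact (Pi\<^sub>E UNIV ?K)"
    by (simp add: euclidean_product_topology compactin_euclidean_iff)
  have "{z \<in> cm_cone d. wnorm d z = 1} \<subseteq> Pi\<^sub>E UNIV ?K"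
  proof
    fix z assume z: "z \<in> {z \<in> cm_cone d. wnorm d z = 1}"
    then have w: "wsum d z = 1" using wnorm_power[OF d, of z] by simp
    have "z i \<in> ?K i" for i
    proof -
      consider "i < 3" | "3 \<le> i" "i < d + 4" | "\<not> i < d + 4" by linarith
      then show ?thesis
      proof cases
        case 1
        then have "cmod (z i) ^ (d - 2) \<le> 1" using wsum_coord(1)[of i z d] w by simp
        then have "cmod (z i) \<le> 1" using d by (metis diff_is_0_eq not_less_eq_eq numeral_2_eq_2 numeral_3_eq_3 power_le_one_iff norm_ge_zero)
        then show ?thesis using 1 by simp
      next
        case 2
        then have "(cmod (z i))\<^sup>2 \<le> 1" using wsum_coord(2)[of i d z] w by simp
        then show ?thesis using 2 by (simp add: abs_square_le_1)
      next
        case 3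
        then show ?thesis using z cone_in_cspace cspaceD by fastforce
      qed
    qed
    then show "z \<in> Pi\<^sub>E UNIV ?K" by (simp add: PiE_iff)
  qed
  then have "{z \<in> cm_cone d. wnorm d z = 1} = Pi\<^sub>E UNIV ?K \<inter> (cm_cone d \<inter> {z. wnorm d z = 1})" by blast
  also have "compact \<dots>"
    by (intro compact_Int_closed K closed_Int closed_cm_cone closed_Collect_eq continuous_wnorm continuous_on_const)
  finally show ?thesis .
qed

text \<open>The neighbourhoods are the images under \<open>to_cm\<close> of small balls for the
  weighted norm. Dilating the link \<open>wnorm = 1\<close> gives their conical structure, and a
  radial rescaling identifies the punctured ball with the whole punctured cone.\<close>

theorem calogero_moser_local_fundamental_group:
  assumes d: "d \<ge> 3"
  shows "has_local_fundamental_group (calogero_moser d) 0 (singleton_group ())"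
  unfolding has_local_fundamental_group_def
proof (intro allI impI)
  fix W assume W: "openin (top_of_set (calogero_moser d)) W \<and> 0 \<in> W"
  let ?Z = "calogero_moser d" and ?Y = "cm_cone d" and ?R = "cm_region d" and ?N = "wnorm d"
  obtain W' where W': "open W'" "W = ?Z \<inter> W'" using W by (auto simp: openin_open)
  have "open (?R \<inter> to_cm d -` W')"
    by (rule continuous_open_preimage[OF continuous_to_cm open_cm_region W'(1)])
  moreover have "0 \<in> ?R \<inter> to_cm d -` W'"
    using W W'(2) d by (simp add: cm_region_def cm_unit_def)
  ultimately obtain \<delta> F where \<delta>: "\<delta> > 0" "\<And>z. (\<forall>i\<in>F. cmod (z i - 0 i) < \<delta>) \<Longrightarrow> z \<in> ?R \<inter> to_cm d -` W'"
    using polydisc_subset_open by metis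
  \<comment> \<open>Below 1, so that the powers occurring in \<open>wsum\<close> bound each
    coordinate, and below \<delta>, so that the coordinates stay in the given polydisc.\<close>
  define \<epsilon> where "\<epsilon> = min \<delta> 1 / 2"
  have \<epsilon>: "\<epsilon> > 0" "\<epsilon> < 1" "\<epsilon> < \<delta>" using \<delta>(1) by (auto simp: \<epsilon>_def)
  have small: "y \<in> ?R" "to_cm d y \<in> W'" if y: "y \<in> ?Y" "?N y \<le> \<epsilon>" for y
  proof -
    have w: "wsum d y \<le> \<epsilon> ^ (2 * (d - 2))"
      unfolding wnorm_power[OF d, symmetric] using y(2) wnorm_nonneg by (rule power_mono)
    have e1: "\<epsilon> ^ (2 * (d - 2)) \<le> \<epsilon> ^ (d - 2)" "\<epsilon> ^ (2 * (d - 2)) \<le> \<epsilon>\<^sup>2"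
      using \<epsilon> d by (auto intro!: power_decreasing)
    have e2: "\<epsilon> ^ (d - 2) < \<delta> ^ (d - 2)" "\<epsilon>\<^sup>2 < \<delta>\<^sup>2"
      using \<epsilon> d by (auto intro!: power_strict_mono)
    have "cmod (y i - 0 i) < \<delta>" for i
    proof -
      consider "i < 3" | "3 \<le> i" "i < d + 4" | "\<not> i < d + 4" by linarith
      then have "cmod (y i) < \<delta>"
      proof cases
        case 1
        then have "cmod (y i) ^ (d - 2) < \<delta> ^ (d - 2)" by (rule order.strict_trans1[OF order.trans[OF order.trans[OF wsum_coord(1) w] e1(1)] e2(1)])
        then show ?thesis by (rule power_less_imp_less_base) (use \<delta>(1) in simp)
      next
        case 2
        then have "cmod (y i) ^ 2 < \<delta> ^ 2" by (rule order.strict_trans1[OF order.trans[OF order.trans[OF wsum_coord(2) w] e1(2)] e2(2)])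
        then show ?thesis by (rule power_less_imp_less_base) (use \<delta>(1) in simp)
      next
        case 3
        then have "y i = 0" using y(1) cone_in_cspace cspaceD by fastforce
        then show ?thesis using \<delta>(1) by simp
      qed
      then show ?thesis by simp
    qed
    then have "y \<in> ?R \<inter> to_cm d -` W'" by (intro \<delta>(2)) blast
    then show "y \<in> ?R" "to_cm d y \<in> W'" by auto
  qed
  define U0 where "U0 = {y \<in> ?Y. ?N y < \<epsilon>}"
  define U where "U = to_cm d ` U0"
  define T where "T = to_cm d ` {y \<in> ?Y. ?N y \<le> \<epsilon>}"
  define L where "L = {z \<in> ?Y. ?N z = 1}"
  define h where "h u = to_cm d (dil d (fst u * \<epsilon>) (snd u))" for u
  have U0R: "U0 \<subseteq> ?R" using small by (auto simp: U0_def)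
  have U_eq: "U = ?Z \<inter> (?R \<inter> (\<lambda>z. ?N (from_cm d z)) -` {..<\<epsilon>})"
  proof (intro equalityI subsetI)
    fix z assume "z \<in> U"
    then obtain y where y: "y \<in> U0" "z = to_cm d y" by (auto simp: U_def)
    then have "y \<in> ?R" using U0R by auto
    then show "z \<in> ?Z \<inter> (?R \<inter> (\<lambda>z. ?N (from_cm d z)) -` {..<\<epsilon>})"
      using y to_cm_in by (auto simp: from_to_cm U0_def)
  next
    fix z assume z: "z \<in> ?Z \<inter> (?R \<inter> (\<lambda>z. ?N (from_cm d z)) -` {..<\<epsilon>})"
    then have "from_cm d z \<in> U0" using from_cm_in by (auto simp: U0_def)
    moreover have "z = to_cm d (from_cm d z)" using z by (simp add: to_from_cm)
    ultimately show "z \<in> U" unfolding U_def using image_eqI[of z "to_cm d" "from_cm d z" U0] by blast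
  qed
  have U_open: "openin (top_of_set ?Z) U"
    unfolding U_eq
    by (intro openin_open_Int continuous_open_preimage open_cm_region
        continuous_on_compose2[OF continuous_wnorm[of UNIV] continuous_from_cm]) auto
  have UW: "U \<subseteq> W"
  proof
    fix z assume "z \<in> U"
    then obtain y where "y \<in> ?Y" "?N y < \<epsilon>" "z = to_cm d y" by (auto simp: U_def U0_def)
    then show "z \<in> W" using small(2)[of y] to_cm_in[of y d] W'(2) by simp
  qed
  have N0: "?N 0 = 0" using d by (simp add: wnorm_eq_0_iff)
  have Y0: "0 \<in> ?Y"
    using dil_in_cone[of "cm_line d 0" d 0] cm_line_in_cone[of d 0] d by (simp add: dil_0)
  have U_0: "0 \<in> U"
    unfolding U_def using Y0 N0 \<epsilon>(1) by (intro image_eqI[of _ _ 0]) (auto simp: U0_def)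
  have Lc: "compact L" unfolding L_def by (rule compact_link[OF d])
  have normalise: "dil d (1 / ?N y) y \<in> L" "y = dil d (?N y) (dil d (1 / ?N y) y)" if "y \<in> ?Y" "y \<noteq> 0" for y
  proof -
    have "?N y > 0" using that wnorm_eq_0_iff[OF d, of y] wnorm_nonneg[of d y] cone_in_cspace by fastforce
    then show "dil d (1 / ?N y) y \<in> L" "y = dil d (?N y) (dil d (1 / ?N y) y)"
      using that d by (simp_all add: L_def dil_in_cone wnorm_dil dil_dil)
  qed
  obtain l0 where l0: "l0 \<in> L"
    using normalise(1)[of "cm_line d 0"] cm_line_in_cone[of d 0] d by auto
  have Ndil: "?N (dil d (t * \<epsilon>) l) = t * \<epsilon>" "dil d (t * \<epsilon>) l \<in> ?Y" if "l \<in> L" "t \<ge> 0" for t l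
    using that \<epsilon>(1) d by (auto simp: L_def wnorm_dil dil_in_cone)
  have dilR: "dil d (t * \<epsilon>) l \<in> ?R" if "l \<in> L" "t \<in> {0..1}" for t l
    using small(1)[OF Ndil(2)] Ndil(1) that \<epsilon>(1) by (auto simp: mult_le_cancel_right1)
  have hK: "h ` ({0..1} \<times> L) = T"
  proof (intro equalityI subsetI)
    fix z assume "z \<in> h ` ({0..1} \<times> L)"
    then obtain t l where tl: "t \<in> {0..1}" "l \<in> L" "z = to_cm d (dil d (t * \<epsilon>) l)" by (auto simp: h_def)
    then have "?N (dil d (t * \<epsilon>) l) \<le> \<epsilon>" using Ndil(1) \<epsilon>(1) by (simp add: mult_le_cancel_right1)
    then show "z \<in> T" using tl Ndil(2) by (auto simp: T_def)
  next
    fix z assume "z \<in> T"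
    then obtain y where y: "y \<in> ?Y" "?N y \<le> \<epsilon>" "z = to_cm d y" by (auto simp: T_def)
    show "z \<in> h ` ({0..1} \<times> L)"
    proof (cases "y = 0")
      case True
      then have "z = h (0, l0)" using y d by (simp add: h_def dil_0)
      then show ?thesis using l0 by auto
    next
      case False
      have "z = h (?N y / \<epsilon>, dil d (1 / ?N y) y)"
        using normalise(2)[OF y(1) False] y(3) \<epsilon>(1) by (simp add: h_def)
      then show ?thesis
        using normalise(1)[OF y(1) False] y(2) \<epsilon>(1) wnorm_nonneg[of d y]
        by (intro image_eqI[of _ _ "(?N y / \<epsilon>, dil d (1 / ?N y) y)"]) auto
    qed
  qed
  have hcont: "continuous_on ({0..1} \<times> L) h"
    unfolding h_def using dilR
    by (intro continuous_on_compose2[OF continuous_to_cm] continuous_dil continuous_intros) auto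
  have hU: "h (t, l) \<in> U \<longleftrightarrow> t < 1" if "t \<in> {0..1}" "l \<in> L" for t l
  proof -
    have "h (t, l) \<in> U \<longleftrightarrow> ?N (dil d (t * \<epsilon>) l) < \<epsilon>"
      using dilR[OF that(2,1)] Ndil(2)[OF that(2), of t] to_cm_in that(1) unfolding U_eq h_def
      by (auto simp: from_to_cm)
    then show ?thesis using Ndil(1)[OF that(2), of t] that(1) \<epsilon>(1) by simp
  qed
  have UT: "U \<subseteq> T" by (auto simp: U_def T_def U0_def)
  have TZ: "T \<subseteq> ?Z" using to_cm_in by (auto simp: T_def)
  \<comment> \<open>Over the closed interval the source is compact and the target Hausdorff, so a
    continuous surjection is a quotient map; it stays one when restricted to the preimage of the
    open set \<open>U\<close>, which is the half-open cone.\<close>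
  have quot: "quotient_map (prod_topology (top_of_set {0..<1::real}) (top_of_set L)) (top_of_set U) h"
  proof -
    have "compact ({0..1::real} \<times> L)" using Lc by (intro compact_Times) auto
    then have q1: "quotient_map (top_of_set ({0..1} \<times> L)) (top_of_set T) h"
      using hcont hK
      by (intro continuous_imp_quotient_map compact_space_subtopology Hausdorff_space_subtopology) auto
    have q2: "{x \<in> topspace (top_of_set ({0..1} \<times> L)). h x \<in> U} = {0..<1} \<times> L"
      using hU by auto
    have q3: "openin (top_of_set T) U"
      using U_open UT TZ by (rule openin_subset_trans)
    have "quotient_map (subtopology (top_of_set ({0..1} \<times> L)) ({0..<1} \<times> L)) (subtopology (top_of_set T) U) h"
      by (rule quotient_map_restriction[OF q1 q2 disjI1[OF q3]])
    moreover have "subtopology (top_of_set ({0..1} \<times> L)) ({0..<1::real} \<times> L) = top_of_set ({0..<1} \<times> L)"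
    proof -
      have eq: "({0..1} \<times> L) \<inter> ({0..<1::real} \<times> L) = {0..<1} \<times> L" by auto
      show ?thesis unfolding subtopology_subtopology eq ..
    qed
    moreover have "subtopology (top_of_set T) U = top_of_set U"
      unfolding subtopology_subtopology Int_absorb1[OF UT] ..
    ultimately show ?thesis by simp
  qed
  have con: "conical_neighbourhood ?Z 0 U"
    unfolding conical_neighbourhood_def
  proof (intro conjI exI)
    show "\<forall>l\<in>L. h (0, l) = 0" using d by (simp add: h_def dil_0)
    show "\<forall>s\<in>{0..<1}. \<forall>t\<in>{0..<1}. \<forall>l\<in>L. \<forall>m\<in>L. (h (s, l) = h (t, m)) = (s = t \<and> l = m \<or> s = 0 \<and> t = 0)"
    proof (intro ballI iffI)
      fix s t l m assume st: "s \<in> {0..<1::real}" "t \<in> {0..<1::real}" and lm: "l \<in> L" "m \<in> L"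
      show "s = t \<and> l = m \<or> s = 0 \<and> t = 0" if "h (s, l) = h (t, m)"
      proof -
        have "dil d (s * \<epsilon>) l = from_cm d (h (s, l))"
          using dilR[OF lm(1), of s] st by (simp add: h_def from_to_cm)
        also have "\<dots> = dil d (t * \<epsilon>) m"
          unfolding that using dilR[OF lm(2), of t] st by (simp add: h_def from_to_cm)
        finally have eq: "dil d (s * \<epsilon>) l = dil d (t * \<epsilon>) m" .
        then have "s * \<epsilon> = t * \<epsilon>"
          using Ndil(1)[OF lm(1), of s] Ndil(1)[OF lm(2), of t] st by auto
        then have "s = t" using \<epsilon>(1) by simp
        moreover have "l = m" if "s \<noteq> 0"
        proof -
          have "dil d (1 / (s * \<epsilon>)) (dil d (s * \<epsilon>) l) = dil d (1 / (s * \<epsilon>)) (dil d (s * \<epsilon>) m)"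
            using eq \<open>s = t\<close> by simp
          then show ?thesis using that \<epsilon>(1) by (simp add: dil_dil)
        qed
        ultimately show ?thesis by blast
      qed
      show "h (s, l) = h (t, m)" if "s = t \<and> l = m \<or> s = 0 \<and> t = 0"
        using that d by (auto simp: h_def dil_0)
    qed
  qed (use U_open U_0 Lc quot in auto)
  \<comment> \<open>On weighted norms this is \<open>r \<mapsto> \<epsilon> r / (1 + r)\<close>, a
    bijection of the half-line onto the interval below \<epsilon>; \<open>g\<close> realises the
    inverse \<open>r \<mapsto> r / (\<epsilon> - r)\<close>.\<close>
  define f where "f y = to_cm d (dil d (\<epsilon> / (1 + ?N y)) y)" for y
  define g where "g z = dil d (1 / (\<epsilon> - ?N (from_cm d z))) (from_cm d z)" for z
  have Nf: "?N (dil d (\<epsilon> / (1 + ?N y)) y) < \<epsilon>" for y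
  proof -
    have "\<epsilon> * ?N y / (1 + ?N y) < \<epsilon>"
      using wnorm_nonneg[of d y] \<epsilon>(1) by (simp add: divide_simps)
    then show ?thesis using wnorm_nonneg[of d y] \<epsilon>(1) d by (simp add: wnorm_dil)
  qed
  have fU: "f y \<in> U - {0}" if y: "y \<in> ?Y - {0}" for y
  proof -
    let ?y = "dil d (\<epsilon> / (1 + ?N y)) y"
    have yU: "?y \<in> U0" using Nf y by (simp add: U0_def dil_in_cone)
    have "f y \<noteq> 0"
    proof
      assume "f y = 0"
      then have "from_cm d (to_cm d ?y) = from_cm d (to_cm d 0)" by (simp add: f_def)
      moreover have "0 \<in> ?R" using small(1)[OF Y0] N0 \<epsilon>(1) by simp
      ultimately have "?y = 0" using yU U0R by (simp add: from_to_cm subset_iff del: to_cm_0)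
      then have "?N ?y = 0" using N0 by simp
      then have "?N y = 0" using wnorm_nonneg[of d y] \<epsilon>(1) d by (simp add: wnorm_dil)
      then show False using y wnorm_eq_0_iff[OF d, of y] cone_in_cspace by auto
    qed
    then show ?thesis using yU by (auto simp: U_def f_def)
  qed
  have from0: "from_cm d z \<in> U0" "from_cm d z \<noteq> 0" "z = to_cm d (from_cm d z)" if z: "z \<in> U - {0}" for z
  proof -
    obtain y where y: "y \<in> U0" "z = to_cm d y" using z by (auto simp: U_def)
    then have "from_cm d z = y" using U0R by (auto simp: from_to_cm)
    then show "from_cm d z \<in> U0" "from_cm d z \<noteq> 0" "z = to_cm d (from_cm d z)" using y z by auto
  qed
  have gY: "g z \<in> ?Y - {0}" "f (g z) = z" if z: "z \<in> U - {0}" for z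
  proof -
    let ?w = "from_cm d z"
    have w: "?w \<in> ?Y" "?N ?w < \<epsilon>" using from0(1)[OF z] by (auto simp: U0_def)
    have wN: "?N ?w > 0"
      using w from0(2)[OF z] wnorm_eq_0_iff[OF d, of ?w] wnorm_nonneg[of d ?w] cone_in_cspace by fastforce
    have gN: "?N (g z) = ?N ?w / (\<epsilon> - ?N ?w)" using w d by (simp add: g_def wnorm_dil)
    then have "?N (g z) > 0" using wN w by simp
    then have "g z \<noteq> 0" using N0 by auto
    then show "g z \<in> ?Y - {0}" using w by (simp add: g_def dil_in_cone)
    have "\<epsilon> / (1 + ?N (g z)) = \<epsilon> - ?N ?w"
    proof -
      have "1 + ?N (g z) = \<epsilon> / (\<epsilon> - ?N ?w)" using w gN by (simp add: field_simps)
      then show ?thesis using \<epsilon>(1) by simp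
    qed
    then have "f (g z) = to_cm d (dil d ((\<epsilon> - ?N ?w) * (1 / (\<epsilon> - ?N ?w))) ?w)"
      by (simp only: f_def) (simp only: g_def dil_dil)
    also have "\<dots> = z" using w from0(3)[OF z] by simp
    finally show "f (g z) = z" .
  qed
  have "trivial_loops (U - {0})"
  proof (rule trivial_loops_retract[OF punctured_cone_trivial_loops[OF d], of f _ g])
    have "1 + ?N y \<noteq> 0" for y using wnorm_nonneg[of d y] by simp
    then show "continuous_on (?Y - {0}) f"
      unfolding f_def using small(1)[OF dil_in_cone less_imp_le[OF Nf]]
      by (intro continuous_on_compose2[OF continuous_to_cm] continuous_dil continuous_intros continuous_wnorm) auto
    show "f ` (?Y - {0}) = U - {0}"
      using fU gY by (metis (no_types, lifting) equalityI image_eqI image_subsetI subsetI)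
    have "U - {0} \<subseteq> ?R" by (auto simp: U_eq)
    then have c: "continuous_on (U - {0}) (from_cm d)" by (rule continuous_on_subset[OF continuous_from_cm])
    have "\<epsilon> - ?N (from_cm d z) \<noteq> 0" if "z \<in> U - {0}" for z using from0(1)[OF that] by (simp add: U0_def)
    then show "continuous_on (U - {0}) g"
      unfolding g_def
      by (intro continuous_dil continuous_intros continuous_on_compose2[OF continuous_wnorm[of UNIV] c] c) auto
  qed (use gY in auto)
  then show "\<exists>U\<subseteq>W. conical_neighbourhood ?Z 0 U \<and> path_connected (U - {0}) \<and>
      (\<forall>b\<in>U - {0}. fundamental_group (U - {0}) b \<cong> singleton_group ())"
    using UW con trivial_fundamental_group by (intro exI[of _ U]) (auto simp: trivial_loops_def)
qed

section \<open>Absolutely convergent power series\<close>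

definition mono_exps :: "'i set \<Rightarrow> ('i \<Rightarrow> nat) set" where
  "mono_exps I = {\<alpha>. \<forall>i. i \<notin> I \<longrightarrow> \<alpha> i = 0}"

definition monom_at :: "'i set \<Rightarrow> ('i \<Rightarrow> complex) \<Rightarrow> ('i \<Rightarrow> nat) \<Rightarrow> complex" where
  "monom_at I w \<alpha> = (\<Prod>i\<in>I. w i ^ \<alpha> i)"

definition total_degree :: "'i set \<Rightarrow> ('i \<Rightarrow> nat) \<Rightarrow> nat" where
  "total_degree I \<alpha> = (\<Sum>i\<in>I. \<alpha> i)"

text \<open>\<open>K\<close> bounds the norm of the expansion of \<open>f\<close> at \<open>p\<close> in the Banach algebra of power series that
  converge absolutely on the closed polydisc of radius \<open>\<rho>\<close>.\<close>

definition majorized ::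
    "'i set \<Rightarrow> ('i \<Rightarrow> complex) \<Rightarrow> real \<Rightarrow> real \<Rightarrow> (('i \<Rightarrow> complex) \<Rightarrow> complex) \<Rightarrow> bool" where
  "majorized I p \<rho> K f \<longleftrightarrow>
     (\<exists>c L. ((\<lambda>\<alpha>. cmod (c \<alpha>) * \<rho> ^ total_degree I \<alpha>) has_sum L) (mono_exps I) \<and> L \<le> K \<and>
        (\<forall>z\<in>cspace I. (\<forall>i\<in>I. cmod (z i - p i) \<le> \<rho>) \<longrightarrow>
           ((\<lambda>\<alpha>. c \<alpha> * monom_at I (\<lambda>i. z i - p i) \<alpha>) has_sum f z) (mono_exps I)))"

lemma monom_at_add: "monom_at I w (\<lambda>i. \<alpha> i + \<beta> i) = monom_at I w \<alpha> * monom_at I w \<beta>"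
  by (simp add: monom_at_def power_add prod.distrib)

lemma total_degree_add: "total_degree I (\<lambda>i. \<alpha> i + \<beta> i) = total_degree I \<alpha> + total_degree I \<beta>"
  by (simp add: total_degree_def sum.distrib)

lemma monom_at_bound:
  assumes "\<And>i. i \<in> I \<Longrightarrow> cmod (w i) \<le> \<rho>"
  shows "cmod (monom_at I w \<alpha>) \<le> \<rho> ^ total_degree I \<alpha>"
proof -
  have "cmod (monom_at I w \<alpha>) \<le> (\<Prod>i\<in>I. \<rho> ^ \<alpha> i)"
    unfolding monom_at_def prod_norm[symmetric]
    by (intro prod_mono) (use assms in \<open>auto simp: norm_power intro: power_mono\<close>)
  then show ?thesis by (simp add: total_degree_def power_sum)
qed

text \<open>
  An expansion into monomials indexed by an arbitrary set can be regrouped; this yields the closure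
  under sums, products and composition.
\<close>

lemma majorizedI:
  assumes rho: "\<rho> > 0" and m: "\<And>t. t \<in> T \<Longrightarrow> m t \<in> mono_exps I"
    and L: "((\<lambda>t. cmod (b t) * \<rho> ^ total_degree I (m t)) has_sum L) T" "L \<le> K"
    and f: "\<And>z. z \<in> cspace I \<Longrightarrow> (\<And>i. i \<in> I \<Longrightarrow> cmod (z i - p i) \<le> \<rho>) \<Longrightarrow>
      ((\<lambda>t. b t * monom_at I (\<lambda>i. z i - p i) (m t)) has_sum f z) T"
  shows "majorized I p \<rho> K f"
proof -
  define B where "B \<alpha> = {t \<in> T. m t = \<alpha>}" for \<alpha>
  have bij: "bij_betw (\<lambda>t. (m t, t)) T (Sigma (mono_exps I) B)"
    by (rule bij_betwI[where g = snd]) (auto simp: B_def m)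
  let ?r = "\<lambda>\<alpha>. \<rho> ^ total_degree I \<alpha>"
  have L1: "((\<lambda>x. cmod (b (snd x)) * ?r (fst x)) has_sum L) (Sigma (mono_exps I) B)"
    by (subst has_sum_reindex_bij_betw[OF bij, symmetric]) (use L in simp)
  have s: "(\<lambda>t. cmod (b t)) summable_on B \<alpha>" if "\<alpha> \<in> mono_exps I" for \<alpha>
  proof -
    have "(\<lambda>x. cmod (b (snd x)) * ?r (fst x)) summable_on (Sigma (mono_exps I) B)"
      using L1 by (rule has_sum_imp_summable)
    from summable_on_SigmaD1[of "\<lambda>x y. cmod (b y) * ?r x" "mono_exps I" B \<alpha>] this that
    have "(\<lambda>t. cmod (b t) * ?r \<alpha>) summable_on B \<alpha>"
      by (simp add: case_prod_unfold)
    then have "(\<lambda>t. cmod (b t) * ?r \<alpha> * inverse (?r \<alpha>)) summable_on B \<alpha>"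
      by (rule summable_on_cmult_left)
    moreover have "cmod (b t) * ?r \<alpha> * inverse (?r \<alpha>) = cmod (b t)" for t
      using rho by simp
    ultimately show ?thesis by simp
  qed
  define c where "c \<alpha> = infsum b (B \<alpha>)" for \<alpha>
  have "((\<lambda>\<alpha>. infsum (\<lambda>t. cmod (b t)) (B \<alpha>) * ?r \<alpha>) has_sum L) (mono_exps I)"
    by (rule has_sum_SigmaD[OF L1]) (use s in \<open>auto intro!: has_sum_cmult_left has_sum_infsum\<close>)
  moreover have le: "cmod (c \<alpha>) * ?r \<alpha> \<le> infsum (\<lambda>t. cmod (b t)) (B \<alpha>) * ?r \<alpha>" if "\<alpha> \<in> mono_exps I" for \<alpha>
    unfolding c_def using rho s[OF that] by (intro mult_right_mono norm_infsum_bound) auto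
  moreover from calculation have "(\<lambda>\<alpha>. cmod (c \<alpha>) * ?r \<alpha>) summable_on mono_exps I"
    using rho by (intro summable_on_comparison_test[OF has_sum_imp_summable]) auto
  then obtain L' where L': "((\<lambda>\<alpha>. cmod (c \<alpha>) * ?r \<alpha>) has_sum L') (mono_exps I)"
    using has_sum_infsum by blast
  ultimately have "L' \<le> L"
    by (intro has_sum_mono[OF L']) auto
  have "((\<lambda>\<alpha>. c \<alpha> * monom_at I (\<lambda>i. z i - p i) \<alpha>) has_sum f z) (mono_exps I)"
    if z: "z \<in> cspace I" "\<forall>i\<in>I. cmod (z i - p i) \<le> \<rho>" for z
  proof -
    have "((\<lambda>x. b (snd x) * monom_at I (\<lambda>i. z i - p i) (fst x)) has_sum f z) (Sigma (mono_exps I) B)"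
      by (subst has_sum_reindex_bij_betw[OF bij, symmetric]) (use f z in simp)
    then show ?thesis
    proof (rule has_sum_SigmaD)
      fix \<alpha> assume "\<alpha> \<in> mono_exps I"
      from has_sum_infsum[OF abs_summable_summable[OF s[OF this]]]
      have "((\<lambda>t. b t * monom_at I (\<lambda>i. z i - p i) \<alpha>) has_sum c \<alpha> * monom_at I (\<lambda>i. z i - p i) \<alpha>) (B \<alpha>)"
        unfolding c_def by (rule has_sum_cmult_left)
      then show "((\<lambda>t. b (snd (\<alpha>, t)) * monom_at I (\<lambda>i. z i - p i) (fst (\<alpha>, t))) has_sum
          c \<alpha> * monom_at I (\<lambda>i. z i - p i) \<alpha>) (B \<alpha>)"
        by simp
    qed
  qed
  with L' \<open>L' \<le> L\<close> \<open>L \<le> K\<close> show ?thesis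
    unfolding majorized_def by (intro exI[of _ c] exI[of _ L']) auto
qed

lemma majorized_const:
  assumes "\<rho> > 0" shows "majorized I p \<rho> (cmod a) (\<lambda>z. a)"
  by (rule majorizedI[where T = "{()}" and m = "\<lambda>_ _. 0" and b = "\<lambda>_. a" and L = "cmod a"])
    (use assms in \<open>auto simp: mono_exps_def total_degree_def monom_at_def
       intro!: has_sum_finiteI\<close>)

lemma majorized_coord:
  assumes "\<rho> > 0" "finite I" "k \<in> I" shows "majorized I p \<rho> \<rho> (\<lambda>z. z k - p k)"
proof (rule majorizedI[where T = "{()}" and m = "\<lambda>_ i. if i = k then 1 else 0" and b = "\<lambda>_. 1" and L = \<rho>])
  have 1: "total_degree I (\<lambda>i. if i = k then 1 else 0) = 1"
    using assms by (simp add: total_degree_def)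
  have 2: "monom_at I w (\<lambda>i. if i = k then 1 else 0) = w k" for w
  proof -
    have "monom_at I w (\<lambda>i. if i = k then 1 else 0) = (\<Prod>i\<in>I. if i = k then w i else 1)"
      unfolding monom_at_def by (intro prod.cong) auto
    then show ?thesis using assms by simp
  qed
  show "((\<lambda>t. cmod 1 * \<rho> ^ total_degree I (\<lambda>i. if i = k then 1 else 0)) has_sum \<rho>) {()}"
    unfolding 1 by (rule has_sum_finiteI) auto
  show "((\<lambda>t. 1 * monom_at I (\<lambda>i. z i - p i) (\<lambda>i. if i = k then 1 else 0)) has_sum z k - p k) {()}" for z
    unfolding 2 by (rule has_sum_finiteI) auto
qed (use assms in \<open>auto simp: mono_exps_def\<close>)

lemma majorizedE:
  assumes "majorized I p \<rho> K f"
  obtains c L where "((\<lambda>\<alpha>. cmod (c \<alpha>) * \<rho> ^ total_degree I \<alpha>) has_sum L) (mono_exps I)" "L \<le> K"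
    "\<And>z. z \<in> cspace I \<Longrightarrow> (\<And>i. i \<in> I \<Longrightarrow> cmod (z i - p i) \<le> \<rho>) \<Longrightarrow>
      ((\<lambda>\<alpha>. c \<alpha> * monom_at I (\<lambda>i. z i - p i) \<alpha>) has_sum f z) (mono_exps I)"
  using assms unfolding majorized_def by blast

lemma majorized_add:
  assumes rho: "\<rho> > 0" and "majorized I p \<rho> K f" "majorized I p \<rho> K' f'"
  shows "majorized I p \<rho> (K + K') (\<lambda>z. f z + f' z)"
proof -
  obtain c L where c: "((\<lambda>\<alpha>. cmod (c \<alpha>) * \<rho> ^ total_degree I \<alpha>) has_sum L) (mono_exps I)" "L \<le> K"
    "\<And>z. z \<in> cspace I \<Longrightarrow> (\<And>i. i \<in> I \<Longrightarrow> cmod (z i - p i) \<le> \<rho>) \<Longrightarrow>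
      ((\<lambda>\<alpha>. c \<alpha> * monom_at I (\<lambda>i. z i - p i) \<alpha>) has_sum f z) (mono_exps I)"
    by (rule majorizedE[OF assms(2)]) blast
  obtain c' L' where c': "((\<lambda>\<alpha>. cmod (c' \<alpha>) * \<rho> ^ total_degree I \<alpha>) has_sum L') (mono_exps I)" "L' \<le> K'"
    "\<And>z. z \<in> cspace I \<Longrightarrow> (\<And>i. i \<in> I \<Longrightarrow> cmod (z i - p i) \<le> \<rho>) \<Longrightarrow>
      ((\<lambda>\<alpha>. c' \<alpha> * monom_at I (\<lambda>i. z i - p i) \<alpha>) has_sum f' z) (mono_exps I)"
    by (rule majorizedE[OF assms(3)]) blast
  let ?T = "Sigma (UNIV :: bool set) (\<lambda>_. mono_exps I)"
  have U: "(g has_sum (g True + g False)) UNIV" for g :: "bool \<Rightarrow> 'b::{comm_monoid_add,topological_space}"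
    by (rule has_sum_finiteI) (simp_all add: UNIV_bool add.commute)
  let ?b = "\<lambda>t. (if fst t then c (snd t) else c' (snd t))"
  have A: "(\<lambda>t. cmod (?b t) * \<rho> ^ total_degree I (snd t)) summable_on ?T"
    by (rule summable_on_SigmaI[where g = "\<lambda>t. if t then L else L'"])
      (use c(1) c'(1) rho in \<open>auto\<close>)
  show ?thesis
  proof (rule majorizedI[where T = ?T and m = snd and b = ?b and L = "L + L'"])
    show "((\<lambda>t. cmod (?b t) * \<rho> ^ total_degree I (snd t)) has_sum L + L') ?T"
      by (rule has_sum_SigmaI[where g = "\<lambda>t. if t then L else L'", OF _ _ A])
        (use c(1) c'(1) U[of "\<lambda>t. if t then L else L'"] in \<open>auto\<close>)
    fix z assume z: "z \<in> cspace I" "\<And>i. i \<in> I \<Longrightarrow> cmod (z i - p i) \<le> \<rho>"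
    have "(\<lambda>t. ?b t * monom_at I (\<lambda>i. z i - p i) (snd t)) summable_on ?T"
      by (rule abs_summable_summable[OF Infinite_Sum.abs_summable_on_comparison_test'[OF A]])
        (use z in \<open>auto simp: norm_mult intro!: mult_left_mono monom_at_bound\<close>)
    then show "((\<lambda>t. ?b t * monom_at I (\<lambda>i. z i - p i) (snd t)) has_sum f z + f' z) ?T"
      by (intro has_sum_SigmaI[where g = "\<lambda>t. if t then f z else f' z"])
        (use c(3)[OF z] c'(3)[OF z] U[of "\<lambda>t. if t then f z else f' z"] in \<open>auto\<close>)
  qed (use rho c(2) c'(2) in auto)
qed

text \<open>The product is the family over pairs of exponents, regrouped by their sum; its absolute
  sum factors, which gives submultiplicativity of the norm.\<close>

lemma majorized_mult:
  assumes rho: "\<rho> > 0" and "majorized I p \<rho> K f" "majorized I p \<rho> K' f'"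
  shows "majorized I p \<rho> (K * K') (\<lambda>z. f z * f' z)"
proof -
  obtain c L where c: "((\<lambda>\<alpha>. cmod (c \<alpha>) * \<rho> ^ total_degree I \<alpha>) has_sum L) (mono_exps I)" "L \<le> K"
    "\<And>z. z \<in> cspace I \<Longrightarrow> (\<And>i. i \<in> I \<Longrightarrow> cmod (z i - p i) \<le> \<rho>) \<Longrightarrow>
      ((\<lambda>\<alpha>. c \<alpha> * monom_at I (\<lambda>i. z i - p i) \<alpha>) has_sum f z) (mono_exps I)"
    by (rule majorizedE[OF assms(2)]) blast
  obtain c' L' where c': "((\<lambda>\<alpha>. cmod (c' \<alpha>) * \<rho> ^ total_degree I \<alpha>) has_sum L') (mono_exps I)" "L' \<le> K'"
    "\<And>z. z \<in> cspace I \<Longrightarrow> (\<And>i. i \<in> I \<Longrightarrow> cmod (z i - p i) \<le> \<rho>) \<Longrightarrow>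
      ((\<lambda>\<alpha>. c' \<alpha> * monom_at I (\<lambda>i. z i - p i) \<alpha>) has_sum f' z) (mono_exps I)"
    by (rule majorizedE[OF assms(3)]) blast
  let ?T = "Sigma (mono_exps I) (\<lambda>_. mono_exps I)"
  let ?r = "\<lambda>\<alpha>. \<rho> ^ total_degree I \<alpha>"
  let ?m = "\<lambda>t i. fst t i + snd t i :: nat"
  have L0: "0 \<le> L" "0 \<le> L'"
    by (rule has_sum_nonneg[OF c(1)], use rho in simp) (rule has_sum_nonneg[OF c'(1)], use rho in simp)
  have i1: "((\<lambda>y. cmod (c x * c' y) * \<rho> ^ total_degree I (\<lambda>i. x i + y i)) has_sum cmod (c x) * ?r x * L') (mono_exps I)" for x
    using has_sum_cmult_right[OF c'(1), of "cmod (c x) * ?r x"]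
    by (simp add: norm_mult total_degree_add power_add mult_ac)
  have A: "(\<lambda>t. cmod (c (fst t) * c' (snd t)) * \<rho> ^ total_degree I (?m t)) summable_on ?T"
    by (rule summable_on_SigmaI[where g = "\<lambda>x. cmod (c x) * ?r x * L'"])
      (use i1 rho has_sum_imp_summable[OF has_sum_cmult_left[OF c(1)]] in auto)
  show ?thesis
  proof (rule majorizedI[where T = ?T and m = ?m and b = "\<lambda>t. c (fst t) * c' (snd t)" and L = "L * L'"])
    show "((\<lambda>t. cmod (c (fst t) * c' (snd t)) * \<rho> ^ total_degree I (?m t)) has_sum L * L') ?T"
      by (rule has_sum_SigmaI[where g = "\<lambda>x. cmod (c x) * ?r x * L'", OF _ _ A])
        (use i1 has_sum_cmult_left[OF c(1)] in auto)
    fix z assume z: "z \<in> cspace I" "\<And>i. i \<in> I \<Longrightarrow> cmod (z i - p i) \<le> \<rho>"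
    let ?M = "monom_at I (\<lambda>i. z i - p i)"
    have "(\<lambda>t. c (fst t) * c' (snd t) * ?M (?m t)) summable_on ?T"
      by (rule abs_summable_summable[OF Infinite_Sum.abs_summable_on_comparison_test'[OF A]])
        (subst norm_mult, use z in \<open>auto intro!: mult_left_mono monom_at_bound\<close>)
    then show "((\<lambda>t. c (fst t) * c' (snd t) * ?M (?m t)) has_sum f z * f' z) ?T"
    proof (rule has_sum_SigmaI[where g = "\<lambda>x. c x * ?M x * f' z", rotated 2])
      show "((\<lambda>x. c x * ?M x * f' z) has_sum f z * f' z) (mono_exps I)"
        by (rule has_sum_cmult_left[OF c(3)[OF z]])
      fix x
      show "((\<lambda>y. c (fst (x, y)) * c' (snd (x, y)) * ?M (?m (x, y))) has_sum c x * ?M x * f' z) (mono_exps I)"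
        using has_sum_cmult_right[OF c'(3)[OF z], of "c x * ?M x"]
        by (simp add: monom_at_add mult_ac)
    qed
  qed (use rho c(2) c'(2) L0 in \<open>auto simp: mono_exps_def intro: mult_mono\<close>)
qed

lemma majorized_power:
  assumes "\<rho> > 0" "majorized I p \<rho> K f"
  shows "majorized I p \<rho> (K ^ n) (\<lambda>z. f z ^ n)"
proof (induction n)
  case 0
  show ?case using majorized_const[OF assms(1), of I p 1] by simp
next
  case (Suc n)
  show ?case using majorized_mult[OF assms(1,2) Suc] by simp
qed

text \<open>Expanding each power \<open>f^n\<close> gives a family over pairs of \<open>n\<close>
  and an exponent, whose absolute sum is bounded by the sum of \<open>|a n| K^n\<close>. Regrouping
  by the exponent is the substitution of one power series into another.\<close>

lemma majorized_powser:
  assumes rho: "\<rho> > 0" and f: "majorized I p \<rho> K f" and K: "summable (\<lambda>n. cmod (a n) * K ^ n)" "K \<ge> 0"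
    and h: "\<And>w. cmod w \<le> K \<Longrightarrow> (\<lambda>n. a n * w ^ n) sums h w"
  shows "majorized I p \<rho> (\<Sum>n. cmod (a n) * K ^ n) (\<lambda>z. h (f z))"
proof -
  define Q where "Q n c L \<longleftrightarrow> ((\<lambda>\<alpha>. cmod (c \<alpha>) * \<rho> ^ total_degree I \<alpha>) has_sum L) (mono_exps I) \<and> L \<le> K ^ n \<and>
    (\<forall>z\<in>cspace I. (\<forall>i\<in>I. cmod (z i - p i) \<le> \<rho>) \<longrightarrow>
      ((\<lambda>\<alpha>. c \<alpha> * monom_at I (\<lambda>i. z i - p i) \<alpha>) has_sum f z ^ n) (mono_exps I))" for n c L
  have "\<forall>n. \<exists>c L. Q n c L"
    using majorized_power[OF rho f] unfolding majorized_def Q_def by blast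
  then obtain c L where cL: "\<And>n. Q n (c n) (L n)"
    by metis
  have c: "((\<lambda>\<alpha>. cmod (c n \<alpha>) * \<rho> ^ total_degree I \<alpha>) has_sum L n) (mono_exps I)" "L n \<le> K ^ n"
    "\<And>z. z \<in> cspace I \<Longrightarrow> (\<And>i. i \<in> I \<Longrightarrow> cmod (z i - p i) \<le> \<rho>) \<Longrightarrow>
      ((\<lambda>\<alpha>. c n \<alpha> * monom_at I (\<lambda>i. z i - p i) \<alpha>) has_sum f z ^ n) (mono_exps I)" for n
    using cL[of n] unfolding Q_def by blast+
  have L0: "0 \<le> L n" for n
    by (rule has_sum_nonneg[OF c(1)]) (use rho in simp)
  let ?T = "Sigma UNIV (\<lambda>_::nat. mono_exps I)"
  let ?b = "\<lambda>t. a (fst t) * c (fst t) (snd t)"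
  have le: "cmod (a n) * L n \<le> cmod (a n) * K ^ n" for n
    using c(2) by (intro mult_left_mono) auto
  have sm: "summable (\<lambda>n. cmod (a n) * L n)"
    by (rule summable_comparison_test'[OF K(1), of 0]) (use le L0 in \<open>simp add: abs_mult\<close>)
  then have S: "((\<lambda>n. cmod (a n) * L n) has_sum (\<Sum>n. cmod (a n) * L n)) UNIV"
    using L0 by (intro norm_summable_imp_has_sum) (auto simp: abs_mult summable_sums)
  have i1: "((\<lambda>y. cmod (a n * c n y) * \<rho> ^ total_degree I y) has_sum cmod (a n) * L n) (mono_exps I)" for n
    using has_sum_cmult_right[OF c(1)[of n], of "cmod (a n)"] by (simp add: norm_mult mult_ac)
  have A: "(\<lambda>t. cmod (?b t) * \<rho> ^ total_degree I (snd t)) summable_on ?T"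
    by (rule summable_on_SigmaI[where g = "\<lambda>n. cmod (a n) * L n"])
      (use i1 rho has_sum_imp_summable[OF S] in auto)
  show ?thesis
  proof (rule majorizedI[where T = ?T and m = snd and b = ?b and L = "\<Sum>n. cmod (a n) * L n"])
    show "((\<lambda>t. cmod (?b t) * \<rho> ^ total_degree I (snd t)) has_sum (\<Sum>n. cmod (a n) * L n)) ?T"
      by (rule has_sum_SigmaI[where g = "\<lambda>n. cmod (a n) * L n", OF _ _ A]) (use i1 S in auto)
    show "(\<Sum>n. cmod (a n) * L n) \<le> (\<Sum>n. cmod (a n) * K ^ n)"
      by (rule suminf_le[OF le sm K(1)])
    fix z assume z: "z \<in> cspace I" "\<And>i. i \<in> I \<Longrightarrow> cmod (z i - p i) \<le> \<rho>"
    let ?M = "monom_at I (\<lambda>i. z i - p i)"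
    \<comment> \<open>A value is at most the norm of the expansion. It puts \<open>f z\<close>
      inside the disc where \<open>h\<close> is given by its series and makes the series in
      \<open>n\<close> converge absolutely.\<close>
    have fz: "cmod (f z) ^ n \<le> L n" for n
    proof -
      have ab: "(\<lambda>\<alpha>. norm (c n \<alpha> * ?M \<alpha>)) summable_on mono_exps I"
        by (rule Infinite_Sum.abs_summable_on_comparison_test'[OF has_sum_imp_summable[OF c(1)[of n]]])
          (use z in \<open>auto simp: norm_mult intro!: mult_left_mono monom_at_bound\<close>)
      have "cmod (f z ^ n) \<le> infsum (\<lambda>\<alpha>. norm (c n \<alpha> * ?M \<alpha>)) (mono_exps I)"
        using norm_infsum_bound[OF ab] infsumI[OF c(3)[OF z]] by simp
      also have "\<dots> \<le> L n"
        by (rule has_sum_mono[OF has_sum_infsum[OF ab] c(1)[of n]])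
          (use z in \<open>auto simp: norm_mult intro!: mult_left_mono monom_at_bound\<close>)
      finally show ?thesis by (simp add: norm_power)
    qed
    have "cmod (f z) \<le> K" using fz[of 1] c(2)[of 1] by simp
    then have h': "(\<lambda>n. a n * f z ^ n) sums h (f z)" by (rule h)
    have "summable (\<lambda>n. norm (a n * f z ^ n))"
      by (rule summable_comparison_test'[OF sm, of 0])
        (use fz in \<open>auto simp: norm_mult norm_power intro!: mult_left_mono\<close>)
    from norm_summable_imp_has_sum[OF this h']
    have H: "((\<lambda>n. a n * f z ^ n) has_sum h (f z)) UNIV" .
    have "(\<lambda>t. ?b t * ?M (snd t)) summable_on ?T"
      by (rule abs_summable_summable[OF Infinite_Sum.abs_summable_on_comparison_test'[OF A]])
        (subst norm_mult, use z in \<open>auto intro!: mult_left_mono monom_at_bound\<close>)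
    then show "((\<lambda>t. ?b t * ?M (snd t)) has_sum h (f z)) ?T"
    proof (rule has_sum_SigmaI[where g = "\<lambda>n. a n * f z ^ n", rotated 2])
      show "((\<lambda>y. ?b (n, y) * ?M (snd (n, y))) has_sum a n * f z ^ n) (mono_exps I)" for n
        using has_sum_cmult_right[OF c(3)[OF z], of "a n"] by (simp add: mult_ac)
    qed (rule H)
  qed (use rho in auto)
qed

lemma analytic_majorized:
  assumes rho: "\<rho> > 0" and f: "majorized I p \<rho> K f"
  shows "analytic_at_point I f p"
proof -
  obtain c L where "\<And>z. z \<in> cspace I \<Longrightarrow> (\<And>i. i \<in> I \<Longrightarrow> cmod (z i - p i) \<le> \<rho>) \<Longrightarrow>
      ((\<lambda>\<alpha>. c \<alpha> * monom_at I (\<lambda>i. z i - p i) \<alpha>) has_sum f z) (mono_exps I)"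
    by (rule majorizedE[OF f]) blast
  then show ?thesis
    unfolding analytic_at_point_def monom_at_def mono_exps_def using rho
    by (intro exI[of _ \<rho>] conjI exI[of _ c] ballI impI) (auto intro!: less_imp_le)
qed

lemma majorized_smaller:
  assumes "majorized I p \<rho> K f" "0 < \<rho>'" "\<rho>' \<le> \<rho>"
  shows "majorized I p \<rho>' K f"
proof -
  obtain c L where c: "((\<lambda>\<alpha>. cmod (c \<alpha>) * \<rho> ^ total_degree I \<alpha>) has_sum L) (mono_exps I)" "L \<le> K"
    "\<And>z. z \<in> cspace I \<Longrightarrow> (\<And>i. i \<in> I \<Longrightarrow> cmod (z i - p i) \<le> \<rho>) \<Longrightarrow>
      ((\<lambda>\<alpha>. c \<alpha> * monom_at I (\<lambda>i. z i - p i) \<alpha>) has_sum f z) (mono_exps I)"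
    by (rule majorizedE[OF assms(1)]) blast
  have le: "cmod (c \<alpha>) * \<rho>' ^ total_degree I \<alpha> \<le> cmod (c \<alpha>) * \<rho> ^ total_degree I \<alpha>" for \<alpha>
    using assms by (intro mult_left_mono power_mono) auto
  have "(\<lambda>\<alpha>. cmod (c \<alpha>) * \<rho>' ^ total_degree I \<alpha>) summable_on mono_exps I"
    by (rule summable_on_comparison_test[OF has_sum_imp_summable[OF c(1)]]) (use le assms in auto)
  then obtain L' where L': "((\<lambda>\<alpha>. cmod (c \<alpha>) * \<rho>' ^ total_degree I \<alpha>) has_sum L') (mono_exps I)"
    using has_sum_infsum by blast
  have "L' \<le> L" by (rule has_sum_mono[OF L' c(1)]) (use le in auto)
  with L' c(2,3) assms(3) show ?thesis
    unfolding majorized_def by (intro exI[of _ c] exI[of _ L']) force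
qed

text \<open>The working form of analyticity: a norm bound on some closed polydisc, kept because it
  makes sums, products and compositions immediate.\<close>

definition analytic_near :: "'i set \<Rightarrow> ('i \<Rightarrow> complex) \<Rightarrow> (('i \<Rightarrow> complex) \<Rightarrow> complex) \<Rightarrow> bool" where
  "analytic_near I p f \<longleftrightarrow> (\<exists>\<rho>>0. \<exists>K. majorized I p \<rho> K f)"

lemma analytic_near_const: "analytic_near I p (\<lambda>z. a)"
  unfolding analytic_near_def using majorized_const[of 1] zero_less_one by blast

lemma analytic_near_add:
  assumes "analytic_near I p f" "analytic_near I p f'"
  shows "analytic_near I p (\<lambda>z. f z + f' z)"
proof -
  obtain r K where r: "r > 0" "majorized I p r K f" using assms(1) unfolding analytic_near_def by blast
  obtain r' K' where r': "r' > 0" "majorized I p r' K' f'" using assms(2) unfolding analytic_near_def by blast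
  have m: "0 < min r r'" using r r' by auto
  have "majorized I p (min r r') (K + K') (\<lambda>z. f z + f' z)"
    by (rule majorized_add[OF m majorized_smaller[OF r(2) m] majorized_smaller[OF r'(2) m]]) auto
  then show ?thesis
    unfolding analytic_near_def by - (rule exI[of _ "min r r'"], rule conjI[OF m], rule exI)
qed

lemma analytic_near_mult:
  assumes "analytic_near I p f" "analytic_near I p f'"
  shows "analytic_near I p (\<lambda>z. f z * f' z)"
proof -
  obtain r K where r: "r > 0" "majorized I p r K f" using assms(1) unfolding analytic_near_def by blast
  obtain r' K' where r': "r' > 0" "majorized I p r' K' f'" using assms(2) unfolding analytic_near_def by blast
  have m: "0 < min r r'" using r r' by auto
  have "majorized I p (min r r') (K * K') (\<lambda>z. f z * f' z)"
    by (rule majorized_mult[OF m majorized_smaller[OF r(2) m] majorized_smaller[OF r'(2) m]]) auto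
  then show ?thesis
    unfolding analytic_near_def by - (rule exI[of _ "min r r'"], rule conjI[OF m], rule exI)
qed

lemma analytic_near_coord:
  assumes "finite I" "k \<in> I"
  shows "analytic_near I p (\<lambda>z. z k)"
proof -
  have "analytic_near I p (\<lambda>z. z k - p k)"
    unfolding analytic_near_def using majorized_coord[OF zero_less_one assms] zero_less_one by blast
  from analytic_near_add[OF this analytic_near_const[of _ _ "p k"]] show ?thesis by simp
qed

lemma analytic_near_diff:
  assumes "analytic_near I p f" "analytic_near I p f'"
  shows "analytic_near I p (\<lambda>z. f z - f' z)"
  using analytic_near_add[OF assms(1) analytic_near_mult[OF analytic_near_const[of _ _ "-1"] assms(2)]]
  by simp

lemma analytic_near_power: "analytic_near I p f \<Longrightarrow> analytic_near I p (\<lambda>z. f z ^ n)"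
  by (induction n) (auto intro: analytic_near_const analytic_near_mult)

lemma analytic_near_divide_const: "analytic_near I p f \<Longrightarrow> analytic_near I p (\<lambda>z. f z / a)"
  using analytic_near_mult[OF _ analytic_near_const[of _ _ "1 / a"]] by simp

lemma analytic_near_minus: "analytic_near I p f \<Longrightarrow> analytic_near I p (\<lambda>z. - f z)"
  using analytic_near_mult[OF analytic_near_const[of _ _ "-1"]] by simp

lemma analytic_near_if:
  "(b \<Longrightarrow> analytic_near I p f) \<Longrightarrow> (\<not> b \<Longrightarrow> analytic_near I p g) \<Longrightarrow>
     analytic_near I p (\<lambda>z. if b then f z else g z)"
  by (cases b) simp_all

lemmas analytic_near_intros = analytic_near_minus analytic_near_if analytic_near_const analytic_near_add analytic_near_mult
  analytic_near_diff analytic_near_power analytic_near_divide_const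

lemma analytic_near_imp_at_point: "analytic_near I p f \<Longrightarrow> analytic_at_point I f p"
  unfolding analytic_near_def using analytic_majorized by blast

text \<open>
  Away from its constant term, the majorant of a power series is at most linear in the radius.
\<close>

lemma majorized_small:
  assumes "analytic_near I p f" "finite I" "p \<in> cspace I" "e > 0"
  obtains \<rho> where "\<rho> > 0" "majorized I p \<rho> e (\<lambda>z. f z - f p)"
proof -
  obtain r K where r: "r > 0" "majorized I p r K f" using assms(1) unfolding analytic_near_def by blast
  from r(2) obtain c L where c: "((\<lambda>\<alpha>. cmod (c \<alpha>) * r ^ total_degree I \<alpha>) has_sum L) (mono_exps I)"
    "\<And>z. z \<in> cspace I \<Longrightarrow> (\<And>i. i \<in> I \<Longrightarrow> cmod (z i - p i) \<le> r) \<Longrightarrow>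
      ((\<lambda>\<alpha>. c \<alpha> * monom_at I (\<lambda>i. z i - p i) \<alpha>) has_sum f z) (mono_exps I)"
    by (rule majorizedE) blast
  have L0: "0 \<le> L" by (rule has_sum_nonneg[OF c(1)]) (use r in simp)
  let ?z = "\<lambda>_. 0 :: nat"
  have z0: "?z \<in> mono_exps I" by (simp add: mono_exps_def)
  have deg: "total_degree I \<alpha> > 0" if "\<alpha> \<in> mono_exps I - {?z}" for \<alpha>
    using that assms(2) by (auto simp: mono_exps_def total_degree_def fun_eq_iff intro!: sum_pos2)
  have m0: "monom_at I w ?z = 1" for w by (simp add: monom_at_def)
  have mono0: "monom_at I (\<lambda>i. 0) \<alpha> = 0" if "\<alpha> \<in> mono_exps I - {?z}" for \<alpha>
    using that assms(2) by (auto simp: mono_exps_def monom_at_def fun_eq_iff)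
  have cp: "c ?z = f p"
  proof -
    have "((\<lambda>\<alpha>. c \<alpha> * monom_at I (\<lambda>i. 0) \<alpha>) has_sum f p) (mono_exps I)"
      using c(2)[OF assms(3)] r(1) by simp
    moreover have "((\<lambda>\<alpha>. c \<alpha> * monom_at I (\<lambda>i. 0) \<alpha>) has_sum c ?z) (mono_exps I)"
      by (subst has_sum_cong_neutral[of "{?z}" _ _ "\<lambda>\<alpha>. c \<alpha> * monom_at I (\<lambda>i. 0) \<alpha>"])
        (use mono0 z0 in \<open>auto simp: m0 intro!: has_sum_finiteI\<close>)
    ultimately show ?thesis using has_sum_unique by blast
  qed
  \<comment> \<open>Shrinking the radius by \<open>t\<close> multiplies every nonconstant monomial
    by at most \<open>t\<close>. The denominator \<open>L + 1\<close> avoids a division by zero when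
    \<open>L = 0\<close>.\<close>
  define t where "t = min 1 (e / (L + 1))"
  have t: "0 < t" "t \<le> 1" "t * L \<le> e"
  proof -
    show "0 < t" "t \<le> 1" using assms(4) L0 by (auto simp: t_def)
    have "t * L \<le> (e / (L + 1)) * L" using L0 by (intro mult_right_mono) (auto simp: t_def)
    also have "\<dots> \<le> e" using L0 assms(4) by (simp add: divide_simps)
    finally show "t * L \<le> e" .
  qed
  have tr: "t * r > 0" using t r by simp
  let ?S = "mono_exps I - {?z}"
  have le: "cmod (c \<alpha>) * (t * r) ^ total_degree I \<alpha> \<le> t * (cmod (c \<alpha>) * r ^ total_degree I \<alpha>)"
    if "\<alpha> \<in> ?S" for \<alpha>
  proof -
    have "t ^ total_degree I \<alpha> \<le> t ^ 1" by (rule power_decreasing) (use deg[OF that] t in auto)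
    then have "(cmod (c \<alpha>) * r ^ total_degree I \<alpha>) * t ^ total_degree I \<alpha> \<le> (cmod (c \<alpha>) * r ^ total_degree I \<alpha>) * t"
      using r by (intro mult_left_mono) auto
    then show ?thesis by (simp add: power_mult_distrib mult_ac)
  qed
  have "(\<lambda>\<alpha>. t * (cmod (c \<alpha>) * r ^ total_degree I \<alpha>)) summable_on ?S"
    using has_sum_imp_summable[OF has_sum_cmult_right[OF c(1), of t]]
    by (rule summable_on_subset_banach) auto
  then have "(\<lambda>\<alpha>. cmod (c \<alpha>) * (t * r) ^ total_degree I \<alpha>) summable_on ?S"
    by (rule summable_on_comparison_test) (use le tr in auto)
  then obtain L' where L': "((\<lambda>\<alpha>. cmod (c \<alpha>) * (t * r) ^ total_degree I \<alpha>) has_sum L') ?S"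
    using has_sum_infsum by blast
  have "L' \<le> t * L"
    by (rule has_sum_mono_neutral[OF L' has_sum_cmult_right[OF c(1), of t]]) (use le t r in auto)
  with t(3) have "L' \<le> e" by simp
  have "majorized I p (t * r) e (\<lambda>z. f z - f p)"
  proof (rule majorizedI[where T = ?S and m = id and b = c and L = L'])
    fix z assume z: "z \<in> cspace I" "\<And>i. i \<in> I \<Longrightarrow> cmod (z i - p i) \<le> t * r"
    have "t * r \<le> r" using t r by (simp add: mult_left_le_one_le)
    then have "((\<lambda>\<alpha>. c \<alpha> * monom_at I (\<lambda>i. z i - p i) \<alpha>) has_sum f z) (mono_exps I)"
      using z by (intro c(2)) (auto intro: order_trans)
    then have "((\<lambda>\<alpha>. c \<alpha> * monom_at I (\<lambda>i. z i - p i) \<alpha>) has_sum f z - c ?z * monom_at I (\<lambda>i. z i - p i) ?z) ?S"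
      using z0 by (intro has_sum_Diff) (auto intro!: has_sum_finiteI)
    then show "((\<lambda>\<alpha>. c \<alpha> * monom_at I (\<lambda>i. z i - p i) (id \<alpha>)) has_sum f z - f p) ?S"
      by (simp add: m0 cp)
  qed (use L' \<open>L' \<le> e\<close> tr in auto)
  then show ?thesis using that tr by blast
qed

text \<open>The polydisc is shrunk until \<open>f - f p\<close> has norm at most
  \<open>R / 2\<close>, within the disc where the Taylor series of \<open>h\<close> at
  \<open>f p\<close> converges absolutely.\<close>

lemma analytic_near_compose:
  assumes f: "analytic_near I p f" and I: "finite I" "p \<in> cspace I"
    and h: "h holomorphic_on S" "open S" "f p \<in> S"
  shows "analytic_near I p (\<lambda>z. h (f z))"
proof -
  obtain R where R: "R > 0" "ball (f p) R \<subseteq> S" using h(2,3) openE by blast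
  define a where "a n = (deriv ^^ n) h (f p) / fact n" for n
  have hs: "(\<lambda>n. a n * w ^ n) sums h (f p + w)" if "cmod w < R" for w
    using holomorphic_power_series[of h "f p" R "f p + w"] holomorphic_on_subset[OF h(1) R(2)] that
    by (simp add: a_def dist_norm)
  \<comment> \<open>Convergence at the larger point \<open>3 R / 4\<close>, still inside the disc,
    gives absolute convergence at \<open>R / 2\<close>.\<close>
  have "summable (\<lambda>n. norm (a n * of_real (R / 2) ^ n))"
    by (rule powser_insidea[where x = "of_real (R * 3 / 4)"])
      (use R(1) hs[of "of_real (R * 3 / 4)"] sums_summable in \<open>auto\<close>)
  then have sm: "summable (\<lambda>n. cmod (a n) * (R / 2) ^ n)"
    using R(1) by (simp add: norm_mult norm_power)
  obtain \<rho> where \<rho>: "\<rho> > 0" "majorized I p \<rho> (R / 2) (\<lambda>z. f z - f p)"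
    using majorized_small[OF f I, of "R / 2"] R(1) by auto
  have "majorized I p \<rho> (\<Sum>n. cmod (a n) * (R / 2) ^ n) (\<lambda>z. h (f p + (f z - f p)))"
    by (rule majorized_powser[OF \<rho> sm, where h = "\<lambda>w. h (f p + w)"]) (use R(1) hs in auto)
  then show ?thesis using \<rho>(1) unfolding analytic_near_def by auto
qed

section \<open>The minimal nilpotent orbit of sl(3)\<close>

context lie_alg
begin

lemma br_0: "y \<in> g \<Longrightarrow> br y 0 = 0"
  using br_scale2[OF _ g_0, of y 0] by (simp add: cscale_def zero_fun_def)

lemma exp_ad_eigen:
  assumes "y \<in> g" "x \<in> g" "br y x = cscale c x"
  shows "exp_ad br y x = cscale (exp c) x"
proof
  fix i
  have "(br y ^^ n) x = cscale (c ^ n) x" for n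
  proof (induction n)
    case (Suc n)
    then show ?case using assms by (simp add: br_scale2 cs.scale_scale mult.commute)
  qed (simp add: cscale_def)
  then have "(\<lambda>n. (br y ^^ n) x i / fact n) = (\<lambda>n. (c ^ n /\<^sub>R fact n) * x i)"
    by (simp add: cscale_def fun_eq_iff scaleR_conv_of_real field_simps)
  moreover have "(\<lambda>n. (c ^ n /\<^sub>R fact n) * x i) sums (exp c * x i)"
    by (intro sums_mult2 exp_converges)
  ultimately show "exp_ad br y x i = cscale (exp c) x i"
    using exp_ad_sums[OF assms(1,2), of i] sums_unique2 unfolding cscale_def by metis
qed

lemma exp_ad_nilpotent3:
  assumes "y \<in> g" "x \<in> g" "br y (br y (br y x)) = 0"
  shows "exp_ad br y x = x + br y x + cscale (1 / 2) (br y (br y x))"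
proof
  fix i
  have z: "(br y ^^ n) x = 0" if "n \<ge> 3" for n
    using that
  proof (induction n rule: nat_induct_at_least)
    case base
    show ?case using assms(3) by (simp add: numeral_3_eq_3)
  next
    case (Suc n)
    show ?case by (simp only: funpow.simps o_apply Suc.IH br_0[OF assms(1)])
  qed
  have "(\<lambda>n. (br y ^^ n) x i / fact n) sums (\<Sum>n\<in>{..<3}. (br y ^^ n) x i / fact n)"
    by (rule sums_finite) (use z in \<open>auto simp: not_less\<close>)
  also have "(\<Sum>n\<in>{..<3}. (br y ^^ n) x i / fact n) = (x + br y x + cscale (1 / 2) (br y (br y x))) i"
    by (simp add: eval_nat_numeral cscale_def)
  finally show "exp_ad br y x i = \<dots>"
    using exp_ad_sums[OF assms(1,2), of i] sums_unique2 by blast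
qed

lemma exp_ad_nilpotent2:
  assumes "y \<in> g" "x \<in> g" "br y (br y x) = 0"
  shows "exp_ad br y x = x + br y x"
  using exp_ad_nilpotent3[OF assms(1,2)] assms br_0[OF assms(1)] by (simp add: cscale_def fun_eq_iff)

lemma adjoint_orbit_trans:
  assumes "z \<in> adjoint_orbit g br y" "y \<in> adjoint_orbit g br x"
  shows "z \<in> adjoint_orbit g br x"
  using assms by (induction rule: adjoint_orbit.induct) (auto intro: adjoint_orbit.step)

lemma orbit_closure_orbit:
  assumes "z \<in> adjoint_orbit g br y" "x \<in> g" "y \<in> closure (adjoint_orbit g br x)"
  shows "z \<in> closure (adjoint_orbit g br x)"
  using assms by (induction rule: adjoint_orbit.induct) (auto intro: exp_ad_closure_orbit)

text \<open>Extremal elements in the sense of Lie theory. The condition uses only the bracket, so it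
  is inherited along adjoint orbits.\<close>

definition extremal :: "('i \<Rightarrow> complex) \<Rightarrow> bool" where
  "extremal x \<longleftrightarrow> x \<in> g \<and> (\<forall>y\<in>g. \<exists>c. br x (br x y) = cscale c x)"

lemma extremal_exp_ad:
  assumes "extremal x" "y \<in> g"
  shows "extremal (exp_ad br y x)"
proof -
  let ?G = "exp_ad br y" and ?H = "exp_ad br (- y)"
  have x: "x \<in> g" and y': "- y \<in> g" using assms by (simp_all add: extremal_def)
  have "\<exists>c. br (?G x) (br (?G x) w) = cscale c (?G x)" if w: "w \<in> g" for w
  proof -
    have Hw: "?H w \<in> g" using w y' by simp
    obtain c where c: "br x (br x (?H w)) = cscale c x"
      using assms(1) Hw unfolding extremal_def by blast
    have "?G (?H w) = w" using exp_ad_inverse[OF y' w] by simp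
    then have "br (?G x) (br (?G x) w) = ?G (br x (br x (?H w)))"
      using exp_ad_bracket[OF assms(2) x Hw] exp_ad_bracket[OF assms(2) x br_in[OF x Hw]] by simp
    then show ?thesis using exp_ad_scale[OF assms(2) x, of c] c by auto
  qed
  then show ?thesis using x assms(2) by (simp add: extremal_def)
qed

lemma extremal_adnil:
  assumes "extremal x"
  shows "adnil 3 x"
  unfolding adnil_def
proof (intro conjI ballI)
  show x: "x \<in> g" using assms by (simp add: extremal_def)
  fix y assume y: "y \<in> g"
  then obtain c where c: "br x (br x y) = cscale c x"
    using assms unfolding extremal_def by blast
  have "br x (br x (br x y)) = cscale c (br x x)"
    unfolding c by (rule br_scale2[OF x x])
  then show "(br x ^^ 3) y = 0"
    by (simp add: numeral_3_eq_3 br_self[OF x])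
qed

lemma extremal_orbit:
  assumes "z \<in> adjoint_orbit g br x" "extremal x" "x \<noteq> 0"
  shows "extremal z \<and> z \<noteq> 0"
  using assms
proof (induction rule: adjoint_orbit.induct)
  case base
  then show ?case by blast
next
  case (step z y)
  have z: "extremal z" "z \<noteq> 0" "z \<in> g" using step by (auto simp: extremal_def)
  have "exp_ad br (- y) (exp_ad br y z) = z"
    by (rule exp_ad_inverse[OF step(2) z(3)])
  moreover have "exp_ad br (- y) 0 = 0"
    using step(2) by (simp add: exp_ad_clin)
  ultimately have "exp_ad br y z \<noteq> 0" using z(2) by metis
  then show ?case using extremal_exp_ad[OF z(1) step(2)] by blast
qed

end

section \<open>Matrices of rank one in sl(3) and their orbit\<close>

lemma sum_lt_3: "(\<Sum>k<3. f k) = f 0 + f 1 + f (2::nat)"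
  by (simp add: eval_nat_numeral)

lemma lt_3_cases: "i < (3::nat) \<longleftrightarrow> i = 0 \<or> i = 1 \<or> i = 2"
  by auto

lemma sl_bracket_outside:
  assumes "A \<in> cspace (sl_index n)" "B \<in> cspace (sl_index n)"
  shows "sl_bracket n A B \<in> cspace (sl_index n)"
  using assms by (auto simp: cspace_def sl_index_def sl_bracket_def intro!: sum.neutral)

lemma lie_algebra_sl: "lie_algebra (sl_index 3) (sl 3) (sl_bracket 3)"
  unfolding lie_algebra_def
proof (intro conjI ballI allI)
  show "finite (sl_index 3)" "sl 3 \<subseteq> cspace (sl_index 3)"
    by (auto simp: sl_index_def sl_def)
  show "cs.subspace (sl 3)"
    by (rule cs.subspaceI)
      (auto simp: sl_def cspace_def cscale_def sum.distrib sum_distrib_left[symmetric])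
  fix A B assume A: "A \<in> sl 3" and B: "B \<in> sl 3"
  show "sl_bracket 3 A B \<in> sl 3"
    using A B sl_bracket_outside[of A 3 B] unfolding sl_def
    by (simp add: sl_bracket_def sum_lt_3 algebra_simps)
  show "sl_bracket 3 (cscale c A) B = cscale c (sl_bracket 3 A B)" for c
    by (rule ext) (auto simp: sl_bracket_def cscale_def sum_lt_3 algebra_simps)
  show "sl_bracket 3 A (cscale c B) = cscale c (sl_bracket 3 A B)" for c
    by (rule ext) (auto simp: sl_bracket_def cscale_def sum_lt_3 algebra_simps)
  show "sl_bracket 3 A A = 0"
    by (rule ext) (auto simp: sl_bracket_def)
  fix C assume C: "C \<in> sl 3"
  show "sl_bracket 3 (A + B) C = sl_bracket 3 A C + sl_bracket 3 B C"
    by (rule ext) (auto simp: sl_bracket_def sum_lt_3 algebra_simps)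
  show "sl_bracket 3 C (A + B) = sl_bracket 3 C A + sl_bracket 3 C B"
    by (rule ext) (auto simp: sl_bracket_def sum_lt_3 algebra_simps)
  show "sl_bracket 3 A (sl_bracket 3 B C) + sl_bracket 3 B (sl_bracket 3 C A) +
      sl_bracket 3 C (sl_bracket 3 A B) = 0"
    by (rule ext) (auto simp: sl_bracket_def sum_lt_3 algebra_simps)
qed

interpretation sl3: lie_alg "sl_index 3" "sl 3" "sl_bracket 3"
  by (rule lie_alg.intro) (rule lie_algebra_sl)

text \<open>Vectors and covectors are both functions of which only the values at 0, 1 and 2 count.
  For this reason their equality is often weakened to agreement below 3.\<close>

definition dot3 :: "(nat \<Rightarrow> complex) \<Rightarrow> (nat \<Rightarrow> complex) \<Rightarrow> complex" where
  "dot3 \<phi> v = \<phi> 0 * v 0 + \<phi> 1 * v 1 + \<phi> 2 * v 2"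

definition outer3 :: "(nat \<Rightarrow> complex) \<Rightarrow> (nat \<Rightarrow> complex) \<Rightarrow> nat \<times> nat \<Rightarrow> complex" where
  "outer3 v \<phi> = (\<lambda>(i, j). if i < 3 \<and> j < 3 then v i * \<phi> j else 0)"

definition app3 :: "(nat \<times> nat \<Rightarrow> complex) \<Rightarrow> (nat \<Rightarrow> complex) \<Rightarrow> nat \<Rightarrow> complex" where
  "app3 A v = (\<lambda>i. dot3 (\<lambda>k. A (i, k)) v)"

definition coapp3 :: "(nat \<Rightarrow> complex) \<Rightarrow> (nat \<times> nat \<Rightarrow> complex) \<Rightarrow> nat \<Rightarrow> complex" where
  "coapp3 \<phi> A = (\<lambda>j. dot3 \<phi> (\<lambda>k. A (k, j)))"

lemma dot3_coapp: "dot3 (coapp3 \<phi> A) v = dot3 \<phi> (app3 A v)"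
  by (simp add: dot3_def app3_def coapp3_def algebra_simps)

lemma outer3_cspace [simp]: "outer3 v \<phi> \<in> cspace (sl_index 3)"
  by (auto simp: outer3_def cspace_def sl_index_def)

lemma outer3_in_sl: "outer3 v \<phi> \<in> sl 3 \<longleftrightarrow> dot3 \<phi> v = 0"
  by (simp add: sl_def) (simp add: outer3_def dot3_def sum_lt_3 mult.commute)

lemma sl_cspaceD: "A \<in> cspace (sl_index 3) \<Longrightarrow> \<not> (i < 3 \<and> j < 3) \<Longrightarrow> A (i, j) = 0"
  by (auto simp: cspace_def sl_index_def)

lemma sl_bracket_outer3:
  assumes "A \<in> cspace (sl_index 3)"
  shows "sl_bracket 3 A (outer3 v \<phi>) = outer3 (app3 A v) \<phi> - outer3 v (coapp3 \<phi> A)"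
  using sl_cspaceD[OF assms]
  by (intro ext) (auto simp: sl_bracket_def outer3_def app3_def coapp3_def dot3_def sum_lt_3 algebra_simps)

lemma outer3_scale1: "outer3 (cscale c v) \<phi> = cscale c (outer3 v \<phi>)"
  and outer3_scale2: "outer3 v (cscale c \<phi>) = cscale c (outer3 v \<phi>)"
  by (auto simp: outer3_def cscale_def)

lemma app_outer3: "i < 3 \<Longrightarrow> app3 (outer3 u \<eta>) v i = dot3 \<eta> v * u i"
  and coapp_outer3: "j < 3 \<Longrightarrow> coapp3 \<phi> (outer3 u \<eta>) j = dot3 \<phi> u * \<eta> j"
  by (auto simp: outer3_def app3_def coapp3_def dot3_def algebra_simps)

lemma outer3_cong: "(\<And>i. i < 3 \<Longrightarrow> v i = v' i) \<Longrightarrow> (\<And>i. i < 3 \<Longrightarrow> \<phi> i = \<phi>' i) \<Longrightarrow> outer3 v \<phi> = outer3 v' \<phi>'"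
  by (auto simp: outer3_def)

lemma sl_bracket_outer3_outer3:
  "sl_bracket 3 (outer3 u \<eta>) (outer3 v \<phi>) =
     cscale (dot3 \<eta> v) (outer3 u \<phi>) - cscale (dot3 \<phi> u) (outer3 v \<eta>)"
  unfolding sl_bracket_outer3[OF outer3_cspace] outer3_scale1[symmetric, of "dot3 \<eta> v"]
    outer3_scale2[symmetric, where c = "dot3 \<phi> u"]
  by (intro arg_cong2[where f = minus] outer3_cong) (simp_all add: app_outer3 coapp_outer3 cscale_def)

text \<open>The matrix \<open>z = v \<phi>\<close> squares to zero because
  \<open>\<phi> v = 0\<close>, so \<open>(ad z)^2 y = - 2 z y z\<close>, and this is
  \<open>- 2 \<phi>(y v)\<close> times \<open>z\<close>.\<close>

lemma outer3_extremal:
  assumes "dot3 \<phi> v = 0"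
  shows "sl3.extremal (outer3 v \<phi>)"
  unfolding sl3.extremal_def
proof (intro conjI ballI)
  let ?z = "outer3 v \<phi>"
  show z: "?z \<in> sl 3" using assms by (simp add: outer3_in_sl)
  fix y assume y: "y \<in> sl 3"
  then have yc: "y \<in> cspace (sl_index 3)" by (simp add: sl_def)
  have "sl_bracket 3 ?z y = cscale (-1) (outer3 (app3 y v) \<phi> - outer3 v (coapp3 \<phi> y))"
    unfolding sl3.br_antisym[OF y z] sl_bracket_outer3[OF yc] ..
  moreover have "sl_bracket 3 ?z (cscale (-1) (outer3 (app3 y v) \<phi> - outer3 v (coapp3 \<phi> y))) =
      cscale (- 2 * dot3 \<phi> (app3 y v)) ?z"
    using assms[symmetric] unfolding dot3_def
    by (intro ext) (clarsimp simp: sl_bracket_def outer3_def cscale_def app3_def coapp3_def dot3_def sum_lt_3, algebra)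
  ultimately show "\<exists>c. sl_bracket 3 ?z (sl_bracket 3 ?z y) = cscale c ?z" by metis
qed

text \<open>As \<open>\<eta> u = 0\<close>, the exponential of \<open>u \<eta>\<close> is
  \<open>1 + u \<eta>\<close> with inverse \<open>1 - u \<eta>\<close>; conjugation by it acts on
  the column \<open>v\<close> and on the row \<open>\<phi>\<close> separately. In the adjoint
  representation the series stops after the quadratic term.\<close>

lemma transvection:
  assumes u: "dot3 \<eta> u = 0" and v: "dot3 \<phi> v = 0"
  shows "outer3 (v + cscale (dot3 \<eta> v) u) (\<phi> - cscale (dot3 \<phi> u) \<eta>) \<in>
    adjoint_orbit (sl 3) (sl_bracket 3) (outer3 v \<phi>)"
proof -
  let ?y = "outer3 u \<eta>" and ?z = "outer3 v \<phi>"
  have y: "?y \<in> sl 3" "?z \<in> sl 3" using u v by (simp_all add: outer3_in_sl)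
  have uu: "sl_bracket 3 ?y ?y = 0" by (rule sl3.br_self[OF y(1)])
  let ?w = "cscale (dot3 \<eta> v) (outer3 u \<phi>) - cscale (dot3 \<phi> u) (outer3 v \<eta>)"
  have 1: "sl_bracket 3 ?y ?z = ?w" by (rule sl_bracket_outer3_outer3)
  have 2: "sl_bracket 3 ?y ?w = cscale (- 2 * dot3 \<eta> v * dot3 \<phi> u) ?y"
    using u unfolding dot3_def
    by (intro ext) (clarsimp simp: sl_bracket_def outer3_def cscale_def sum_lt_3, algebra)
  have 3: "sl_bracket 3 ?y (cscale (- 2 * dot3 \<eta> v * dot3 \<phi> u) ?y) = 0"
    unfolding sl3.br_scale2[OF y(1) y(1)] uu by (simp add: cscale_def zero_fun_def)
  have "exp_ad (sl_bracket 3) ?y ?z = ?z + ?w + cscale (1 / 2) (cscale (- 2 * dot3 \<eta> v * dot3 \<phi> u) ?y)"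
    using sl3.exp_ad_nilpotent3[OF y] 3 unfolding 1 2 by blast
  also have "\<dots> = outer3 (v + cscale (dot3 \<eta> v) u) (\<phi> - cscale (dot3 \<phi> u) \<eta>)"
    by (rule ext) (auto simp: outer3_def cscale_def algebra_simps)
  finally show ?thesis
    using adjoint_orbit.step[OF adjoint_orbit.base y(1)] by metis
qed

definition vec3_nz :: "(nat \<Rightarrow> complex) \<Rightarrow> bool" where
  "vec3_nz v \<longleftrightarrow> (\<exists>i<3. v i \<noteq> 0)"

text \<open>Two vectors are proportional, or some 2 by 2 minor is nonzero and Cramer's rule gives a
  covector with value 1 on both. Such a covector annihilates their difference, as required for a
  transvection that moves one to the other.\<close>

lemma vec3_pair:
  assumes "vec3_nz v" "vec3_nz w"
  obtains c where "c \<noteq> 0" "\<And>i. i < 3 \<Longrightarrow> w i = c * v i"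
    | \<eta> where "dot3 \<eta> v = 1" "dot3 \<eta> w = 1"
proof (cases "\<exists>i<3. \<exists>j<3. v i * w j \<noteq> v j * w i")
  case True
  then obtain i j where ij: "i < 3" "j < 3" "v i * w j \<noteq> v j * w i" by blast
  define D where "D = v i * w j - v j * w i"
  have D: "D \<noteq> 0" using ij by (simp add: D_def)
  have "i \<noteq> j" using ij by auto
  define \<eta> where "\<eta> = (\<lambda>k. if k = i then (w j - v j) / D else if k = j then (v i - w i) / D else 0)"
  have e: "dot3 \<eta> x = \<eta> i * x i + \<eta> j * x j" for x
    using ij \<open>i \<noteq> j\<close> by (auto simp: dot3_def lt_3_cases \<eta>_def)
  have "dot3 \<eta> v = ((w j - v j) * v i + (v i - w i) * v j) / D"
    using \<open>i \<noteq> j\<close> unfolding e by (simp add: \<eta>_def add_divide_distrib)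
  also have "(w j - v j) * v i + (v i - w i) * v j = D" by (simp add: D_def algebra_simps)
  finally have 1: "dot3 \<eta> v = 1" using D by simp
  have "dot3 \<eta> w = ((w j - v j) * w i + (v i - w i) * w j) / D"
    using \<open>i \<noteq> j\<close> unfolding e by (simp add: \<eta>_def add_divide_distrib)
  also have "(w j - v j) * w i + (v i - w i) * w j = D" by (simp add: D_def algebra_simps)
  finally have "dot3 \<eta> w = 1" using D by simp
  with 1 show ?thesis by (rule that(2))
next
  case False
  then have m: "v i * w j = v j * w i" if "i < 3" "j < 3" for i j using that by blast
  obtain i where i: "i < 3" "v i \<noteq> 0" using assms(1) unfolding vec3_nz_def by blast
  obtain j where j: "j < 3" "w j \<noteq> 0" using assms(2) unfolding vec3_nz_def by blast
  show ?thesis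
  proof (rule that(1)[of "w i / v i"])
    show "w k = w i / v i * v k" if "k < 3" for k
      using m[OF i(1) that] i(2) by (simp add: field_simps)
    with j show "w i / v i \<noteq> 0" by force
  qed
qed

lemma dot3_cong: "(\<And>i. i < 3 \<Longrightarrow> v i = v' i) \<Longrightarrow> (\<And>i. i < 3 \<Longrightarrow> \<phi> i = \<phi>' i) \<Longrightarrow> dot3 \<phi> v = dot3 \<phi>' v'"
  by (simp add: dot3_def)

lemma dot3_linear [simp]:
  "dot3 \<phi> (v + w) = dot3 \<phi> v + dot3 \<phi> w" "dot3 \<phi> (v - w) = dot3 \<phi> v - dot3 \<phi> w"
  "dot3 \<phi> (cscale c v) = c * dot3 \<phi> v" "dot3 (\<phi> + \<psi>) v = dot3 \<phi> v + dot3 \<psi> v"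
  "dot3 (\<phi> - \<psi>) v = dot3 \<phi> v - dot3 \<psi> v" "dot3 (cscale c \<phi>) v = c * dot3 \<phi> v"
  by (simp_all add: dot3_def cscale_def algebra_simps)

lemma vec3_nz_dual: "vec3_nz v \<Longrightarrow> \<exists>\<eta>. dot3 \<eta> v = 1"
proof -
  assume "vec3_nz v"
  then obtain i where i: "i < 3" "v i \<noteq> 0" unfolding vec3_nz_def by blast
  have "dot3 (cscale (1 / v i) (cdelta i)) v = 1"
    using i by (auto simp: dot3_def cscale_def cdelta_def lt_3_cases)
  then show ?thesis by blast
qed

lemma dot3_commute: "dot3 \<phi> v = dot3 v \<phi>"
  by (simp add: dot3_def mult.commute)

text \<open>In the independent case the transvection has direction \<open>w - v\<close> and a
  covector equal to 1 on \<open>v\<close> and \<open>w\<close>. In the proportional case the scalar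
  is moved to the covector.\<close>

lemma orbit_change_vector:
  assumes "vec3_nz v" "vec3_nz w" "vec3_nz \<phi>" "dot3 \<phi> v = 0"
  shows "\<exists>\<phi>'. vec3_nz \<phi>' \<and> dot3 \<phi>' w = 0 \<and> outer3 w \<phi>' \<in> adjoint_orbit (sl 3) (sl_bracket 3) (outer3 v \<phi>)"
proof (rule vec3_pair[OF assms(1,2)])
  fix c assume c: "c \<noteq> 0" "\<And>i. i < 3 \<Longrightarrow> w i = c * v i"
  have "outer3 w (cscale (1 / c) \<phi>) = outer3 v \<phi>"
    using c by (auto simp: outer3_def cscale_def)
  moreover have "dot3 \<phi> w = dot3 \<phi> (cscale c v)"
    using c(2) by (intro dot3_cong) (auto simp: cscale_def)
  moreover have "vec3_nz (cscale (1 / c) \<phi>)"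
    using assms(3) c(1) by (auto simp: vec3_nz_def cscale_def)
  ultimately show ?thesis
    using assms(4) adjoint_orbit.base[of "outer3 v \<phi>"]
    by (intro exI[of _ "cscale (1 / c) \<phi>"]) simp
next
  fix \<eta> assume \<eta>: "dot3 \<eta> v = 1" "dot3 \<eta> w = 1"
  define \<phi>' where "\<phi>' = \<phi> - cscale (dot3 \<phi> (w - v)) \<eta>"
  have "outer3 (v + cscale (dot3 \<eta> v) (w - v)) \<phi>' \<in> adjoint_orbit (sl 3) (sl_bracket 3) (outer3 v \<phi>)"
    unfolding \<phi>'_def using \<eta> assms(4) by (intro transvection) auto
  moreover have "v + cscale (dot3 \<eta> v) (w - v) = w"
    using \<eta> by (auto simp: cscale_def)
  ultimately have o: "outer3 w \<phi>' \<in> adjoint_orbit (sl 3) (sl_bracket 3) (outer3 v \<phi>)"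
    by metis
  have w: "dot3 \<phi>' w = 0"
    unfolding \<phi>'_def using \<eta> assms(4) by simp
  have nz: "outer3 v \<phi> \<noteq> 0"
  proof -
    obtain i j where "i < 3" "v i \<noteq> 0" "j < 3" "\<phi> j \<noteq> 0"
      using assms(1,3) unfolding vec3_nz_def by blast
    then have "outer3 v \<phi> (i, j) \<noteq> 0" by (simp add: outer3_def)
    then show ?thesis by auto
  qed
  have "outer3 w \<phi>' \<noteq> 0"
    using sl3.extremal_orbit[OF o outer3_extremal[OF assms(4)] nz] by blast
  then have "vec3_nz \<phi>'" unfolding vec3_nz_def by (auto simp: outer3_def fun_eq_iff split: if_splits)
  with o w show ?thesis by blast
qed

text \<open>In the independent case a vector \<open>u\<close> with
  \<open>\<phi> u = \<psi> u = 1\<close> and the covector \<open>\<phi> - \<psi>\<close> define a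
  transvection that fixes \<open>w\<close>. Proportional covectors need a torus element
  instead.\<close>

lemma orbit_change_covector:
  assumes "vec3_nz w" "vec3_nz \<phi>" "vec3_nz \<psi>" "dot3 \<phi> w = 0" "dot3 \<psi> w = 0"
  shows "outer3 w \<psi> \<in> adjoint_orbit (sl 3) (sl_bracket 3) (outer3 w \<phi>)"
proof (rule vec3_pair[OF assms(2,3)])
  fix u assume "dot3 u \<phi> = 1" "dot3 u \<psi> = 1"
  then have u: "dot3 \<phi> u = 1" "dot3 \<psi> u = 1" by (simp_all add: dot3_commute)
  have "outer3 (w + cscale (dot3 (\<phi> - \<psi>) w) u) (\<phi> - cscale (dot3 \<phi> u) (\<phi> - \<psi>)) \<in>
    adjoint_orbit (sl 3) (sl_bracket 3) (outer3 w \<phi>)"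
    using u assms by (intro transvection) auto
  moreover have "w + cscale (dot3 (\<phi> - \<psi>) w) u = w" "\<phi> - cscale (dot3 \<phi> u) (\<phi> - \<psi>) = \<psi>"
    using u assms(4,5) by (auto simp: cscale_def)
  ultimately show ?thesis by metis
next
  fix c assume c: "c \<noteq> 0" "\<And>i. i < 3 \<Longrightarrow> \<psi> i = c * \<phi> i"
  obtain \<eta> \<xi> where \<eta>: "dot3 \<eta> w = 1" and \<xi>: "dot3 \<phi> \<xi> = 1"
    using vec3_nz_dual[OF assms(1)] vec3_nz_dual[OF assms(2)] dot3_commute by metis
  \<comment> \<open>The bracket of \<open>w \<eta> - \<xi> \<phi>\<close> with
    \<open>w \<phi>\<close> is twice \<open>w \<phi>\<close>, hence the factor 1/2; the exponential
    then multiplies by \<open>c\<close>.\<close>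
  define h where "h = cscale (Ln c / 2) (outer3 w \<eta> - outer3 \<xi> \<phi>)"
  have "outer3 w \<eta> - outer3 \<xi> \<phi> \<in> sl 3"
    using \<eta> \<xi> by (simp add: sl_def cspace_def sl_index_def outer3_def dot3_def sum_lt_3 algebra_simps)
  then have h: "h \<in> sl 3" unfolding h_def by (rule sl3.g_scale)
  have z: "outer3 w \<phi> \<in> sl 3" using assms(4) by (simp add: outer3_in_sl)
  have "sl_bracket 3 h (outer3 w \<phi>) = cscale (Ln c) (outer3 w \<phi>)"
    using \<eta> \<xi> assms(4) unfolding h_def dot3_def
    by (intro ext) (clarsimp simp: sl_bracket_def outer3_def cscale_def sum_lt_3, algebra)
  from sl3.exp_ad_eigen[OF h z this] c(1)
  have "exp_ad (sl_bracket 3) h (outer3 w \<phi>) = cscale c (outer3 w \<phi>)" by simp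
  also have "\<dots> = outer3 w \<psi>" using c(2) by (auto simp: outer3_def cscale_def)
  finally show ?thesis
    using adjoint_orbit.step[OF adjoint_orbit.base h] by metis
qed

lemma orbit_outer3:
  assumes "vec3_nz v" "vec3_nz \<phi>" "dot3 \<phi> v = 0" "vec3_nz w" "vec3_nz \<psi>" "dot3 \<psi> w = 0"
  shows "outer3 w \<psi> \<in> adjoint_orbit (sl 3) (sl_bracket 3) (outer3 v \<phi>)"
proof -
  obtain \<phi>' where \<phi>': "vec3_nz \<phi>'" "dot3 \<phi>' w = 0"
    "outer3 w \<phi>' \<in> adjoint_orbit (sl 3) (sl_bracket 3) (outer3 v \<phi>)"
    using orbit_change_vector assms by blast
  show ?thesis
    by (rule sl3.adjoint_orbit_trans[OF orbit_change_covector \<phi>'(3)]) (use \<phi>' assms in auto)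
qed

definition rank_one_nilpotents :: "(nat \<times> nat \<Rightarrow> complex) set" where
  "rank_one_nilpotents = {A \<in> sl 3. \<forall>i<3. \<forall>j<3. \<forall>k<3. \<forall>l<3. A (i, j) * A (k, l) = A (i, l) * A (k, j)}"

lemma rank_one_decomposition:
  assumes "A \<in> rank_one_nilpotents" "A \<noteq> 0"
  obtains v \<phi> where "A = outer3 v \<phi>" "vec3_nz v" "vec3_nz \<phi>" "dot3 \<phi> v = 0"
proof -
  have A: "A \<in> cspace (sl_index 3)" "A (0, 0) + A (1, 1) + A (2, 2) = 0"
    and m: "\<And>i j k l. i < 3 \<Longrightarrow> j < 3 \<Longrightarrow> k < 3 \<Longrightarrow> l < 3 \<Longrightarrow> A (i, j) * A (k, l) = A (i, l) * A (k, j)"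
    using assms(1) by (auto simp: rank_one_nilpotents_def sl_def sum_lt_3)
  obtain i j where ij: "i < 3" "j < 3" "A (i, j) \<noteq> 0"
    using assms(2) sl_cspaceD[OF A(1)] by (auto simp: fun_eq_iff)
  let ?v = "\<lambda>k. A (k, j)" and ?f = "\<lambda>l. A (i, l) / A (i, j)"
  have e: "?v k * ?f l = A (k, l)" if "k < 3" "l < 3" for k l
    using m[of k j i l] that ij by (simp add: field_simps)
  have "A = outer3 ?v ?f"
    using e sl_cspaceD[OF A(1)] by (auto simp: outer3_def)
  moreover have "dot3 ?f ?v = 0"
    using e[of 0 0] e[of 1 1] e[of 2 2] A(2) unfolding dot3_def by (simp add: mult.commute)
  moreover have "vec3_nz ?v" "vec3_nz ?f"
    using ij unfolding vec3_nz_def by blast (rule exI[of _ j], use ij in simp)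
  ultimately show ?thesis using that by blast
qed

lemma outer3_nonzero: "vec3_nz v \<Longrightarrow> vec3_nz \<phi> \<Longrightarrow> outer3 v \<phi> \<noteq> 0"
proof -
  assume "vec3_nz v" "vec3_nz \<phi>"
  then obtain i j where "i < 3" "v i \<noteq> 0" "j < 3" "\<phi> j \<noteq> 0"
    unfolding vec3_nz_def by blast
  then have "outer3 v \<phi> (i, j) \<noteq> 0" by (simp add: outer3_def)
  then show ?thesis by auto
qed

lemma vec3_nz_dot:
  assumes "dot3 \<phi> v \<noteq> 0"
  shows "vec3_nz \<phi>" "vec3_nz v"
proof -
  have "\<exists>i<3. \<phi> i * v i \<noteq> 0"
  proof (rule ccontr)
    assume "\<not> (\<exists>i<3. \<phi> i * v i \<noteq> 0)"
    then have "\<phi> i * v i = 0" if "i < 3" for i using that by blast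
    from this[of 0] this[of 1] this[of 2] have "dot3 \<phi> v = 0" by (auto simp: dot3_def)
    with assms show False by simp
  qed
  then show "vec3_nz \<phi>" "vec3_nz v" unfolding vec3_nz_def by auto
qed

section \<open>Eigenvectors and nilpotent matrices of size three\<close>

definition idx3 :: "3 \<Rightarrow> nat" where
  "idx3 i = (if i = 1 then 0 else if i = 2 then 1 else 2)"

lemma idx3 [simp]: "idx3 1 = 0" "idx3 2 = 1" "idx3 3 = 2"
  by (simp_all add: idx3_def)

definition det3 :: "(nat \<times> nat \<Rightarrow> complex) \<Rightarrow> complex" where
  "det3 A = A (0,0) * (A (1,1) * A (2,2) - A (1,2) * A (2,1))
    - A (0,1) * (A (1,0) * A (2,2) - A (1,2) * A (2,0))
    + A (0,2) * (A (1,0) * A (2,1) - A (1,1) * A (2,0))"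

lemma null_vector:
  assumes "det3 A = 0"
  obtains v where "vec3_nz v" "\<And>i. i < 3 \<Longrightarrow> app3 A v i = 0"
proof -
  define M :: "complex^3^3" where "M = (\<chi> i j. A (idx3 i, idx3 j))"
  have "det M = 0" using assms by (simp add: det_3 M_def det3_def algebra_simps)
  then have "\<not> (\<exists>B. B ** M = mat 1)"
    unfolding invertible_left_inverse[symmetric] invertible_det_nz by simp
  then obtain x where x: "M *v x = 0" "x \<noteq> 0"
    unfolding matrix_left_invertible_ker by blast
  define v where "v = (\<lambda>i::nat. if i = 0 then x $ 1 else if i = 1 then x $ 2 else x $ 3)"
  have "app3 A v i = 0" if "i < 3" for i
    using x(1) that unfolding lt_3_cases
    by (auto simp: vec_eq_iff forall_3 matrix_vector_mult_def sum_3 M_def app3_def dot3_def v_def)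
  moreover have "vec3_nz v"
  proof (rule ccontr)
    assume "\<not> vec3_nz v"
    then have "v i = 0" if "i < 3" for i using that by (simp add: vec3_nz_def)
    from this[of 0] this[of 1] this[of 2] have "x = 0"
      by (simp add: vec_eq_iff forall_3 v_def)
    with x(2) show False by simp
  qed
  ultimately show ?thesis using that by blast
qed

lemma null_covector:
  assumes "det3 A = 0"
  obtains \<phi> where "vec3_nz \<phi>" "\<And>i. i < 3 \<Longrightarrow> coapp3 \<phi> A i = 0"
proof -
  have "det3 (A \<circ> prod.swap) = 0" using assms by (simp add: det3_def algebra_simps)
  then obtain v where "vec3_nz v" "\<And>i. i < 3 \<Longrightarrow> app3 (A \<circ> prod.swap) v i = 0"
    by (rule null_vector) blast
  moreover have "app3 (A \<circ> prod.swap) v = coapp3 v A" for v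
    by (simp add: app3_def coapp3_def dot3_def mult.commute)
  ultimately show ?thesis using that by metis
qed

text \<open>The hypotheses say that a matrix with rows \<open>a, b, c\<close> is a left inverse of
  the one with columns \<open>u, v, w\<close>. For square matrices it is also a right inverse, which
  is the resolution of the identity.\<close>

lemma dual_basis3:
  assumes "dot3 a u = 1" "dot3 a v = 0" "dot3 a w = 0" "dot3 b u = 0" "dot3 b v = 1" "dot3 b w = 0"
    "dot3 c u = 0" "dot3 c v = 0" "dot3 c w = 1" and ij: "i < 3" "j < 3"
  shows "u i * a j + v i * b j + w i * c j = (if i = j then 1 else 0)"
proof -
  define P R :: "complex^3^3"
    where "P = (\<chi> i j. if j = 1 then u (idx3 i) else if j = 2 then v (idx3 i) else w (idx3 i))"
      and "R = (\<chi> i j. if i = 1 then a (idx3 j) else if i = 2 then b (idx3 j) else c (idx3 j))"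
  have "R ** P = mat 1"
    using assms(1-9) by (simp add: vec_eq_iff forall_3 matrix_matrix_mult_def sum_3 P_def R_def mat_def dot3_def)
  then have "P ** R = mat 1" using matrix_left_right_inverse by blast
  then show ?thesis
    using ij unfolding lt_3_cases
    by (auto simp: vec_eq_iff forall_3 matrix_matrix_mult_def sum_3 P_def R_def mat_def)
qed

text \<open>The second coefficient of the characteristic polynomial; for a traceless matrix this
  polynomial is \<open>t^3 + minor_sum3 A * t - det3 A\<close>.\<close>

definition minor_sum3 :: "(nat \<times> nat \<Rightarrow> complex) \<Rightarrow> complex" where
  "minor_sum3 A = A (0,0) * A (1,1) - A (0,1) * A (1,0) + A (0,0) * A (2,2) - A (0,2) * A (2,0)
    + A (1,1) * A (2,2) - A (1,2) * A (2,1)"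

lemma eigenvectors3:
  assumes A: "A \<in> sl 3" and "t ^ 3 + minor_sum3 A * t - det3 A = 0"
  obtains v \<phi> where "vec3_nz v" "\<And>i. i < 3 \<Longrightarrow> app3 A v i = t * v i"
    "vec3_nz \<phi>" "\<And>i. i < 3 \<Longrightarrow> coapp3 \<phi> A i = t * \<phi> i"
proof -
  define B where "B = (\<lambda>(i, j). A (i, j) - (if i = j then t else 0))"
  have tr: "A (0, 0) + A (1, 1) + A (2, 2) = 0" using A by (simp add: sl_def sum_lt_3)
  have "det3 B = - (t ^ 3 + minor_sum3 A * t - det3 A)"
    using tr unfolding det3_def minor_sum3_def B_def by simp algebra
  then have B: "det3 B = 0" using assms(2) by simp
  obtain v where v: "vec3_nz v" "\<And>i. i < 3 \<Longrightarrow> app3 B v i = 0"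
    using B by (rule null_vector) blast
  obtain \<phi> where \<phi>: "vec3_nz \<phi>" "\<And>i. i < 3 \<Longrightarrow> coapp3 \<phi> B i = 0"
    using B by (rule null_covector) blast
  have "app3 B v i = app3 A v i - t * v i" "coapp3 \<phi> B i = coapp3 \<phi> A i - t * \<phi> i" if "i < 3" for i
    using that unfolding lt_3_cases by (auto simp: app3_def coapp3_def B_def dot3_def algebra_simps)
  with that[OF v(1) _ \<phi>(1)] v(2) \<phi>(2) show ?thesis by simp
qed

lemma cubic_root: "\<exists>t::complex. t ^ 3 + a * t - b = 0"
proof -
  have "\<not> constant (poly [:- b, a, 0, 1:])"
    by (simp add: constant_degree)
  then obtain t where "poly [:- b, a, 0, 1:] t = 0"
    using fundamental_theorem_of_algebra by blast
  then have "t ^ 3 + a * t - b = 0" by (simp add: algebra_simps power3_eq_cube)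
  then show ?thesis by blast
qed

text \<open>
  If \<open>v\<close> and \<open>\<phi>\<close> are right and left eigenvectors for \<open>s\<close> and \<open>t\<close>, then \<open>v \<phi>\<close> is an eigenvector of
  \<open>ad A\<close> for \<open>s - t\<close>.
\<close>

lemma adnil_eigenvalues_equal:
  assumes A: "sl3.adnil n A" and s: "s ^ 3 + minor_sum3 A * s - det3 A = 0" and t: "t ^ 3 + minor_sum3 A * t - det3 A = 0"
  shows "s = t"
proof -
  have Ag: "A \<in> sl 3" using A by (simp add: sl3.adnil_def)
  then have Ac: "A \<in> cspace (sl_index 3)" by (simp add: sl_def)
  obtain v where v: "vec3_nz v" "\<And>i. i < 3 \<Longrightarrow> app3 A v i = s * v i"
    by (rule eigenvectors3[OF Ag s]) blast
  obtain \<phi> where \<phi>: "vec3_nz \<phi>" "\<And>i. i < 3 \<Longrightarrow> coapp3 \<phi> A i = t * \<phi> i"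
    by (rule eigenvectors3[OF Ag t]) blast
  show ?thesis
  \<comment> \<open>If \<open>\<phi> v\<close> is nonzero, evaluating \<open>\<phi> A v\<close> in
    two ways settles the matter. Otherwise \<open>v \<phi>\<close> is traceless, hence an element of
    sl(3) on which the nilpotent \<open>ad A\<close> can be tested.\<close>
  proof (cases "dot3 \<phi> v = 0")
    case False
    have "s * dot3 \<phi> v = dot3 \<phi> (app3 A v)"
      using v(2) by (simp add: dot3_def algebra_simps)
    also have "\<dots> = t * dot3 \<phi> v"
      using \<phi>(2) unfolding dot3_coapp[symmetric] by (simp add: dot3_def algebra_simps)
    finally show ?thesis using False by simp
  next
    case True
    let ?B = "outer3 v \<phi>"
    have B: "?B \<in> sl 3" using True by (simp add: outer3_in_sl)
    have 1: "sl_bracket 3 A ?B = cscale (s - t) ?B"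
      unfolding sl_bracket_outer3[OF Ac] using v(2) \<phi>(2) by (auto simp: outer3_def cscale_def algebra_simps)
    have "(sl_bracket 3 A ^^ m) ?B = cscale ((s - t) ^ m) ?B" for m
    proof (induction m)
      case (Suc m)
      show ?case unfolding funpow.simps o_apply Suc.IH sl3.br_scale2[OF Ag B] 1
        by (simp add: cs.scale_scale mult.commute)
    qed (simp add: cscale_def)
    then have "cscale ((s - t) ^ n) ?B = 0" using A B unfolding sl3.adnil_def by metis
    then have "(s - t) ^ n = 0" using outer3_nonzero[OF v(1) \<phi>(1)] unfolding cs.scale_eq_0_iff by blast
    then show ?thesis by simp
  qed
qed

text \<open>Dividing the characteristic polynomial by \<open>t - s\<close> leaves
  \<open>t^2 + s t + s^2 + minor_sum3 A\<close>, of discriminant \<open>r^2\<close>. Both of its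
  roots must equal \<open>s\<close>, which forces \<open>r = 0\<close> and
  \<open>s = 0\<close>.\<close>

lemma adnil_invariants:
  assumes A: "sl3.adnil n A"
  shows "minor_sum3 A = 0" "det3 A = 0"
proof -
  obtain s where s: "s ^ 3 + minor_sum3 A * s - det3 A = 0" using cubic_root by blast
  define r where "r = csqrt (- 3 * s\<^sup>2 - 4 * minor_sum3 A)"
  have r: "r\<^sup>2 = - 3 * s\<^sup>2 - 4 * minor_sum3 A" by (simp add: r_def)
  have root: "t ^ 3 + minor_sum3 A * t - det3 A = 0" if "t\<^sup>2 + s * t + (s\<^sup>2 + minor_sum3 A) = 0" for t
    using s that by algebra
  have "((- s + r) / 2)\<^sup>2 + s * ((- s + r) / 2) + (s\<^sup>2 + minor_sum3 A) = 0"
    using r by (simp add: power2_eq_square field_simps) algebra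
  from adnil_eigenvalues_equal[OF A s root[OF this]] have 1: "s = (- s + r) / 2" .
  have "((- s - r) / 2)\<^sup>2 + s * ((- s - r) / 2) + (s\<^sup>2 + minor_sum3 A) = 0"
    using r by (simp add: power2_eq_square field_simps) algebra
  from adnil_eigenvalues_equal[OF A s root[OF this]] have 2: "s = (- s - r) / 2" .
  from 1 2 have "s = 0" "r = 0" by (simp_all add: field_simps)
  then show "minor_sum3 A = 0" "det3 A = 0" using r s by simp_all
qed

lemma sl_bracket_bilinear:
  "sl_bracket n (A + B) C = sl_bracket n A C + sl_bracket n B C"
  "sl_bracket n (A - B) C = sl_bracket n A C - sl_bracket n B C"
  "sl_bracket n (cscale c A) C = cscale c (sl_bracket n A C)"
  "sl_bracket n A (B + C) = sl_bracket n A B + sl_bracket n A C"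
  "sl_bracket n A (B - C) = sl_bracket n A B - sl_bracket n A C"
  "sl_bracket n A (cscale c C) = cscale c (sl_bracket n A C)"
  by (rule ext; clarsimp simp: sl_bracket_def cscale_def algebra_simps sum.distrib sum_subtractf sum_distrib_left)+

definition sq3 :: "(nat \<times> nat \<Rightarrow> complex) \<Rightarrow> nat \<Rightarrow> nat \<Rightarrow> complex" where
  "sq3 A i k = dot3 (\<lambda>j. A (i, j)) (\<lambda>j. A (j, k))"

text \<open>Up to sign the 2 by 2 minors are the entries of the adjugate, and the adjugate is the
  square of \<open>A\<close>, minus the trace times \<open>A\<close>, plus
  \<open>minor_sum3 A\<close> times the identity. All three terms vanish here.\<close>

lemma square_zero_rank_one:
  assumes A: "A \<in> sl 3" and "minor_sum3 A = 0" and sq: "\<And>i k. i < 3 \<Longrightarrow> k < 3 \<Longrightarrow> sq3 A i k = 0"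
  shows "A \<in> rank_one_nilpotents"
proof -
  have tr: "A (0, 0) + A (1, 1) + A (2, 2) = 0" using A by (simp add: sl_def sum_lt_3)
  note c2 = assms(2)[unfolded minor_sum3_def]
  note s = sq[unfolded sq3_def dot3_def]
  have "A (0,0) * A (1,1) = A (0,1) * A (1,0)" "A (0,0) * A (2,2) = A (0,2) * A (2,0)"
    "A (1,1) * A (2,2) = A (1,2) * A (2,1)"
    using tr c2 s[of 0 0] s[of 1 1] s[of 2 2] by simp_all algebra+
  moreover have "A (0,0) * A (1,2) = A (0,2) * A (1,0)" "A (0,1) * A (1,2) = A (0,2) * A (1,1)"
    "A (0,0) * A (2,1) = A (0,1) * A (2,0)" "A (0,1) * A (2,2) = A (0,2) * A (2,1)"
    "A (1,0) * A (2,1) = A (1,1) * A (2,0)" "A (1,0) * A (2,2) = A (1,2) * A (2,0)"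
    using tr s[of 0 1] s[of 0 2] s[of 1 0] s[of 1 2] s[of 2 0] s[of 2 1] by simp_all algebra+
  ultimately have "A (i, j) * A (k, l) = A (i, l) * A (k, j)" if "i < 3" "j < 3" "k < 3" "l < 3" for i j k l
    using that unfolding lt_3_cases by (elim disjE) (simp_all add: mult.commute)
  then show ?thesis using A by (simp add: rank_one_nilpotents_def)
qed

text \<open>By Cayley and Hamilton \<open>A\<close> cubed is zero, while its square is not. A cyclic
  vector \<open>u\<close> gives the Jordan basis \<open>u\<close>, \<open>v = A u\<close>,
  \<open>w = A v\<close>; the covectors \<open>a\<close>, \<open>b = a A\<close>,
  \<open>c = a A A\<close> become dual to \<open>w, v, u\<close> once \<open>a\<close> is made to
  vanish on \<open>u\<close> and \<open>v\<close>.\<close>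

lemma regular_nilpotent:
  assumes A: "A \<in> sl 3" "minor_sum3 A = 0" "det3 A = 0" and sq: "i < 3" "k < 3" "sq3 A i k \<noteq> 0"
  obtains u v w a b c where "A = outer3 w b + outer3 v c"
    "dot3 a w = 1" "dot3 a v = 0" "dot3 a u = 0" "dot3 b w = 0" "dot3 b v = 1" "dot3 b u = 0"
    "dot3 c w = 0" "dot3 c v = 0" "dot3 c u = 1"
proof -
  have Ac: "A \<in> cspace (sl_index 3)" and tr: "A (0, 0) + A (1, 1) + A (2, 2) = 0"
    using A by (simp_all add: sl_def sum_lt_3)
  have ap0: "app3 A x j = 0" if "j \<ge> 3" for x j
    using sl_cspaceD[OF Ac, of j] that by (simp add: app3_def dot3_def)
  have cube: "app3 A (app3 A (app3 A x)) = 0" for x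
  proof
    fix j
    have "app3 A (app3 A (app3 A x)) 0 = 0" "app3 A (app3 A (app3 A x)) 1 = 0"
      "app3 A (app3 A (app3 A x)) 2 = 0"
      using tr A(2,3) unfolding app3_def dot3_def minor_sum3_def det3_def by algebra+
    then have "app3 A (app3 A (app3 A x)) j = 0" if "j < 3"
      using that unfolding lt_3_cases by blast
    then show "app3 A (app3 A (app3 A x)) j = 0 j" using ap0 by (cases "j < 3") auto
  qed
  have lin: "app3 A (x - y) = app3 A x - app3 A y" "app3 A (cscale t x) = cscale t (app3 A x)" for x y t
    by (auto simp: app3_def dot3_def cscale_def algebra_simps)
  define a where "a = cdelta i"
  have a: "dot3 a x = x i" for x
    using sq(1) unfolding lt_3_cases a_def by (auto simp: dot3_def cdelta_def)
  define e where "e = cscale (1 / sq3 A i k) (cdelta k)"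
  have "app3 A (app3 A (cdelta k)) i = sq3 A i k"
    using sq(2) unfolding lt_3_cases by (auto simp: app3_def sq3_def dot3_def cdelta_def)
  then have e2: "dot3 a (app3 A (app3 A e)) = 1"
    using sq(3) unfolding e_def lin a by (simp add: cscale_def)
  define r where "r = dot3 a (app3 A e)"
  \<comment> \<open>Since \<open>a\<close> is 1 on the square of \<open>A\<close> applied to
    \<open>e\<close>, the two coefficients can be solved successively: \<open>r\<close> gives
    \<open>a v = 0\<close>, the other one \<open>a u = 0\<close>.\<close>
  define u where "u = e - cscale r (app3 A e) - cscale (dot3 a e - r * r) (app3 A (app3 A e))"
  define v where "v = app3 A u"
  define w where "w = app3 A v"
  have v: "v = app3 A e - cscale r (app3 A (app3 A e))"
    unfolding v_def u_def lin cube by (simp add: cscale_def zero_fun_def)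
  have w: "w = app3 A (app3 A e)"
    unfolding w_def v lin cube by (simp add: cscale_def zero_fun_def)
  have Aw: "app3 A w = 0" unfolding w by (rule cube)
  have au: "dot3 a u = 0" "dot3 a v = 0" "dot3 a w = 1"
    using e2 by (simp_all add: u_def v w r_def)
  define b where "b = coapp3 a A"
  define c where "c = coapp3 b A"
  have b: "dot3 b x = dot3 a (app3 A x)" and c: "dot3 c x = dot3 a (app3 A (app3 A x))" for x
    by (simp_all add: b_def c_def dot3_coapp)
  have z: "app3 A 0 = 0" "dot3 a 0 = 0" by (auto simp: app3_def dot3_def zero_fun_def)
  have bu: "dot3 b u = 0" "dot3 b v = 1" "dot3 b w = 0" "dot3 c u = 1" "dot3 c v = 0" "dot3 c w = 0"
    unfolding b c v_def[symmetric] w_def[symmetric] Aw z by (simp_all add: au z)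
  have id: "w j * a l + v j * b l + u j * c l = (if j = l then 1 else 0)" if "j < 3" "l < 3" for j l
    by (rule dual_basis3) (use au bu that in auto)
  have "A (j, l) = w j * b l + v j * c l" if "j < 3" "l < 3" for j l
  proof -
    have "A (j, l) = dot3 (\<lambda>m. A (j, m)) (\<lambda>m. w m * a l + v m * b l + u m * c l)"
      using id[OF _ that(2)] that(2) unfolding lt_3_cases by (auto simp: dot3_def)
    also have "\<dots> = app3 A w j * a l + app3 A v j * b l + app3 A u j * c l"
      by (simp add: app3_def dot3_def algebra_simps)
    also have "\<dots> = w j * b l + v j * c l"
      unfolding Aw v_def[symmetric] w_def[symmetric] by simp
    finally show ?thesis .
  qed
  then have "A = outer3 w b + outer3 v c"
    using sl_cspaceD[OF Ac] by (auto simp: outer3_def fun_eq_iff)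
  then show ?thesis by (rule that) (use au bu in auto)
qed

text \<open>
  For a regular nilpotent \<open>A\<close>, with the basis adapted to it, \<open>h\<close> is the semisimple element with
  \<open>[h, A] = 2 A\<close> and \<open>E = w c\<close> is a highest root vector, \<open>[h, E] = 4 E\<close>. The orbit contains
  \<open>A + s E\<close> for all \<open>s\<close>, and \<open>exp (\<tau> ad h)\<close> takes this to \<open>exp (2 \<tau>) A + exp (4 \<tau>) s E\<close>; so
  \<open>E\<close> is in the closure.
\<close>

lemma regular_nilpotent_closure:
  assumes A: "A \<in> sl 3" "minor_sum3 A = 0" "det3 A = 0" and sq: "i < 3" "k < 3" "sq3 A i k \<noteq> 0"
  shows "\<exists>v \<phi>. vec3_nz v \<and> vec3_nz \<phi> \<and> dot3 \<phi> v = 0 \<and>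
    outer3 v \<phi> \<in> closure (adjoint_orbit (sl 3) (sl_bracket 3) A)"
proof -
  obtain u v w a b c where x: "A = outer3 w b + outer3 v c"
    and d [simp]: "dot3 a w = 1" "dot3 a v = 0" "dot3 a u = 0" "dot3 b w = 0" "dot3 b v = 1" "dot3 b u = 0"
    "dot3 c w = 0" "dot3 c v = 0" "dot3 c u = 1"
    by (rule regular_nilpotent[OF assms])
  let ?O = "adjoint_orbit (sl 3) (sl_bracket 3) A"
  let ?E = "outer3 w c" and ?y = "outer3 w b"
  define h where "h = cscale 2 (outer3 w a - outer3 u c)"
  have E: "?E \<in> sl 3" "?y \<in> sl 3" by (simp_all add: outer3_in_sl)
  have h: "h \<in> sl 3"
  proof -
    have "dot3 a w - dot3 c u = 0" by simp
    then have "outer3 w a - outer3 u c \<in> sl 3"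
      by (simp add: sl_def cspace_def sl_index_def outer3_def dot3_def sum_lt_3 algebra_simps)
    then show ?thesis unfolding h_def by (rule sl3.g_scale)
  qed
  note br = sl_bracket_bilinear sl_bracket_outer3_outer3
  have hx: "sl_bracket 3 h A = cscale 2 A"
    unfolding h_def x br d by (auto simp: cscale_def fun_eq_iff)
  have hE: "sl_bracket 3 h ?E = cscale 4 ?E"
    unfolding h_def br d by (auto simp: cscale_def fun_eq_iff)
  have yx: "sl_bracket 3 ?y A = ?E"
    unfolding x br d by (auto simp: cscale_def fun_eq_iff)
  have yE: "sl_bracket 3 ?y ?E = 0"
    unfolding br d by (auto simp: cscale_def fun_eq_iff)
  have pt: "cscale (of_real t) A + ?E \<in> ?O" if t: "t > 0" for t :: real
  proof -
    \<comment> \<open>The flow of \<open>h\<close> at time \<open>ln t / 2\<close> multiplies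
      \<open>A\<close> by \<open>t\<close> and \<open>E\<close> by \<open>t^2\<close>. Starting from
      \<open>A + E / t^2\<close> it arrives at \<open>t A + E\<close>, which tends to
      \<open>E\<close> with \<open>t\<close>.\<close>
    let ?s = "1 / of_real (t\<^sup>2) :: complex"
    have sy: "cscale ?s ?y \<in> sl 3" using E(2) by (rule sl3.g_scale)
    have "exp_ad (sl_bracket 3) (cscale ?s ?y) A = A + sl_bracket 3 (cscale ?s ?y) A"
      by (rule sl3.exp_ad_nilpotent2[OF sy A(1)])
        (unfold sl_bracket_bilinear(3,6) yx yE, auto simp: cscale_def)
    also have "\<dots> = A + cscale ?s ?E" unfolding sl_bracket_bilinear(3) yx ..
    finally have 1: "A + cscale ?s ?E \<in> ?O"
      using adjoint_orbit.step[OF adjoint_orbit.base sy] by metis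
    let ?\<tau> = "of_real (ln t / 2) :: complex"
    have th: "cscale ?\<tau> h \<in> sl 3" using h by (rule sl3.g_scale)
    have e: "exp (2 * ?\<tau>) = of_real t" "exp (4 * ?\<tau>) = of_real (t\<^sup>2)"
    proof -
      have "exp (2 * ?\<tau>) = of_real (exp (ln t))" unfolding exp_of_real[symmetric] by simp
      then show 1: "exp (2 * ?\<tau>) = of_real t" using t by simp
      have "exp (4 * ?\<tau>) = exp (2 * ?\<tau>) * exp (2 * ?\<tau>)"
        unfolding exp_add[symmetric] by simp
      then show "exp (4 * ?\<tau>) = of_real (t\<^sup>2)" unfolding 1 by (simp add: power2_eq_square)
    qed
    have "exp_ad (sl_bracket 3) (cscale ?\<tau> h) (A + cscale ?s ?E) =
        exp_ad (sl_bracket 3) (cscale ?\<tau> h) A + cscale ?s (exp_ad (sl_bracket 3) (cscale ?\<tau> h) ?E)"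
      using th A(1) E(1) by (simp only: sl3.exp_ad_add sl3.exp_ad_scale sl3.g_scale)
    also have "exp_ad (sl_bracket 3) (cscale ?\<tau> h) A = cscale (exp (2 * ?\<tau>)) A"
      by (rule sl3.exp_ad_eigen[OF th A(1)]) (unfold sl_bracket_bilinear(3) hx, simp add: cs.scale_scale mult.commute)
    also have "exp_ad (sl_bracket 3) (cscale ?\<tau> h) ?E = cscale (exp (4 * ?\<tau>)) ?E"
      by (rule sl3.exp_ad_eigen[OF th E(1)]) (unfold sl_bracket_bilinear(3) hE, simp add: cs.scale_scale mult.commute)
    also have "cscale (exp (2 * ?\<tau>)) A + cscale ?s (cscale (exp (4 * ?\<tau>)) ?E) = cscale (of_real t) A + ?E"
      unfolding e cs.scale_scale using t by (simp add: cscale_def)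
    finally show ?thesis using adjoint_orbit.step[OF 1 th] by metis
  qed
  have OI: "?O \<subseteq> cspace (sl_index 3)"
    using sl3.orbit_in_g[OF A(1)] sl3.gI by blast
  have "?E \<in> closure ?O"
    unfolding closure_cspace_iff[OF sl3.fin OI]
  proof (intro conjI allI impI)
    fix \<epsilon> :: real assume \<epsilon>: "\<epsilon> > 0"
    define K where "K = (\<Sum>p\<in>sl_index 3. cmod (A p)) + 1"
    have K: "K > 0" "\<And>p. p \<in> sl_index 3 \<Longrightarrow> cmod (A p) < K"
    proof -
      show "K > 0" unfolding K_def by (intro add_nonneg_pos sum_nonneg) auto
      show "cmod (A p) < K" if "p \<in> sl_index 3" for p
        using member_le_sum[OF that, of "\<lambda>p. cmod (A p)"] sl3.fin unfolding K_def by simp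
    qed
    let ?t = "\<epsilon> / K"
    have t: "?t > 0" using \<epsilon> K by simp
    have "cmod ((cscale (of_real ?t) A + ?E) p - ?E p) < \<epsilon>" if "p \<in> sl_index 3" for p
    proof -
      have "cmod ((cscale (of_real ?t) A + ?E) p - ?E p) = ?t * cmod (A p)"
        using \<epsilon> K(1) by (simp add: cscale_def norm_mult norm_divide)
      also have "\<dots> < ?t * K" using t K(2)[OF that] by (intro mult_strict_left_mono)
      finally show ?thesis using K(1) by simp
    qed
    then show "\<exists>s\<in>?O. \<forall>i\<in>sl_index 3. cmod (s i - ?E i) < \<epsilon>" using pt[OF t] by blast
  qed simp
  moreover have "vec3_nz w" "vec3_nz c"
    using vec3_nz_dot[of a w] vec3_nz_dot[of c u] by simp_all
  ultimately show ?thesis using d(7) by blast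
qed

text \<open>
  Extremality is invariant under the adjoint group, so this keeps the orbit of a rank one element
  inside the rank one elements.
\<close>

lemma extremal_rank_one:
  assumes A: "sl3.extremal A"
  shows "A \<in> rank_one_nilpotents"
proof -
  have Ag: "A \<in> sl 3" using A by (simp add: sl3.extremal_def)
  note inv = adnil_invariants[OF sl3.extremal_adnil[OF A]]
  have "sq3 A i k = 0" if ik: "i < 3" "k < 3" for i k
  proof (rule ccontr)
    assume sq: "sq3 A i k \<noteq> 0"
    obtain u v w a b c where x: "A = outer3 w b + outer3 v c"
      and d [simp]: "dot3 a w = 1" "dot3 a v = 0" "dot3 a u = 0" "dot3 b w = 0" "dot3 b v = 1" "dot3 b u = 0"
      "dot3 c w = 0" "dot3 c v = 0" "dot3 c u = 1"
      by (rule regular_nilpotent[OF Ag inv ik sq])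
    note br = sl_bracket_bilinear sl_bracket_outer3_outer3
    \<comment> \<open>The test element: the square of \<open>ad A\<close> takes it to
      \<open>w b - 2 v c\<close>, while \<open>A\<close> is \<open>w b + v c\<close>. Pairing with
      \<open>a, v\<close> and with \<open>b, u\<close> reads off the incompatible factors 1 and
      -2.\<close>
    have "outer3 u b \<in> sl 3" by (simp add: outer3_in_sl)
    then obtain s where "sl_bracket 3 A (sl_bracket 3 A (outer3 u b)) = cscale s A"
      using A unfolding sl3.extremal_def by blast
    moreover have "sl_bracket 3 A (sl_bracket 3 A (outer3 u b)) = outer3 w b - cscale 2 (outer3 v c)"
      unfolding x br d by (auto simp: cscale_def fun_eq_iff)
    ultimately have eq: "outer3 w b - cscale 2 (outer3 v c) = cscale s (outer3 w b + outer3 v c)"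
      using x by simp
    have pair: "dot3 \<phi> (app3 (outer3 y \<eta>) z) = dot3 \<phi> y * dot3 \<eta> z" for \<phi> y \<eta> z
      by (simp add: dot3_def app3_def outer3_def algebra_simps)
    have lin: "dot3 \<phi> (app3 (M + N) z) = dot3 \<phi> (app3 M z) + dot3 \<phi> (app3 N z)"
      "dot3 \<phi> (app3 (M - N) z) = dot3 \<phi> (app3 M z) - dot3 \<phi> (app3 N z)"
      "dot3 \<phi> (app3 (cscale t M) z) = t * dot3 \<phi> (app3 M z)" for \<phi> M N z t
      by (simp_all add: dot3_def app3_def cscale_def algebra_simps)
    have "1 = s" using arg_cong[OF eq, of "\<lambda>M. dot3 a (app3 M v)"] unfolding lin pair d by simp
    moreover have "- 2 = s" using arg_cong[OF eq, of "\<lambda>M. dot3 b (app3 M u)"] unfolding lin pair d by simp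
    ultimately show False by simp
  qed
  then show ?thesis by (rule square_zero_rank_one[OF Ag inv(1)])
qed

section \<open>The minimal orbit of sl(3) and its closure\<close>

definition sl3_minimal_orbit :: "(nat \<times> nat \<Rightarrow> complex) set" where
  "sl3_minimal_orbit = rank_one_nilpotents - {0}"

lemma sl3_minimal_orbit_eq:
  assumes "vec3_nz v" "vec3_nz \<phi>" "dot3 \<phi> v = 0"
  shows "adjoint_orbit (sl 3) (sl_bracket 3) (outer3 v \<phi>) = sl3_minimal_orbit"
proof (intro equalityI subsetI)
  fix A assume "A \<in> adjoint_orbit (sl 3) (sl_bracket 3) (outer3 v \<phi>)"
  from sl3.extremal_orbit[OF this outer3_extremal[OF assms(3)] outer3_nonzero[OF assms(1,2)]]
  show "A \<in> sl3_minimal_orbit" unfolding sl3_minimal_orbit_def using extremal_rank_one by blast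
next
  fix A assume "A \<in> sl3_minimal_orbit"
  then have "A \<in> rank_one_nilpotents" "A \<noteq> 0" unfolding sl3_minimal_orbit_def by auto
  then show "A \<in> adjoint_orbit (sl 3) (sl_bracket 3) (outer3 v \<phi>)"
    by (rule rank_one_decomposition) (use orbit_outer3[OF assms] in blast)
qed

text \<open>A nonzero nilpotent squares to zero and has rank one, or is regular and has a rank one
  element in the closure of its orbit. Either way the closure meets the single orbit of rank one
  nilpotents, and so contains it.\<close>

lemma minimal_nilpotent_orbit_sl3: "minimal_nilpotent_orbit (sl 3) (sl_bracket 3) sl3_minimal_orbit"
  unfolding minimal_nilpotent_orbit_def
proof (intro conjI allI impI)
  have e: "vec3_nz (cdelta 0)" "vec3_nz (cdelta 2)" "dot3 (cdelta 2) (cdelta 0) = 0"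
    by (auto simp: vec3_nz_def cdelta_def dot3_def)
  let ?E = "outer3 (cdelta 0) (cdelta 2)"
  have "sl3.adnil 3 ?E" by (rule sl3.extremal_adnil[OF outer3_extremal[OF e(3)]])
  then show "nonzero_nilpotent_orbit (sl 3) (sl_bracket 3) sl3_minimal_orbit"
    unfolding nonzero_nilpotent_orbit_def
    using sl3_minimal_orbit_eq[OF e] outer3_nonzero[OF e(1,2)] unfolding sl3.adnil_def by blast
  fix O' assume "nonzero_nilpotent_orbit (sl 3) (sl_bracket 3) O'"
  then obtain A n where A: "A \<in> sl 3" "A \<noteq> 0" "sl3.adnil n A" "O' = adjoint_orbit (sl 3) (sl_bracket 3) A"
    unfolding nonzero_nilpotent_orbit_def sl3.adnil_def by blast
  note inv = adnil_invariants[OF A(3)]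
  have "\<exists>v \<phi>. vec3_nz v \<and> vec3_nz \<phi> \<and> dot3 \<phi> v = 0 \<and> outer3 v \<phi> \<in> closure O'"
  proof (cases "\<exists>i<3. \<exists>k<3. sq3 A i k \<noteq> 0")
    case True
    then show ?thesis using regular_nilpotent_closure[OF A(1) inv] A(4) by blast
  next
    case False
    then have "A \<in> rank_one_nilpotents" by (intro square_zero_rank_one[OF A(1) inv(1)]) blast
    then obtain v \<phi> where "A = outer3 v \<phi>" "vec3_nz v" "vec3_nz \<phi>" "dot3 \<phi> v = 0"
      using A(2) by (rule rank_one_decomposition)
    moreover have "A \<in> closure O'"
      unfolding A(4) using closure_subset adjoint_orbit.base by blast
    ultimately show ?thesis by blast
  qed
  then obtain v \<phi> where v: "vec3_nz v" "vec3_nz \<phi>" "dot3 \<phi> v = 0" "outer3 v \<phi> \<in> closure O'"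
    by blast
  show "sl3_minimal_orbit \<subseteq> closure O'"
    unfolding sl3_minimal_orbit_eq[OF v(1-3), symmetric]
    using sl3.orbit_closure_orbit[OF _ A(1)] v(4) A(4) by blast
qed

lemma closure_sl3_minimal_orbit: "closure sl3_minimal_orbit = rank_one_nilpotents"
proof (intro equalityI)
  have "closed rank_one_nilpotents"
  proof -
    have "rank_one_nilpotents = sl 3 \<inter> (\<Inter>i\<in>{..<3}. \<Inter>j\<in>{..<3}. \<Inter>k\<in>{..<3}. \<Inter>l\<in>{..<3}.
        {A. A (i, j) * A (k, l) = A (i, l) * A (k, j)})"
      by (auto simp: rank_one_nilpotents_def)
    also have "closed \<dots>"
      by (intro closed_Int sl3.closed_g closed_INT ballI closed_Collect_eq continuous_intros continuous_coord)
    finally show ?thesis .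
  qed
  then show "closure sl3_minimal_orbit \<subseteq> rank_one_nilpotents"
    by (intro closure_minimal) (auto simp: sl3_minimal_orbit_def)
  have "0 \<in> closure sl3_minimal_orbit"
  proof -
    have OI: "sl3_minimal_orbit \<subseteq> cspace (sl_index 3)"
      by (auto simp: sl3_minimal_orbit_def rank_one_nilpotents_def sl_def)
    show ?thesis
      unfolding closure_cspace_iff[OF sl3.fin OI]
    proof (intro conjI allI impI)
      fix e :: real assume e: "e > 0"
      let ?s = "\<lambda>p::nat \<times> nat. if p = (0, 2) then of_real (e / 2) else (0::complex)"
      have "?s \<noteq> 0"
      proof
        assume "?s = 0"
        from fun_cong[OF this, of "(0, 2)"] show False using e by simp
      qed
      then have s: "?s \<in> sl3_minimal_orbit"
        by (auto simp: sl3_minimal_orbit_def rank_one_nilpotents_def sl_def cspace_def sl_index_def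
            intro!: sum.neutral)
      show "\<exists>s\<in>sl3_minimal_orbit. \<forall>i\<in>sl_index 3. cmod (s i - 0 i) < e"
        by (rule bexI[OF _ s]) (use e in \<open>auto simp: norm_divide\<close>)
    qed (simp add: zero_in_cspace)
  qed
  then show "rank_one_nilpotents \<subseteq> closure sl3_minimal_orbit"
    using closure_subset[of sl3_minimal_orbit] by (auto simp: sl3_minimal_orbit_def)
qed

section \<open>The case d = 4\<close>

lemma cm_eqs_4:
  "cm_eqs 4 \<kappa> q Q e a \<longleftrightarrow>
     e * a 1 = q * a 2 + Q * a 0 \<and> e * a 2 = q * a 3 + Q * a 1 \<and> e * a 3 = q * a 4 + Q * a 2 \<and>
     a 0 * a 2 - a 1 * a 1 = \<kappa> * q\<^sup>2 \<and> a 0 * a 3 - a 1 * a 2 = \<kappa> * q * e \<and>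
     a 0 * a 4 - a 1 * a 3 = \<kappa> * (e * e - q * Q) \<and> a 1 * a 3 - a 2 * a 2 = \<kappa> * q * Q \<and>
     a 1 * a 4 - a 2 * a 3 = \<kappa> * Q * e \<and> a 2 * a 4 - a 3 * a 3 = \<kappa> * Q\<^sup>2" (is "?L \<longleftrightarrow> ?R")
proof
  assume L: ?L
  show ?R
    using cm_eqsD(1)[OF L, of 1] cm_eqsD(1)[OF L, of 2] cm_eqsD(1)[OF L, of 3]
      cm_eqsD(2)[OF L, of 1 1] cm_eqsD(2)[OF L, of 1 2] cm_eqsD(2)[OF L, of 1 3]
      cm_eqsD(2)[OF L, of 2 2] cm_eqsD(2)[OF L, of 2 3] cm_eqsD(2)[OF L, of 3 3]
    by (simp add: eval_nat_numeral)
next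
  assume R: ?R
  show ?L
  proof (rule cm_eqsI)
    fix j :: nat assume "1 \<le> j" "j \<le> 4 - 1"
    then have "j = 1 \<or> j = 2 \<or> j = 3" by auto
    then show "e * a j = q * a (j + 1) + Q * a (j - 1)"
      using R by (elim disjE) (simp_all add: eval_nat_numeral)
  next
    fix j k :: nat assume "1 \<le> j" "j \<le> k" "k \<le> 4 - 1"
    then have "j = 1 \<and> k = 1 \<or> j = 1 \<and> k = 2 \<or> j = 1 \<and> k = 3 \<or> j = 2 \<and> k = 2 \<or> j = 2 \<and> k = 3 \<or> j = 3 \<and> k = 3"
      by auto
    then show "a (j - 1) * a (k + 1) - a j * a k = \<kappa> * q ^ (4 - k - 1) * Q ^ (j - 1) * Psi (k - j) q Q e"
      using R by (elim disjE conjE) (simp_all add: eval_nat_numeral)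
  qed
qed

text \<open>
  For \<open>d = 4\<close> the weights of all the coordinates agree and the cone is defined by nine quadrics. With
  the torus of the diagonal matrices acting by \<open>q \<mapsto> t\<^sup>2 q, Q \<mapsto> t\<^sup>-\<^sup>2 Q, a\<^sub>j \<mapsto> t\<^sup>4\<^sup>-\<^sup>2\<^sup>j a\<^sub>j\<close>, the
  adjoint representation of \<open>sl 3\<close> has the same weights; the coefficients are fitted so that the
  \<open>2 \<times> 2\<close> minors span the same space as these quadrics.
\<close>

definition cone_to_sl3 :: "(nat \<Rightarrow> complex) \<Rightarrow> nat \<times> nat \<Rightarrow> complex" where
  "cone_to_sl3 z p =
    (if p = (0,0) then - (z 5 + z 2) / 2 else if p = (0,1) then z 4 + z 0 else if p = (0,2) then z 3 else
     if p = (1,0) then - (z 6 + z 1) / 2 else if p = (1,1) then z 5 else if p = (1,2) then z 4 - z 0 else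
     if p = (2,0) then z 7 / 4 else if p = (2,1) then (z 1 - z 6) / 2 else if p = (2,2) then (z 2 - z 5) / 2
     else 0)"

definition sl3_to_cone :: "(nat \<times> nat \<Rightarrow> complex) \<Rightarrow> nat \<Rightarrow> complex" where
  "sl3_to_cone A i =
    (if i = 0 then (A (0,1) - A (1,2)) / 2 else if i = 1 then A (2,1) - A (1,0) else
     if i = 2 then A (2,2) - A (0,0) else if i = 3 then A (0,2) else
     if i = 4 then (A (0,1) + A (1,2)) / 2 else if i = 5 then A (1,1) else
     if i = 6 then - (A (1,0) + A (2,1)) else if i = 7 then 4 * A (2,0) else 0)"

lemma lt_8_cases: "i < (8::nat) \<longleftrightarrow> i = 0 \<or> i = 1 \<or> i = 2 \<or> i = 3 \<or> i = 4 \<or> i = 5 \<or> i = 6 \<or> i = 7"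
  by auto

lemma sl3_to_cone_cspace: "sl3_to_cone A \<in> cspace {..<8}"
  by (auto simp: cspace_def sl3_to_cone_def)

lemma cone_to_sl3_in: "cone_to_sl3 z \<in> sl 3"
  by (auto simp: sl_def cspace_def sl_index_def cone_to_sl3_def sum_lt_3 field_simps)

lemma sl3_to_cone_to_sl3:
  assumes "z \<in> cspace {..<8}"
  shows "sl3_to_cone (cone_to_sl3 z) = z"
proof
  fix i
  show "sl3_to_cone (cone_to_sl3 z) i = z i"
  proof (cases "i < 8")
    case True
    then show ?thesis unfolding lt_8_cases
      by (elim disjE) (simp_all add: sl3_to_cone_def cone_to_sl3_def field_simps)
  next
    case False
    then show ?thesis using assms by (auto simp: cspace_def sl3_to_cone_def)
  qed
qed

lemma cone_to_sl3_to_cone: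
  assumes "A \<in> sl 3"
  shows "cone_to_sl3 (sl3_to_cone A) = A"
proof -
  have Ac: "A \<in> cspace (sl_index 3)" and tr: "A (0,0) + A (1,1) + A (2,2) = 0"
    using assms by (simp_all add: sl_def sum_lt_3)
  have e: "A (0,0) = - (A (1,1) + A (2,2))" using tr by algebra
  have "cone_to_sl3 (sl3_to_cone A) (i, j) = A (i, j)" for i j
  proof (cases "i < 3 \<and> j < 3")
    case True
    then show ?thesis unfolding lt_3_cases
      by (elim conjE disjE) (simp_all add: sl3_to_cone_def cone_to_sl3_def e[simplified] field_simps)
  next
    case False
    then show ?thesis using sl_cspaceD[OF Ac False] by (auto simp: cone_to_sl3_def)
  qed
  then show ?thesis by auto
qed

lemma cone_to_sl3_rank_one:
  assumes z: "z \<in> cspace {..<8}"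
  shows "cone_to_sl3 z \<in> rank_one_nilpotents \<longleftrightarrow> z \<in> cm_cone 4"
proof
  assume "cone_to_sl3 z \<in> rank_one_nilpotents"
  then have m: "\<And>i j k l. i < 3 \<Longrightarrow> j < 3 \<Longrightarrow> k < 3 \<Longrightarrow> l < 3 \<Longrightarrow>
      cone_to_sl3 z (i, j) * cone_to_sl3 z (k, l) = cone_to_sl3 z (i, l) * cone_to_sl3 z (k, j)"
    by (simp add: rank_one_nilpotents_def)
  note m' = m[of 0 0 1 1] m[of 0 0 1 2] m[of 0 1 1 2] m[of 0 0 2 1] m[of 0 0 2 2] m[of 0 1 2 2]
    m[of 1 0 2 1] m[of 1 0 2 2] m[of 1 1 2 2]
  have "cm_eqs 4 (-1) (z 0) (z 1) (z 2) (\<lambda>j. z (j + 3))"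
    unfolding cm_eqs_4 using m' by (simp add: cone_to_sl3_def field_simps power2_eq_square) algebra
  then show "z \<in> cm_cone 4" using z by (simp add: cm_cone_def)
next
  assume "z \<in> cm_cone 4"
  then have "cm_eqs 4 (-1) (z 0) (z 1) (z 2) (\<lambda>j. z (j + 3))" by (simp add: cm_cone_def)
  note e = this[unfolded cm_eqs_4, simplified]
  let ?A = "cone_to_sl3 z"
  have "?A (0,0) * ?A (1,1) = ?A (0,1) * ?A (1,0)" "?A (0,0) * ?A (1,2) = ?A (0,2) * ?A (1,0)"
    "?A (0,1) * ?A (1,2) = ?A (0,2) * ?A (1,1)" "?A (0,0) * ?A (2,1) = ?A (0,1) * ?A (2,0)"
    "?A (0,0) * ?A (2,2) = ?A (0,2) * ?A (2,0)" "?A (0,1) * ?A (2,2) = ?A (0,2) * ?A (2,1)"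
    "?A (1,0) * ?A (2,1) = ?A (1,1) * ?A (2,0)" "?A (1,0) * ?A (2,2) = ?A (1,2) * ?A (2,0)"
    "?A (1,1) * ?A (2,2) = ?A (1,2) * ?A (2,1)"
    using e by (simp_all add: cone_to_sl3_def field_simps power2_eq_square) algebra+
  then have "?A (i, j) * ?A (k, l) = ?A (i, l) * ?A (k, j)" if "i < 3" "j < 3" "k < 3" "l < 3" for i j k l
    using that unfolding lt_3_cases by (elim disjE) (simp_all add: mult.commute)
  then show "?A \<in> rank_one_nilpotents"
    using cone_to_sl3_in by (simp add: rank_one_nilpotents_def)
qed

section \<open>Analyticity of the isomorphism for d = 4\<close>

lemma analytic_near_cm_unit:
  assumes f: "\<And>i. i < 3 \<Longrightarrow> analytic_near I p (\<lambda>z. f z i)"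
  shows "analytic_near I p (\<lambda>z. cm_unit d (f z))"
  unfolding cm_unit_def by (intro analytic_near_intros f) auto

lemma analytic_near_scale_a:
  assumes I: "finite I" "p \<in> cspace I" and f: "\<And>i. analytic_near I p (\<lambda>z. f z i)"
    and p: "f p \<in> cm_region d"
  shows "analytic_near I p (\<lambda>z. to_cm d (f z) i)" "analytic_near I p (\<lambda>z. from_cm d (f z) i)"
proof -
  have u: "analytic_near I p (\<lambda>z. cm_unit d (f z))"
    by (rule analytic_near_cm_unit[OF f])
  have o: "open {w. 0 < Re w}" by (intro open_Collect_less continuous_intros)
  have s: "csqrt holomorphic_on {w. 0 < Re w}"
    by (rule holomorphic_on_subset[OF holomorphic_on_csqrt]) (auto simp: complex_nonpos_Reals_iff)
  have s': "(\<lambda>w. 1 / csqrt w) holomorphic_on {w. 0 < Re w}"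
    by (intro holomorphic_on_divide holomorphic_on_const s) auto
  have r: "cm_unit d (f p) \<in> {w. 0 < Re w}" using p by (simp add: cm_region_def)
  have c: "analytic_near I p (\<lambda>z. csqrt (cm_unit d (f z)))"
    by (rule analytic_near_compose[OF u I s o r])
  have c': "analytic_near I p (\<lambda>z. 1 / csqrt (cm_unit d (f z)))"
    by (rule analytic_near_compose[OF u I s' o r])
  show "analytic_near I p (\<lambda>z. to_cm d (f z) i)"
    unfolding to_cm_def scale_a_def by (rule analytic_near_if[OF f analytic_near_mult[OF c f]])
  show "analytic_near I p (\<lambda>z. from_cm d (f z) i)"
    unfolding from_cm_def scale_a_def by (rule analytic_near_if[OF f analytic_near_mult[OF c' f]])
qed

text \<open>Coordinates outside \<open>I\<close> are zero on \<open>cspace I\<close>, the only place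
  where an expansion is compared with the function. They can therefore share the expansion of the
  zero function, and case distinctions on indices are avoided.\<close>

lemma analytic_near_component:
  assumes "finite I" "p \<in> cspace I"
  shows "analytic_near I p (\<lambda>z. z i)"
proof (cases "i \<in> I")
  case False
  obtain r K where r: "r > 0" "majorized I p r K (\<lambda>z. 0)"
    using analytic_near_const[of I p 0] unfolding analytic_near_def by blast
  have "majorized I p r K (\<lambda>z. z i)"
    using r(2) False unfolding majorized_def by (simp add: cspace_def)
  with r(1) show ?thesis unfolding analytic_near_def by blast
qed (rule analytic_near_coord[OF assms(1)])

lemma analytic_near_cone_to_sl3:
  assumes "\<And>i. analytic_near I p (\<lambda>z. f z i)"
  shows "analytic_near I p (\<lambda>z. cone_to_sl3 (f z) j)"
  unfolding cone_to_sl3_def by (intro analytic_near_intros assms)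

lemma analytic_near_sl3_to_cone:
  assumes "finite I" "p \<in> cspace I"
  shows "analytic_near I p (\<lambda>A. sl3_to_cone A j)"
  unfolding sl3_to_cone_def by (intro analytic_near_intros analytic_near_component assms)

lemma continuous_if_const:
  "(b \<Longrightarrow> continuous_on S f) \<Longrightarrow> (\<not> b \<Longrightarrow> continuous_on S g) \<Longrightarrow>
     continuous_on S (\<lambda>z. if b then f z else g z)"
  by (cases b) simp_all

text \<open>The rescaling by the square root of the unit is followed by the linear isomorphism. Both
  are invertible and analytic at every point of the region, so no further shrinking is
  needed.\<close>

lemma calogero_moser_4_iso:
  "locally_analytically_isomorphic {..<4 + 4} (calogero_moser 4) 0 (sl_index 3) rank_one_nilpotents 0"
proof -
  define U where "U = cspace {..<8::nat} \<inter> cm_region 4"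
  define V where "V = cspace (sl_index 3) \<inter> sl3_to_cone -` cm_region 4"
  define F where "F z = cone_to_sl3 (from_cm 4 z)" for z
  define G where "G A = to_cm 4 (sl3_to_cone A)" for A
  have cont_sc: "continuous_on S sl3_to_cone" for S
    by (rule continuous_on_coordinatewise_then_product)
      (unfold sl3_to_cone_def, intro continuous_if_const continuous_intros continuous_coord, auto)
  have cont_cs: "continuous_on S cone_to_sl3" for S
    by (rule continuous_on_coordinatewise_then_product)
      (unfold cone_to_sl3_def, intro continuous_if_const continuous_intros continuous_coord, auto)
  have F0: "F 0 = 0"
    by (auto simp: F_def from_cm_def cone_to_sl3_def)
  have s0: "sl3_to_cone 0 = 0" by (auto simp: sl3_to_cone_def)
  have reg0: "0 \<in> cm_region 4" by (simp add: cm_region_def cm_unit_def)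
  have X: "calogero_moser 4 \<subseteq> cspace {..<8}" by (auto simp: calogero_moser_def)
  have C: "cm_cone 4 \<subseteq> cspace {..<8}" by (auto simp: cm_cone_def)
  have R: "rank_one_nilpotents \<subseteq> sl 3" "sl 3 \<subseteq> cspace (sl_index 3)"
    by (auto simp: rank_one_nilpotents_def sl_def)
  have from_c: "from_cm 4 z \<in> cspace {..<8}" if "z \<in> cspace {..<8}" for z
    using that unfolding from_cm_def by (rule scale_a_in_cspace)
  have to_c: "to_cm 4 z \<in> cspace {..<8}" if "z \<in> cspace {..<8}" for z
    using that unfolding to_cm_def by (rule scale_a_in_cspace)
  have GF: "G (F z) = z" if "z \<in> U" for z
    using that from_c[of z] by (simp add: F_def G_def U_def sl3_to_cone_to_sl3 to_from_cm)
  have FG: "F (G A) = A" if "A \<in> sl 3" "A \<in> V" for A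
    using that by (simp add: F_def G_def V_def from_to_cm cone_to_sl3_to_cone)
  have FV: "F z \<in> V" if "z \<in> U" for z
    using that from_c[of z] cone_to_sl3_in R by (auto simp: F_def U_def V_def sl3_to_cone_to_sl3)
  have GU: "G A \<in> U" if "A \<in> V" for A
    using that sl3_to_cone_cspace to_c by (auto simp: G_def U_def V_def)
  have FR: "F z \<in> rank_one_nilpotents" if "z \<in> U" "z \<in> calogero_moser 4" for z
    using that from_c[of z] from_cm_in[of z 4] by (simp add: F_def U_def cone_to_sl3_rank_one)
  have GX: "G A \<in> calogero_moser 4" if "A \<in> V" "A \<in> rank_one_nilpotents" for A
  proof -
    have "A \<in> sl 3" using that R by blast
    then have "cone_to_sl3 (sl3_to_cone A) \<in> rank_one_nilpotents"
      using that by (simp add: cone_to_sl3_to_cone)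
    then have "sl3_to_cone A \<in> cm_cone 4"
      using cone_to_sl3_rank_one[OF sl3_to_cone_cspace] by blast
    then show ?thesis unfolding G_def by (rule to_cm_in)
  qed
  have aF: "analytic_map {..<4 + 4} (sl_index 3) U F"
    unfolding analytic_map_def
  proof (intro conjI ballI)
    show "openin (top_of_set (cspace {..<4 + 4})) U"
      using openin_open_Int[OF open_cm_region[of 4], of "cspace {..<8}"] by (simp add: U_def)
    show "F \<in> U \<rightarrow> cspace (sl_index 3)" using FV by (auto simp: V_def)
    fix p j assume p: "p \<in> U"
    have I: "finite {..<8::nat}" "p \<in> cspace {..<8}" "p \<in> cm_region 4" using p by (auto simp: U_def)
    have "analytic_near {..<8} p (\<lambda>z. F z j)"
      unfolding F_def
      by (intro analytic_near_cone_to_sl3 analytic_near_scale_a(2) I(1,2,3) analytic_near_component)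
    then show "analytic_at_point {..<4 + 4} (\<lambda>z. F z j) p"
      using analytic_near_imp_at_point by simp
  qed
  have aG: "analytic_map (sl_index 3) {..<4 + 4} V G"
    unfolding analytic_map_def
  proof (intro conjI ballI)
    have "open (sl3_to_cone -` cm_region 4)"
      by (rule open_vimage[OF open_cm_region cont_sc])
    from openin_open_Int[OF this, of "cspace (sl_index 3)"]
    show "openin (top_of_set (cspace (sl_index 3))) V" by (simp add: V_def)
    show "G \<in> V \<rightarrow> cspace {..<4 + 4}" using GU by (auto simp: U_def)
    fix p j assume p: "p \<in> V"
    have I: "finite (sl_index 3)" "p \<in> cspace (sl_index 3)" "sl3_to_cone p \<in> cm_region 4"
      using p sl3.fin by (auto simp: V_def)
    show "analytic_at_point (sl_index 3) (\<lambda>z. G z j) p"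
      unfolding G_def
      by (intro analytic_near_imp_at_point analytic_near_scale_a(1) analytic_near_sl3_to_cone I)
  qed
  have hom: "homeomorphism (calogero_moser 4 \<inter> U) (rank_one_nilpotents \<inter> V) F G"
  proof (rule homeomorphismI)
    have "continuous_on (calogero_moser 4 \<inter> U) (cone_to_sl3 \<circ> from_cm 4)"
      by (intro continuous_on_compose cont_cs continuous_on_subset[OF continuous_from_cm]) (auto simp: U_def)
    then show "continuous_on (calogero_moser 4 \<inter> U) F"
      by (simp add: F_def[abs_def] o_def)
    have "continuous_on (rank_one_nilpotents \<inter> V) (to_cm 4 \<circ> sl3_to_cone)"
      by (intro continuous_on_compose cont_sc continuous_on_subset[OF continuous_to_cm]) (auto simp: V_def)
    then show "continuous_on (rank_one_nilpotents \<inter> V) G"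
      by (simp add: G_def[abs_def] o_def)
    show "F ` (calogero_moser 4 \<inter> U) \<subseteq> rank_one_nilpotents \<inter> V" using FR FV by auto
    show "G ` (rank_one_nilpotents \<inter> V) \<subseteq> calogero_moser 4 \<inter> U" using GX GU by auto
    show "G (F z) = z" if "z \<in> calogero_moser 4 \<inter> U" for z using GF that by blast
    show "F (G A) = A" if "A \<in> rank_one_nilpotents \<inter> V" for A using FG that R by blast
  qed
  have "0 \<in> calogero_moser 4 \<inter> U" "0 \<in> rank_one_nilpotents \<inter> V"
    using reg0 s0 by (auto simp: U_def V_def zero_in_cspace rank_one_nilpotents_def
        calogero_moser_eq cm_eqs_4)
  with aF aG hom F0 show ?thesis unfolding locally_analytically_isomorphic_def by blast
qed

theorem theorem1p3:
  shows "(\<forall>d\<ge>4. has_local_fundamental_group (calogero_moser d) 0 (singleton_group ())) \<and>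
    (\<exists>Omin. minimal_nilpotent_orbit (sl 3) (sl_bracket 3) Omin \<and>
       locally_analytically_isomorphic
         {..<4 + 4} (calogero_moser 4) 0 (sl_index 3) (closure Omin) 0) \<and>
    (\<forall>d\<ge>5. \<forall>(I :: 'i set) g br Omin.
       simple_lie_algebra I g br \<and> minimal_nilpotent_orbit g br Omin \<longrightarrow>
       \<not> locally_analytically_isomorphic {..<d + 4} (calogero_moser d) 0 I (closure Omin) 0) \<and>
    (\<forall>d d'. 4 \<le> d \<and> d < d' \<longrightarrow>
       \<not> locally_analytically_isomorphic
           {..<d + 4} (calogero_moser d) 0 {..<d' + 4} (calogero_moser d') 0)"
proof (intro conjI allI impI)
  fix d :: nat assume "4 \<le> d"
  then show "has_local_fundamental_group (calogero_moser d) 0 (singleton_group ())"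
    by (intro calogero_moser_local_fundamental_group) simp
next
  show "\<exists>Omin. minimal_nilpotent_orbit (sl 3) (sl_bracket 3) Omin \<and>
      locally_analytically_isomorphic
        {..<4 + 4} (calogero_moser 4) 0 (sl_index 3) (closure Omin) 0"
    using minimal_nilpotent_orbit_sl3 calogero_moser_4_iso
    unfolding closure_sl3_minimal_orbit[symmetric] by blast
next
  fix d :: nat and I :: "'i set" and g br Omin
  assume d: "5 \<le> d" and O: "simple_lie_algebra I g br \<and> minimal_nilpotent_orbit g br Omin"
  then have "lie_alg I g br"
    by (auto simp: simple_lie_algebra_def intro: lie_alg.intro)
  then show "\<not> locally_analytically_isomorphic {..<d + 4} (calogero_moser d) 0 I (closure Omin) 0"
    using lie_alg.calogero_moser_not_minimal_orbit d O by blast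
next
  fix d d' :: nat assume "4 \<le> d \<and> d < d'"
  then show "\<not> locally_analytically_isomorphic
      {..<d + 4} (calogero_moser d) 0 {..<d' + 4} (calogero_moser d') 0"
    using calogero_moser_not_isomorphic by blast
qed

end
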